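(* Let $\mathcal B\subset\mathcal A((\Omega))$ be a rich real Weierstrass system over an ordered abelian group $\Omega$ and let $K$ be an ordered field with $\mathcal B$-analytic structure, with value group $G$ for the natural valuation. Then there exists an inclusion $\Omega\hookrightarrow G$ of (ordered) abelian groups, and an $\mathcal L_{\mathcal B}$-embedding $K\hookrightarrow\mathbb R((G))$, where $\mathbb R((G))$ is equipped with the natural $\mathcal B$-analytic structure.
   Context: **Power series.** Let $\Omega$ be an ordered abelian group. For $n\ge 0$ and $\alpha\in\mathbb R_{>0}$, $A_{n,\alpha}$ is the ring of power series in $\mathbb R[[\xi_1,\dots,\xi_n]]$ with radius of convergence strictly larger than $\alpha$. Put $\mathbb R((\Omega))=\{\sum_{i\in I}a_it^i : a_i\in\mathbb R,\ I\subset\Omega\text{ well-ordered}\}$ (Hahn series, ordered by the sign of the leading coefficient) and $A_{n,\alpha}((\Omega))=\{\sum_{i\in I}f_it^i : f_i\in A_{n,\alpha},\ I\subset\Omega\text{ well-ordered}\}$; $\mathbb R(\Omega)\subset\mathbb R((\Omega))$ is the subfield of rational functions in the $t^\omega$, $\omega\in\Omega$; $\mathcal A((\Omega))$ is the family of all $A_{n,\alpha}((\Omega))$. The Gauss norm of a nonzero $f=\sum f_it^i$ is $\|f\|=t^{i_0}$ with $i_0=\min\{i: f_i\ne0\}$, and $\|0\|=0$; norms are ordered by $t^i<t^j$ iff $i>j$, and $1=t^0$. The coefficient $f_{i_0}$ is the top slice of $f$. $f\in A_{n,\alpha}$ is regular in $\xi_1$ of degree $s$ at $0$ if $f(\xi_1,0,\dots,0)=a\xi_1^s+$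 higher degree terms with $a\ne0$; an $f\in A_{n,\alpha}((\Omega))$ with $\|f\|=1$ is regular in $\xi_1$ of degree $s$ at $0$ if its top slice $f_0$ is. **Real Weierstrass systems.** A real Weierstrass system over $\Omega$ is a family $\mathcal B=\{B_{n,\alpha}\}_{n\in\mathbb N,\alpha\in\mathbb R_{>0}}$ of $\mathbb R$-algebras with $\mathbb R[\xi_1,\dots,\xi_n]\subset B_{n,\alpha}\subset A_{n,\alpha}((\Omega))$ such that: (1a) if $m\le m'$ and $\alpha'\le\alpha$ then $B_{m,\alpha}\subset B_{m',\alpha'}$, and $B_{0,\alpha}=B_{0,\alpha'}=:B_0$; (1b) if $f\in B_{m+n,\alpha}$ and $f=\sum_\mu f_\mu(\xi_1,\dots,\xi_m)\eta^\mu$ with $\eta=(\xi_{m+1},\dots,\xi_{m+n})$, then all $f_\mu\in B_{m,\alpha}$; (1c) if $f\in B_{m,\alpha}$, $a\in(-\alpha,\alpha)^m\subset\mathbb R^m$, $r\in\mathbb R_{>0}$, then $f(r\xi+a)\in B_{m,\delta}$ with $\delta=\min_i\min\{\frac{\alpha-a_i}{r},\frac{\alpha+a_i}{r}\}$; (1d) if $0\neq f\in B_{n,\alpha}$, there is $a\in B_0$ with $\|af\|=1$; (1e) each $B_{n,\alpha}$ is closed under permutations of the variables; (2) (Weierstrass division) if $f\in B_{n,\alpha}$ with $\|f\|=1$ is regular in $\xi_1$ of degree $s$ at $0$, then there is $\delta\in\mathbb R_{>0}$ such that for every $m\ge n$ and $g\in B_{m,\alpha}$ there are unique $Q\in B_{m,\delta}$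 and $R_0,\dots,R_{s-1}\in B_{m-1,\delta}$ with $\|Q\|,\|R_i\|\le\|g\|$ and $g=Qf+\sum_{i<s}R_i(\xi')\xi_1^i$, where $\xi'=(\xi_2,\dots,\xi_m)$. $\mathcal B$ is rich if moreover $\mathbb R(\Omega)$ is a subring of $B_0$. **Analytic structure.** Let $K$ be an ordered field containing $B_0$ as an ordered subfield. A (real) $\mathcal B$-analytic structure on $K$ is a family of $\mathbb R$-algebra morphisms $\sigma_{n,\alpha}$ ($n\in\mathbb N$, $\alpha\in\mathbb R_{>1}$) from $B_{n,\alpha}$ to the ring of $K$-valued functions on $[-1,1]_K^n$, compatible with the inclusions $B_{n,\alpha}\subset B_{n,\beta}$ for $1<\beta<\alpha$ and with the rescalings and translations in (1c), such that the induced maps $\sigma_n$ on $\bigcup_{\alpha>1}B_{n,\alpha}$ satisfy: $\sigma_0$ is the inclusion $B_0\to K$; $\sigma_m(\xi_i)$ is the $i$-th coordinate function; $\sigma_{m+1}$ extends $\sigma_m$ (functions on $[-1,1]_K^m$ being viewed as functions on $[-1,1]_K^{m+1}$ not depending on the last variable); $\sigma_m$ respects permutation of coordinates. **Natural valuation and natural structure on Hahn fields.** The natural valuation on $K$ has valuation ring $K^\circ$ the convex closure of $\mathbb R$ in $K$; its value group is $G=K^\times/(K^\circ)^\times$. For forming $\mathbb R((G))$, $G$ is written additively and ordered so that the class of $x$ is $\ge0$ iff $x\in K^\circ$. If $\Omega\le G$ is an ordered subgroup and $\mathcal B$ is a real Weierstrass system over $\Omega$, the natural $\mathcal B$-analytic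 structure on $\mathbb R((G))$ is given by substitution: for $f=\sum_if_it^i\in B_{n,\alpha}$ with $\alpha>1$ and $a\in[-1,1]^n_{\mathbb R((G))}$, write $a=a^\circ+\varepsilon$ with $a^\circ\in[-1,1]^n_{\mathbb R}$ and $\varepsilon$ a tuple of infinitesimals, and set $f(a)=\sum_it^i\sum_{\mu\in\mathbb N^n}\frac{1}{\mu!}\partial^\mu f_i(a^\circ)\varepsilon^\mu$ (Hahn sum). **Language.** $\mathcal L_{\mathcal B}$ is $\{0,1,+,\cdot,(\cdot)^{-1},<\}$ with an $n$-ary function symbol for each element of $\bigcup_{\alpha>1}B_{n,\alpha}$, all $n$; in a field $K$ with $\mathcal B$-analytic structure, $0^{-1}=0$ and $f$ is interpreted as $\sigma_n(f)$ on $[-1,1]_K^n$ and as $0$ elsewhere. An $\mathcal L_{\mathcal B}$-embedding is an embedding of $\mathcal L_{\mathcal B}$-structures. *)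

theory Defs
  imports "HOL-Analysis.Analysis" "HOL-Library.Poly_Mapping"
begin

definition convolution :: "('m::comm_monoid_add \<Rightarrow> 'a::comm_ring_1) \<Rightarrow> ('m \<Rightarrow> 'a) \<Rightarrow> 'm \<Rightarrow> 'a" where
  "convolution f g c = (\<Sum>(a, b) | a + b = c \<and> f a \<noteq> 0 \<and> g b \<noteq> 0. f a * g b)"

lemma convolution_eq_sum:
  assumes "finite S" "S \<subseteq> {(a, b). a + b = c}"
    and "\<And>a b. a + b = c \<Longrightarrow> f a \<noteq> 0 \<Longrightarrow> g b \<noteq> 0 \<Longrightarrow> (a, b) \<in> S"
  shows "convolution f g c = (\<Sum>(a, b)\<in>S. f a * g b)"
  unfolding convolution_def
  using assms by (intro sum.mono_neutral_left) auto

lemma convolution_commute: "convolution f g = convolution g f"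
proof
  fix c
  show "convolution f g c = convolution g f c"
    unfolding convolution_def
    by (rule sum.reindex_bij_witness[of _ "\<lambda>(a, b). (b, a)" "\<lambda>(a, b). (b, a)"])
       (auto simp: add.commute mult.commute)
qed

lemma convolution_nonzeroE:
  assumes "convolution f g c \<noteq> 0"
  obtains a b where "a + b = c" "f a \<noteq> 0" "g b \<noteq> 0"
proof -
  have "{(a, b). a + b = c \<and> f a \<noteq> 0 \<and> g b \<noteq> 0} \<noteq> {}"
    using assms unfolding convolution_def by (metis sum.empty)
  with that show ?thesis by auto
qed

lemma convolution_assoc_aux:
  fixes f g h :: "'m::comm_monoid_add \<Rightarrow> 'a::comm_ring_1"
  assumes fin: "finite {(a, b, d). a + b + d = c \<and> f a \<noteq> 0 \<and> g b \<noteq> 0 \<and> h d \<noteq> 0}"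
  shows "convolution (convolution f g) h c
    = (\<Sum>(a, b, d) | a + b + d = c \<and> f a \<noteq> 0 \<and> g b \<noteq> 0 \<and> h d \<noteq> 0. f a * g b * h d)"
proof -
  define T where "T = {(a, b, d). a + b + d = c \<and> f a \<noteq> 0 \<and> g b \<noteq> 0 \<and> h d \<noteq> 0}"
  have finT: "finite T" using fin by (simp add: T_def)
  define F where "F = (\<lambda>(a, b, d). (a + b, d) :: 'm \<times> 'm)"
  define U where "U = F ` T"
  have finU: "finite U" using finT by (simp add: U_def)
  have "convolution (convolution f g) h c = (\<Sum>(u, d)\<in>U. convolution f g u * h d)"
  proof (rule convolution_eq_sum[OF finU])
    show "U \<subseteq> {(a, b). a + b = c}" by (auto simp: U_def F_def T_def)
  next
    fix u d assume *: "u + d = c" "convolution f g u \<noteq> 0" "h d \<noteq> 0"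
    from *(2) obtain a b where "a + b = u" "f a \<noteq> 0" "g b \<noteq> 0" by (rule convolution_nonzeroE)
    with * have "(a, b, d) \<in> T" "F (a, b, d) = (u, d)" by (auto simp: T_def F_def)
    then show "(u, d) \<in> U" unfolding U_def by (metis imageI)
  qed
  also have "\<dots> = (\<Sum>p\<in>U. \<Sum>x\<in>{x\<in>T. F x = p}. case x of (a, b, d) \<Rightarrow> f a * g b * h d)"
  proof (rule sum.cong[OF refl])
    fix p assume "p \<in> U"
    obtain u d where p: "p = (u, d)" by force
    with \<open>p \<in> U\<close> have ud: "u + d = c" "h d \<noteq> 0" by (auto simp: U_def F_def T_def)
    have "convolution f g u * h d = (\<Sum>(a, b) | a + b = u \<and> f a \<noteq> 0 \<and> g b \<noteq> 0. f a * g b * h d)"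
      unfolding convolution_def by (simp add: sum_distrib_right case_prod_unfold)
    also have "\<dots> = (\<Sum>x\<in>{x\<in>T. F x = p}. case x of (a, b, d) \<Rightarrow> f a * g b * h d)"
      using ud by (intro sum.reindex_bij_witness[of _ "\<lambda>(a, b, d). (a, b)" "\<lambda>(a, b). (a, b, d)"])
         (auto simp: T_def F_def p)
    finally show "(case p of (u, d) \<Rightarrow> convolution f g u * h d)
      = (\<Sum>x\<in>{x\<in>T. F x = p}. case x of (a, b, d) \<Rightarrow> f a * g b * h d)"
      by (simp add: p)
  qed
  also have "\<dots> = (\<Sum>x\<in>T. case x of (a, b, d) \<Rightarrow> f a * g b * h d)"
    by (rule sum.group[OF finT finU]) (simp add: U_def)
  finally show ?thesis by (simp add: T_def)
qed

lemma convolution_assoc: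
  fixes f g h :: "'m::comm_monoid_add \<Rightarrow> 'a::comm_ring_1"
  assumes fin: "finite {(a, b, d). a + b + d = c \<and> f a \<noteq> 0 \<and> g b \<noteq> 0 \<and> h d \<noteq> 0}"
  shows "convolution (convolution f g) h c = convolution f (convolution g h) c"
proof -
  let ?T = "{(a, b, d). a + b + d = c \<and> f a \<noteq> 0 \<and> g b \<noteq> 0 \<and> h d \<noteq> 0}"
  let ?T' = "{(b, d, a). b + d + a = c \<and> g b \<noteq> 0 \<and> h d \<noteq> 0 \<and> f a \<noteq> 0}"
  have "?T' = (\<lambda>(a, b, d). (b, d, a)) ` ?T"
    by (force simp: image_iff add_ac)
  then have fin': "finite ?T'" using fin by simp
  have "convolution f (convolution g h) c = convolution (convolution g h) f c" by (simp only: convolution_commute)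
  also have "\<dots> = (\<Sum>(b, d, a)\<in>?T'. g b * h d * f a)" by (rule convolution_assoc_aux[OF fin'])
  also have "\<dots> = (\<Sum>(a, b, d)\<in>?T. f a * g b * h d)"
    by (rule sum.reindex_bij_witness[of _ "\<lambda>(a, b, d). (b, d, a)" "\<lambda>(b, d, a). (a, b, d)"])
       (auto simp: add_ac mult_ac)
  also have "\<dots> = convolution (convolution f g) h c" by (rule convolution_assoc_aux[OF fin, symmetric])
  finally show ?thesis by simp
qed

lemma convolution_add:
  assumes "finite {(a, b). a + b = c \<and> f a \<noteq> 0 \<and> h b \<noteq> 0}"
    and "finite {(a, b). a + b = c \<and> g a \<noteq> 0 \<and> h b \<noteq> 0}"
  shows "convolution (\<lambda>x. f x + g x) h c = convolution f h c + convolution g h c"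
proof -
  define S where "S = {(a, b). a + b = c \<and> f a \<noteq> 0 \<and> h b \<noteq> 0} \<union> {(a, b). a + b = c \<and> g a \<noteq> 0 \<and> h b \<noteq> 0}"
  have S: "finite S" "S \<subseteq> {(a, b). a + b = c}" using assms by (auto simp: S_def)
  have "convolution (\<lambda>x. f x + g x) h c = (\<Sum>(a, b)\<in>S. (f a + g a) * h b)"
    by (rule convolution_eq_sum[OF S]) (auto simp: S_def)
  moreover have "convolution f h c = (\<Sum>(a, b)\<in>S. f a * h b)"
    by (rule convolution_eq_sum[OF S]) (auto simp: S_def)
  moreover have "convolution g h c = (\<Sum>(a, b)\<in>S. g a * h b)"
    by (rule convolution_eq_sum[OF S]) (auto simp: S_def)
  ultimately show ?thesis
    by (simp add: sum.distrib[symmetric] case_prod_unfold distrib_right)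
qed

lemma convolution_single:
  fixes g :: "'m::comm_monoid_add \<Rightarrow> 'a::comm_ring_1"
  shows "convolution (\<lambda>x. if x = 0 then k else 0) g c = k * g c"
proof -
  have "convolution (\<lambda>x. if x = 0 then k else 0) g c = (\<Sum>(a, b)\<in>{(0 :: 'm, c)}. (if a = 0 then k else 0) * g b)"
    by (rule convolution_eq_sum[where S = "{(0, c)}"]) (auto split: if_splits)
  then show ?thesis by simp
qed

text \<open>Formal power series in the variables \<open>\<xi>\<^sub>0, \<xi>\<^sub>1, \<dots>\<close>, given by their coefficients.
  Variables are counted from 0, so a series in \<open>n\<close> variables is one that involves only
  \<open>\<xi>\<^sub>0, \<dots>, \<xi>\<^bsub>n-1\<^esub>\<close>; this makes the inclusions between different \<open>n\<close> set inclusions.\<close>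

typedef 'a mps = "UNIV :: ((nat \<Rightarrow>\<^sub>0 nat) \<Rightarrow> 'a) set"
  morphisms mps_coeff Abs_mps by simp

setup_lifting type_definition_mps

lemma finite_antidiagonal: "finite {(a, b). a + b = (c :: nat \<Rightarrow>\<^sub>0 nat)}"
proof -
  define F where "F = {f. \<forall>i. (i \<in> Poly_Mapping.keys c \<longrightarrow> f i \<in> (\<Union>j\<in>Poly_Mapping.keys c. {..Poly_Mapping.lookup c j}))
    \<and> (i \<notin> Poly_Mapping.keys c \<longrightarrow> f i = 0)}"
  have "finite F" unfolding F_def by (rule finite_set_of_finite_funs) auto
  then have "finite (F \<times> F)" by blast
  moreover have F: "Poly_Mapping.lookup a \<in> F"
    if "\<And>i. Poly_Mapping.lookup a i \<le> Poly_Mapping.lookup c i" for a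
    unfolding F_def
  proof (intro CollectI allI conjI impI)
    fix i
    show "Poly_Mapping.lookup a i \<in> (\<Union>j\<in>Poly_Mapping.keys c. {..Poly_Mapping.lookup c j})"
      if "i \<in> Poly_Mapping.keys c"
      using that \<open>\<And>i. Poly_Mapping.lookup a i \<le> Poly_Mapping.lookup c i\<close> by blast
    show "Poly_Mapping.lookup a i = 0" if "i \<notin> Poly_Mapping.keys c"
      using that \<open>\<And>i. Poly_Mapping.lookup a i \<le> Poly_Mapping.lookup c i\<close>[of i] by (simp add: in_keys_iff)
  qed
  have "(\<lambda>(a, b). (Poly_Mapping.lookup a, Poly_Mapping.lookup b)) ` {(a, b). a + b = c} \<subseteq> F \<times> F"
    by (auto intro!: F simp: lookup_add)
  moreover have "inj_on (\<lambda>(a, b). (Poly_Mapping.lookup a, Poly_Mapping.lookup b)) {(a, b). a + b = c}"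
    by (auto simp: inj_on_def lookup_inject)
  ultimately show ?thesis
    by (meson finite_imageD finite_subset)
qed

lemma mps_eqI: "(\<And>\<mu>. mps_coeff f \<mu> = mps_coeff g \<mu>) \<Longrightarrow> f = g"
  by transfer auto

instantiation mps :: (comm_ring_1) comm_ring_1
begin

lift_definition zero_mps :: "'a mps" is "\<lambda>_. 0" .
lift_definition one_mps :: "'a mps" is "\<lambda>\<mu>. if \<mu> = 0 then 1 else 0" .
lift_definition plus_mps :: "'a mps \<Rightarrow> 'a mps \<Rightarrow> 'a mps" is "\<lambda>f g \<mu>. f \<mu> + g \<mu>" .
lift_definition minus_mps :: "'a mps \<Rightarrow> 'a mps \<Rightarrow> 'a mps" is "\<lambda>f g \<mu>. f \<mu> - g \<mu>" .
lift_definition uminus_mps :: "'a mps \<Rightarrow> 'a mps" is "\<lambda>f \<mu>. - f \<mu>" .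
lift_definition times_mps :: "'a mps \<Rightarrow> 'a mps \<Rightarrow> 'a mps" is convolution .

instance
proof
  have fin2: "finite {(a, b). a + b = c \<and> f a \<noteq> 0 \<and> g b \<noteq> 0}"
    for f g :: "(nat \<Rightarrow>\<^sub>0 nat) \<Rightarrow> 'a" and c
    by (rule finite_subset[OF _ finite_antidiagonal[of c]]) auto
  have fin3: "finite {(a, b, d). a + b + d = c \<and> f a \<noteq> 0 \<and> g b \<noteq> 0 \<and> h d \<noteq> 0}"
    for f g h :: "(nat \<Rightarrow>\<^sub>0 nat) \<Rightarrow> 'a" and c
  proof (rule finite_subset)
    show "finite ((\<lambda>((u, d), (a, b)). (a, b, d)) `
      (SIGMA p:{(u, d). u + d = c}. {(a, b). a + b = fst p}))"
      by (intro finite_imageI finite_SigmaI finite_antidiagonal)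
  qed (force simp: image_iff)
  fix a b c :: "'a mps"
  show "a * b * c = a * (b * c)"
    by transfer (auto intro!: convolution_assoc fin3)
  show "a * b = b * a"
    by transfer (rule convolution_commute)
  show "1 * a = a"
    by transfer (simp add: convolution_single fun_eq_iff)
  show "(a + b) * c = a * c + b * c"
    by transfer (auto intro!: convolution_add fin2)
  show "(0::'a mps) \<noteq> 1"
    by transfer (auto simp: fun_eq_iff)
qed (transfer; auto simp: fun_eq_iff)+

end

definition wo_set :: "'g::linorder set \<Rightarrow> bool" where
  "wo_set S \<longleftrightarrow> (\<forall>X\<subseteq>S. X \<noteq> {} \<longrightarrow> (\<exists>m\<in>X. \<forall>x\<in>X. m \<le> x))"

lemma wo_set_min: "wo_set S \<Longrightarrow> X \<subseteq> S \<Longrightarrow> X \<noteq> {} \<Longrightarrow> \<exists>m\<in>X. \<forall>x\<in>X. m \<le> x"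
  by (simp add: wo_set_def)

lemma wo_setD:
  assumes "wo_set S" "X \<subseteq> S" "X \<noteq> {}"
  obtains m where "m \<in> X" "\<And>x. x \<in> X \<Longrightarrow> m \<le> x"
  using wo_set_min[OF assms] by blast

lemma wo_set_subset: "wo_set S \<Longrightarrow> T \<subseteq> S \<Longrightarrow> wo_set T"
  unfolding wo_set_def by (blast intro: subset_trans)

lemma wo_set_Un:
  assumes "wo_set S" "wo_set T" shows "wo_set (S \<union> T)"
  unfolding wo_set_def
proof (intro allI impI)
  fix X assume X: "X \<subseteq> S \<union> T" "X \<noteq> {}"
  show "\<exists>m\<in>X. \<forall>x\<in>X. m \<le> x"
  proof (cases "X \<inter> S = {} \<or> X \<inter> T = {}")
    case True
    then have "X \<subseteq> S \<or> X \<subseteq> T" using X by auto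
    then show ?thesis using X assms by (auto simp: wo_set_def)
  next
    case False
    then have ne: "X \<inter> S \<noteq> {}" "X \<inter> T \<noteq> {}" by auto
    obtain m where m: "m \<in> X \<inter> S" "\<And>x. x \<in> X \<inter> S \<Longrightarrow> m \<le> x"
      using wo_set_min[OF assms(1) _ ne(1)] by auto
    obtain n where n: "n \<in> X \<inter> T" "\<And>x. x \<in> X \<inter> T \<Longrightarrow> n \<le> x"
      using wo_set_min[OF assms(2) _ ne(2)] by auto
    have "min m n \<in> X" using m n by (auto simp: min_def)
    moreover have "min m n \<le> x" if "x \<in> X" for x
      using that X(1) m(2)[of x] n(2)[of x] by (auto simp: min_le_iff_disj)
    ultimately show ?thesis by blast
  qed
qed

lemma wo_set_finite: "finite S \<Longrightarrow> wo_set S"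
  unfolding wo_set_def
proof (intro allI impI)
  fix X assume "finite S" "X \<subseteq> S" "X \<noteq> {}"
  then have "finite X" "X \<noteq> {}" by (auto intro: finite_subset)
  then show "\<exists>m\<in>X. \<forall>x\<in>X. m \<le> x" by (intro bexI[of _ "Min X"]) auto
qed

lemma finite_if_min_max:
  fixes S :: "'g::linorder set"
  assumes mn: "\<And>X. X \<subseteq> S \<Longrightarrow> X \<noteq> {} \<Longrightarrow> \<exists>m\<in>X. \<forall>x\<in>X. m \<le> x"
    and mx: "\<And>X. X \<subseteq> S \<Longrightarrow> X \<noteq> {} \<Longrightarrow> \<exists>m\<in>X. \<forall>x\<in>X. x \<le> m"
  shows "finite S"
proof -
  define P where "P = {x\<in>S. finite {y\<in>S. y \<le> x}}"
  have "P = S"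
  proof (rule ccontr)
    assume "P \<noteq> S"
    then have "S - P \<noteq> {}" "S - P \<subseteq> S" by (auto simp: P_def)
    then obtain m where m: "m \<in> S - P" "\<And>x. x \<in> S - P \<Longrightarrow> m \<le> x" using mn[of "S - P"] by auto
    have sub: "{y\<in>S. y < m} \<subseteq> P" using m(2) by (fastforce simp: not_le[symmetric])
    have "finite {y\<in>S. y < m}"
    proof (cases "{y\<in>S. y < m} = {}")
      case False
      then obtain p where p: "p \<in> {y\<in>S. y < m}" "\<And>x. x \<in> {y\<in>S. y < m} \<Longrightarrow> x \<le> p"
        using mx[of "{y\<in>S. y < m}"] by auto
      then have "finite {y\<in>S. y \<le> p}" using sub by (auto simp: P_def)
      moreover have "{y\<in>S. y < m} \<subseteq> {y\<in>S. y \<le> p}" using p by auto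
      ultimately show ?thesis by (rule rev_finite_subset)
    qed (simp only: finite.emptyI)
    moreover have "{y\<in>S. y \<le> m} = insert m {y\<in>S. y < m}" using m by auto
    ultimately have "m \<in> P" using m by (auto simp: P_def)
    then show False using m by auto
  qed
  show ?thesis
  proof (cases "S = {}")
    case False
    then obtain p where p: "p \<in> S" "\<And>x. x \<in> S \<Longrightarrow> x \<le> p" using mx[of S] by auto
    then have "finite {y\<in>S. y \<le> p}" using \<open>P = S\<close> by (auto simp: P_def)
    moreover have "{y\<in>S. y \<le> p} = S" using p by auto
    ultimately show ?thesis by simp
  qed simp
qed

lemma wo_set_finite_pairs:
  fixes A B :: "'g::linordered_ab_group_add set"
  assumes A: "wo_set A" and B: "wo_set B"
  shows "finite {(a, b). a + b = c \<and> a \<in> A \<and> b \<in> B}"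
proof -
  define S where "S = {a\<in>A. c - a \<in> B}"
  have "finite S"
  proof (rule finite_if_min_max)
    fix X assume X: "X \<subseteq> S" "X \<noteq> {}"
    then have "X \<subseteq> A" by (auto simp: S_def)
    with X A show "\<exists>m\<in>X. \<forall>x\<in>X. m \<le> x" by (auto simp: wo_set_def)
    have "(\<lambda>a. c - a) ` X \<subseteq> B" "(\<lambda>a. c - a) ` X \<noteq> {}" using X by (auto simp: S_def)
    then obtain m where m: "m \<in> (\<lambda>a. c - a) ` X" "\<And>x. x \<in> (\<lambda>a. c - a) ` X \<Longrightarrow> m \<le> x"
      by (rule wo_setD[OF B]) (rule that)
    then obtain a where a: "a \<in> X" "m = c - a" by auto
    have "x \<le> a" if "x \<in> X" for x
    proof -
      have "c - a \<le> c - x" using m(2)[of "c - x"] a that by auto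
      then show ?thesis by simp
    qed
    then show "\<exists>m\<in>X. \<forall>x\<in>X. x \<le> m" using a by blast
  qed
  moreover have "{(a, b). a + b = c \<and> a \<in> A \<and> b \<in> B} \<subseteq> (\<lambda>a. (a, c - a)) ` S"
    by (auto simp: S_def image_iff algebra_simps)
  ultimately show ?thesis by (blast intro: finite_subset finite_imageI)
qed

lemma wo_set_sums:
  fixes A B :: "'g::linordered_ab_group_add set"
  assumes A: "wo_set A" and B: "wo_set B"
  shows "wo_set {c. \<exists>a\<in>A. \<exists>b\<in>B. c = a + b}"
  unfolding wo_set_def
proof (intro allI impI)
  fix X assume X: "X \<subseteq> {c. \<exists>a\<in>A. \<exists>b\<in>B. c = a + b}" "X \<noteq> {}"
  define A' where "A' = {a\<in>A. \<exists>b\<in>B. a + b \<in> X}"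
  have "A' \<noteq> {}" using X by (auto simp: A'_def)
  have "\<forall>a\<in>A'. \<exists>m. m \<in> B \<and> a + m \<in> X \<and> (\<forall>b\<in>B. a + b \<in> X \<longrightarrow> m \<le> b)"
  proof
    fix a assume "a \<in> A'"
    then have "{b\<in>B. a + b \<in> X} \<noteq> {}" "{b\<in>B. a + b \<in> X} \<subseteq> B" by (auto simp: A'_def)
    from wo_set_min[OF B this(2,1)]
    show "\<exists>m. m \<in> B \<and> a + m \<in> X \<and> (\<forall>b\<in>B. a + b \<in> X \<longrightarrow> m \<le> b)" by auto
  qed
  from bchoice[OF this] obtain \<beta> where
    "\<forall>a\<in>A'. \<beta> a \<in> B \<and> a + \<beta> a \<in> X \<and> (\<forall>b\<in>B. a + b \<in> X \<longrightarrow> \<beta> a \<le> b)" ..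
  then have \<beta>: "\<And>a. a \<in> A' \<Longrightarrow> \<beta> a \<in> B" "\<And>a. a \<in> A' \<Longrightarrow> a + \<beta> a \<in> X"
    "\<And>a b. a \<in> A' \<Longrightarrow> b \<in> B \<Longrightarrow> a + b \<in> X \<Longrightarrow> \<beta> a \<le> b" by auto
  define R where "R = {a\<in>A'. \<forall>a'\<in>A'. a' < a \<longrightarrow> \<beta> a < \<beta> a'}"
  have "finite R"
  proof (rule finite_if_min_max)
    fix Y assume Y: "Y \<subseteq> R" "Y \<noteq> {}"
    then have "Y \<subseteq> A" by (auto simp: R_def A'_def)
    with Y A show "\<exists>m\<in>Y. \<forall>x\<in>Y. m \<le> x" by (auto simp: wo_set_def)
    have "\<beta> ` Y \<subseteq> B" "\<beta> ` Y \<noteq> {}" using Y \<beta>(1) by (auto simp: R_def)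
    then obtain m where m: "m \<in> \<beta> ` Y" "\<And>x. x \<in> \<beta> ` Y \<Longrightarrow> m \<le> x"
      by (rule wo_setD[OF B]) (rule that)
    then obtain a where a: "a \<in> Y" "m = \<beta> a" by auto
    have "x \<le> a" if "x \<in> Y" for x
    proof (rule ccontr)
      assume "\<not> x \<le> a"
      moreover have "x \<in> R" "a \<in> R" using that a Y by auto
      ultimately have "\<beta> x < \<beta> a" by (auto simp: R_def)
      then show False using m(2)[of "\<beta> x"] a that by auto
    qed
    then show "\<exists>m\<in>Y. \<forall>x\<in>Y. x \<le> m" using a by blast
  qed
  have rec: "\<exists>r\<in>R. r \<le> a \<and> \<beta> r \<le> \<beta> a" if a: "a \<in> A'" for a
  proof -
    let ?V = "\<beta> ` {b\<in>A'. b \<le> a}"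
    have "?V \<subseteq> B" "?V \<noteq> {}" using a \<beta>(1) by auto
    then obtain v where v: "v \<in> ?V" "\<And>x. x \<in> ?V \<Longrightarrow> v \<le> x" by (rule wo_setD[OF B]) (rule that)
    let ?W = "{b\<in>A'. b \<le> a \<and> \<beta> b = v}"
    have "?W \<subseteq> A" "?W \<noteq> {}" using v(1) by (auto simp: A'_def)
    then obtain r where r: "r \<in> ?W" "\<And>x. x \<in> ?W \<Longrightarrow> r \<le> x" by (rule wo_setD[OF A]) (rule that)
    have "r \<in> R"
      unfolding R_def
    proof (intro CollectI conjI ballI impI)
      show "r \<in> A'" using r by simp
    next
      fix a' assume a': "a' \<in> A'" "a' < r"
      then have "a' \<le> a" using r by auto
      then have "v \<le> \<beta> a'" using v(2) a' by blast
      moreover have "\<beta> a' \<noteq> v" using r(2)[of a'] a' \<open>a' \<le> a\<close> by auto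
      ultimately show "\<beta> r < \<beta> a'" using r by auto
    qed
    moreover have "r \<le> a" "\<beta> r \<le> \<beta> a" using r v(2)[of "\<beta> a"] a by auto
    ultimately show ?thesis by blast
  qed
  have "R \<noteq> {}" using rec \<open>A' \<noteq> {}\<close> by blast
  define M where "M = (\<lambda>r. r + \<beta> r) ` R"
  have M: "finite M" "M \<noteq> {}" using \<open>finite R\<close> \<open>R \<noteq> {}\<close> by (auto simp: M_def)
  have "Min M \<in> X" using Min_in[OF M] \<beta>(2) by (auto simp: M_def R_def)
  moreover have "Min M \<le> x" if x: "x \<in> X" for x
  proof -
    obtain a b where ab: "a \<in> A" "b \<in> B" "x = a + b" using X(1) x by blast
    then have a: "a \<in> A'" using x by (auto simp: A'_def)
    then obtain r where r: "r \<in> R" "r \<le> a" "\<beta> r \<le> \<beta> a" using rec by blast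
    have "Min M \<le> r + \<beta> r" using M(1) r(1) by (auto simp: M_def)
    also have "\<dots> \<le> a + b" using r \<beta>(3)[OF a ab(2)] x ab by (intro add_mono) auto
    finally show ?thesis using ab by simp
  qed
  ultimately show "\<exists>m\<in>X. \<forall>x\<in>X. m \<le> x" by blast
qed

typedef (overloaded) ('g::linorder, 'a::zero) hahn = "{f :: 'g \<Rightarrow> 'a. wo_set {i. f i \<noteq> 0}}"
  morphisms hahn_coeff Abs_hahn
  by (rule exI[of _ "\<lambda>_. 0"]) (simp add: wo_set_finite)

setup_lifting type_definition_hahn

lemma hahn_eqI: "(\<And>i. hahn_coeff f i = hahn_coeff g i) \<Longrightarrow> f = g"
  by transfer auto

lemma wo_set_supp: "wo_set {i. hahn_coeff f i \<noteq> 0}"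
  using hahn_coeff by blast

lift_definition hahn_single :: "'g::linorder \<Rightarrow> 'a::zero \<Rightarrow> ('g, 'a) hahn"
  is "\<lambda>i a j. if j = i then a else 0"
proof -
  fix i :: 'g and a :: 'a
  have "{j. (if j = i then a else 0) \<noteq> 0} \<subseteq> {i}" by auto
  then show "wo_set {j. (if j = i then a else 0) \<noteq> 0}"
    by (meson finite.emptyI finite_insert finite_subset wo_set_finite)
qed

text \<open>Coefficientwise application of \<open>F\<close>. All uses have \<open>F 0 = 0\<close>; the case distinction only keeps
  the support well-ordered for arbitrary \<open>F\<close>.\<close>

lift_definition hahn_map :: "('a \<Rightarrow> 'b) \<Rightarrow> ('g::linorder, 'a::zero) hahn \<Rightarrow> ('g, 'b::zero) hahn"
  is "\<lambda>F f i. if f i = 0 then 0 else F (f i)"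
  by (erule wo_set_subset) auto

text \<open>Meaningful for nonzero series only.\<close>

definition hahn_ord :: "('g::linorder, 'a::zero) hahn \<Rightarrow> 'g" where
  "hahn_ord f = (LEAST i. hahn_coeff f i \<noteq> 0)"

instantiation hahn :: (linordered_ab_group_add, comm_ring_1) comm_ring_1
begin

lift_definition zero_hahn :: "('a, 'b) hahn" is "\<lambda>_. 0"
  by (simp add: wo_set_finite)
lift_definition plus_hahn :: "('a, 'b) hahn \<Rightarrow> ('a, 'b) hahn \<Rightarrow> ('a, 'b) hahn" is "\<lambda>f g i. f i + g i"
  by (drule (1) wo_set_Un, erule wo_set_subset) auto
lift_definition minus_hahn :: "('a, 'b) hahn \<Rightarrow> ('a, 'b) hahn \<Rightarrow> ('a, 'b) hahn" is "\<lambda>f g i. f i - g i"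
  by (drule (1) wo_set_Un, erule wo_set_subset) auto
lift_definition uminus_hahn :: "('a, 'b) hahn \<Rightarrow> ('a, 'b) hahn" is "\<lambda>f i. - f i"
  by simp
lift_definition times_hahn :: "('a, 'b) hahn \<Rightarrow> ('a, 'b) hahn \<Rightarrow> ('a, 'b) hahn" is convolution
  by (drule (1) wo_set_sums, erule wo_set_subset) (fastforce elim: convolution_nonzeroE)

definition one_hahn :: "('a, 'b) hahn" where
  "one_hahn = hahn_single 0 1"

instance
proof
  have fin2: "finite {(a, b). a + b = c \<and> f a \<noteq> 0 \<and> g b \<noteq> 0}"
    if "wo_set {i. f i \<noteq> 0}" "wo_set {i. g i \<noteq> 0}" for f g :: "'a \<Rightarrow> 'b" and c
    using wo_set_finite_pairs[OF that, of c] by simp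
  have fin3: "finite {(a, b, d). a + b + d = c \<and> f a \<noteq> 0 \<and> g b \<noteq> 0 \<and> h d \<noteq> 0}"
    if wo: "wo_set {i. f i \<noteq> 0}" "wo_set {i. g i \<noteq> 0}" "wo_set {i. h i \<noteq> 0}"
    for f g h :: "'a \<Rightarrow> 'b" and c
  proof (rule finite_subset)
    let ?S = "{c. \<exists>a\<in>{i. f i \<noteq> 0}. \<exists>b\<in>{i. g i \<noteq> 0}. c = a + b}"
    show "finite ((\<lambda>((u, d), (a, b)). (a, b, d)) `
      (SIGMA p:{(u, d). u + d = c \<and> u \<in> ?S \<and> d \<in> {i. h i \<noteq> 0}}. {(a, b). a + b = fst p \<and> f a \<noteq> 0 \<and> g b \<noteq> 0}))"
      by (intro finite_imageI finite_SigmaI fin2 wo_set_finite_pairs wo_set_sums wo)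
  qed (force simp: image_iff)
  fix a b c :: "('a, 'b) hahn"
  show "a * b * c = a * (b * c)"
    by transfer (auto intro!: convolution_assoc fin3)
  show "a * b = b * a"
    by transfer (rule convolution_commute)
  show "1 * a = a"
    unfolding one_hahn_def by transfer (simp add: convolution_single fun_eq_iff)
  show "(a + b) * c = a * c + b * c"
    by transfer (auto intro!: convolution_add fin2)
  show "(0::('a, 'b) hahn) \<noteq> 1"
    unfolding one_hahn_def by transfer (auto simp: fun_eq_iff)
qed (transfer; auto simp: fun_eq_iff)+

end

lemma hahn_coeff_simps [simp]:
  "hahn_coeff 0 i = 0"
  "hahn_coeff (f + g) i = hahn_coeff f i + hahn_coeff g i"
  "hahn_coeff (f - g) i = hahn_coeff f i - hahn_coeff g i"
  "hahn_coeff (- f) i = - hahn_coeff f i"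
  "hahn_coeff (hahn_single j a) i = (if i = j then a else 0)"
  by (transfer; simp)+

lemma hahn_coeff_one [simp]: "hahn_coeff 1 i = (if i = 0 then 1 else 0)"
  by (simp add: one_hahn_def)

lemma hahn_coeff_times: "hahn_coeff (f * g) = convolution (hahn_coeff f) (hahn_coeff g)"
  by transfer simp

lemma hahn_ord:
  fixes f :: "('g::linordered_ab_group_add, 'a::comm_ring_1) hahn"
  assumes "f \<noteq> 0"
  shows hahn_coeff_ord: "hahn_coeff f (hahn_ord f) \<noteq> 0"
    and hahn_ord_le: "hahn_coeff f i \<noteq> 0 \<Longrightarrow> hahn_ord f \<le> i"
proof -
  have "{i. hahn_coeff f i \<noteq> 0} \<noteq> {}" using assms by (auto intro: hahn_eqI)
  then obtain m where m: "hahn_coeff f m \<noteq> 0" "\<And>x. hahn_coeff f x \<noteq> 0 \<Longrightarrow> m \<le> x"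
    using wo_set_min[OF wo_set_supp order_refl] by auto
  then have "hahn_ord f = m" unfolding hahn_ord_def by (intro Least_equality) auto
  with m show "hahn_coeff f (hahn_ord f) \<noteq> 0" "hahn_coeff f i \<noteq> 0 \<Longrightarrow> hahn_ord f \<le> i" by auto
qed

lemma hahn_coeff_below_ord:
  fixes f :: "('g::linordered_ab_group_add, 'a::comm_ring_1) hahn"
  shows "i < hahn_ord f \<Longrightarrow> hahn_coeff f i = 0"
  using hahn_ord_le[of f i] by (metis hahn_coeff_simps(1) leD)

lemma hahn_ord_eqI:
  fixes f :: "('g::linordered_ab_group_add, 'a::comm_ring_1) hahn"
  assumes "hahn_coeff f w \<noteq> 0" "\<And>i. i < w \<Longrightarrow> hahn_coeff f i = 0"
  shows "hahn_ord f = w"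
  unfolding hahn_ord_def by (intro Least_equality) (use assms in \<open>auto simp: not_less[symmetric]\<close>)

lemma hahn_coeff_times_below:
  fixes f g :: "('g::linordered_ab_group_add, 'a::comm_ring_1) hahn"
  assumes f: "\<And>i. i < u \<Longrightarrow> hahn_coeff f i = 0" and g: "\<And>i. i < v \<Longrightarrow> hahn_coeff g i = 0"
  shows "w < u + v \<Longrightarrow> hahn_coeff (f * g) w = 0"
    and "hahn_coeff (f * g) (u + v) = hahn_coeff f u * hahn_coeff g v"
proof -
  show "hahn_coeff (f * g) w = 0" if "w < u + v"
  proof (rule ccontr)
    assume "hahn_coeff (f * g) w \<noteq> 0"
    then obtain a b where ab: "a + b = w" "hahn_coeff f a \<noteq> 0" "hahn_coeff g b \<noteq> 0"
      unfolding hahn_coeff_times by (rule convolution_nonzeroE)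
    then have "u \<le> a" "v \<le> b" using f g by (meson not_less)+
    then have "u + v \<le> w" using ab add_mono by blast
    then show False using that by simp
  qed
  have "hahn_coeff (f * g) (u + v) = (\<Sum>(a, b)\<in>{(u, v)}. hahn_coeff f a * hahn_coeff g b)"
    unfolding hahn_coeff_times
  proof (rule convolution_eq_sum)
    fix a b assume ab: "a + b = u + v" "hahn_coeff f a \<noteq> 0" "hahn_coeff g b \<noteq> 0"
    then have "u \<le> a" "v \<le> b" using f g by (meson not_less)+
    then have "a = u \<and> b = v"
      using ab(1) by (metis add_less_le_mono add_le_less_mono order_le_less less_irrefl)
    then show "(a, b) \<in> {(u, v)}" by simp
  qed auto
  then show "hahn_coeff (f * g) (u + v) = hahn_coeff f u * hahn_coeff g v" by simp
qed

lemma hahn_ord_times: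
  fixes f g :: "('g::linordered_ab_group_add, 'a::idom) hahn"
  assumes "f \<noteq> 0" "g \<noteq> 0"
  shows "hahn_ord (f * g) = hahn_ord f + hahn_ord g"
    and "hahn_coeff (f * g) (hahn_ord f + hahn_ord g) = hahn_coeff f (hahn_ord f) * hahn_coeff g (hahn_ord g)"
proof -
  show c: "hahn_coeff (f * g) (hahn_ord f + hahn_ord g) = hahn_coeff f (hahn_ord f) * hahn_coeff g (hahn_ord g)"
    by (intro hahn_coeff_times_below) (auto intro: hahn_coeff_below_ord)
  show "hahn_ord (f * g) = hahn_ord f + hahn_ord g"
  proof (rule hahn_ord_eqI)
    show "hahn_coeff (f * g) (hahn_ord f + hahn_ord g) \<noteq> 0"
      using assms by (simp add: c hahn_coeff_ord)
  qed (auto intro!: hahn_coeff_times_below(1)[of "hahn_ord f" f "hahn_ord g" g] intro: hahn_coeff_below_ord)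
qed

instance hahn :: (linordered_ab_group_add, idom) idom
proof
  fix f g :: "('a, 'b) hahn"
  assume "f \<noteq> 0" "g \<noteq> 0"
  then have "hahn_coeff (f * g) (hahn_ord f + hahn_ord g) \<noteq> 0"
    by (simp add: hahn_ord_times hahn_coeff_ord)
  then show "f * g \<noteq> 0" by (metis hahn_coeff_simps(1))
qed

lemma hahn_inverse_exists_aux:
  fixes f :: "('g::linordered_ab_group_add, 'a::comm_ring_1) hahn"
  assumes f0: "hahn_coeff f 0 = 1" and fneg: "\<And>i. i < 0 \<Longrightarrow> hahn_coeff f i = 0"
  shows "\<exists>g. f * g = 1"
proof -
  define P where "P = {g. \<forall>w u. hahn_coeff g w \<noteq> 0 \<longrightarrow> u \<le> w \<longrightarrow> hahn_coeff (f * g - 1) u = 0}"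
  have PD: "x < v" if "g \<in> P" "hahn_coeff (f * g - 1) v \<noteq> 0" "hahn_coeff g x \<noteq> 0" for g x v
  proof (rule ccontr)
    assume "\<not> x < v"
    then show False using that unfolding P_def by (simp add: not_less)
  qed
  have below: "hahn_coeff (f * d) w = hahn_coeff d w" if "\<And>u. u < w \<Longrightarrow> hahn_coeff d u = 0" for d w
    using hahn_coeff_times_below(2)[of 0 f w d] fneg that f0 by simp
  have below0: "hahn_coeff (f * d) w = 0" if "\<And>u. u \<le> w \<Longrightarrow> hahn_coeff d u = 0" for d w
    using below[of w d] that by simp
  have trunc: "(\<forall>u\<le>w. hahn_coeff g' u = hahn_coeff g u) \<or> (\<forall>u. hahn_coeff g' u \<noteq> 0 \<longrightarrow> u < w)"
    if g: "g \<in> P" "g' \<in> P" "hahn_coeff g w \<noteq> 0" for g g' w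
  proof (cases "g = g'")
    case False
    define d where "d = g - g'"
    have "d \<noteq> 0" using False by (simp add: d_def)
    define v where "v = hahn_ord d"
    have dv: "hahn_coeff d v \<noteq> 0" "\<And>u. u < v \<Longrightarrow> hahn_coeff d u = 0"
      using \<open>d \<noteq> 0\<close> by (auto simp: v_def hahn_coeff_ord hahn_coeff_below_ord)
    have "f * d = (f * g - 1) - (f * g' - 1)" by (simp add: d_def algebra_simps)
    then have "hahn_coeff (f * g - 1) v - hahn_coeff (f * g' - 1) v = hahn_coeff (f * d) v"
      by (simp only: hahn_coeff_simps)
    also have "\<dots> = hahn_coeff d v" by (rule below[OF dv(2)])
    finally have "hahn_coeff (f * g - 1) v \<noteq> 0 \<or> hahn_coeff (f * g' - 1) v \<noteq> 0" using dv(1) by auto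
    then have alt: "(\<forall>x. hahn_coeff g x \<noteq> 0 \<longrightarrow> x < v) \<or> (\<forall>x. hahn_coeff g' x \<noteq> 0 \<longrightarrow> x < v)"
      using PD[OF g(1)] PD[OF g(2)] by blast
    show ?thesis
    proof (cases "w < v")
      case True
      then have "hahn_coeff d u = 0" if "u \<le> w" for u using dv(2) that by auto
      then show ?thesis by (simp add: d_def)
    next
      case False
      then have "\<not> (\<forall>x. hahn_coeff g x \<noteq> 0 \<longrightarrow> x < v)" using g(3) by blast
      then have "\<forall>x. hahn_coeff g' x \<noteq> 0 \<longrightarrow> x < v" using alt by blast
      then show ?thesis using False by (auto intro: less_le_trans)
    qed
  qed auto
  define G0 where "G0 = (\<lambda>w. if \<exists>g\<in>P. hahn_coeff g w \<noteq> 0 then hahn_coeff (SOME g. g \<in> P \<and> hahn_coeff g w \<noteq> 0) w else 0)"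
  have G0_nz: "\<exists>g\<in>P. hahn_coeff g w \<noteq> 0 \<and> hahn_coeff g w = G0 w" if "G0 w \<noteq> 0" for w
  proof -
    have ex: "\<exists>g. g \<in> P \<and> hahn_coeff g w \<noteq> 0" using that unfolding G0_def by (auto split: if_splits)
    then have "G0 w = hahn_coeff (SOME g. g \<in> P \<and> hahn_coeff g w \<noteq> 0) w" unfolding G0_def by auto
    then show ?thesis using someI_ex[OF ex] by auto
  qed
  have G0_ex: "\<exists>g'\<in>P. hahn_coeff g' u \<noteq> 0 \<and> hahn_coeff g' u = G0 u" if "g \<in> P" "hahn_coeff g u \<noteq> 0" for g u
  proof -
    have ex: "\<exists>g. g \<in> P \<and> hahn_coeff g u \<noteq> 0" using that by blast
    then have "G0 u = hahn_coeff (SOME g. g \<in> P \<and> hahn_coeff g u \<noteq> 0) u" unfolding G0_def by auto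
    then show ?thesis using someI_ex[OF ex] by auto
  qed
  have G0_eq: "G0 u = hahn_coeff g u" if g: "g \<in> P" "hahn_coeff g w \<noteq> 0" "u \<le> w" for g w u
  proof (cases "\<exists>g'\<in>P. hahn_coeff g' u \<noteq> 0")
    case True
    then obtain g' where g': "g' \<in> P" "hahn_coeff g' u \<noteq> 0" "hahn_coeff g' u = G0 u"
      using G0_ex by blast
    have "\<not> (\<forall>x. hahn_coeff g x \<noteq> 0 \<longrightarrow> x < u)" using g(2,3) by (auto simp: not_less)
    with trunc[OF g'(1) g(1) g'(2)] have "hahn_coeff g u = hahn_coeff g' u" by auto
    then show ?thesis using g' by simp
  next
    case False
    then show ?thesis using g G0_def by auto
  qed
  have "wo_set {w. G0 w \<noteq> 0}"
    unfolding wo_set_def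
  proof (intro allI impI)
    fix X assume X: "X \<subseteq> {w. G0 w \<noteq> 0}" "X \<noteq> {}"
    then obtain x where x: "x \<in> X" "G0 x \<noteq> 0" by auto
    then obtain g where g: "g \<in> P" "hahn_coeff g x \<noteq> 0" using G0_nz by blast
    let ?Y = "{y\<in>X. y \<le> x}"
    have "?Y \<subseteq> {i. hahn_coeff g i \<noteq> 0}" "?Y \<noteq> {}" using X x G0_eq[OF g] by auto
    then obtain m where m: "m \<in> ?Y" "\<And>y. y \<in> ?Y \<Longrightarrow> m \<le> y" by (rule wo_setD[OF wo_set_supp]) (rule that)
    then have "m \<le> y" if "y \<in> X" for y using that by (cases "y \<le> x") auto
    then show "\<exists>m\<in>X. \<forall>x\<in>X. m \<le> x" using m by blast
  qed
  then have "hahn_coeff (Abs_hahn G0) = G0" by (simp add: Abs_hahn_inverse)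
  then obtain G where G: "\<And>w. hahn_coeff G w = G0 w" by (metis fun_cong)
  have fG: "hahn_coeff (f * G - 1) u = 0" if "G0 w \<noteq> 0" "u \<le> w" for u w
  proof -
    from G0_nz[OF that(1)] obtain g where g: "g \<in> P" "hahn_coeff g w \<noteq> 0" by blast
    have "hahn_coeff (f * (G - g)) u = 0"
      by (rule below0) (use that G0_eq[OF g] G in auto)
    then have "hahn_coeff (f * G - 1) u = hahn_coeff (f * g - 1) u" by (simp add: algebra_simps)
    also have "\<dots> = 0" using g that(2) unfolding P_def by blast
    finally show ?thesis .
  qed
  show ?thesis
  proof (rule ccontr)
    assume "\<nexists>g. f * g = 1"
    define r where "r = 1 - f * G"
    have "r \<noteq> 0" using \<open>\<nexists>g. f * g = 1\<close> by (auto simp: r_def)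
    define u c where "u = hahn_ord r" and "c = hahn_coeff r u"
    have c: "c \<noteq> 0" using \<open>r \<noteq> 0\<close> by (simp add: c_def u_def hahn_coeff_ord)
    have r0: "hahn_coeff r x = 0" if "x < u" for x using that by (simp add: u_def hahn_coeff_below_ord)
    have Glt: "w < u" if "G0 w \<noteq> 0" for w
    proof (rule ccontr)
      assume "\<not> w < u"
      then have "hahn_coeff (f * G - 1) u = 0" using fG[OF that] by auto
      then show False using c by (simp add: c_def r_def)
    qed
    define G' where "G' = G + hahn_single u c"
    have eq: "f * G' - 1 = f * hahn_single u c - r" by (simp add: G'_def r_def algebra_simps)
    have z: "hahn_coeff (f * G' - 1) x = 0" if "x \<le> u" for x
    proof -
      have "hahn_coeff (f * hahn_single u c) x = hahn_coeff (hahn_single u c) x"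
        by (rule below) (use that in auto)
      then show ?thesis unfolding eq using that r0[of x] by (cases "x = u") (auto simp: c_def)
    qed
    have "w \<le> u" if "hahn_coeff G' w \<noteq> 0" for w
      using that Glt[of w] by (cases "w = u") (auto simp: G'_def G)
    then have "G' \<in> P" unfolding P_def using z by (blast intro: order_trans)
    moreover have "G0 u = 0" using Glt by blast
    then have "hahn_coeff G' u = c" by (simp add: G'_def G)
    ultimately have "G0 u = c" using G0_eq[of G' u u] c by simp
    then show False using \<open>G0 u = 0\<close> c by simp
  qed
qed

lemma hahn_inverse_exists:
  fixes f :: "('g::linordered_ab_group_add, 'a::field) hahn"
  assumes "f \<noteq> 0"
  shows "\<exists>g. f * g = 1"
proof -
  define w c where "w = hahn_ord f" and "c = hahn_coeff f w"
  define s where "s = hahn_single (- w) (inverse c)"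
  have c: "c \<noteq> 0" using assms by (simp add: c_def w_def hahn_coeff_ord)
  have "hahn_coeff (s * f) (- w + w) = hahn_coeff s (- w) * hahn_coeff f w"
    by (rule hahn_coeff_times_below) (auto simp: s_def w_def hahn_coeff_below_ord)
  then have "hahn_coeff (s * f) 0 = 1" using c by (simp add: s_def c_def)
  moreover have "hahn_coeff (s * f) i = 0" if "i < 0" for i
    by (rule hahn_coeff_times_below(1)[of "- w" _ w]) (use that in \<open>auto simp: s_def w_def hahn_coeff_below_ord\<close>)
  ultimately obtain g where "s * f * g = 1" using hahn_inverse_exists_aux by blast
  then have "f * (s * g) = 1" by (simp add: mult_ac)
  then show ?thesis by blast
qed

instantiation hahn :: (linordered_ab_group_add, field) field
begin

definition inverse_hahn :: "('a, 'b) hahn \<Rightarrow> ('a, 'b) hahn" where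
  "inverse_hahn f = (if f = 0 then 0 else (THE g. f * g = 1))"
definition divide_hahn :: "('a, 'b) hahn \<Rightarrow> ('a, 'b) hahn \<Rightarrow> ('a, 'b) hahn" where
  "divide_hahn f g = f * inverse g"

instance
proof
  fix f :: "('a, 'b) hahn"
  assume f: "f \<noteq> 0"
  then obtain g where g: "f * g = 1" using hahn_inverse_exists by blast
  have "(THE g. f * g = 1) = g"
    by (rule the_equality[where P = "\<lambda>g. f * g = 1", OF g]) (use f g in \<open>metis mult_cancel_left\<close>)
  then show "inverse f * f = 1" using f g by (simp add: inverse_hahn_def mult.commute)
qed (simp_all add: inverse_hahn_def divide_hahn_def)

end

instantiation hahn :: (linordered_ab_group_add, linordered_idom) linordered_idom
begin

definition less_hahn :: "('a, 'b) hahn \<Rightarrow> ('a, 'b) hahn \<Rightarrow> bool" where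
  "less_hahn f g \<longleftrightarrow> f \<noteq> g \<and> hahn_coeff (g - f) (hahn_ord (g - f)) > 0"
definition less_eq_hahn :: "('a, 'b) hahn \<Rightarrow> ('a, 'b) hahn \<Rightarrow> bool" where
  "less_eq_hahn f g \<longleftrightarrow> f = g \<or> f < g"
definition abs_hahn :: "('a, 'b) hahn \<Rightarrow> ('a, 'b) hahn" where
  "abs_hahn f = (if f < 0 then - f else f)"
definition sgn_hahn :: "('a, 'b) hahn \<Rightarrow> ('a, 'b) hahn" where
  "sgn_hahn f = (if f = 0 then 0 else if 0 < f then 1 else - 1)"

instance
proof
  define pos where "pos = (\<lambda>f :: ('a, 'b) hahn. f \<noteq> 0 \<and> hahn_coeff f (hahn_ord f) > 0)"
  have less_iff: "f < g \<longleftrightarrow> pos (g - f)" for f g by (auto simp: less_hahn_def pos_def)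
  have pos_0: "\<not> pos 0" by (simp add: pos_def)
  have ord_uminus: "hahn_ord (- f) = hahn_ord f" for f :: "('a, 'b) hahn" by (simp add: hahn_ord_def)
  have pos_uminus: "pos f \<or> pos (- f)" if "f \<noteq> 0" for f
    using that hahn_coeff_ord[OF that] by (auto simp: pos_def ord_uminus)
  have pos_not_uminus: "\<not> pos (- f)" if "pos f" for f
    using that by (auto simp: pos_def ord_uminus)
  have pos_add: "pos (f + g)" if "pos f" "pos g" for f g
  proof -
    have *: "pos (f + g)" if "pos f" "pos g" "hahn_ord f \<le> hahn_ord g" for f g
    proof -
      have "hahn_coeff g (hahn_ord f) \<ge> 0"
        using that hahn_coeff_below_ord[of "hahn_ord f" g] by (cases "hahn_ord f = hahn_ord g") (auto simp: pos_def)
      then have p: "hahn_coeff (f + g) (hahn_ord f) > 0" using that by (simp add: pos_def add_pos_nonneg)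
      moreover have "hahn_ord (f + g) = hahn_ord f"
        by (rule hahn_ord_eqI) (use p that in \<open>auto simp: hahn_coeff_below_ord\<close>)
      moreover have "f + g \<noteq> 0" using p by (metis hahn_coeff_simps(1) less_irrefl)
      ultimately show ?thesis by (simp add: pos_def)
    qed
    show ?thesis using *[of f g] *[of g f] that by (metis add.commute linear)
  qed
  have pos_mult: "pos (f * g)" if "pos f" "pos g" for f g
    using that by (auto simp: pos_def hahn_ord_times)
  fix f g h :: "('a, 'b) hahn"
  show "f < g \<longleftrightarrow> f \<le> g \<and> \<not> g \<le> f"
    using pos_0 pos_not_uminus[of "g - f"] by (auto simp: less_eq_hahn_def less_iff)
  show "f \<le> f" by (simp add: less_eq_hahn_def)
  show "f \<le> h" if "f \<le> g" "g \<le> h"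
    using that pos_add[of "g - f" "h - g"] by (auto simp: less_eq_hahn_def less_iff)
  show "f = g" if "f \<le> g" "g \<le> f"
    using that pos_not_uminus[of "g - f"] by (auto simp: less_eq_hahn_def less_iff)
  show "h + f \<le> h + g" if "f \<le> g"
    using that by (auto simp: less_eq_hahn_def less_iff)
  show "f \<le> g \<or> g \<le> f"
    using pos_uminus[of "g - f"] by (auto simp: less_eq_hahn_def less_iff)
  show "h * f < h * g" if "f < g" "0 < h"
    using that pos_mult[of h "g - f"] by (auto simp: less_iff algebra_simps)
  show "\<bar>f\<bar> = (if f < 0 then - f else f)" by (simp add: abs_hahn_def)
  show "sgn f = (if f = 0 then 0 else if 0 < f then 1 else - 1)" by (simp add: sgn_hahn_def)
qed

end

instance hahn :: (linordered_ab_group_add, linordered_field) linordered_field ..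

definition convex_closure :: "'k::linorder set \<Rightarrow> 'k set" where
  "convex_closure S = {x. \<exists>a\<in>S. \<exists>b\<in>S. a \<le> x \<and> x \<le> b}"

text \<open>The valuation ring of the natural valuation, i.e. the convex closure of the reals. As the type
  \<open>'k\<close> does not fix an embedding of the reals, the integers are used; the lemma
  \<open>val_ring_eq_convex_closure_reals\<close> shows that every order-preserving embedding of the reals
  gives the same set.\<close>

definition val_ring :: "'k::linordered_field set" where
  "val_ring = convex_closure \<int>"

lemma val_ring_iff: "x \<in> val_ring \<longleftrightarrow> (\<exists>n. \<bar>x\<bar> \<le> of_nat n)"
proof
  assume "x \<in> val_ring"
  then obtain i j :: int where ij: "of_int i \<le> x" "x \<le> of_int j"
    by (auto simp: val_ring_def convex_closure_def elim!: Ints_cases)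
  have "\<bar>x\<bar> \<le> of_int (max \<bar>i\<bar> \<bar>j\<bar>)"
  proof (rule abs_leI)
    have "x \<le> of_int j" by (rule ij)
    also have "\<dots> \<le> of_int (max \<bar>i\<bar> \<bar>j\<bar>)" unfolding of_int_le_iff by linarith
    finally show "x \<le> of_int (max \<bar>i\<bar> \<bar>j\<bar>)" .
    have "- x \<le> of_int (- i)" using ij by simp
    also have "\<dots> \<le> of_int (max \<bar>i\<bar> \<bar>j\<bar>)" unfolding of_int_le_iff by linarith
    finally show "- x \<le> of_int (max \<bar>i\<bar> \<bar>j\<bar>)" .
  qed
  also have "\<dots> = of_nat (nat (max \<bar>i\<bar> \<bar>j\<bar>))" by (intro of_nat_nat[symmetric]) auto
  finally show "\<exists>n. \<bar>x\<bar> \<le> of_nat n" ..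
next
  assume "\<exists>n. \<bar>x\<bar> \<le> of_nat n"
  then obtain n where "\<bar>x\<bar> \<le> of_nat n" ..
  then have "- of_nat n \<le> x" "x \<le> of_nat n" by (auto simp: abs_le_iff)
  moreover have "- of_nat n \<in> (\<int> :: 'a set)" "of_nat n \<in> (\<int> :: 'a set)" by simp_all
  ultimately show "x \<in> val_ring" unfolding val_ring_def convex_closure_def by blast
qed

lemma val_ring_eq_convex_closure_reals:
  fixes h :: "real \<Rightarrow> 'k::linordered_field"
  assumes add: "\<And>x y. h (x + y) = h x + h y" and one: "h 1 = 1"
    and mono: "\<And>x y. x < y \<Longrightarrow> h x < h y"
  shows "val_ring = convex_closure (range h)"
proof -
  have zero: "h 0 = 0" using add[of 0 0] by simp
  have uminus: "h (- x) = - h x" for x using add[of "- x" x] zero by (simp add: eq_neg_iff_add_eq_0)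
  have nat: "h (of_nat n) = of_nat n" for n by (induction n) (simp_all add: zero add one)
  have mono': "h x \<le> h y" if "x \<le> y" for x y using mono[of x y] that by (cases "x = y") auto
  show ?thesis
  proof (intro set_eqI iffI)
    fix x :: 'k assume "x \<in> val_ring"
    then obtain n where "\<bar>x\<bar> \<le> of_nat n" by (auto simp: val_ring_iff)
    then have "h (- of_nat n) \<le> x" "x \<le> h (of_nat n)" by (auto simp: abs_le_iff uminus nat)
    then show "x \<in> convex_closure (range h)" by (auto simp: convex_closure_def)
  next
    fix x assume "x \<in> convex_closure (range h)"
    then obtain r s where rs: "h r \<le> x" "x \<le> h s" by (auto simp: convex_closure_def)
    obtain n :: nat where n: "max \<bar>r\<bar> \<bar>s\<bar> \<le> of_nat n" using real_arch_simple by blast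
    then have "h (- of_nat n) \<le> h r" "h s \<le> h (of_nat n)" by (auto intro!: mono')
    with rs have "- of_nat n \<le> x" "x \<le> of_nat n" unfolding uminus nat by linarith+
    then show "x \<in> val_ring" by (auto simp: val_ring_iff abs_le_iff)
  qed
qed

lemma val_ring_1 [simp]: "1 \<in> val_ring"
  unfolding val_ring_iff by (rule exI[of _ 1]) simp

lemma val_ring_mult: "x \<in> val_ring \<Longrightarrow> y \<in> val_ring \<Longrightarrow> x * y \<in> val_ring"
proof -
  assume "x \<in> val_ring" "y \<in> val_ring"
  then obtain m n where "\<bar>x\<bar> \<le> of_nat m" "\<bar>y\<bar> \<le> of_nat n" by (auto simp: val_ring_iff)
  then have "\<bar>x * y\<bar> \<le> of_nat (m * n)" unfolding abs_mult of_nat_mult by (intro mult_mono) auto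
  then show ?thesis unfolding val_ring_iff by (rule exI)
qed

lemma val_ring_total: "x \<in> val_ring \<or> inverse x \<in> val_ring"
proof (cases "\<bar>x\<bar> \<le> 1")
  case True
  then have "\<bar>x\<bar> \<le> of_nat 1" by simp
  then have "x \<in> val_ring" unfolding val_ring_iff by (rule exI)
  then show ?thesis ..
next
  case False
  then have "\<bar>inverse x\<bar> \<le> of_nat 1" by (simp add: inverse_le_1_iff)
  then have "inverse x \<in> val_ring" unfolding val_ring_iff by (rule exI)
  then show ?thesis ..
qed

text \<open>\<open>y / x\<close> is a unit of the valuation ring.\<close>

definition val_rel :: "'k::linordered_field \<Rightarrow> 'k \<Rightarrow> bool" where
  "val_rel x y \<longleftrightarrow> x \<noteq> 0 \<and> y \<noteq> 0 \<and> y / x \<in> val_ring \<and> x / y \<in> val_ring"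

lemma val_ring_trans:
  assumes "y / x \<in> val_ring" "z / y \<in> val_ring" "y \<noteq> 0"
  shows "z / x \<in> val_ring"
  using val_ring_mult[OF assms(1,2)] assms(3) by simp

text \<open>The value group, written additively. The class of \<open>x\<close> is nonnegative iff \<open>x \<in> val_ring\<close>.\<close>

quotient_type (overloaded) 'k vgroup = "'k::linordered_field" / partial: val_rel
proof (rule part_equivpI)
  show "\<exists>x::'k. val_rel x x" by (rule exI[of _ 1]) (simp add: val_rel_def)
  show "symp (val_rel :: 'k \<Rightarrow> _)" by (rule sympI) (simp add: val_rel_def)
  show "transp (val_rel :: 'k \<Rightarrow> _)"
    by (rule transpI) (unfold val_rel_def, meson val_ring_trans)
qed

instantiation vgroup :: (linordered_field) linordered_ab_group_add
begin

lift_definition zero_vgroup :: "'a vgroup" is 1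
  by (simp add: val_rel_def)
lift_definition plus_vgroup :: "'a vgroup \<Rightarrow> 'a vgroup \<Rightarrow> 'a vgroup" is "(*)"
proof -
  fix x x' y y' :: 'a
  assume *: "val_rel x x'" "val_rel y y'"
  have "(x' * y') / (x * y) = (x' / x) * (y' / y)" "(x * y) / (x' * y') = (x / x') * (y / y')" by simp_all
  with * show "val_rel (x * y) (x' * y')" unfolding val_rel_def by (simp only: val_ring_mult) simp
qed
lift_definition uminus_vgroup :: "'a vgroup \<Rightarrow> 'a vgroup" is inverse
  unfolding val_rel_def by (auto simp: divide_inverse mult.commute)
lift_definition minus_vgroup :: "'a vgroup \<Rightarrow> 'a vgroup \<Rightarrow> 'a vgroup" is "(/)"
proof -
  fix x x' y y' :: 'a
  assume *: "val_rel x x'" "val_rel y y'"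
  have "(x' / y') / (x / y) = (x' / x) * (y / y')" "(x / y) / (x' / y') = (x / x') * (y' / y)" by simp_all
  with * show "val_rel (x / y) (x' / y')" unfolding val_rel_def by (simp only: val_ring_mult) simp
qed
lift_definition less_eq_vgroup :: "'a vgroup \<Rightarrow> 'a vgroup \<Rightarrow> bool" is "\<lambda>x y. y / x \<in> val_ring"
  unfolding val_rel_def by (meson val_ring_trans)
definition less_vgroup :: "'a vgroup \<Rightarrow> 'a vgroup \<Rightarrow> bool" where
  "less_vgroup a b \<longleftrightarrow> a \<le> b \<and> \<not> b \<le> a"

instance
proof
  fix a b c :: "'a vgroup"
  show "a < b \<longleftrightarrow> a \<le> b \<and> \<not> b \<le> a" by (rule less_vgroup_def)
  show "a + b + c = a + (b + c)" by transfer (simp add: val_rel_def mult.assoc)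
  show "a + b = b + a" by transfer (simp add: val_rel_def mult.commute)
  show "0 + a = a" by transfer (simp add: val_rel_def)
  show "- a + a = 0" by transfer (simp add: val_rel_def)
  show "a - b = a + - b" by transfer (simp add: val_rel_def divide_inverse)
  show "a \<le> a" by transfer (simp add: val_rel_def)
  show "a \<le> b \<Longrightarrow> b \<le> c \<Longrightarrow> a \<le> c" by transfer (unfold val_rel_def, meson val_ring_trans)
  show "a \<le> b \<Longrightarrow> b \<le> a \<Longrightarrow> a = b" by transfer (auto simp: val_rel_def)
  show "a \<le> b \<Longrightarrow> c + a \<le> c + b" by transfer (auto simp: val_rel_def)
  show "a \<le> b \<or> b \<le> a"
  proof transfer
    fix x y :: 'a
    show "y / x \<in> val_ring \<or> x / y \<in> val_ring" using val_ring_total[of "y / x"] by simp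
  qed
qed

end

definition mon_degree :: "(nat \<Rightarrow>\<^sub>0 nat) \<Rightarrow> nat" where
  "mon_degree \<mu> = (\<Sum>i\<in>Poly_Mapping.keys \<mu>. Poly_Mapping.lookup \<mu> i)"

definition mon_fact :: "(nat \<Rightarrow>\<^sub>0 nat) \<Rightarrow> real" where
  "mon_fact \<mu> = (\<Prod>i\<in>Poly_Mapping.keys \<mu>. fact (Poly_Mapping.lookup \<mu> i))"

definition mon_eval :: "'a::comm_monoid_mult list \<Rightarrow> (nat \<Rightarrow>\<^sub>0 nat) \<Rightarrow> 'a" where
  "mon_eval a \<mu> = (\<Prod>i\<in>Poly_Mapping.keys \<mu>. a ! i ^ Poly_Mapping.lookup \<mu> i)"

definition mps_in_vars :: "nat \<Rightarrow> 'a::zero mps \<Rightarrow> bool" where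
  "mps_in_vars n f \<longleftrightarrow> (\<forall>\<mu>. mps_coeff f \<mu> \<noteq> 0 \<longrightarrow> Poly_Mapping.keys \<mu> \<subseteq> {..<n})"

lift_definition mps_const :: "'a::zero \<Rightarrow> 'a mps" is "\<lambda>c \<mu>. if \<mu> = 0 then c else 0" .

lift_definition mps_var :: "nat \<Rightarrow> 'a::comm_ring_1 mps"
  is "\<lambda>i \<mu>. if \<mu> = Poly_Mapping.single i 1 then 1 else 0" .

definition mps_polys :: "nat \<Rightarrow> 'a::zero mps set" where
  "mps_polys n = {p. mps_in_vars n p \<and> finite {\<mu>. mps_coeff p \<mu> \<noteq> 0}}"

definition mps_radius :: "real mps \<Rightarrow> ereal" where
  "mps_radius f = Sup {ereal r |r. 0 \<le> r \<and> (\<lambda>\<mu>. \<bar>mps_coeff f \<mu>\<bar> * r ^ mon_degree \<mu>) summable_on UNIV}"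

definition A_ring :: "nat \<Rightarrow> real \<Rightarrow> real mps set" where
  "A_ring n \<alpha> = {f. mps_in_vars n f \<and> ereal \<alpha> < mps_radius f}"

definition mps_eval :: "real mps \<Rightarrow> real list \<Rightarrow> real" where
  "mps_eval f a = (\<Sum>\<^sub>\<infinity>\<mu>. mps_coeff f \<mu> * mon_eval a \<mu>)"

lift_definition mps_deriv :: "(nat \<Rightarrow>\<^sub>0 nat) \<Rightarrow> real mps \<Rightarrow> real mps"
  is "\<lambda>\<mu> f \<nu>. mon_fact (\<nu> + \<mu>) / mon_fact \<nu> * f (\<nu> + \<mu>)" .

definition mps_taylor :: "real mps \<Rightarrow> real list \<Rightarrow> (nat \<Rightarrow>\<^sub>0 nat) \<Rightarrow> real" where
  "mps_taylor f a \<mu> = mps_eval (mps_deriv \<mu> f) a / mon_fact \<mu>"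

text \<open>The expansion at the origin of \<open>\<xi> \<mapsto> f (r \<xi> + a)\<close>.\<close>

definition mps_affine :: "real \<Rightarrow> real list \<Rightarrow> real mps \<Rightarrow> real mps" where
  "mps_affine r a f = Abs_mps (\<lambda>\<nu>. r ^ mon_degree \<nu> * mps_taylor f a \<nu>)"

text \<open>The coefficient of \<open>\<eta>\<^sup>\<mu>\<close>, where \<open>\<eta>\<close> are the variables of index \<open>\<ge> m\<close>.\<close>

lift_definition mps_slice :: "nat \<Rightarrow> (nat \<Rightarrow>\<^sub>0 nat) \<Rightarrow> 'a::zero mps \<Rightarrow> 'a mps"
  is "\<lambda>m \<mu> f \<nu>. if Poly_Mapping.keys \<nu> \<subseteq> {..<m} then f (\<nu> + \<mu>) else 0" .

text \<open>\<open>mps_permute \<pi>\<close> substitutes \<open>\<xi>\<^bsub>\<pi> i\<^esub>\<close> for \<open>\<xi>\<^sub>i\<close> and \<open>mps_shift\<close> substitutes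
  \<open>\<xi>\<^bsub>i + 1\<^esub>\<close> for \<open>\<xi>\<^sub>i\<close>.\<close>

lift_definition mps_permute :: "(nat \<Rightarrow> nat) \<Rightarrow> 'a mps \<Rightarrow> 'a mps"
  is "\<lambda>\<pi> f \<nu>. f (Poly_Mapping.map_key \<pi> \<nu>)" .

lift_definition mps_shift :: "'a::zero mps \<Rightarrow> 'a mps"
  is "\<lambda>f \<nu>. if Poly_Mapping.lookup \<nu> 0 = 0 then f (Poly_Mapping.map_key Suc \<nu>) else 0" .

definition mps_regular :: "nat \<Rightarrow> 'a::zero mps \<Rightarrow> bool" where
  "mps_regular s f \<longleftrightarrow> mps_coeff f (Poly_Mapping.single 0 s) \<noteq> 0 \<and>
     (\<forall>k<s. mps_coeff f (Poly_Mapping.single 0 k) = 0)"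

text \<open>\<open>Norm_Pow i\<close> is \<open>t\<^sup>i\<close>, so the order on exponents is reversed.\<close>

datatype 'w gauss_norm = Norm_Zero | Norm_Pow 'w

instantiation gauss_norm :: (linorder) linorder
begin

fun less_eq_gauss_norm :: "'a gauss_norm \<Rightarrow> 'a gauss_norm \<Rightarrow> bool" where
  "less_eq_gauss_norm Norm_Zero _ \<longleftrightarrow> True"
| "less_eq_gauss_norm (Norm_Pow _) Norm_Zero \<longleftrightarrow> False"
| "less_eq_gauss_norm (Norm_Pow i) (Norm_Pow j) \<longleftrightarrow> j \<le> i"

definition less_gauss_norm :: "'a gauss_norm \<Rightarrow> 'a gauss_norm \<Rightarrow> bool" where
  "less_gauss_norm x y \<longleftrightarrow> x \<le> y \<and> \<not> y \<le> x"

instance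
proof
  fix x y z :: "'a gauss_norm"
  show "x < y \<longleftrightarrow> x \<le> y \<and> \<not> y \<le> x" by (rule less_gauss_norm_def)
  show "x \<le> x" by (cases x) auto
  show "x \<le> y \<Longrightarrow> y \<le> z \<Longrightarrow> x \<le> z" by (cases x; cases y; cases z) auto
  show "x \<le> y \<Longrightarrow> y \<le> x \<Longrightarrow> x = y" by (cases x; cases y) auto
  show "x \<le> y \<or> y \<le> x" by (cases x; cases y) auto
qed

end

instantiation gauss_norm :: (zero) one
begin
definition one_gauss_norm :: "'a gauss_norm" where "1 = Norm_Pow 0"
instance ..
end

definition gauss_norm :: "('w::linordered_ab_group_add, 'a::comm_ring_1) hahn \<Rightarrow> 'w gauss_norm" where
  "gauss_norm f = (if f = 0 then Norm_Zero else Norm_Pow (hahn_ord f))"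

definition A_hahn :: "nat \<Rightarrow> real \<Rightarrow> ('w::linordered_ab_group_add, real mps) hahn set" where
  "A_hahn n \<alpha> = {f. \<forall>i. hahn_coeff f i \<in> A_ring n \<alpha>}"

definition rat_functions :: "('w::linordered_ab_group_add, real) hahn set" where
  "rat_functions = {p / q |p q. finite {i. hahn_coeff p i \<noteq> 0} \<and> finite {i. hahn_coeff q i \<noteq> 0} \<and> q \<noteq> 0}"

definition affine_radius :: "real \<Rightarrow> real \<Rightarrow> real list \<Rightarrow> real" where
  "affine_radius \<alpha> r a = Min ((\<lambda>c. min ((\<alpha> - c) / r) ((\<alpha> + c) / r)) ` set a)"

text \<open>\<open>B 0 1\<close> stands for \<open>B\<^sub>0\<close>. Closure under negation and scalars follows from closure under
  products, since \<open>B n \<alpha>\<close> contains the constants. In \<open>affine\<close> the case \<open>m = 0\<close>, where the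
  minimum over the coordinates is empty and the substitution is trivial, is left out. In
  \<open>division\<close> the distinguished variable is \<open>\<xi>\<^sub>0\<close> and the remainders \<open>R ! i\<close>, which are series in the
  first \<open>m - 1\<close> variables, are shifted to series in \<open>\<xi>\<^sub>1, \<dots>, \<xi>\<^bsub>m-1\<^esub>\<close>.\<close>

locale real_weierstrass_system =
  fixes B :: "nat \<Rightarrow> real \<Rightarrow> ('w::linordered_ab_group_add, real mps) hahn set"
  assumes subset: "0 < \<alpha> \<Longrightarrow> B n \<alpha> \<subseteq> A_hahn n \<alpha>"
    and polys: "0 < \<alpha> \<Longrightarrow> p \<in> mps_polys n \<Longrightarrow> hahn_single 0 p \<in> B n \<alpha>"
    and add: "0 < \<alpha> \<Longrightarrow> f \<in> B n \<alpha> \<Longrightarrow> g \<in> B n \<alpha> \<Longrightarrow> f + g \<in> B n \<alpha>"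
    and mult: "0 < \<alpha> \<Longrightarrow> f \<in> B n \<alpha> \<Longrightarrow> g \<in> B n \<alpha> \<Longrightarrow> f * g \<in> B n \<alpha>"
    and mono: "m \<le> m' \<Longrightarrow> 0 < \<alpha>' \<Longrightarrow> \<alpha>' \<le> \<alpha> \<Longrightarrow> B m \<alpha> \<subseteq> B m' \<alpha>'"
    and B0: "0 < \<alpha> \<Longrightarrow> 0 < \<alpha>' \<Longrightarrow> B 0 \<alpha> = B 0 \<alpha>'"
    and slice: "0 < \<alpha> \<Longrightarrow> f \<in> B (m + n) \<alpha> \<Longrightarrow> Poly_Mapping.keys \<mu> \<subseteq> {m..<m + n} \<Longrightarrow>
      hahn_map (mps_slice m \<mu>) f \<in> B m \<alpha>"
    and affine: "0 < \<alpha> \<Longrightarrow> f \<in> B m \<alpha> \<Longrightarrow> 1 \<le> m \<Longrightarrow> length a = m \<Longrightarrow> set a \<subseteq> {-\<alpha><..<\<alpha>} \<Longrightarrow> 0 < r \<Longrightarrow>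
      hahn_map (mps_affine r a) f \<in> B m (affine_radius \<alpha> r a)"
    and normalize: "0 < \<alpha> \<Longrightarrow> f \<in> B n \<alpha> \<Longrightarrow> f \<noteq> 0 \<Longrightarrow> \<exists>a\<in>B 0 1. gauss_norm (a * f) = 1"
    and permute: "0 < \<alpha> \<Longrightarrow> f \<in> B n \<alpha> \<Longrightarrow> \<pi> permutes {..<n} \<Longrightarrow> hahn_map (mps_permute \<pi>) f \<in> B n \<alpha>"
    and division: "0 < \<alpha> \<Longrightarrow> 1 \<le> n \<Longrightarrow> f \<in> B n \<alpha> \<Longrightarrow> gauss_norm f = 1 \<Longrightarrow> mps_regular s (hahn_coeff f 0) \<Longrightarrow>
      \<exists>\<delta>>0. \<forall>m\<ge>n. \<forall>g\<in>B m \<alpha>. \<exists>!(Q, R).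
        Q \<in> B m \<delta> \<and> length R = s \<and> set R \<subseteq> B (m - 1) \<delta> \<and>
        gauss_norm Q \<le> gauss_norm g \<and> (\<forall>i<s. gauss_norm (R ! i) \<le> gauss_norm g) \<and>
        g = Q * f + (\<Sum>i<s. hahn_map mps_shift (R ! i) * hahn_single 0 (mps_var 0) ^ i)"

locale rich_real_weierstrass_system = real_weierstrass_system B
  for B :: "nat \<Rightarrow> real \<Rightarrow> ('w::linordered_ab_group_add, real mps) hahn set" +
  assumes rich: "hahn_map mps_const ` rat_functions \<subseteq> B 0 1"

definition unit_box :: "nat \<Rightarrow> 'k::linordered_idom list set" where
  "unit_box n = {xs. length xs = n \<and> set xs \<subseteq> {-1..1}}"

text \<open>\<open>e\<close> is the inclusion of \<open>B\<^sub>0\<close> into \<open>'k\<close>. Elements of \<open>B\<^sub>0\<close> are Hahn series whose coefficients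
  are constant power series; they are compared in the ordered field of real Hahn series by taking
  constant terms (\<open>e_less\<close>). The axiom \<open>affine\<close> is required at all points where both sides are
  defined, i.e. \<open>xs\<close> and \<open>ys = r xs + a\<close> both lie in the unit box. Values of \<open>\<sigma> n \<alpha> f\<close> outside the
  unit box, and for \<open>\<alpha> \<le> 1\<close> or \<open>f \<notin> B n \<alpha>\<close>, are irrelevant.\<close>

locale analytic_structure =
  fixes B :: "nat \<Rightarrow> real \<Rightarrow> ('w::linordered_ab_group_add, real mps) hahn set"
    and e :: "('w, real mps) hahn \<Rightarrow> 'k::linordered_field"
    and \<sigma> :: "nat \<Rightarrow> real \<Rightarrow> ('w, real mps) hahn \<Rightarrow> 'k list \<Rightarrow> 'k"
  assumes e_one: "e 1 = 1"
    and e_add: "f \<in> B 0 1 \<Longrightarrow> g \<in> B 0 1 \<Longrightarrow> e (f + g) = e f + e g"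
    and e_mult: "f \<in> B 0 1 \<Longrightarrow> g \<in> B 0 1 \<Longrightarrow> e (f * g) = e f * e g"
    and e_less: "f \<in> B 0 1 \<Longrightarrow> g \<in> B 0 1 \<Longrightarrow>
      hahn_map (\<lambda>p. mps_coeff p 0) f < hahn_map (\<lambda>p. mps_coeff p 0) g \<Longrightarrow> e f < e g"
    and one: "1 < \<alpha> \<Longrightarrow> xs \<in> unit_box n \<Longrightarrow> \<sigma> n \<alpha> 1 xs = 1"
    and add: "1 < \<alpha> \<Longrightarrow> f \<in> B n \<alpha> \<Longrightarrow> g \<in> B n \<alpha> \<Longrightarrow> xs \<in> unit_box n \<Longrightarrow>
      \<sigma> n \<alpha> (f + g) xs = \<sigma> n \<alpha> f xs + \<sigma> n \<alpha> g xs"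
    and mult: "1 < \<alpha> \<Longrightarrow> f \<in> B n \<alpha> \<Longrightarrow> g \<in> B n \<alpha> \<Longrightarrow> xs \<in> unit_box n \<Longrightarrow>
      \<sigma> n \<alpha> (f * g) xs = \<sigma> n \<alpha> f xs * \<sigma> n \<alpha> g xs"
    and scale: "1 < \<alpha> \<Longrightarrow> f \<in> B n \<alpha> \<Longrightarrow> xs \<in> unit_box n \<Longrightarrow>
      \<sigma> n \<alpha> (hahn_single 0 (mps_const c) * f) xs = e (hahn_single 0 (mps_const c)) * \<sigma> n \<alpha> f xs"
    and inclusion: "1 < \<beta> \<Longrightarrow> \<beta> < \<alpha> \<Longrightarrow> f \<in> B n \<alpha> \<Longrightarrow> xs \<in> unit_box n \<Longrightarrow> \<sigma> n \<beta> f xs = \<sigma> n \<alpha> f xs"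
    and affine: "1 < \<alpha> \<Longrightarrow> f \<in> B m \<alpha> \<Longrightarrow> 1 \<le> m \<Longrightarrow> length a = m \<Longrightarrow> set a \<subseteq> {-\<alpha><..<\<alpha>} \<Longrightarrow> 0 < r \<Longrightarrow>
      1 < affine_radius \<alpha> r a \<Longrightarrow> xs \<in> unit_box m \<Longrightarrow>
      ys = map2 (\<lambda>x c. e (hahn_single 0 (mps_const r)) * x + e (hahn_single 0 (mps_const c))) xs a \<Longrightarrow>
      ys \<in> unit_box m \<Longrightarrow>
      \<sigma> m (affine_radius \<alpha> r a) (hahn_map (mps_affine r a) f) xs = \<sigma> m \<alpha> f ys"
    and nullary: "1 < \<alpha> \<Longrightarrow> f \<in> B 0 1 \<Longrightarrow> \<sigma> 0 \<alpha> f [] = e f"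
    and coordinate: "1 < \<alpha> \<Longrightarrow> i < m \<Longrightarrow> xs \<in> unit_box m \<Longrightarrow> \<sigma> m \<alpha> (hahn_single 0 (mps_var i)) xs = xs ! i"
    and extend: "1 < \<alpha> \<Longrightarrow> f \<in> B m \<alpha> \<Longrightarrow> xs \<in> unit_box m \<Longrightarrow> x \<in> {-1..1} \<Longrightarrow>
      \<sigma> (Suc m) \<alpha> f (xs @ [x]) = \<sigma> m \<alpha> f xs"
    and permute: "1 < \<alpha> \<Longrightarrow> f \<in> B m \<alpha> \<Longrightarrow> \<pi> permutes {..<m} \<Longrightarrow> xs \<in> unit_box m \<Longrightarrow>
      \<sigma> m \<alpha> (hahn_map (mps_permute \<pi>) f) xs = \<sigma> m \<alpha> f (map (\<lambda>i. xs ! \<pi> i) [0..<m])"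

lemma val_ring_eq_convex_closure_analytic:
  fixes B :: "nat \<Rightarrow> real \<Rightarrow> ('w::linordered_ab_group_add, real mps) hahn set"
  assumes "real_weierstrass_system B" "analytic_structure B e \<sigma>"
  shows "val_ring = convex_closure (range (\<lambda>r. e (hahn_single 0 (mps_const r))))"
proof -
  interpret real_weierstrass_system B by fact
  interpret S: analytic_structure B e \<sigma> by fact
  have poly: "mps_const r \<in> mps_polys 0" for r :: real
  proof -
    have c: "mps_coeff (mps_const r) \<mu> = (if \<mu> = 0 then r else 0)" for \<mu>
      by transfer simp
    have "finite {\<mu>. mps_coeff (mps_const r) \<mu> \<noteq> 0}"
      by (rule finite_subset[of _ "{0}"]) (auto simp: c)
    then show ?thesis by (simp add: mps_polys_def mps_in_vars_def c)
  qed
  have mem: "hahn_single 0 (mps_const r) \<in> B 0 1" for r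
    by (rule polys) (simp_all add: poly)
  have const_add: "mps_const (r + s) = mps_const r + mps_const s" for r s :: real
    by transfer auto
  have one: "mps_const 1 = (1 :: real mps)" by transfer simp
  have coeff: "hahn_map (\<lambda>p. mps_coeff p 0) (hahn_single 0 (mps_const r)) = (hahn_single 0 r :: ('w, real) hahn)" for r :: real
  proof (rule hahn_eqI)
    have "mps_coeff (mps_const r) 0 = r" "mps_coeff 0 0 = (0 :: real)" by (transfer; simp)+
    then show "hahn_coeff (hahn_map (\<lambda>p. mps_coeff p 0) (hahn_single 0 (mps_const r))) i
      = hahn_coeff (hahn_single 0 r) i" for i :: 'w
      by (auto simp: hahn_map.rep_eq)
  qed
  show ?thesis
  proof (rule val_ring_eq_convex_closure_reals[of "\<lambda>r. e (hahn_single 0 (mps_const r))"])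
    fix r s :: real
    have "hahn_single 0 (mps_const (r + s)) = (hahn_single 0 (mps_const r) + hahn_single 0 (mps_const s) :: ('w, real mps) hahn)"
      by (rule hahn_eqI) (simp add: const_add)
    then show "e (hahn_single 0 (mps_const (r + s))) = e (hahn_single 0 (mps_const r)) + e (hahn_single 0 (mps_const s))"
      by (simp add: S.e_add mem)
    show "e (hahn_single 0 (mps_const 1)) = 1"
      using S.e_one by (simp add: one one_hahn_def)
    assume "r < s"
    have diff: "hahn_coeff (hahn_single 0 s - hahn_single 0 r :: ('w, real) hahn) i = (if i = 0 then s - r else 0)" for i
      by simp
    have ord: "hahn_ord (hahn_single 0 s - hahn_single 0 r :: ('w, real) hahn) = 0"
      by (rule hahn_ord_eqI) (use \<open>r < s\<close> in simp_all)
    have "hahn_coeff (hahn_single 0 r :: ('w, real) hahn) 0 \<noteq> hahn_coeff (hahn_single 0 s :: ('w, real) hahn) 0"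
      using \<open>r < s\<close> by simp
    then have "(hahn_single 0 r :: ('w, real) hahn) \<noteq> hahn_single 0 s"
      by (intro notI) (drule arg_cong[where f = "\<lambda>x. hahn_coeff x 0"], simp only: not_True_eq_False)
    then have "(hahn_single 0 r :: ('w, real) hahn) < hahn_single 0 s"
      unfolding less_hahn_def ord using \<open>r < s\<close> by simp
    then show "e (hahn_single 0 (mps_const r)) < e (hahn_single 0 (mps_const s))"
      by (intro S.e_less mem) (simp add: coeff)
  qed
qed

definition hahn_summable :: "('j \<Rightarrow> ('g::linordered_ab_group_add, 'a::comm_ring_1) hahn) \<Rightarrow> 'j set \<Rightarrow> bool" where
  "hahn_summable h J \<longleftrightarrow> wo_set {i. \<exists>j\<in>J. hahn_coeff (h j) i \<noteq> 0} \<and>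
     (\<forall>i. finite {j\<in>J. hahn_coeff (h j) i \<noteq> 0})"

definition hahn_sum :: "('j \<Rightarrow> ('g::linordered_ab_group_add, 'a::comm_ring_1) hahn) \<Rightarrow> 'j set \<Rightarrow> ('g, 'a) hahn" where
  "hahn_sum h J = (if hahn_summable h J
     then Abs_hahn (\<lambda>i. \<Sum>j | j \<in> J \<and> hahn_coeff (h j) i \<noteq> 0. hahn_coeff (h j) i) else 0)"

text \<open>\<open>a0\<close> consists of the real parts and \<open>\<epsilon>\<close> of the infinitesimal parts of a point \<open>a\<close> of the unit box;
  \<open>\<iota>\<close> is the inclusion of the exponent groups. The result does not depend on \<open>\<alpha>\<close>.\<close>

definition natural_structure ::
  "('w::linordered_ab_group_add \<Rightarrow> 'g::linordered_ab_group_add) \<Rightarrow>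
    nat \<Rightarrow> real \<Rightarrow> ('w, real mps) hahn \<Rightarrow> ('g, real) hahn list \<Rightarrow> ('g, real) hahn" where
  "natural_structure \<iota> n \<alpha> f a =
    (let a0 = map (\<lambda>x. hahn_coeff x 0) a;
         \<epsilon> = map (\<lambda>x. x - hahn_single 0 (hahn_coeff x 0)) a
     in hahn_sum (\<lambda>i. hahn_single (\<iota> i) 1 *
          hahn_sum (\<lambda>\<mu>. hahn_single 0 (mps_taylor (hahn_coeff f i) a0 \<mu>) * mon_eval \<epsilon> \<mu>)
            {\<mu>. Poly_Mapping.keys \<mu> \<subseteq> {..<n}})
        {i. hahn_coeff f i \<noteq> 0})"

definition symbols :: "(nat \<Rightarrow> real \<Rightarrow> 'f set) \<Rightarrow> nat \<Rightarrow> 'f set" where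
  "symbols B n = (\<Union>\<alpha>\<in>{1<..}. B n \<alpha>)"

text \<open>The map on the union over \<open>\<alpha> > 1\<close>; the choice of \<open>\<alpha>\<close> does not matter by \<open>inclusion\<close>.\<close>

definition induced_map :: "(nat \<Rightarrow> real \<Rightarrow> 'f set) \<Rightarrow> (nat \<Rightarrow> real \<Rightarrow> 'f \<Rightarrow> 'k list \<Rightarrow> 'k) \<Rightarrow>
    nat \<Rightarrow> 'f \<Rightarrow> 'k list \<Rightarrow> 'k" where
  "induced_map B \<sigma> n f = \<sigma> n (SOME \<alpha>. 1 < \<alpha> \<and> f \<in> B n \<alpha>) f"

definition interp :: "(nat \<Rightarrow> real \<Rightarrow> 'f set) \<Rightarrow> (nat \<Rightarrow> real \<Rightarrow> 'f \<Rightarrow> 'k list \<Rightarrow> 'k::linordered_field) \<Rightarrow>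
    nat \<Rightarrow> 'f \<Rightarrow> 'k list \<Rightarrow> 'k" where
  "interp B \<sigma> n f xs = (if xs \<in> unit_box n then induced_map B \<sigma> n f xs else 0)"

definition L_embedding :: "(nat \<Rightarrow> real \<Rightarrow> 'f set) \<Rightarrow>
    (nat \<Rightarrow> real \<Rightarrow> 'f \<Rightarrow> 'k list \<Rightarrow> 'k::linordered_field) \<Rightarrow>
    (nat \<Rightarrow> real \<Rightarrow> 'f \<Rightarrow> 'l list \<Rightarrow> 'l::linordered_field) \<Rightarrow> ('k \<Rightarrow> 'l) \<Rightarrow> bool" where
  "L_embedding B \<sigma> \<tau> \<phi> \<longleftrightarrow> inj \<phi> \<and> \<phi> 0 = 0 \<and> \<phi> 1 = 1 \<and>
     (\<forall>x y. \<phi> (x + y) = \<phi> x + \<phi> y) \<and>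
     (\<forall>x y. \<phi> (x * y) = \<phi> x * \<phi> y) \<and>
     (\<forall>x. \<phi> (inverse x) = inverse (\<phi> x)) \<and>
     (\<forall>x y. x < y \<longleftrightarrow> \<phi> x < \<phi> y) \<and>
     (\<forall>n. \<forall>f\<in>symbols B n. \<forall>xs. length xs = n \<longrightarrow>
        \<phi> (interp B \<sigma> n f xs) = interp B \<tau> n f (map \<phi> xs))"

definition ordered_group_embedding ::
  "('w::linordered_ab_group_add \<Rightarrow> 'g::linordered_ab_group_add) \<Rightarrow> bool" where
  "ordered_group_embedding \<iota> \<longleftrightarrow> strict_mono \<iota> \<and> (\<forall>x y. \<iota> (x + y) = \<iota> x + \<iota> y)"

end

(*
  The pairs (x, y) in K * R((G)) with nonzero entries of the same sign and the same value are called good.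
  An analytic subfield is a subfield of the ring K * R((G)) whose nonzero elements are good, and which contains
  the values of the germs of B at its pairs of infinitesimals; it is the graph of a partial L_B-embedding.
  The pairs coming from R(Omega) generate one, and by Zorn's lemma there is a maximal one; the point is that it
  is total. If x is not in its first projection, one adjoins a suitable pair (x, y), distinguishing whether
  some x - c with c in the projection has a value outside the value group, torsion modulo it or free over it,
  or whether there are no new values, in which case y is a limit of the images of approximations of x. In each
  case one has to see that every value of a series at the new infinitesimals is zero or good. By the strong
  Noetherian property and Weierstrass preparation such a value is, up to a unit, an element of the old subfield
  times a polynomial in the new element, whose leading monomial can be read off. Neumann's lemma makes the
  natural structure on R((G)) meaningful.
*)

theory Submission
  imports Defs
begin

text \<open>Everything is done with germs at the origin: Weierstrass division shrinks the radius by
  an uncontrolled amount, so only infinitesimal arguments survive repeated division. Points of the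
  box are reduced to infinitesimal ones by expanding at their standard parts. In the product ring
  one division, with the same germ, acts on both sides at once, and since good elements have two
  nonzero components, an analytic subfield is automatically the graph of an injective map. The price
  is that the ring has zero divisors and that sums of good elements need not be good, so
  cancellation is the danger. It is met by exhibiting each value as a leading monomial times
  \<open>1 + w\<close> with \<open>w\<close> infinitesimal. Two steps divide by integers and so use
  that the residue field is real: extracting roots of such units, and the Tschirnhaus shift in the
  immediate case. The free case is the hardest: a multiple of the new element and a multiple of its
  inverse may both be infinitesimal, and a series in the two is not a series in one of them; their
  sum then serves as the one new element.\<close>

abbreviation "lookup == Poly_Mapping.lookup"
abbreviation "single == Poly_Mapping.single"
abbreviation "keys == Poly_Mapping.keys"
abbreviation "map_key == Poly_Mapping.map_key"
abbreviation "transposition == Transposition.transpose"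

type_synonym 'w series = "('w, real mps) hahn"

section \<open>Power series and Hahn series\<close>

lemma mps_coeff_simps [simp]:
  "mps_coeff 0 mu = 0"
  "mps_coeff (f + g) mu = mps_coeff f mu + mps_coeff g mu"
  "mps_coeff (f - g) mu = mps_coeff f mu - mps_coeff g mu"
  "mps_coeff (- f) mu = - mps_coeff f mu"
  "mps_coeff 1 mu = (if mu = 0 then 1 else 0)"
  "mps_coeff (mps_const c) mu = (if mu = 0 then c else 0)"
  "mps_coeff (mps_var i) mu = (if mu = single i 1 then 1 else 0)" by (transfer; simp)+

lemma mps_coeff_times:
  "mps_coeff (f * g) c = (SUM (a, b) | a + b = c. mps_coeff f a * mps_coeff g b)"
  unfolding times_mps.rep_eq by (rule convolution_eq_sum) (auto simp: finite_antidiagonal)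

lemma mps_coeff_const_times [simp]: "mps_coeff (mps_const c * f) mu = c * mps_coeff f mu"
  unfolding times_mps.rep_eq mps_const.rep_eq by (rule convolution_single)

lemma mps_const_simps [simp]:
  "mps_const 0 = (0 :: 'a::comm_ring_1 mps)" "mps_const 1 = (1 :: 'a::comm_ring_1 mps)"
  "mps_const (a + b) = mps_const a + (mps_const b :: 'a::comm_ring_1 mps)"
  "mps_const (a * b) = mps_const a * (mps_const b :: 'a::comm_ring_1 mps)" by (rule mps_eqI; simp)+

lemma hahn_coeff_map: "F 0 = 0 ==> hahn_coeff (hahn_map F f) i = F (hahn_coeff f i)"
  by (simp add: hahn_map.rep_eq)

lemma hahn_map_add:
  assumes "F 0 = 0" "!!i. F (hahn_coeff f i + hahn_coeff g i) = F (hahn_coeff f i) + F (hahn_coeff g i)"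
  shows "hahn_map F (f + g) = hahn_map F f + hahn_map F g" by (rule hahn_eqI) (simp add: hahn_coeff_map assms)

lemma hahn_map_single:
  fixes F :: "'a::comm_ring_1 => 'b::comm_ring_1"
  shows "F 0 = 0 ==> hahn_map F (hahn_single (i :: 'g::linordered_ab_group_add) a) = hahn_single i (F a)"
  by (rule hahn_eqI) (simp add: hahn_coeff_map)

lemma hahn_map_zero [simp]: "hahn_map F 0 = 0" by (rule hahn_eqI) (simp add: hahn_map.rep_eq)

lemma hahn_times_pairs_finite:
  fixes f g :: "('g::linordered_ab_group_add, 'a::comm_ring_1) hahn"
  shows "finite {(a, b). a + b = c & hahn_coeff f a ~= 0 & hahn_coeff g b ~= 0}"
  using wo_set_finite_pairs[OF wo_set_supp[of f] wo_set_supp[of g], of c] by simp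

lemma hahn_coeff_times_sum:
  fixes f g :: "('g::linordered_ab_group_add, 'a::comm_ring_1) hahn"
  assumes "finite S" "S <= {(a, b). a + b = c}"
    and "!!a b. a + b = c ==> hahn_coeff f a ~= 0 ==> hahn_coeff g b ~= 0 ==> (a, b) : S"
  shows "hahn_coeff (f * g) c = (SUM (a, b):S. hahn_coeff f a * hahn_coeff g b)"
  unfolding hahn_coeff_times by (rule convolution_eq_sum) (use assms in auto)

lemma hahn_map_times:
  fixes f g :: "('g::linordered_ab_group_add, 'a::comm_ring_1) hahn"
    and F :: "'a => 'b::comm_ring_1"
  assumes z: "F 0 = 0" "G 0 = 0" "H 0 = 0" and add: "!!x y. F (x + y) = F x + F y"
    and mult: "!!i j. F (hahn_coeff f i * hahn_coeff g j) = G (hahn_coeff f i) * H (hahn_coeff g j)"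
  shows "hahn_map F (f * g) = hahn_map G f * hahn_map H g"
proof (rule hahn_eqI)
  fix c
  let ?S = "{(a, b). a + b = c & hahn_coeff f a ~= 0 & hahn_coeff g b ~= 0}"
  have fin: "finite ?S" by (rule hahn_times_pairs_finite)
  have Fsum: "F (sum h T) = (SUM x:T. F (h x))" if "finite T" for h :: "'g \<times> 'g => 'a" and T
    using that by (induction T) (simp_all add: z add)
  have "hahn_coeff (hahn_map F (f * g)) c = F (SUM (a, b):?S. hahn_coeff f a * hahn_coeff g b)"
    by (subst hahn_coeff_times_sum[OF fin, symmetric]) (auto simp: hahn_coeff_map z)
  also have "... = (SUM (a, b):?S. G (hahn_coeff f a) * H (hahn_coeff g b))"
    by (subst Fsum[OF fin]) (auto intro!: sum.cong simp: mult)
  also have "... = hahn_coeff (hahn_map G f * hahn_map H g) c"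
    by (subst hahn_coeff_times_sum[OF fin]) (auto simp: hahn_coeff_map z)
  finally show "hahn_coeff (hahn_map F (f * g)) c = hahn_coeff (hahn_map G f * hahn_map H g) c" .
qed

lemma hahn_coeff_single_times [simp]:
  fixes f :: "('g::linordered_ab_group_add, 'a::comm_ring_1) hahn"
  shows "hahn_coeff (hahn_single u c * f) i = c * hahn_coeff f (i - u)"
proof -
  have "hahn_coeff (hahn_single u c * f) i
    = (SUM (a, b):{(u, i - u)}. hahn_coeff (hahn_single u c) a * hahn_coeff f b)"
    by (rule hahn_coeff_times_sum) (auto split: if_splits)
  thus ?thesis by simp
qed

lemma hahn_single_times: "hahn_single i a * hahn_single j b = hahn_single (i + j) (a * (b :: 'a::comm_ring_1))"
  by (rule hahn_eqI) (auto simp: algebra_simps)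

lemma hahn_single_add: "hahn_single i (a + b) = hahn_single i a + hahn_single i (b :: 'a::comm_ring_1)"
  by (rule hahn_eqI) simp

lemma hahn_single_zero [simp]: "hahn_single i (0 :: 'a::comm_ring_1) = 0" by (rule hahn_eqI) simp

lemma hahn_single_zero_one: "hahn_single 0 1 = 1" by (simp add: one_hahn_def)

section \<open>Shifting, permuting and slicing the variables\<close>

lemma lookup_map_key:
  "inj h ==> lookup (map_key h nu) i = lookup nu (h i)" by (simp add: map_key.rep_eq)

text \<open>The conditions are restricted to decompositions of \<open>nu\<close> because the
  renamings in question are not injective on all exponents: \<open>map_key Suc\<close> forgets the
  exponent of the variable 0.\<close>

lemma mps_times_reindex:
  fixes f g :: "'a::comm_ring_1 mps"
  assumes "!!a b. a + b = nu ==> F (a + b) = F a + F b"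
    and "!!alpha beta. alpha + beta = F nu ==> G alpha + G beta = nu & F (G alpha) = alpha & F (G beta) = beta"
    and "!!a b. a + b = nu ==> G (F a) = a & G (F b) = b"
  shows "mps_coeff (f * g) (F nu) = (SUM (a, b) | a + b = nu. mps_coeff f (F a) * mps_coeff g (F b))"
  unfolding mps_coeff_times
  by (rule sum.reindex_bij_witness[where j = "%(a, b). (G a, G b)" and i = "%(a, b). (F a, F b)"])
     (use assms in "auto simp: assms(1)[symmetric]")

lemma map_key_add: "inj h ==> map_key h (a + b) = map_key h a + map_key h b"
  by (rule poly_mapping_eqI) (simp add: lookup_map_key lookup_add)

lemma mps_shift_times: "mps_shift (f * g) = mps_shift f * mps_shift (g :: 'a::comm_ring_1 mps)"
proof (rule mps_eqI)
  fix nu :: "nat \<Rightarrow>\<^sub>0 nat"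
  \<comment> \<open>\<open>G\<close> inserts exponent 0 at the variable 0; it inverts
    \<open>map_key Suc\<close> on the exponents that do not involve that variable.\<close>
  define G where "G = (%alpha::nat \<Rightarrow>\<^sub>0 nat. Abs_poly_mapping (%i. case i of 0 => 0 | Suc j => lookup alpha j))"
  have G: "lookup (G alpha) i = (case i of 0 => 0 | Suc j => lookup alpha j)" for alpha i
  proof -
    have "{i. (case i of 0 => 0 | Suc j => lookup alpha j) ~= 0} <= Suc ` keys alpha"
    proof
      fix i assume "i : {i. (case i of 0 => 0 | Suc j => lookup alpha j) ~= 0}"
      thus "i : Suc ` keys alpha" by (cases i) (auto simp: in_keys_iff)
    qed
    hence "finite {i. (case i of 0 => 0 | Suc j => lookup alpha j) ~= 0}"
      by (meson finite_imageI finite_keys finite_subset)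
    thus ?thesis unfolding G_def by (subst lookup_Abs_poly_mapping) auto
  qed
  have inj: "inj Suc" by simp
  show "mps_coeff (mps_shift (f * g)) nu = mps_coeff (mps_shift f * mps_shift g) nu"
  proof (cases "lookup nu 0 = 0")
    case True
    hence 0: "lookup a 0 = 0 & lookup b 0 = 0" if "a + b = nu" for a b using that by (auto simp: lookup_add)
    have GF: "G (map_key Suc a) = a" if "lookup a 0 = 0" for a
      by (rule poly_mapping_eqI) (use that in "auto simp: G lookup_map_key split: nat.splits")
    have FG: "map_key Suc (G a) = a" for a by (rule poly_mapping_eqI) (auto simp: G lookup_map_key)
    have Gadd: "G (a + b) = G a + G b" for a b
      by (rule poly_mapping_eqI) (auto simp: G lookup_add split: nat.splits)
    have "mps_coeff (f * g) (map_key Suc nu)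
      = (SUM (a, b) | a + b = nu. mps_coeff f (map_key Suc a) * mps_coeff g (map_key Suc b))"
      by (rule mps_times_reindex[where G = G]) (use 0 True in "auto simp: GF FG Gadd[symmetric] map_key_add")
    also have "... = mps_coeff (mps_shift f * mps_shift g) nu"
      unfolding mps_coeff_times by (rule sum.cong) (use 0 in "auto simp: mps_shift.rep_eq")
    finally show ?thesis using True by (simp add: mps_shift.rep_eq)
  next
    case False
    hence "mps_coeff (mps_shift f) a * mps_coeff (mps_shift g) b = 0" if "a + b = nu" for a b
      using that by (auto simp: mps_shift.rep_eq lookup_add)
    thus ?thesis using False unfolding mps_coeff_times by (subst sum.neutral) (auto simp: mps_shift.rep_eq)
  qed
qed

lemma mps_shift_zero [simp]: "mps_shift 0 = (0 :: 'a::comm_ring_1 mps)"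
  and mps_shift_add: "mps_shift (f + g) = mps_shift f + mps_shift (g :: 'a::comm_ring_1 mps)"
  and mps_shift_minus: "mps_shift (f - g) = mps_shift f - mps_shift (g :: 'a::comm_ring_1 mps)"
  by (rule mps_eqI; simp add: mps_shift.rep_eq)+

lemma mps_shift_const [simp]: "mps_shift (mps_const c) = mps_const (c :: 'a::comm_ring_1)"
proof (rule mps_eqI)
  fix mu :: "nat \<Rightarrow>\<^sub>0 nat"
  have "mu = 0" if "lookup mu 0 = 0" "map_key Suc mu = 0"
  proof (rule poly_mapping_eqI)
    fix i show "lookup mu i = lookup 0 i" using that lookup_map_key[of Suc mu "i - 1"] by (cases i) auto
  qed
  moreover have "map_key Suc 0 = (0 :: nat \<Rightarrow>\<^sub>0 nat)"
    by (rule poly_mapping_eqI) (simp add: lookup_map_key)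
  ultimately show "mps_coeff (mps_shift (mps_const c)) mu = mps_coeff (mps_const c) mu"
    by (auto simp: mps_shift.rep_eq)
qed

lemma mps_shift_var [simp]: "mps_shift (mps_var i) = (mps_var (Suc i) :: 'a::comm_ring_1 mps)"
proof (rule mps_eqI)
  fix mu :: "nat \<Rightarrow>\<^sub>0 nat"
  have "mu = single (Suc i) 1"
    if "lookup mu 0 = 0" "map_key Suc mu = single i 1"
  proof (rule poly_mapping_eqI)
    fix j show "lookup mu j = lookup (single (Suc i) 1) j"
      using that(1) lookup_map_key[of Suc mu "j - 1"] unfolding that(2) by (cases j) (auto simp: lookup_single when_def)
  qed
  moreover have "map_key Suc (single (Suc i) 1) = (single i 1 :: nat \<Rightarrow>\<^sub>0 nat)"
    by (rule poly_mapping_eqI) (auto simp: lookup_map_key lookup_single when_def)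
  ultimately have eq: "lookup mu 0 = 0 & map_key Suc mu = single i 1
      \<longleftrightarrow> mu = single (Suc i) 1" by (metis lookup_single_not_eq nat.distinct(1))
  show "mps_coeff (mps_shift (mps_var i)) mu = mps_coeff (mps_var (Suc i) :: 'a mps) mu"
    unfolding mps_shift.rep_eq mps_var.rep_eq using eq by presburger
qed

text \<open>The axioms of a Weierstrass system provide permutations of variables, not shifts. On
  series in \<open>n\<close> variables the shift agrees with the cycle of \<open>n + 1\<close>
  variables that brings the absent last one to the front, and so it stays within the system.\<close>

lemma mps_shift_eq_permute:
  fixes f :: "'a::comm_ring_1 mps"
  assumes "mps_in_vars n f" "\<pi> permutes {..<Suc n}" "!!i. i < n ==> \<pi> i = Suc i" "\<pi> n = 0"
  shows "mps_shift f = mps_permute \<pi> f"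
proof (rule mps_eqI)
  fix nu :: "nat \<Rightarrow>\<^sub>0 nat"
  have inj: "inj \<pi>" using assms(2) by (rule permutes_inj)
  have out: "mps_coeff f mu = 0" if "lookup mu i ~= 0" "n <= i" for mu i
  proof (rule ccontr)
    assume "mps_coeff f mu ~= 0"
    hence "keys mu <= {..<n}" using assms(1) unfolding mps_in_vars_def by blast
    moreover have "i : keys mu" using that by (simp add: in_keys_iff)
    ultimately show False using that by auto
  qed
  show "mps_coeff (mps_shift f) nu = mps_coeff (mps_permute \<pi> f) nu"
  proof (cases "lookup nu 0 = 0 & (ALL i>n. lookup nu i = 0)")
    case True
    have "map_key Suc nu = map_key \<pi> nu"
    proof (rule poly_mapping_eqI)
      fix i
      consider "i < n" | "i = n" | "i > n" by linarith
      thus "lookup (map_key Suc nu) i = lookup (map_key \<pi> nu) i"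
        using True assms(3,4) permutes_not_in[OF assms(2), of i] by cases (auto simp: lookup_map_key inj)
    qed
    thus ?thesis using True by (simp add: mps_shift.rep_eq mps_permute.rep_eq)
  next
    case False
    then consider "lookup nu 0 ~= 0" | i where "lookup nu 0 = 0" "i > n" "lookup nu i ~= 0" by (meson)
    thus ?thesis
    proof cases
      case 1
      hence "mps_coeff f (map_key \<pi> nu) = 0"
        by - (rule out[of _ n], simp_all add: lookup_map_key inj assms(4))
      thus ?thesis using 1 by (simp add: mps_shift.rep_eq mps_permute.rep_eq)
    next
      case 2
      have "mps_coeff f (map_key \<pi> nu) = 0"
        using 2 permutes_not_in[OF assms(2), of i] by - (rule out[of _ i], simp_all add: lookup_map_key inj)
      moreover have "mps_coeff f (map_key Suc nu) = 0"
        using 2 by - (rule out[of _ "i - 1"], simp_all add: lookup_map_key)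
      ultimately show ?thesis by (simp add: mps_shift.rep_eq mps_permute.rep_eq)
    qed
  qed
qed

lemma in_keys_add: "keys (a + b) = keys a Un keys (b :: nat \<Rightarrow>\<^sub>0 nat)"
  by (auto simp: in_keys_iff lookup_add)

text \<open>Multiplying by a series in the first \<open>m\<close> variables does not change the
  exponents of the others. So in a decomposition of \<open>nu + mu\<close> the whole of
  \<open>mu\<close> sits in the first summand.\<close>

lemma mps_slice_times:
  fixes f g :: "'a::comm_ring_1 mps"
  assumes g: "mps_in_vars m g" and mu: "keys mu Int {..<m} = {}"
  shows "mps_slice m mu (f * g) = mps_slice m mu f * g"
proof (rule mps_eqI)
  fix nu :: "nat \<Rightarrow>\<^sub>0 nat"
  show "mps_coeff (mps_slice m mu (f * g)) nu = mps_coeff (mps_slice m mu f * g) nu"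
  proof (cases "keys nu <= {..<m}")
    case True
    let ?S = "{(a, b). a + b = nu + mu & keys b <= {..<m}}"
    have "mps_coeff (mps_slice m mu (f * g)) nu = (SUM (a, b) | a + b = nu + mu. mps_coeff f a * mps_coeff g b)"
      using True by (simp add: mps_slice.rep_eq mps_coeff_times)
    also have "... = (SUM (a, b):?S. mps_coeff f a * mps_coeff g b)"
    proof (rule sum.mono_neutral_right)
      show "ALL x:{(a, b). a + b = nu + mu} - ?S. (case x of (a, b) => mps_coeff f a * mps_coeff g b) = 0"
        using g unfolding mps_in_vars_def by (clarsimp) (metis lessThan_iff mult_zero_right subset_iff)
    qed (auto simp: finite_antidiagonal)
    also have "... = (SUM (a, b) | a + b = nu. mps_coeff (mps_slice m mu f) a * mps_coeff g b)"
    proof (rule sum.reindex_bij_witness[where j = "%(a, b). (a - mu, b)" and i = "%(a, b). (a + mu, b)"])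
      fix x assume x: "x : ?S"
      obtain a b where ab: "x = (a, b)" by force
      with x have e: "a + b = nu + mu" and b: "keys b <= {..<m}" by auto
      have le: "lookup mu i <= lookup a i" for i
      proof (cases "i : keys mu")
        case True
        hence "i ~: keys b" "i ~: keys nu" using mu b `keys nu <= {..<m}` by auto
        hence "lookup b i = 0" "lookup nu i = 0" by (auto simp: in_keys_iff)
        thus ?thesis using arg_cong[OF e, of "%p. lookup p i"] by (simp add: lookup_add)
      qed (simp add: in_keys_iff)
      have am: "a - mu + mu = a" by (rule poly_mapping_eqI) (simp add: lookup_add lookup_minus le)
      show "(case case x of (a, b) => (a - mu, b) of (a, b) => (a + mu, b)) = x" using am ab by simp
      have "(a - mu) + b + mu = nu + mu" using am e by (metis add.assoc add.commute)
      hence s: "(a - mu) + b = nu" by simp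
      thus "(case x of (a, b) => (a - mu, b)) : {(a, b). a + b = nu}" using ab by simp
      have "keys (a - mu) <= {..<m}" using s True in_keys_add by blast
      thus "(case case x of (a, b) => (a - mu, b) of (a, b) => mps_coeff (mps_slice m mu f) a * mps_coeff g b)
        = (case x of (a, b) => mps_coeff f a * mps_coeff g b)" using am ab by (simp add: mps_slice.rep_eq)
    next
      fix x assume x: "x : {(a, b). a + b = nu}"
      obtain a b where ab: "x = (a, b)" by force
      with x have e: "a + b = nu" by simp
      show "(case case x of (a, b) => (a + mu, b) of (a, b) => (a - mu, b)) = x" by (simp add: ab)
      show "(case x of (a, b) => (a + mu, b)) : ?S" using True e ab by (auto simp: add_ac in_keys_add)
    qed
    finally show ?thesis by (simp add: mps_coeff_times)
  next
    case False
    have "mps_coeff (mps_slice m mu f) a * mps_coeff g b = 0" if ab: "a + b = nu" for a b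
    proof (cases "mps_coeff g b = 0")
      case nz: False
      hence "keys b <= {..<m}" using g unfolding mps_in_vars_def by blast
      hence "~ keys a <= {..<m}" using False ab in_keys_add[of a b] by blast
      thus ?thesis by (simp add: mps_slice.rep_eq)
    qed simp
    thus ?thesis using False unfolding mps_coeff_times by (subst sum.neutral) (auto simp: mps_slice.rep_eq)
  qed
qed

lemma mps_permute_0 [simp]: "mps_permute \<pi> 0 = (0 :: 'a::comm_ring_1 mps)"
  by (rule mps_eqI) (simp add: mps_permute.rep_eq)

section \<open>Germs and Weierstrass division\<close>

lemma mps_coeff_times_single:
  fixes f g :: "'a::comm_ring_1 mps"
  shows "mps_coeff (f * g) (single i k)
    = (SUM l<=k. mps_coeff f (single i l) * mps_coeff g (single i (k - l)))"
proof -
  have *: "a = single i (lookup a i)" if "a + b = single i k"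
    for a b :: "nat \<Rightarrow>\<^sub>0 nat"
  proof (rule poly_mapping_eqI)
    fix j
    show "lookup a j = lookup (single i (lookup a i)) j" using arg_cong[OF that, of "%p. lookup p j"]
      by (cases "i = j") (auto simp: lookup_add lookup_single)
  qed
  have **: "lookup a i + lookup b i = k" if "a + b = single i k" for a b
    using arg_cong[OF that, of "%p. lookup p i"] by (simp add: lookup_add)
  show ?thesis unfolding mps_coeff_times
  proof (rule sum.reindex_bij_witness[where j = "%(a, b). lookup a i"
        and i = "%l. (single i l, single i (k - l))"])
    fix x assume "x : {(a, b). a + b = single i k}"
    then obtain a b where x: "x = (a, b)" and ab: "a + b = single i k" by auto
    have a: "a = single i (lookup a i)" by (rule *[OF ab])
    have b: "b = single i (lookup b i)" using * ab add.commute by metis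
    have s: "k - lookup a i = lookup b i" using **[OF ab] by simp
    show "(single i (case x of (a, b) => lookup a i),
           single i (k - (case x of (a, b) => lookup a i))) = x" using a b by (simp add: x s)
    show "(case x of (a, b) => lookup a i) : {..k}" using **[OF ab] by (simp add: x)
    show "mps_coeff f (single i (case x of (a, b) => lookup a i)) *
         mps_coeff g (single i (k - (case x of (a, b) => lookup a i)))
         = (case x of (a, b) => mps_coeff f a * mps_coeff g b)" using a b by (simp add: x s)
  qed (auto simp: single_add[symmetric])
qed

lemma single_eq_iff: "single i a = single i b \<longleftrightarrow> a = b" by (metis lookup_single_eq)

lemma single_Suc_neq_0: "single i (Suc k) ~= 0" by (metis lookup_single_eq lookup_zero nat.distinct(1))

lemma mps_coeff_times_zero: "mps_coeff (f * g) 0 = mps_coeff f 0 * mps_coeff (g :: 'a::comm_ring_1 mps) 0"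
  using mps_coeff_times_single[of f g 0 0] by simp

lemma mps_var_power:
  "mps_coeff (mps_var i ^ k) mu = (if mu = single i k then 1 else (0 :: 'a::comm_ring_1))"
proof (induction k arbitrary: mu)
  case (Suc k)
  let ?S = "{(a, b). a + b = mu} Int {(single i 1, single i k)}"
  have "mps_coeff (mps_var i ^ Suc k :: 'a mps) mu
    = (SUM (a, b):?S. mps_coeff (mps_var i) a * mps_coeff (mps_var i ^ k :: 'a mps) b)"
    unfolding power_Suc mps_coeff_times
    by (rule sum.mono_neutral_right) (auto simp: finite_antidiagonal Suc split: if_splits)
  also have "... = (if mu = single i (Suc k) then 1 else 0)" by (auto simp: Suc single_add[symmetric])
  finally show ?case .
qed simp

abbreviation hconst :: "real => ('w::linordered_ab_group_add, real mps) hahn" where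
  "hconst c == hahn_single 0 (mps_const c)"

abbreviation hvar :: "nat => ('w::linordered_ab_group_add, real mps) hahn" where
  "hvar i == hahn_single 0 (mps_var i)"

abbreviation hshift :: "('w::linordered_ab_group_add, real mps) hahn => 'w series" where
  "hshift == hahn_map mps_shift"

text \<open>On integral series this is a homomorphism to the real numbers, and on integral germs its
  kernel consists of the nonunits.\<close>

definition res :: "('w::linordered_ab_group_add, real mps) hahn => real" where
  "res f = mps_coeff (hahn_coeff f 0) 0"

definition integral_series :: "('w::linordered_ab_group_add, 'a::comm_ring_1) hahn => bool" where
  "integral_series f \<longleftrightarrow> (ALL i<0. hahn_coeff f i = 0)"

lemma integral_series_closed:
  "integral_series 0" "integral_series 1" "integral_series (hahn_single 0 c)"
  "integral_series f ==> integral_series (- f)"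
  "integral_series f ==> integral_series g ==> integral_series (f + g)"
  "integral_series f ==> integral_series g ==> integral_series (f - g)" by (auto simp: integral_series_def)

lemma integral_series_times:
  fixes f g :: "('w::linordered_ab_group_add, 'a::comm_ring_1) hahn"
  assumes "integral_series f" "integral_series g"
  shows "integral_series (f * g)" "hahn_coeff (f * g) 0 = hahn_coeff f 0 * hahn_coeff g 0"
  using hahn_coeff_times_below[of 0 f 0 g] assms by (simp_all add: integral_series_def)

lemma integral_series_map: "integral_series f ==> F 0 = 0 ==> integral_series (hahn_map F f)"
  by (simp add: integral_series_def hahn_coeff_map)

lemma integral_series_power: "integral_series f ==> integral_series (f ^ n)"
  by (induction n) (auto intro: integral_series_times integral_series_closed)

lemma integral_series_sum: "(!!x. x : A ==> integral_series (f x)) ==> integral_series (sum f A)"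
  by (induction A rule: infinite_finite_induct) (auto intro: integral_series_closed)

lemma hahn_coeff_sum: "hahn_coeff (sum f A) i = (SUM x:A. hahn_coeff (f x :: ('w::linordered_ab_group_add, 'a::comm_ring_1) hahn) i)"
  by (induction A rule: infinite_finite_induct) auto

lemma mps_coeff_sum: "mps_coeff (sum f A) i = (SUM x:A. mps_coeff (f x :: 'a::comm_ring_1 mps) i)"
  by (induction A rule: infinite_finite_induct) auto

lemma res_simps [simp]:
  "res 0 = 0" "res 1 = 1" "res (hconst c) = c" "res (hvar i) = 0" "res (- f) = - res f"
  "res (f + g) = res f + res g" "res (f - g) = res f - res g"
  by (simp_all add: res_def single_Suc_neq_0[symmetric])

lemma res_sum: "res (sum f A) = (SUM x:A. res (f x))" by (simp add: res_def hahn_coeff_sum mps_coeff_sum)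

lemma res_times: "integral_series f ==> integral_series g ==> res (f * g) = res f * res g"
  by (simp add: res_def integral_series_times mps_coeff_times_zero)

lemma res_shift [simp]: "res (hshift f) = res f"
proof -
  have "map_key Suc 0 = (0 :: nat \<Rightarrow>\<^sub>0 nat)" by (rule poly_mapping_eqI) (simp add: lookup_map_key)
  thus ?thesis by (simp add: res_def hahn_coeff_map mps_shift.rep_eq)
qed

lemma hshift_simps [simp]:
  "hshift 0 = 0" "hshift 1 = 1" "hshift (hconst c) = hconst c" "hshift (hvar i) = hvar (Suc i)"
  "hshift (f + g) = hshift f + hshift g" "hshift (f - g) = hshift f - hshift g"
  "hshift (f * g) = hshift f * hshift g"
proof -
  show c: "hshift (hconst c) = hconst c" for c by (simp add: hahn_map_single)
  show "hshift 1 = 1" using c[of 1] by (simp add: hahn_single_zero_one)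
  show "hshift (hvar i) = hvar (Suc i)" by (simp add: hahn_map_single)
  show "hshift (f + g) = hshift f + hshift g" "hshift (f - g) = hshift f - hshift g"
    by (rule hahn_eqI; simp add: hahn_coeff_map mps_shift_add mps_shift_minus)+
  show "hshift (f * g) = hshift f * hshift g"
    by (rule hahn_map_times) (simp_all add: mps_shift_add mps_shift_times)
qed simp

lemma hshift_sum: "hshift (sum f A) = (SUM x:A. hshift (f x))"
  by (induction A rule: infinite_finite_induct) auto

lemma coeff_hvar_power: "hahn_coeff (hvar i ^ k :: ('w::linordered_ab_group_add, real mps) hahn) 0 = mps_var i ^ k"
  by (induction k) (auto simp: integral_series_times integral_series_power integral_series_closed)

text \<open>The shifted series does not involve the variable 0, so among the pure powers of that
  variable only the \<open>k\<close>-th can occur, with the constant term of \<open>R\<close> as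
  coefficient.\<close>

lemma coeff_shift_power:
  fixes R :: "('w::linordered_ab_group_add, real mps) hahn"
  assumes "integral_series R"
  shows "mps_coeff (hahn_coeff (hshift R * hvar 0 ^ k) 0) (single 0 j) = (if j = k then res R else 0)"
proof -
  have "integral_series (hshift R)" using assms by (simp add: integral_series_map)
  hence "mps_coeff (hahn_coeff (hshift R * hvar 0 ^ k) 0) (single 0 j)
    = mps_coeff (mps_shift (hahn_coeff R 0) * mps_var 0 ^ k) (single 0 j)"
    by (simp add: integral_series_times integral_series_power integral_series_closed coeff_hvar_power hahn_coeff_map)
  also have "... = (SUM l<=j. if l = 0 & j = k then res R else 0)" unfolding mps_coeff_times_single
    using res_shift[of R]
    by (intro sum.cong) (auto simp: mps_shift.rep_eq mps_var_power lookup_single res_def hahn_coeff_map single_eq_iff)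
  also have "... = (if j = k then res R else 0)" by (cases "j = k") (simp_all add: sum.delta)
  finally show ?thesis .
qed

lemma gauss_norm_le_integral:
  assumes "gauss_norm f <= gauss_norm g" "integral_series g"
  shows "integral_series f"
proof (cases "f = 0")
  case False
  hence "g ~= 0" "hahn_ord g <= hahn_ord f" using assms(1) by (auto simp: gauss_norm_def split: if_splits)
  moreover have "0 <= hahn_ord g" using assms(2) `g ~= 0` hahn_coeff_ord[of g]
    by (force simp: integral_series_def not_less[symmetric])
  ultimately show ?thesis using hahn_coeff_below_ord[of _ f] by (auto simp: integral_series_def)
qed (simp add: integral_series_closed)

lemma gauss_norm_eq_1I:
  assumes "integral_series f" "hahn_coeff f 0 ~= 0" shows "gauss_norm f = 1"
proof -
  have "hahn_ord f = 0" by (rule hahn_ord_eqI) (use assms in "auto simp: integral_series_def")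
  moreover have "f ~= 0" using assms(2) by auto
  ultimately show ?thesis by (simp add: gauss_norm_def one_gauss_norm_def)
qed

lemma gauss_norm_eq_1D:
  assumes "gauss_norm f = 1" shows "integral_series f" "hahn_coeff f 0 ~= 0"
proof -
  have "f ~= 0" "hahn_ord f = 0" using assms by (auto simp: gauss_norm_def one_gauss_norm_def split: if_splits)
  thus "integral_series f" "hahn_coeff f 0 ~= 0"
    using hahn_coeff_ord[of f] hahn_coeff_below_ord[of _ f] by (auto simp: integral_series_def)
qed

lemma shift_permutation:
  obtains \<pi> where "\<pi> permutes {..<Suc n}" "!!i. i < n ==> \<pi> i = Suc i" "\<pi> n = 0"
proof -
  let ?\<pi> = "%i. if i < n then Suc i else if i = n then 0 else i"
  have "?\<pi> permutes {..<Suc n}"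
  proof (rule bij_imp_permutes)
    show "bij_betw ?\<pi> {..<Suc n} {..<Suc n}"
      by (rule bij_betw_byWitness[where f' = "%i. if i = 0 then n else i - 1"]) auto
  qed auto
  thus ?thesis by (rule that) auto
qed

context real_weierstrass_system
begin

text \<open>Radii are forgotten because the \<open>delta\<close> of Weierstrass division depends on
  the divisor; the union over all radii is closed under division without any bookkeeping.\<close>

definition germ :: "nat => 'w series set" where
  "germ n = (UN delta:{0<..}. B n delta)"

definition bgerm :: "nat => 'w series set" where
  "bgerm n = {f : germ n. integral_series f}"

lemma germI: "0 < delta ==> f : B n delta ==> f : germ n" by (auto simp: germ_def)

lemma germE:
  assumes "f : germ n" obtains delta where "0 < delta" "f : B n delta" using assms by (auto simp: germ_def)

lemma germ_mono: "m <= n ==> f : germ m ==> f : germ n" by (meson germE germI mono order_refl subsetD)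

lemma germE2:
  assumes "f : germ n" "g : germ m" "n <= N" "m <= N"
  obtains delta where "0 < delta" "f : B N delta" "g : B N delta"
proof -
  obtain a where a: "0 < a" "f : B n a" using assms germE by blast
  obtain b where b: "0 < b" "g : B m b" using assms germE by blast
  have "f : B N (min a b)" using mono[of n N "min a b" a] a b assms by auto
  moreover have "g : B N (min a b)" using mono[of m N "min a b" b] a b assms by auto
  ultimately show ?thesis using that[of "min a b"] a b by auto
qed

lemma in_vars_germ: "f : germ n ==> mps_in_vars n (hahn_coeff f i)"
  by (elim germE) (use subset in "auto simp: A_hahn_def A_ring_def")

lemma germ_add: "f : germ n ==> g : germ n ==> f + g : germ n" by (metis germE2 germI add order_refl)

lemma germ_mult: "f : germ n ==> g : germ n ==> f * g : germ n" by (metis germE2 germI mult order_refl)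

lemma germ_poly: "p : mps_polys n ==> hahn_single 0 p : germ n" by (rule germI[of 1]) (simp_all add: polys)

lemma const_polys: "mps_const c : mps_polys n"
proof -
  have "finite {mu. mps_coeff (mps_const c) mu ~= 0}" by (rule finite_subset[of _ "{0}"]) auto
  thus ?thesis by (auto simp: mps_polys_def mps_in_vars_def)
qed

lemma var_polys: "i < n ==> (mps_var i :: real mps) : mps_polys n"
proof -
  have "finite {mu. mps_coeff (mps_var i :: real mps) mu ~= 0}"
    by (rule finite_subset[of _ "{single i 1}"]) auto
  thus "i < n ==> ?thesis" by (auto simp: mps_polys_def mps_in_vars_def)
qed

lemma germ_const [simp]: "hconst c : germ n" by (rule germ_poly) (rule const_polys)

lemma germ_var [simp]: "i < n ==> hvar i : germ n" by (rule germ_poly) (rule var_polys)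

lemma germ_0 [simp]: "0 : germ n" and germ_1 [simp]: "1 : germ n"
  using germ_const[of 0 n] germ_const[of 1 n] by (simp_all add: hahn_single_zero_one)

lemma uminus_hahn: "- f = hconst (- 1) * f"
proof -
  have "mps_const (- 1) = - (1 :: real mps)" by (rule mps_eqI) simp
  thus ?thesis by (intro hahn_eqI) simp
qed

lemma germ_uminus: "f : germ n ==> - f : germ n" by (subst uminus_hahn) (rule germ_mult; simp)

lemma germ_minus: "f : germ n ==> g : germ n ==> f - g : germ n"
  using germ_add[of f n "- g"] germ_uminus[of g n] by simp

lemma germ_sum: "(!!x. x : A ==> f x : germ n) ==> sum f A : germ n"
  by (induction A rule: infinite_finite_induct) (auto intro: germ_add)

lemma germ_power: "f : germ n ==> f ^ k : germ n" by (induction k) (auto intro: germ_mult)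

lemma germ_permute: "f : germ n ==> \<pi> permutes {..<n} ==> hahn_map (mps_permute \<pi>) f : germ n"
  by (elim germE) (auto intro!: germI permute)

lemma hshift_eq_permute:
  assumes "f : germ n" "\<pi> permutes {..<Suc n}" "!!i. i < n ==> \<pi> i = Suc i" "\<pi> n = 0"
  shows "hshift f = hahn_map (mps_permute \<pi>) f"
  using mps_shift_eq_permute[OF in_vars_germ[OF assms(1)] assms(2-)]
  by (intro hahn_eqI) (simp add: hahn_coeff_map)

lemma germ_shift: "f : germ n ==> hshift f : germ (Suc n)"
proof -
  assume f: "f : germ n"
  obtain \<pi> where \<pi>: "\<pi> permutes {..<Suc n}" "!!i. i < n ==> \<pi> i = Suc i" "\<pi> n = 0"
    using shift_permutation[of n] by metis
  have "f : germ (Suc n)" using f germ_mono[of n "Suc n"] by simp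
  thus ?thesis using hshift_eq_permute[OF f \<pi>] germ_permute[OF _ \<pi>(1)] by simp
qed

lemma bgerm_germ: "f : bgerm n ==> f : germ n" and bgerm_integral: "f : bgerm n ==> integral_series f"
  by (auto simp: bgerm_def)

lemma bgerm_closed:
  "hconst c : bgerm n" "0 : bgerm n" "1 : bgerm n" "i < n ==> hvar i : bgerm n"
  "f : bgerm n ==> g : bgerm n ==> f + g : bgerm n" "f : bgerm n ==> g : bgerm n ==> f - g : bgerm n"
  "f : bgerm n ==> g : bgerm n ==> f * g : bgerm n" "f : bgerm n ==> - f : bgerm n"
  "f : bgerm n ==> f ^ k : bgerm n" "f : bgerm n ==> hshift f : bgerm (Suc n)"
  by (auto simp: bgerm_def integral_series_closed integral_series_times integral_series_power
    integral_series_map germ_add germ_minus germ_mult germ_uminus germ_power germ_shift)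

lemma bgerm_sum: "(!!x. x : A ==> f x : bgerm n) ==> sum f A : bgerm n"
  by (simp add: bgerm_def germ_sum integral_series_sum)

lemma bgerm_mono: "m <= n ==> f : bgerm m ==> f : bgerm n" using germ_mono by (auto simp: bgerm_def)

lemma res_mult: "f : bgerm n ==> g : bgerm m ==> res (f * g) = res f * res g"
  by (simp add: bgerm_def res_times)

lemma res_power: "f : bgerm n ==> res (f ^ k) = res f ^ k"
  by (induction k) (auto simp: res_mult[of f n _ n] bgerm_closed)

text \<open>The division axiom for \<open>m = n\<close>. Its norm bounds turn integrality of the
  dividend into integrality of the quotient and the remainders.\<close>

lemma germ_division:
  assumes f: "f : bgerm n" and n: "1 <= n" and reg: "mps_regular s (hahn_coeff f 0)" and g: "g : germ n"
  shows "EX Q R. Q : germ n & (ALL i<s. R i : germ (n - 1)) &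
    g = Q * f + (SUM i<s. hshift (R i) * hvar 0 ^ i) &
    (integral_series g --> Q : bgerm n & (ALL i<s. R i : bgerm (n - 1)))"
proof -
  obtain alpha where alpha: "0 < alpha" "f : B n alpha" "g : B n alpha"
    using germE2[OF bgerm_germ[OF f] g order_refl order_refl] by blast
  have "hahn_coeff f 0 ~= 0" using reg by (auto simp: mps_regular_def)
  hence norm: "gauss_norm f = 1" using f by (intro gauss_norm_eq_1I) (auto simp: bgerm_def)
  obtain delta where delta: "0 < delta" and ex: "ALL m>=n. ALL g:B m alpha. EX! (Q, R).
        Q : B m delta & length R = s & set R <= B (m - 1) delta &
        gauss_norm Q <= gauss_norm g & (ALL i<s. gauss_norm (R ! i) <= gauss_norm g) &
        g = Q * f + (SUM i<s. hahn_map mps_shift (R ! i) * hahn_single 0 (mps_var 0) ^ i)"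
    using division[OF alpha(1) n alpha(2) norm reg] by blast
  from ex alpha(3) have "EX! (Q, R).
        Q : B n delta & length R = s & set R <= B (n - 1) delta &
        gauss_norm Q <= gauss_norm g & (ALL i<s. gauss_norm (R ! i) <= gauss_norm g) &
        g = Q * f + (SUM i<s. hahn_map mps_shift (R ! i) * hahn_single 0 (mps_var 0) ^ i)" by blast
  then obtain Q R where QR: "Q : B n delta" "length R = s" "set R <= B (n - 1) delta"
        "gauss_norm Q <= gauss_norm g" "ALL i<s. gauss_norm (R ! i) <= gauss_norm g"
        "g = Q * f + (SUM i<s. hahn_map mps_shift (R ! i) * hahn_single 0 (mps_var 0) ^ i)"
    by (auto simp: Ex1_def)
  have Q: "Q : germ n" using QR delta germI by blast
  have R: "ALL i<s. R ! i : germ (n - 1)" using QR delta germI by (meson nth_mem subsetD)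
  have "integral_series g --> Q : bgerm n & (ALL i<s. R ! i : bgerm (n - 1))"
    using Q R QR(4,5) gauss_norm_le_integral by (auto simp: bgerm_def)
  thus ?thesis using Q R QR(6) by (intro exI[of _ Q] exI[of _ "(!) R"] conjI)
qed

text \<open>Weierstrass preparation as a division of a power of the variable 0 by \<open>f\<close>.
  The pure powers of that variable are compared in the top slice: below degree \<open>s\<close> the
  product \<open>Q * f\<close> contributes nothing, so the remainders have residue 0, and in degree
  \<open>s\<close> the coefficient 1 can come only from the constant term of
  \<open>Q\<close>.\<close>

lemma germ_Weierstrass:
  assumes f: "f : bgerm n" and n: "1 <= n" and reg: "mps_regular s (hahn_coeff f 0)"
  shows "EX Q R. Q : bgerm n & res Q ~= 0 & (ALL i<s. R i : bgerm (n - 1) & res (R i) = 0) &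
    hvar 0 ^ s = Q * f + (SUM i<s. hshift (R i) * hvar 0 ^ i)"
proof -
  have v: "(hvar 0 :: 'w series) : bgerm n" using n by (intro bgerm_closed) simp
  have int: "integral_series (hvar 0 ^ k :: 'w series)" for k
    using bgerm_closed(9)[OF v] by (simp add: bgerm_def)
  have "hvar 0 ^ s : germ n" using v bgerm_closed(9) bgerm_germ by blast
  from germ_division[OF f n reg this] int[of s]
  obtain Q R where Q: "Q : bgerm n" and R: "!!i. i < s ==> R i : bgerm (n - 1)"
    and eq: "hvar 0 ^ s = Q * f + (SUM i<s. hshift (R i) * hvar 0 ^ i)" by blast
  have coeff: "mps_coeff (hahn_coeff (hshift (R i) * hvar 0 ^ k) 0) (single 0 j) = (if j = k then res (R i) else 0)"
    if "i < s" for i j k by (rule coeff_shift_power) (use R[OF that] in "simp add: bgerm_def")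
  define q where "q = (%l. mps_coeff (hahn_coeff Q 0) (single 0 l))"
  define h where "h = (%l. mps_coeff (hahn_coeff f 0) (single 0 l))"
  have Qf: "mps_coeff (hahn_coeff (Q * f) 0) (single 0 j) = (SUM l<=j. q l * h (j - l))" for j
    using Q f by (simp add: bgerm_def integral_series_times mps_coeff_times_single q_def h_def)
  have h0: "h k = 0" if "k < s" for k using reg that by (auto simp: mps_regular_def h_def)
  have key: "(if j = s then 1 else 0) = (SUM l<=j. q l * h (j - l)) + (SUM i<s. if j = i then res (R i) else 0)" for j
  proof -
    have "(if j = s then 1 else 0) = mps_coeff (hahn_coeff (hvar 0 ^ s :: 'w series) 0) (single 0 j)"
      unfolding coeff_hvar_power mps_var_power by (simp add: single_eq_iff)
    also have "... = (SUM l<=j. q l * h (j - l)) + (SUM i<s. mps_coeff (hahn_coeff (hshift (R i) * hvar 0 ^ i) 0) (single 0 j))"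
      unfolding eq by (simp only: hahn_coeff_simps mps_coeff_simps Qf hahn_coeff_sum mps_coeff_sum)
    also have "(SUM i<s. mps_coeff (hahn_coeff (hshift (R i) * hvar 0 ^ i) 0) (single 0 j))
      = (SUM i<s. if j = i then res (R i) else 0)" by (intro sum.cong) (auto simp: coeff)
    finally show ?thesis .
  qed
  have "res (R j) = 0" if "j < s" for j
  proof -
    have "(SUM l<=j. q l * h (j - l)) = 0" by (rule sum.neutral) (use that h0 in auto)
    moreover have "(SUM i<s. if j = i then res (R i) else 0) = res (R j)" using that by (simp add: sum.delta)
    ultimately show ?thesis using key[of j] that by simp
  qed
  moreover have "res Q ~= 0"
  proof
    assume "res Q = 0"
    hence "q 0 = 0" by (simp add: q_def res_def)
    hence "q l * h (s - l) = 0" if "l <= s" for l using h0[of "s - l"] that by (cases "l = 0") auto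
    hence "(SUM l<=s. q l * h (s - l)) = 0" by (intro sum.neutral) auto
    moreover have "(SUM i<s. if s = i then res (R i) else 0) = 0" by (intro sum.neutral) auto
    ultimately show False using key[of s] by simp
  qed
  ultimately show ?thesis using Q R eq by blast
qed

end

section \<open>Coefficients with respect to the last variable, units and composition\<close>

lemma mps_slice_add:
  "mps_slice m mu 0 = (0 :: 'a::comm_ring_1 mps)"
  "mps_slice m mu (f + g) = mps_slice m mu f + mps_slice m mu (g :: 'a::comm_ring_1 mps)"
  "mps_slice m mu (f - g) = mps_slice m mu f - mps_slice m mu (g :: 'a::comm_ring_1 mps)"
  by (rule mps_eqI; simp add: mps_slice.rep_eq)+

lemma mps_slice_in_vars:
  fixes g :: "'a::comm_ring_1 mps"
  assumes "mps_in_vars n g"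
  shows "mps_slice n (single n k) g = (if k = 0 then g else 0)"
proof (rule mps_eqI)
  fix nu :: "nat \<Rightarrow>\<^sub>0 nat"
  have out: "mps_coeff g mu = 0" if "~ keys mu <= {..<n}" for mu
    using assms that unfolding mps_in_vars_def by blast
  show "mps_coeff (mps_slice n (single n k) g) nu = mps_coeff (if k = 0 then g else 0) nu"
    using out[of nu] out[of "nu + single n k"] by (auto simp: mps_slice.rep_eq in_keys_add)
qed

lemma mps_slice_shift:
  fixes f :: "'a::comm_ring_1 mps"
  shows "mps_slice (Suc n) (single (Suc n) k) (mps_shift f)
    = mps_shift (mps_slice n (single n k) f)"
proof (rule mps_eqI)
  fix nu :: "nat \<Rightarrow>\<^sub>0 nat"
  have s: "map_key Suc (nu + single (Suc n) k)
    = map_key Suc nu + single n k"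
    by (rule poly_mapping_eqI) (simp add: lookup_map_key lookup_add lookup_single when_def)
  have "keys (map_key Suc nu) <= {..<n} \<longleftrightarrow> keys nu <= {..<Suc n}"
    if "lookup nu 0 = 0"
  proof -
    have "i : keys (map_key Suc nu) \<longleftrightarrow> Suc i : keys nu" for i by (simp add: in_keys_iff lookup_map_key)
    moreover have "0 ~: keys nu" using that by (simp add: in_keys_iff)
    ultimately show ?thesis by (metis (no_types, lifting) Suc_less_eq lessThan_iff not0_implies_Suc subset_iff)
  qed
  thus "mps_coeff (mps_slice (Suc n) (single (Suc n) k) (mps_shift f)) nu
    = mps_coeff (mps_shift (mps_slice n (single n k) f)) nu"
    by (simp add: mps_slice.rep_eq mps_shift.rep_eq s lookup_add lookup_single)
qed

definition hslice :: "nat => nat => ('w::linordered_ab_group_add, real mps) hahn => 'w series" where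
  "hslice n k = hahn_map (mps_slice n (single n k))"

lemma hslice_simps:
  "hslice n k 0 = 0" "hslice n k (f + g) = hslice n k f + hslice n k g"
  "hslice n k (f - g) = hslice n k f - hslice n k g"
  "hslice (Suc n) k (hshift f) = hshift (hslice n k f)"
  "res (hslice n k f) = mps_coeff (hahn_coeff f 0) (single n k)"
  by ((rule hahn_eqI)?; simp add: hslice_def res_def hahn_coeff_map mps_slice_add mps_slice_shift mps_slice.rep_eq)+

lemma hslice_sum: "hslice n k (sum f A) = (SUM x:A. hslice n k (f x))"
  by (induction A rule: infinite_finite_induct) (auto simp: hslice_simps)

lemma hslice_shiftn: "hslice (n + m) k ((hshift ^^ n) f) = (hshift ^^ n) (hslice m k f)"
  by (induction n) (auto simp: hslice_simps)

lemma hshiftn_simps: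
  "(hshift ^^ n) 0 = 0" "(hshift ^^ n) (f + g) = (hshift ^^ n) f + (hshift ^^ n) g"
  "(hshift ^^ n) (f * g) = (hshift ^^ n) f * (hshift ^^ n) g"
  "(hshift ^^ n) (hvar i) = hvar (n + i)" "(hshift ^^ n) (hconst c) = hconst c" "res ((hshift ^^ n) f) = res f"
  by (induction n) simp_all

context real_weierstrass_system
begin

lemma hslice_germ: "f : germ (Suc n) ==> hslice n k f : germ n"
proof (elim germE)
  fix delta :: real assume "0 < delta" "f : B (Suc n) delta"
  thus "hslice n k f : germ n"
    using slice[of delta f n 1 "single n k"] unfolding hslice_def by (intro germI) auto
qed

lemma hslice_bgerm: "f : bgerm (Suc n) ==> hslice n k f : bgerm n" unfolding bgerm_def using hslice_germ
  by (auto simp: hslice_def mps_slice_add intro!: integral_series_map)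

lemma hslice_times: "g : germ n ==> hslice n k (f * g) = hslice n k f * g"
proof -
  assume g: "g : germ n"
  have "hslice n k (f * g) = hslice n k f * hahn_map (%x. x) g" unfolding hslice_def by (rule hahn_map_times)
       (simp_all add: mps_slice_add mps_slice_times[OF in_vars_germ[OF g]])
  also have "hahn_map (%x. x) g = g" by (rule hahn_eqI) (simp add: hahn_coeff_map)
  finally show ?thesis .
qed

lemma hslice_const: "g : germ n ==> hslice n k g = (if k = 0 then g else 0)"
  by (rule hahn_eqI) (simp add: hslice_def hahn_coeff_map mps_slice_add mps_slice_in_vars[OF in_vars_germ])

lemma germ_shiftn: "f : germ n ==> (hshift ^^ m) f : germ (m + n)" by (induction m) (auto intro: germ_shift)

lemma bgerm_shiftn: "f : bgerm n ==> (hshift ^^ m) f : bgerm (m + n)"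
  by (induction m) (auto intro: bgerm_closed)

text \<open>A germ with nonzero residue is regular of degree 0, so dividing 1 by it leaves no
  remainder.\<close>

lemma bgerm_unit:
  assumes f: "f : bgerm n" and r: "res f ~= 0"
  shows "EX g:bgerm n. f * g = 1 & res g = 1 / res f"
proof -
  have reg: "mps_regular 0 (hahn_coeff f 0)" using r by (simp add: mps_regular_def res_def)
  have *: "EX g:bgerm m. f * g = 1" if "1 <= m" "f : bgerm m" for m
    using germ_Weierstrass[OF that(2,1) reg] by (auto simp: mult.commute)
  have "EX g:bgerm n. f * g = 1"
  proof (cases "n = 0")
    case True
    \<comment> \<open>Division requires at least one variable. The inverse found in one variable is
      projected back by taking its constant coefficient, which is linear over the constants.\<close>
    hence "f : bgerm (Suc 0)" using f bgerm_mono[of 0 1] by simp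
    then obtain g where g: "g : bgerm (Suc 0)" "f * g = 1" using *[of 1] by auto
    have "hslice 0 0 1 = hslice 0 0 (g * f)" using g by (simp add: mult.commute)
    hence "1 = hslice 0 0 g * f" using f True by (simp add: hslice_times hslice_const bgerm_germ)
    moreover have "hslice 0 0 g : bgerm 0" by (rule hslice_bgerm[OF g(1)])
    ultimately show ?thesis using True by (auto simp: mult.commute)
  qed (use * f in auto)
  then obtain g where g: "g : bgerm n" "f * g = 1" by blast
  have "res f * res g = 1" using res_mult[OF f g(1)] g(2) by simp
  thus ?thesis using g r by (intro bexI[of _ g]) (auto simp: field_simps)
qed

text \<open>The series \<open>h\<close> is \<open>f\<close> with \<open>g i\<close> substituted for the \<open>i\<close>-th variable, obtained by
  dividing successively by \<open>\<xi>\<^sub>i - g i\<close>.\<close>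

lemma germ_compose:
  assumes "f : germ (n + m)" "!!i. i < n ==> g i : bgerm m & res (g i) = 0"
  shows "EX h Q. h : germ m & (ALL i<n. Q i : germ (n + m)) &
    f = (SUM i<n. Q i * (hvar i - (hshift ^^ n) (g i))) + (hshift ^^ n) h &
    (integral_series f --> h : bgerm m & (ALL i<n. Q i : bgerm (n + m)))" using assms
proof (induction n arbitrary: f g)
  case 0
  thus ?case by (intro exI[of _ f]) (auto simp: bgerm_def)
next
  case (Suc n)
  define G where "G = (hshift ^^ n) (g 0)"
  define D where "D = hvar 0 - hshift G"
  have G: "G : bgerm (n + m)" unfolding G_def using Suc.prems(2)[of 0] by (intro bgerm_shiftn) simp
  have rG: "res G = 0" using Suc.prems(2)[of 0] by (simp add: G_def hshiftn_simps)
  have D: "D : bgerm (Suc n + m)" unfolding D_def using bgerm_closed(10)[OF G] by (intro bgerm_closed) auto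
  \<comment> \<open>\<open>D\<close> is the variable 0 minus a series that is free of it and has
    residue 0, hence regular of degree 1. The remainder is a single series in the remaining
    variables.\<close>
  have "mps_coeff (hahn_coeff D 0) 0 = 0" using rG res_shift[of G] unfolding D_def
    by (simp add: res_def single_Suc_neq_0[symmetric])
  moreover have "mps_coeff (hahn_coeff D 0) (single 0 1) = 1"
    unfolding D_def by (simp add: hahn_coeff_map mps_shift.rep_eq lookup_single)
  ultimately have reg: "mps_regular 1 (hahn_coeff D 0)" by (simp add: mps_regular_def)
  obtain Q R where QR: "Q : germ (Suc n + m)" "R : germ (n + m)" "f = Q * D + hshift R"
    "integral_series f --> Q : bgerm (Suc n + m) & R : bgerm (n + m)"
    using germ_division[OF D _ reg Suc.prems(1)] by auto
  obtain h Q' where h: "h : germ m" "!!i. i < n ==> Q' i : germ (n + m)"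
    "R = (SUM i<n. Q' i * (hvar i - (hshift ^^ n) (g (Suc i)))) + (hshift ^^ n) h"
    "integral_series R --> h : bgerm m & (ALL i<n. Q' i : bgerm (n + m))"
    using Suc.IH[OF QR(2), of "%i. g (Suc i)"] Suc.prems(2) by auto
  define P where "P = (%i. case i of 0 => Q | Suc j => hshift (Q' j))"
  have "hshift R = (SUM i<n. P (Suc i) * (hvar (Suc i) - (hshift ^^ Suc n) (g (Suc i)))) + (hshift ^^ Suc n) h"
    unfolding h(3) P_def by (simp add: hshift_sum)
  hence "f = (SUM i<Suc n. P i * (hvar i - (hshift ^^ Suc n) (g i))) + (hshift ^^ Suc n) h"
    unfolding QR(3) sum.lessThan_Suc_shift by (simp add: P_def D_def G_def)
  moreover have "P i : germ (Suc n + m)" if "i < Suc n" for i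
    using that QR(1) germ_shift[OF h(2)] by (auto simp: P_def split: nat.splits)
  moreover have "h : bgerm m & (ALL i<Suc n. P i : bgerm (Suc n + m))" if "integral_series f"
  proof -
    have "Q : bgerm (Suc n + m)" "R : bgerm (n + m)" using QR(4) that by auto
    moreover from this have "h : bgerm m" "ALL i<n. Q' i : bgerm (n + m)" using h(4) by (auto simp: bgerm_def)
    ultimately show ?thesis using bgerm_closed(10) by (auto simp: P_def split: nat.splits)
  qed
  ultimately show ?case using h(1) by (intro exI[of _ h] exI[of _ P]) blast
qed

text \<open>After normalization the top slice is nonzero; in zero variables it consists of its
  constant term, so the residue is nonzero and the germ is a unit.\<close>

lemma germ0_inverse:
  assumes "b : germ 0" "b ~= 0"
  shows "EX c:germ 0. b * c = 1"
proof -
  obtain delta where delta: "0 < delta" "b : B 0 delta" using assms germE by blast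
  then obtain a where a: "a : B 0 1" "gauss_norm (a * b) = 1" using normalize assms(2) by blast
  have a': "a : germ 0" using a(1) by (rule germI[rotated]) simp
  have ab: "a * b : bgerm 0" using germ_mult[OF a' assms(1)] gauss_norm_eq_1D[OF a(2)] by (simp add: bgerm_def)
  have "mps_in_vars 0 (hahn_coeff (a * b) 0)" using in_vars_germ bgerm_germ[OF ab] by blast
  moreover have "hahn_coeff (a * b) 0 ~= 0" using gauss_norm_eq_1D[OF a(2)] by simp
  ultimately have "res (a * b) ~= 0"
    unfolding res_def mps_in_vars_def by (metis keys_eq_empty lessThan_0 mps_coeff_simps(1) mps_eqI subset_empty)
  then obtain c where "c : bgerm 0" "a * b * c = 1" using bgerm_unit[OF ab] by blast
  thus ?thesis using a' by (intro bexI[of _ "a * c"]) (auto intro: germ_mult bgerm_germ simp: mult_ac)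
qed

lemma germ_normalize:
  assumes "f : germ n" "f ~= 0"
  shows "EX a:germ 0. EX a':germ 0. a * a' = 1 & a * f : bgerm n & hahn_coeff (a * f) 0 ~= 0"
proof -
  obtain delta where delta: "0 < delta" "f : B n delta" using assms germE by blast
  then obtain a where a: "a : B 0 1" "gauss_norm (a * f) = 1" using normalize assms(2) by blast
  have a': "a : germ 0" using a(1) by (rule germI[rotated]) simp
  have "a ~= 0" using a(2) by (auto simp: gauss_norm_def one_gauss_norm_def)
  then obtain c where c: "c : germ 0" "a * c = 1" using germ0_inverse a' by blast
  have "a * f : germ n" using germ_mult[OF germ_mono[OF _ a'] assms(1)] by simp
  thus ?thesis using a' c gauss_norm_eq_1D[OF a(2)] by (intro bexI[of _ a] bexI[of _ c]) (auto simp: bgerm_def)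
qed

end

section \<open>Evaluation of germs\<close>

text \<open>Evaluation of germs at infinitesimals, to be instantiated by the analytic field, by the
  Hahn field and by their product; because of the last one \<open>'p\<close> is only a ring. Points
  are infinite sequences so that the number of variables can grow freely, and by
  \<open>ev_cong\<close> a germ in \<open>n\<close> variables sees the first \<open>n\<close>
  entries. Compatibility with composition is not an axiom: it follows from division.\<close>

locale germ_model = real_weierstrass_system B
  for B :: "nat => real => ('w::linordered_ab_group_add, real mps) hahn set" +
  fixes ev :: "'w series => (nat => 'p::comm_ring_1) => 'p"
    and inf :: "'p set"
  assumes zero_inf: "0 : inf"
    and ev_one: "range a <= inf ==> ev 1 a = 1"
    and ev_add: "f : germ n ==> g : germ n ==> range a <= inf ==> ev (f + g) a = ev f a + ev g a"
    and ev_mult: "f : germ n ==> g : germ n ==> range a <= inf ==> ev (f * g) a = ev f a * ev g a"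
    and ev_var: "range a <= inf ==> ev (hvar i) a = a i"
    and ev_permute: "f : germ n ==> range a <= inf ==> \<pi> permutes {..<n} ==>
      ev (hahn_map (mps_permute \<pi>) f) a = ev f (%i. a (\<pi> i))"
    and ev_cong: "f : germ n ==> range a <= inf ==> range b <= inf ==> (!!i. i < n ==> a i = b i) ==> ev f a = ev f b"
    and ev_inf: "f : bgerm n ==> res f = 0 ==> range a <= inf ==> ev f a : inf"
begin

lemma ev_zero: "range a <= inf ==> ev 0 a = 0" using ev_add[of 0 0 0 a] by simp

lemma ev_uminus: "f : germ n ==> range a <= inf ==> ev (- f) a = - ev f a"
  using ev_add[of f n "- f" a] germ_uminus[of f n] ev_zero[of a] by (simp add: eq_neg_iff_add_eq_0 add.commute)

lemma ev_minus: "f : germ n ==> g : germ n ==> range a <= inf ==> ev (f - g) a = ev f a - ev g a"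
  using ev_add[of f n "- g" a] germ_uminus[of g n] ev_uminus[of g n a] by simp

lemma ev_sum: "(!!x. x : A ==> f x : germ n) ==> range a <= inf ==> ev (sum f A) a = (SUM x:A. ev (f x) a)"
proof (induction A rule: infinite_finite_induct)
  case (insert x A)
  hence "sum f A : germ n" by (intro germ_sum) auto
  thus ?case using insert by (simp add: ev_add[of _ n])
qed (simp_all add: ev_zero)

lemma ev_power: "f : germ n ==> range a <= inf ==> ev (f ^ k) a = ev f a ^ k"
  by (induction k) (simp_all add: ev_one ev_mult[of _ n] germ_power)

lemma ev_shift: "f : germ n ==> range a <= inf ==> ev (hshift f) a = ev f (%i. a (Suc i))"
proof -
  assume f: "f : germ n" and a: "range a <= inf"
  obtain \<pi> where \<pi>: "\<pi> permutes {..<Suc n}" "!!i. i < n ==> \<pi> i = Suc i" "\<pi> n = 0"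
    using shift_permutation[of n] by metis
  have "hshift f = hahn_map (mps_permute \<pi>) f" by (rule hshift_eq_permute[OF f]) (use \<pi> in auto)
  hence "ev (hshift f) a = ev f (%i. a (\<pi> i))"
    using ev_permute[of f "Suc n" a \<pi>] a \<pi> germ_mono[of n "Suc n" f] f by simp
  also have "... = ev f (%i. a (Suc i))" by (rule ev_cong[OF f]) (use a \<pi> in auto)
  finally show ?thesis .
qed

lemma ev_shiftn: "f : germ m ==> range a <= inf ==> ev ((hshift ^^ n) f) a = ev f (%i. a (n + i))"
proof (induction n arbitrary: a)
  case (Suc n)
  have "ev ((hshift ^^ Suc n) f) a = ev ((hshift ^^ n) f) (%i. a (Suc i))"
    using ev_shift[of _ "n + m" a] germ_shiftn[OF Suc.prems(1), of n] Suc.prems(2) by simp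
  also have "... = ev f (%i. a (Suc n + i))"
    using Suc.IH[OF Suc.prems(1), of "%i. a (Suc i)"] Suc.prems(2) by (auto simp: image_subset_iff)
  finally show ?case .
qed simp

definition kc :: "real => 'p" where
  "kc c = ev (hconst c) (%_. 0)"

lemma ev_const: "range a <= inf ==> ev (hconst c) a = kc c"
  unfolding kc_def by (rule ev_cong[of _ 0]) (use zero_inf in auto)

lemma kc_simps: "kc 0 = 0" "kc 1 = 1" "kc (r + s) = kc r + kc s" "kc (r * s) = kc r * kc s" "kc (- r) = - kc r"
  "kc (r - s) = kc r - kc s"
proof -
  have r: "range (%_. 0 :: 'p) <= inf" using zero_inf by auto
  show "kc 0 = 0" by (simp add: kc_def ev_zero[OF r])
  show "kc 1 = 1" by (simp add: kc_def hahn_single_zero_one ev_one[OF r])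
  show "kc (r * s) = kc r * kc s" for r s
    using ev_mult[of "hconst r" 0 "hconst s" "%_. 0"] r by (simp add: kc_def hahn_single_times)
  show add: "kc (r + s) = kc r + kc s" for r s
    using ev_add[of "hconst r" 0 "hconst s" "%_. 0"] r by (simp add: kc_def hahn_single_add)
  show m: "kc (- r) = - kc r" for r using add[of r "- r"] `kc 0 = 0` by (simp add: eq_neg_iff_add_eq_0 add.commute)
  show "kc (r - s) = kc r - kc s" using add[of r "- s"] m[of s] by simp
qed

text \<open>The identity of \<open>germ_compose\<close> is evaluated at the point that lists the
  values of the \<open>g i\<close> first and then \<open>b\<close>: there all factors
  \<open>xi_i - g i\<close> vanish. One germ \<open>h\<close> serves for all points.\<close>

lemma ev_compose:
  assumes f: "f : germ n" and g': "ALL i<n. g i : bgerm m & res (g i) = 0"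
  shows "EX h:germ m. (f : bgerm n --> h : bgerm m & res h = res f) &
    (ALL w b. range w <= inf --> range b <= inf --> (ALL i<n. w i = ev (g i) b) --> ev f w = ev h b)"
proof -
  have g: "g i : bgerm m & res (g i) = 0" if "i < n" for i using g' that by blast
  have f': "f : germ (n + m)" using f germ_mono[of n "n + m"] by simp
  obtain h Q where h: "h : germ m" "!!i. i < n ==> Q i : germ (n + m)"
    "f = (SUM i<n. Q i * (hvar i - (hshift ^^ n) (g i))) + (hshift ^^ n) h"
    "integral_series f ==> h : bgerm m & (ALL i<n. Q i : bgerm (n + m))"
    using germ_compose[OF f', of g] g by blast
  have L: "hvar i - (hshift ^^ n) (g i) : bgerm (n + m)" if "i < n" for i
    using g[OF that] that by (intro bgerm_closed bgerm_shiftn) auto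
  have sh: "(hshift ^^ n) h : germ (n + m)" using germ_shiftn h(1) by blast
  have "h : bgerm m & res h = res f" if "f : bgerm n"
  proof -
    have hQ: "h : bgerm m" "!!i. i < n ==> Q i : bgerm (n + m)" using h(4) that by (auto simp: bgerm_def)
    have "res (Q i * (hvar i - (hshift ^^ n) (g i))) = 0" if "i < n" for i
      using res_mult[OF hQ(2)[OF that] L[OF that]] g[OF that] by (simp add: hshiftn_simps)
    hence "res f = res h" by (subst h(3)) (simp add: res_sum hshiftn_simps)
    thus ?thesis using hQ by simp
  qed
  moreover have "ev f w = ev h b"
    if w: "range w <= inf" and b: "range b <= inf" and eq: "ALL i<n. w i = ev (g i) b" for w b
  proof -
    define c where "c = (%i. if i < n then w i else b (i - n))"
    have c: "range c <= inf" using w b by (auto simp: c_def)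
    have cb: "(%i. c (n + i)) = b" by (simp add: c_def)
    have "ev (Q i * (hvar i - (hshift ^^ n) (g i))) c = 0" if i: "i < n" for i
    proof -
      have gi: "g i : germ m" using g[OF i] bgerm_germ by blast
      have "ev (hvar i - (hshift ^^ n) (g i)) c = c i - ev (g i) b"
        using ev_minus[of "hvar i" "n + m" "(hshift ^^ n) (g i)" c] i germ_shiftn[OF gi, of n] c
        by (simp add: ev_var ev_shiftn[OF gi] cb)
      also have "... = 0" using i eq by (simp add: c_def)
      finally show ?thesis using ev_mult[OF h(2)[OF i] bgerm_germ[OF L[OF i]] c] by simp
    qed
    moreover have "Q i * (hvar i - (hshift ^^ n) (g i)) : germ (n + m)" if "i < n" for i
      using h(2)[OF that] L[OF that] bgerm_germ germ_mult by blast
    ultimately have S: "ev (SUM i<n. Q i * (hvar i - (hshift ^^ n) (g i))) c = 0"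
      "(SUM i<n. Q i * (hvar i - (hshift ^^ n) (g i))) : germ (n + m)"
      using ev_sum[of "{..<n}" "%i. Q i * (hvar i - (hshift ^^ n) (g i))" "n + m" c] c
      by (auto intro: germ_sum)
    have "ev f c = ev ((hshift ^^ n) h) c" by (subst h(3)) (simp add: ev_add[OF S(2) sh c] S(1))
    also have "... = ev h b" using ev_shiftn[OF h(1) c] cb by simp
    also have "ev f c = ev f w" by (rule ev_cong[OF f]) (use c w in "auto simp: c_def")
    finally show ?thesis .
  qed
  ultimately show ?thesis using h(1) by blast
qed

section \<open>Values of germs at a set of infinitesimals\<close>

definition mgerm :: "nat => 'w series set" where
  "mgerm n = {f : bgerm n. res f = 0}"

text \<open>The three sets \<open>gen\<close>, \<open>gen1\<close> and \<open>gen0\<close> are the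
  ring generated by \<open>A\<close> under germs, the ring of values of integral germs, and the
  ideal of the latter formed by the values of nonunits.\<close>

definition gen :: "'p set => 'p set" where
  "gen A = {ev f a |f n a. f : germ n & range a <= A}"

definition gen1 :: "'p set => 'p set" where
  "gen1 A = {ev f a |f n a. f : bgerm n & range a <= A}"

definition gen0 :: "'p set => 'p set" where
  "gen0 A = {ev f a |f n a. f : mgerm n & range a <= A}"

lemma gen_mono: "A <= A' ==> gen A <= gen A'" and gen1_mono: "A <= A' ==> gen1 A <= gen1 A'"
  and gen0_mono: "A <= A' ==> gen0 A <= gen0 A'"
  unfolding gen_def gen1_def gen0_def by (blast intro: subset_trans)+

lemma gen0_gen1: "u : gen0 A ==> u : gen1 A" and gen1_gen: "u : gen1 A ==> u : gen A"
  unfolding gen_def gen1_def gen0_def mgerm_def using bgerm_germ by blast+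

lemma gen0_inf: "A <= inf ==> gen0 A <= inf" unfolding gen0_def mgerm_def using ev_inf by auto

text \<open>Values at different points can be combined only as values of germs at one point. The
  points are concatenated and the germs shifted accordingly; entries beyond the number of variables
  of a germ do not affect its value.\<close>

lemma common_point:
  fixes k :: nat
  assumes A: "A <= inf" "0 : A" and F: "ALL i<k. F i : germ (N i) & range (a i) <= A"
  shows "EX n F' b. range b <= A & (ALL i<k. F' i : germ n & ev (F' i) b = ev (F i) (a i) &
    (F i : bgerm (N i) --> F' i : bgerm n) & res (F' i) = res (F i))" using F
proof (induction k)
  case 0
  thus ?case using A by (intro exI[of _ 0] exI[of _ "%_. 0"]) auto
next
  case (Suc k)
  then obtain n F' b where b: "range b <= A" and F': "!!i. i < k ==> F' i : germ n & ev (F' i) b = ev (F i) (a i) &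
    (F i : bgerm (N i) --> F' i : bgerm n) & res (F' i) = res (F i)" by auto
  define c where "c = (%i. if i < n then b i else a k (i - n))"
  have ck: "range (a k) <= A" "F k : germ (N k)" using Suc.prems by auto
  have c: "range c <= A" using b ck by (auto simp: c_def)
  define F2 where "F2 = F'(k := (hshift ^^ n) (F k))"
  have "F2 i : germ (n + N k) & ev (F2 i) c = ev (F i) (a i) &
    (F i : bgerm (N i) --> F2 i : bgerm (n + N k)) & res (F2 i) = res (F i)" if i: "i < Suc k" for i
  proof (cases "i = k")
    case True
    have "ev ((hshift ^^ n) (F k)) c = ev (F k) (a k)"
      using ev_shiftn[OF ck(2) subset_trans[OF c A(1)], of n] by (simp add: c_def)
    thus ?thesis using True ck germ_shiftn[OF ck(2), of n] bgerm_shiftn[of "F k" "N k" n]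
      by (simp add: F2_def hshiftn_simps)
  next
    case False
    hence ik: "i < k" using i by simp
    have "ev (F' i) c = ev (F' i) b" by (rule ev_cong[of _ n]) (use F'[OF ik] b c A in "auto simp: c_def")
    thus ?thesis using False F'[OF ik] germ_mono[of n "n + N k"] bgerm_mono[of n "n + N k"] by (simp add: F2_def)
  qed
  thus ?case using c by blast
qed

lemma gen_closed:
  assumes A: "A <= inf" "0 : A"
  shows "u : gen A ==> v : gen A ==> u + v : gen A" "u : gen A ==> v : gen A ==> u * v : gen A"
    "u : gen1 A ==> v : gen1 A ==> u + v : gen1 A" "u : gen1 A ==> v : gen1 A ==> u * v : gen1 A"
    "u : gen0 A ==> v : gen0 A ==> u + v : gen0 A" "u : gen1 A ==> v : gen0 A ==> u * v : gen0 A"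
proof -
  have *: "EX n f' g' b. range b <= A & f' : germ n & g' : germ n & ev f' b = ev f a & ev g' b = ev g a' &
    (f : bgerm m --> f' : bgerm n) & (g : bgerm m' --> g' : bgerm n) & res f' = res f & res g' = res g"
    if "f : germ m" "g : germ m'" "range a <= A" "range a' <= A" for f g m m' a a'
  proof -
    have "EX n F' b. range b <= A & (ALL i<2::nat. F' i : germ n &
      ev (F' i) b = ev (if i = 0 then f else g) (if i = 0 then a else a') &
      ((if i = 0 then f else g) : bgerm (if i = 0 then m else m') --> F' i : bgerm n) &
      res (F' i) = res (if i = 0 then f else g))" by (rule common_point[OF A]) (use that in auto)
    then obtain n and F' :: "nat => 'w series" and b where b: "range b <= A" and
      F: "!!i. i < 2 ==> F' i : germ n &
      ev (F' i) b = ev (if i = 0 then f else g) (if i = 0 then a else a') &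
      ((if i = 0 then f else g) : bgerm (if i = 0 then m else m') --> F' i : bgerm n) &
      res (F' i) = res (if i = 0 then f else g)" by blast
    show ?thesis using b F[of 0] F[of 1] by (intro exI[of _ n] exI[of _ "F' 0"] exI[of _ "F' 1"] exI[of _ b]) simp
  qed
  have r: "range b <= inf" if "range b <= A" for b :: "nat => 'p" using that A by auto
  {
    assume "u : gen A" "v : gen A"
    then obtain f m a g m' a' where "f : germ m" "range a <= A" "u = ev f a" "g : germ m'" "range a' <= A" "v = ev g a'"
      unfolding gen_def by blast
    with *[of f m g m' a a'] obtain n f' g' b where b: "range b <= A" "f' : germ n" "g' : germ n" "ev f' b = u" "ev g' b = v"
      by blast
    have "u + v = ev (f' + g') b" "u * v = ev (f' * g') b" "f' + g' : germ n" "f' * g' : germ n"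
      using b r[OF b(1)] by (auto simp: ev_add ev_mult germ_add germ_mult)
    thus "u + v : gen A" "u * v : gen A" unfolding gen_def using b(1) by blast+
  next
    assume "u : gen1 A" "v : gen1 A"
    then obtain f m a g m' a' where f: "f : bgerm m" "range a <= A" "u = ev f a" "g : bgerm m'" "range a' <= A" "v = ev g a'"
      unfolding gen1_def by blast
    with *[of f m g m' a a'] obtain n f' g' b where b: "range b <= A" "f' : bgerm n" "g' : bgerm n" "ev f' b = u" "ev g' b = v"
      using bgerm_germ by blast
    have "u + v = ev (f' + g') b" "u * v = ev (f' * g') b" "f' + g' : bgerm n" "f' * g' : bgerm n"
      using b r[OF b(1)] bgerm_germ by (auto simp: ev_add[of _ n] ev_mult[of _ n] bgerm_closed)
    thus "u + v : gen1 A" "u * v : gen1 A" unfolding gen1_def using b(1) by blast+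
  next
    assume "u : gen0 A" "v : gen0 A"
    then obtain f m a g m' a' where "f : mgerm m" "range a <= A" "u = ev f a" "g : mgerm m'" "range a' <= A" "v = ev g a'"
      unfolding gen0_def by blast
    with *[of f m g m' a a'] obtain n f' g' b where b: "range b <= A" "f' : mgerm n" "g' : mgerm n" "ev f' b = u" "ev g' b = v"
      using bgerm_germ unfolding mgerm_def by force
    have "u + v = ev (f' + g') b" "f' + g' : mgerm n"
      using b r[OF b(1)] bgerm_germ by (auto simp: mgerm_def ev_add[of _ n] bgerm_closed)
    thus "u + v : gen0 A" unfolding gen0_def using b(1) by blast
  next
    assume "u : gen1 A" "v : gen0 A"
    then obtain f m a g m' a' where "f : bgerm m" "range a <= A" "u = ev f a" "g : mgerm m'" "range a' <= A" "v = ev g a'"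
      unfolding gen0_def gen1_def by blast
    with *[of f m g m' a a'] obtain n f' g' b where b: "range b <= A" "f' : bgerm n" "g' : mgerm n" "ev f' b = u" "ev g' b = v"
      using bgerm_germ unfolding mgerm_def by force
    have "u * v = ev (f' * g') b" "f' * g' : mgerm n"
      using b r[OF b(1)] bgerm_germ by (auto simp: mgerm_def ev_mult[of _ n] bgerm_closed res_mult)
    thus "u * v : gen0 A" unfolding gen0_def using b(1) by blast
  }
qed

lemma gen_kc: "A <= inf ==> 0 : A ==> kc r : gen1 A" unfolding gen1_def kc_def using bgerm_closed(1) by blast

lemma gen0_0: "A <= inf ==> 0 : A ==> 0 : gen0 A"
  unfolding gen0_def mgerm_def using bgerm_closed(2)[of 0] ev_zero[of "%_. 0"] zero_inf
  by (auto intro!: exI[of _ "0 :: 'w series"] exI[of _ "%_. 0"] exI[of _ 0])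

lemma gen0_incl: "A <= inf ==> 0 : A ==> A <= gen0 A"
proof
  fix x assume A: "A <= inf" "0 : A" "x : A"
  have "(hvar 0 :: 'w series) : mgerm 1" using bgerm_closed(4)[of 0 1] by (simp add: mgerm_def)
  moreover have "x = ev (hvar 0) (%_. x)" using A ev_var[of "%_. x" 0] by auto
  ultimately show "x : gen0 A" unfolding gen0_def using A by blast
qed

text \<open>Germs at values of germs are germs at the original points. This transitivity is what
  makes a generated field closed under all germs.\<close>

lemma gen_compose:
  assumes A: "A <= inf" "0 : A" and w: "range w <= gen0 A"
  shows "f : germ n ==> ev f w : gen A" "f : bgerm n ==> ev f w : gen1 A" "f : mgerm n ==> ev f w : gen0 A"
proof -
  have "ALL i. EX N f a. f : mgerm N & range a <= A & w i = ev f a" using w unfolding gen0_def by blast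
  then obtain N F a where F: "!!i. F i : mgerm (N i) & range (a i) <= A & w i = ev (F i) (a i)" by metis
  have "ALL i<n. F i : germ (N i) & range (a i) <= A" using F bgerm_germ by (auto simp: mgerm_def)
  from common_point[OF A this] obtain m F' b where b: "range b <= A" and F1:
    "ALL i<n. F' i : germ m & ev (F' i) b = ev (F i) (a i) &
      (F i : bgerm (N i) --> F' i : bgerm m) & res (F' i) = res (F i)" by blast
  have F': "ALL i<n. F' i : bgerm m & res (F' i) = 0" and evF': "ALL i<n. w i = ev (F' i) b"
    using F1 F by (auto simp: mgerm_def)
  have *: "EX h:germ m. (f : bgerm n --> h : bgerm m & res h = res f) & ev f w = ev h b" if fg: "f : germ n" for f
  proof -
    obtain h where h: "h : germ m" "f : bgerm n --> h : bgerm m & res h = res f"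
      "!!w b. range w <= inf ==> range b <= inf ==> ALL i<n. w i = ev (F' i) b ==> ev f w = ev h b"
      using ev_compose[OF fg F'] by blast
    have "range w <= inf" "range b <= inf" using w gen0_inf[OF A(1)] A b by auto
    thus ?thesis using h evF' by (intro bexI[of _ h]) auto
  qed
  show "f : germ n ==> ev f w : gen A" using *[of f] b unfolding gen_def by blast
  show "f : bgerm n ==> ev f w : gen1 A" using *[of f] b bgerm_germ unfolding gen1_def by blast
  show "f : mgerm n ==> ev f w : gen0 A" using *[of f] b bgerm_germ unfolding gen0_def mgerm_def by force
qed

lemma gen1_decomp:
  assumes A: "A <= inf" "0 : A"
  shows "u : gen1 A \<longleftrightarrow> (EX r. EX v:gen0 A. u = kc r + v)"
proof
  assume "u : gen1 A"
  then obtain f n a where f: "f : bgerm n" "range a <= A" "u = ev f a" unfolding gen1_def by blast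
  have "f - hconst (res f) : mgerm n" using f by (simp add: mgerm_def bgerm_closed)
  moreover have "u = kc (res f) + ev (f - hconst (res f)) a"
    using f A by (simp add: ev_minus[of _ n] bgerm_germ ev_const)
  ultimately show "EX r. EX v:gen0 A. u = kc r + v" unfolding gen0_def using f by blast
next
  assume "EX r. EX v:gen0 A. u = kc r + v"
  thus "u : gen1 A" using gen_closed(3)[OF A] gen_kc[OF A] gen0_gen1 by blast
qed

lemma gen1_unit:
  assumes A: "A <= inf" "0 : A" and u: "v : gen0 A" and r: "r ~= 0"
  shows "EX v':gen0 A. (kc r + v) * (kc (1 / r) + v') = 1"
proof -
  obtain f n a where f: "f : mgerm n" "range a <= A" "v = ev f a" using u unfolding gen0_def by blast
  let ?f = "hconst r + f"
  have f': "?f : bgerm n" "res ?f = r" using f by (auto simp: mgerm_def bgerm_closed)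
  then obtain g where g: "g : bgerm n" "?f * g = 1" "res g = 1 / r" using bgerm_unit[of ?f n] r by auto
  have a: "range a <= inf" using f A by auto
  have "ev ?f a * ev g a = 1" using ev_mult[OF _ _ a, of ?f n g] f' g bgerm_germ ev_one[OF a] by simp
  moreover have "ev ?f a = kc r + v" using ev_add[OF _ _ a, of "hconst r" n f] f a by (simp add: mgerm_def bgerm_germ ev_const)
  moreover have "ev g a = kc (1 / r) + ev (g - hconst (1 / r)) a"
    using g a by (simp add: ev_minus[of _ n] bgerm_germ ev_const)
  moreover have "g - hconst (1 / r) : mgerm n" using g by (simp add: mgerm_def bgerm_closed)
  moreover from this have "ev (g - hconst (1 / r)) a : gen0 A" unfolding gen0_def using f(2) by blast
  ultimately show ?thesis by (intro bexI[of _ "ev (g - hconst (1 / r)) a"]) simp_all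
qed

text \<open>The element \<open>z\<close> may occur several times among the arguments. All its
  occurrences outside \<open>A\<close> are merged into one variable, put last in the first form, for
  expansion in powers of \<open>z\<close>, and first in the second form, for Weierstrass division.
  The places freed in this way are filled with the default 0.\<close>

lemma gen_insert:
  assumes A: "A <= inf" "0 : A" and z: "z : inf" and f: "f : germ n" "range a <= insert z A"
  shows "EX h:germ (Suc n). EX b. range b <= A & ev f a = ev h (b(n := z)) & (f : bgerm n --> h : bgerm (Suc n) & res h = res f)"
    and "EX h:germ (Suc n). EX b. range b <= A & ev f a = ev h (case_nat z b) & (f : bgerm n --> h : bgerm (Suc n) & res h = res f)"
proof -
  have a: "range a <= inf" using f A z by auto
  define b where "b = (%i. if a i : A then a i else 0)"
  have b: "range b <= A" using A by (auto simp: b_def)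
  have *: "EX h:germ (Suc n). ev f a = ev h c & (f : bgerm n --> h : bgerm (Suc n) & res h = res f)"
    if c: "range c <= inf" and j: "ALL i<n. j i < Suc n & a i = c (j i)" for c j
  proof -
    have g: "ALL i<n. hvar (j i) : bgerm (Suc n) & res (hvar (j i) :: 'w series) = 0" using j by (simp add: bgerm_closed)
    have "ALL i<n. a i = ev (hvar (j i)) c" using j ev_var[OF c] by simp
    moreover obtain h where "h : germ (Suc n)" "f : bgerm n --> h : bgerm (Suc n) & res h = res f"
      "!!w b. range w <= inf ==> range b <= inf ==> ALL i<n. w i = ev (hvar (j i)) b ==> ev f w = ev h b"
      using ev_compose[OF f(1) g] by blast
    ultimately show ?thesis using a c by metis
  qed
  have "b i : inf" for i using b A by auto
  hence r: "range (b(n := z)) <= inf" "range (case_nat z b) <= inf" using z by (auto split: nat.splits)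
  have "ALL i<n. (if a i : A then i else n) < Suc n & a i = (b(n := z)) (if a i : A then i else n)"
    "ALL i<n. (if a i : A then Suc i else 0) < Suc n & a i = case_nat z b (if a i : A then Suc i else 0)"
    using f(2) by (auto simp: b_def)
  note * = *[OF r(1) this(1)] *[OF r(2) this(2)]
  show "EX h:germ (Suc n). EX b. range b <= A & ev f a = ev h (b(n := z)) & (f : bgerm n --> h : bgerm (Suc n) & res h = res f)"
    using *(1) b by blast
  show "EX h:germ (Suc n). EX b. range b <= A & ev f a = ev h (case_nat z b) & (f : bgerm n --> h : bgerm (Suc n) & res h = res f)"
    using *(2) b by blast
qed

lemma gen1_insert:
  assumes A: "A <= inf" "0 : A" and z: "z : inf" and u: "u : gen1 (insert z A)"
  obtains n f b where "f : bgerm (Suc n)" "range b <= A" "u = ev f (case_nat z b)"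
proof -
  obtain f n a where f: "f : bgerm n" "range a <= insert z A" "u = ev f a" using u unfolding gen1_def by blast
  thus ?thesis using gen_insert(2)[OF A z bgerm_germ[OF f(1)] f(2)] that by blast
qed

lemma gen1_power: "A <= inf ==> 0 : A ==> u : gen1 A ==> u ^ k : gen1 A"
  using gen_kc[of A 1] by (induction k) (auto simp: kc_simps intro: gen_closed(4))

lemma gen1_sum: "A <= inf ==> 0 : A ==> (!!i. i : I ==> f i : gen1 A) ==> sum f I : gen1 A"
  using gen_kc[of A 0] by (induction I rule: infinite_finite_induct) (auto simp: kc_simps intro: gen_closed(3))

lemma gen0_sum: "A <= inf ==> 0 : A ==> (!!i. i : I ==> f i : gen0 A) ==> sum f I : gen0 A"
  by (induction I rule: infinite_finite_induct) (auto simp: gen0_0 intro: gen_closed(5))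

lemma gen0_uminus: "A <= inf ==> 0 : A ==> u : gen0 A ==> - u : gen0 A"
  using gen_closed(6)[OF _ _ gen_kc, of A u "-1"] by (simp add: kc_simps)

end

section \<open>Neumann's lemma and Hahn sums\<close>

text \<open>Every sequence has a monotone subsequence; a decreasing one attains its minimum and is
  constant from there on.\<close>

lemma wo_set_mono_subseq:
  fixes x :: "nat => 'g::linorder"
  assumes S: "wo_set S" and x: "!!n. x n : S"
  shows "EX r :: nat => nat. strict_mono r & (ALL i j. i <= j --> x (r i) <= x (r j))"
proof -
  obtain r :: "nat => nat" where r: "strict_mono r" "monoseq (%n. x (r n))" using seq_monosub[of x] by blast
  show ?thesis
  proof (cases "ALL m n. m <= n --> x (r m) <= x (r n)")
    case False
    hence dec: "!!m n. m <= n ==> x (r n) <= x (r m)" using r(2) unfolding monoseq_def by blast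
    have "range (%n. x (r n)) <= S" "range (%n. x (r n)) ~= {}" using x by auto
    then obtain m where m: "m : range (%n. x (r n))" "!!y. y : range (%n. x (r n)) ==> m <= y"
      by (rule wo_setD[OF S]) (rule that)
    then obtain n0 where n0: "m = x (r n0)" by auto
    have const: "x (r (n + n0)) = m" for n using m(2)[of "x (r (n + n0))"] dec[of n0 "n + n0"] n0 by auto
    have "strict_mono (%n. r (n + n0))" using r(1) by (auto simp: strict_mono_def)
    thus ?thesis using const by (intro exI[of _ "%n. r (n + n0)"]) auto
  qed (use r in blast)
qed

text \<open>One notion covers both halves of Neumann's lemma: a strictly descending sequence of
  sums, and one sum that is attained by words of unboundedly many lengths.\<close>

definition bad_words :: "'g::linordered_ab_group_add set => (nat => 'g list) => bool" where
  "bad_words S w \<longleftrightarrow> (ALL i. set (w i) <= S) & (ALL i j. i < j -->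
     sum_list (w j) < sum_list (w i) | sum_list (w j) = sum_list (w i) & length (w i) < length (w j))"

lemma bad_wordsD: "bad_words S w ==> i < j ==>
    sum_list (w j) < sum_list (w i) | sum_list (w j) = sum_list (w i) & length (w i) < length (w j)"
  unfolding bad_words_def by blast

lemma sum_list_filter_split:
  fixes xs :: "'g::ab_group_add list"
  shows "sum_list xs = sum_list (filter P xs) + sum_list (filter (%x. ~ P x) xs)"
  by (induction xs) (simp_all add: add_ac)

lemma sum_list_ge_replicate:
  fixes xs :: "'g::linordered_ab_group_add list"
  shows "(!!x. x : set xs ==> s <= x) ==> sum_list (replicate (length xs) s) <= sum_list xs"
    and "(!!x. x : set xs ==> x <= s) ==> sum_list xs <= sum_list (replicate (length xs) s)"
  by (induction xs) (auto intro: add_mono)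

lemma sum_list_replicate_mono:
  fixes s :: "'g::linordered_ab_group_add"
  assumes "0 < s" "m < n" shows "sum_list (replicate m s) < sum_list (replicate n s)"
proof -
  have "sum_list (replicate m s) < sum_list (replicate (Suc k + m) s)" for k
  proof (induction k)
    case (Suc k)
    have "sum_list (replicate (Suc k + m) s) < sum_list (replicate (Suc (Suc k) + m) s)"
      using assms(1) by simp
    thus ?case using Suc by (rule less_trans[rotated])
  qed (use assms(1) in simp)
  from this[of "n - m - 1"] show ?thesis using assms(2) by simp
qed

lemma sum_list_nonneg_words:
  fixes xs :: "'g::linordered_ab_group_add list"
  assumes "!!x. x : set xs ==> 0 < x"
  shows "0 <= sum_list xs" using assms by (induction xs) (auto intro: add_nonneg_nonneg less_imp_le)

lemma sum_list_pos_words: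
  fixes xs :: "'g::linordered_ab_group_add list"
  assumes "!!x. x : set xs ==> 0 < x" "xs ~= []"
  shows "0 < sum_list xs"
  using assms sum_list_nonneg_words[of "tl xs"] by (cases xs) (auto intro: add_pos_nonneg)

lemma bad_words_nonempty:
  assumes "bad_words S w" "!!s. s : S ==> 0 < s"
  shows "w i ~= []"
proof
  assume "w i = []"
  have pos: "!!x. x : set (w (Suc i)) ==> 0 < x" using assms unfolding bad_words_def by blast
  have "sum_list (w (Suc i)) < 0 | sum_list (w (Suc i)) = 0 & 0 < length (w (Suc i))"
    using bad_wordsD[OF assms(1), of i "Suc i"] `w i = []` by simp
  moreover have "0 <= sum_list (w (Suc i))" by (rule sum_list_nonneg_words) (rule pos)
  moreover have "0 < sum_list (w (Suc i))" if "w (Suc i) ~= []"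
    by (rule sum_list_pos_words) (use pos that in auto)
  ultimately show False by auto
qed

lemma wo_set_words_length:
  fixes S :: "'g::linordered_ab_group_add set"
  assumes "wo_set S"
  shows "wo_set {sum_list w |w. set w <= S & length w <= N}"
proof (induction N)
  case 0
  have "{sum_list w |w. set w <= S & length w <= 0} = {0}" by auto
  thus ?case by (simp add: wo_set_finite)
next
  case (Suc N)
  let ?T = "%N. {sum_list w |w. set w <= S & length w <= N}"
  have "?T (Suc N) <= {0} Un {c. EX a:S. EX b:?T N. c = a + b}"
  proof
    fix c assume "c : ?T (Suc N)"
    then obtain w where w: "set w <= S" "length w <= Suc N" "c = sum_list w" by auto
    thus "c : {0} Un {c. EX a:S. EX b:?T N. c = a + b}" by (cases w) auto
  qed
  moreover have "wo_set ({0} Un {c. EX a:S. EX b:?T N. c = a + b})"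
    by (intro wo_set_Un wo_set_sums assms Suc wo_set_finite) simp
  ultimately show ?case using wo_set_subset by blast
qed

text \<open>Each word is split into the letters that are at least \<open>s\<close> and those below.
  All sums are bounded by \<open>N\<close> copies of \<open>s\<close>, so at most \<open>N\<close>
  letters of a word are large. Two passages to subsequences make the numbers of large letters
  nonincreasing and their sums nondecreasing; what makes the sequence bad must then come from the
  small letters.\<close>

lemma bad_words_split:
  fixes S :: "'g::linordered_ab_group_add set"
  assumes S: "wo_set S" "!!s. s : S ==> 0 < s" and bad: "bad_words S w"
    and s: "s : S" "sum_list (w 0) <= sum_list (replicate N s)"
  shows "EX v. bad_words S v & (ALL i. ALL x:set (v i). x < s)"
proof -
  define u where "u = (%n. filter (%x. s <= x) (w n))"
  define v where "v = (%n. filter (%x. ~ s <= x) (w n))"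
  have wS: "set (w n) <= S" for n using bad by (simp add: bad_words_def)
  have split: "sum_list (w n) = sum_list (u n) + sum_list (v n)" "length (w n) = length (u n) + length (v n)" for n
    unfolding u_def v_def by (rule sum_list_filter_split, rule sum_length_filter_compl[symmetric])
  have le0: "sum_list (w n) <= sum_list (w 0)" for n using bad_wordsD[OF bad, of 0 n] by (cases "n = 0") auto
  have lenu: "length (u n) <= N" for n
  proof (rule ccontr)
    assume "~ length (u n) <= N"
    hence "sum_list (replicate N s) < sum_list (replicate (length (u n)) s)"
      by (intro sum_list_replicate_mono S s) auto
    also have "... <= sum_list (u n)" by (rule sum_list_ge_replicate) (simp add: u_def)
    also have "... <= sum_list (w n)"
    proof -
      have "0 <= sum_list (v n)" by (rule sum_list_nonneg_words) (use wS[of n] S(2) in "auto simp: v_def")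
      thus ?thesis using split(1)[of n] by simp
    qed
    also have "... <= sum_list (w 0)" by (rule le0)
    finally show False using s(2) by simp
  qed
  have W: "wo_set {- int N..0}" by (intro wo_set_finite) simp
  \<comment> \<open>The sign makes the subsequence nonincreasing in length: a well-ordered set
    yields nondecreasing subsequences.\<close>
  have "- int (length (u n)) : {- int N..0}" for n using lenu[of n] by simp
  from wo_set_mono_subseq[OF W this] obtain r :: "nat => nat" where "strict_mono r &
    (ALL i j. i <= j --> - int (length (u (r i))) <= - int (length (u (r j))))" ..
  hence r: "strict_mono r" "ALL i j. i <= j --> - int (length (u (r i))) <= - int (length (u (r j)))" by auto
  have "set (u n) <= S" for n using wS[of n] by (auto simp: u_def)
  hence "sum_list (u (r n)) : {sum_list w |w. set w <= S & length w <= N}" for n using lenu by blast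
  from wo_set_mono_subseq[OF wo_set_words_length[OF S(1), of N] this] obtain q :: "nat => nat"
    where "strict_mono q & (ALL i j. i <= j --> sum_list (u (r (q i))) <= sum_list (u (r (q j))))" ..
  hence q: "strict_mono q" "ALL i j. i <= j --> sum_list (u (r (q i))) <= sum_list (u (r (q j)))" by auto
  have "bad_words S (%n. v (r (q n)))" unfolding bad_words_def
  proof (intro conjI allI impI)
    show "set (v (r (q i))) <= S" for i using wS by (auto simp: v_def)
    fix i j :: nat assume "i < j"
    hence ij: "r (q i) < r (q j)" using r q by (simp add: strict_mono_def)
    have U: "sum_list (u (r (q i))) <= sum_list (u (r (q j)))" "length (u (r (q j))) <= length (u (r (q i)))"
      using q(2)[rule_format, of i j] r(2)[rule_format, of "q i" "q j"] `i < j` q(1) by (auto simp: strict_mono_less_eq)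
    consider "sum_list (w (r (q j))) < sum_list (w (r (q i)))" |
      "sum_list (w (r (q j))) = sum_list (w (r (q i)))" "length (w (r (q i))) < length (w (r (q j)))"
      using bad_wordsD[OF bad ij] by blast
    thus "sum_list (v (r (q j))) < sum_list (v (r (q i))) |
      sum_list (v (r (q j))) = sum_list (v (r (q i))) & length (v (r (q i))) < length (v (r (q j)))"
    proof cases
      case 1
      hence "sum_list (u (r (q j))) + sum_list (v (r (q j))) < sum_list (u (r (q i))) + sum_list (v (r (q i)))"
        by (simp add: split)
      thus ?thesis using U(1) by (meson add_mono not_less)
    next
      case 2
      hence e: "sum_list (u (r (q j))) + sum_list (v (r (q j))) = sum_list (u (r (q i))) + sum_list (v (r (q i)))"
        by (simp add: split)
      hence "sum_list (v (r (q j))) <= sum_list (v (r (q i)))"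
        using U(1) by (metis add_less_le_mono add.commute not_less order.irrefl)
      thus ?thesis using 2(2) U(2) by (auto simp: split order_le_less)
    qed
  qed
  moreover have "ALL x:set (v i). x < s" for i by (auto simp: v_def)
  ultimately show ?thesis by blast
qed

text \<open>Neumann's lemma. Take the smallest \<open>s \<in> S\<close> some multiple of which bounds a bad sequence of words;
  the letters \<open>\<ge> s\<close> are then bounded in number, and removing them leaves a bad sequence bounded by
  a multiple of a smaller letter.\<close>

lemma no_bad_words:
  fixes S :: "'g::linordered_ab_group_add set"
  assumes S: "wo_set S" "!!s. s : S ==> 0 < s"
  shows "~ bad_words S w"
proof
  assume bad: "bad_words S w"
  define X where "X = {s:S. EX w N. bad_words S w & sum_list (w 0) <= sum_list (replicate N s)}"
  have X: "Max (set (w 0)) : X" if "bad_words S w" for w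
  proof -
    have ne: "w 0 ~= []" using bad_words_nonempty[OF that S(2)] .
    hence "Max (set (w 0)) : set (w 0)" by simp
    moreover have "set (w 0) <= S" using that by (simp add: bad_words_def)
    moreover have "sum_list (w 0) <= sum_list (replicate (length (w 0)) (Max (set (w 0))))"
      by (rule sum_list_ge_replicate) simp
    ultimately show ?thesis unfolding X_def using that by blast
  qed
  have "X <= S" "X ~= {}" using X[OF bad] by (auto simp: X_def)
  then obtain s where s: "s : X" "!!x. x : X ==> s <= x" by (rule wo_setD[OF S(1)]) (rule that)
  then obtain w' N where "bad_words S w'" "s : S" "sum_list (w' 0) <= sum_list (replicate N s)"
    unfolding X_def by blast
  then obtain v where v: "bad_words S v" "!!i x. x : set (v i) ==> x < s" using bad_words_split[OF S] by blast
  have "Max (set (v 0)) < s" using v(2)[of _ 0] bad_words_nonempty[OF v(1) S(2), of 0] by simp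
  thus False using s(2)[OF X[OF v(1)]] by simp
qed

lemma wo_set_words:
  fixes S :: "'g::linordered_ab_group_add set"
  assumes S: "wo_set S" "!!s. s : S ==> 0 < s"
  shows "wo_set {sum_list w |w. set w <= S}" unfolding wo_set_def
proof (intro allI impI, rule ccontr)
  fix X assume X: "X <= {sum_list w |w. set w <= S}" "X ~= {}" and no: "~ (EX m:X. ALL x:X. m <= x)"
  have "EX x. ALL n. x n : X & x (Suc n) < x n"
    using X(2) no by (intro dependent_nat_choice) (auto simp: not_le)
  then obtain x :: "nat => 'g" where x: "!!n. x n : X" "!!n. x (Suc n) < x n" by blast
  have dec: "x j < x i" if "i < j" for i j
    using that by (induction rule: less_Suc_induct) (use x in "auto intro: less_trans")
  have "ALL n. EX w. set w <= S & x n = sum_list w" using X(1) x(1) by blast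
  then obtain w where "!!n. set (w n) <= S & x n = sum_list (w n)" by metis
  hence "bad_words S w" using dec unfolding bad_words_def by metis
  thus False using no_bad_words[OF S] by blast
qed

lemma finite_words_length:
  fixes S :: "'g::linordered_ab_group_add set"
  assumes S: "wo_set S" "!!s. s : S ==> 0 < s"
  shows "finite {k. EX w. set w <= S & length w = k & sum_list w = x}" (is "finite ?K")
proof (rule ccontr)
  assume inf: "infinite ?K"
  have "ALL n. EX w. set w <= S & length w = enumerate ?K n & sum_list w = x"
    using enumerate_in_set[OF inf] by blast
  then obtain w where w: "!!n. set (w n) <= S & length (w n) = enumerate ?K n & sum_list (w n) = x" by metis
  have "bad_words S w" unfolding bad_words_def using w enumerate_mono[OF _ inf] by simp
  thus False using no_bad_words[OF S] by blast
qed

section \<open>Rearranging Hahn sums\<close>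

lemma hahn_summable_subset: "hahn_summable h J ==> I <= J ==> hahn_summable h I"
  unfolding hahn_summable_def by (auto elim!: wo_set_subset finite_subset[rotated])

lemma hahn_coeff_hahn_sum:
  assumes "hahn_summable h J" "finite A" "A <= J" "!!j. j : J ==> hahn_coeff (h j) i ~= 0 ==> j : A"
  shows "hahn_coeff (hahn_sum h J) i = (SUM j:A. hahn_coeff (h j) i)"
proof -
  let ?c = "%i. SUM j | j : J & hahn_coeff (h j) i ~= 0. hahn_coeff (h j) i"
  have "{i. ?c i ~= 0} <= {i. EX j:J. hahn_coeff (h j) i ~= 0}"
    by (smt (verit) Collect_mono_iff mem_Collect_eq sum.neutral)
  hence "wo_set {i. ?c i ~= 0}" using assms(1) wo_set_subset unfolding hahn_summable_def by blast
  hence "hahn_coeff (hahn_sum h J) i = ?c i" using assms(1) by (simp add: hahn_sum_def Abs_hahn_inverse)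
  also have "... = (SUM j:A. hahn_coeff (h j) i)" by (rule sum.mono_neutral_left) (use assms in auto)
  finally show ?thesis .
qed

lemma hahn_sum_support:
  assumes "hahn_summable h J" "hahn_coeff (hahn_sum h J) i ~= 0"
  shows "EX j:J. hahn_coeff (h j) i ~= 0"
proof (rule ccontr)
  assume "~ ?thesis"
  hence "hahn_coeff (hahn_sum h J) i = (SUM j:{}. hahn_coeff (h j) i)"
    by (intro hahn_coeff_hahn_sum assms(1)) auto
  thus False using assms(2) by simp
qed

lemma hahn_summable_finite: "hahn_summable h J ==> finite {j:J. hahn_coeff (h j) i ~= 0}"
  and hahn_summable_wo: "hahn_summable h J ==> wo_set {i. EX j:J. hahn_coeff (h j) i ~= 0}"
  by (auto simp: hahn_summable_def)

lemma hahn_sum_add: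
  assumes "hahn_summable h J" "hahn_summable g J"
  shows "hahn_summable (%j. h j + g j) J" "hahn_sum (%j. h j + g j) J = hahn_sum h J + hahn_sum g J"
proof -
  let ?A = "%i. {j:J. hahn_coeff (h j) i ~= 0} Un {j:J. hahn_coeff (g j) i ~= 0}"
  have fin: "finite (?A i)" for i using assms hahn_summable_finite by blast
  show s: "hahn_summable (%j. h j + g j) J" unfolding hahn_summable_def
  proof (intro conjI allI)
    show "wo_set {i. EX j:J. hahn_coeff (h j + g j) i ~= 0}"
      by (rule wo_set_subset[OF wo_set_Un[OF assms[THEN hahn_summable_wo]]]) auto
    show "finite {j:J. hahn_coeff (h j + g j) i ~= 0}" for i by (rule finite_subset[OF _ fin[of i]]) auto
  qed
  show "hahn_sum (%j. h j + g j) J = hahn_sum h J + hahn_sum g J"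
  proof (rule hahn_eqI)
    fix i
    have "hahn_coeff (hahn_sum h J) i = (SUM j:?A i. hahn_coeff (h j) i)"
      "hahn_coeff (hahn_sum g J) i = (SUM j:?A i. hahn_coeff (g j) i)"
      "hahn_coeff (hahn_sum (%j. h j + g j) J) i = (SUM j:?A i. hahn_coeff (h j + g j) i)"
      by (rule hahn_coeff_hahn_sum; use fin assms s in auto)+
    thus "hahn_coeff (hahn_sum (%j. h j + g j) J) i = hahn_coeff (hahn_sum h J + hahn_sum g J) i"
      by (simp add: sum.distrib)
  qed
qed

text \<open>The exponents occurring in each family form a well-ordered set, so an exponent of the
  product arises from finitely many pairs; every coefficient is a finite double sum.\<close>

lemma hahn_sum_times:
  fixes h :: "'j => ('g::linordered_ab_group_add, 'a::comm_ring_1) hahn" and g :: "'k => ('g, 'a) hahn"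
  assumes h: "hahn_summable h J" and g: "hahn_summable g K"
  shows "hahn_summable (%(j, k). h j * g k) (J \<times> K)"
    "hahn_sum (%(j, k). h j * g k) (J \<times> K) = hahn_sum h J * hahn_sum g K"
proof -
  define H G where "H = {i. EX j:J. hahn_coeff (h j) i ~= 0}" and "G = {i. EX j:K. hahn_coeff (g j) i ~= 0}"
  have wo: "wo_set H" "wo_set G" using hahn_summable_wo h g by (auto simp: H_def G_def)
  define P where "P = (%x. {(y, z). y + z = x & y : H & z : G})"
  have finP: "finite (P x)" for x unfolding P_def by (rule wo_set_finite_pairs[OF wo])
  define A where "A = (%x. UN (y, z):P x. {j:J. hahn_coeff (h j) y ~= 0})"
  define C where "C = (%x. UN (y, z):P x. {j:K. hahn_coeff (g j) z ~= 0})"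
  have finA: "finite (A x)" "finite (C x)" for x
    using finP hahn_summable_finite[OF h] hahn_summable_finite[OF g] by (auto simp: A_def C_def)
  have coeff: "hahn_coeff (h j * g k) x = (SUM (y, z):P x. hahn_coeff (h j) y * hahn_coeff (g k) z)"
    if "j : J" "k : K" for j k x
    by (rule hahn_coeff_times_sum) (use finP that in "auto simp: P_def H_def G_def")
  have nz: "EX y z. (y, z) : P x & hahn_coeff (h j) y ~= 0 & hahn_coeff (g k) z ~= 0"
    if jk: "j : J" "k : K" and n: "hahn_coeff (h j * g k) x ~= 0" for j k x
  proof -
    obtain p where "p : P x" "(case p of (y, z) => hahn_coeff (h j) y * hahn_coeff (g k) z) ~= 0"
      using n unfolding coeff[OF jk] by (rule sum.not_neutral_contains_not_neutral)
    moreover obtain y z where "p = (y, z)" by force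
    ultimately have "(y, z) : P x" "hahn_coeff (h j) y * hahn_coeff (g k) z ~= 0" by auto
    moreover from this(2) have "hahn_coeff (h j) y ~= 0" "hahn_coeff (g k) z ~= 0" by (auto simp del: mult_eq_0_iff)
    ultimately show ?thesis by blast
  qed
  show s: "hahn_summable (%(j, k). h j * g k) (J \<times> K)" unfolding hahn_summable_def
  proof (intro conjI allI)
    show "wo_set {x. EX p:J \<times> K. hahn_coeff (case p of (j, k) => h j * g k) x ~= 0}"
      by (rule wo_set_subset[OF wo_set_sums[OF wo]]) (use nz in "fastforce simp: P_def")
    have "{p : J \<times> K. hahn_coeff (case p of (j, k) => h j * g k) x ~= 0} <= A x \<times> C x" for x
      using nz by (fastforce simp: A_def C_def)
    thus "finite {p : J \<times> K. hahn_coeff (case p of (j, k) => h j * g k) x ~= 0}" for x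
      using finA by (meson finite_SigmaI finite_subset)
  qed
  show "hahn_sum (%(j, k). h j * g k) (J \<times> K) = hahn_sum h J * hahn_sum g K"
  proof (rule hahn_eqI)
    fix x
    have AJ: "A x <= J" "C x <= K" by (auto simp: A_def C_def)
    have "hahn_coeff (hahn_sum (%(j, k). h j * g k) (J \<times> K)) x
      = (SUM p:A x \<times> C x. hahn_coeff (case p of (j, k) => h j * g k) x)"
    proof (rule hahn_coeff_hahn_sum[OF s])
      fix p assume "p : J \<times> K" "hahn_coeff (case p of (j, k) => h j * g k) x ~= 0"
      thus "p : A x \<times> C x" using nz by (fastforce simp: A_def C_def)
    qed (use finA AJ in auto)
    also have "... = (SUM (j, k):A x \<times> C x. SUM (y, z):P x. hahn_coeff (h j) y * hahn_coeff (g k) z)"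
      by (rule sum.cong) (use AJ in "auto simp: coeff subset_iff")
    also have "... = (SUM (y, z):P x. SUM (j, k):A x \<times> C x. hahn_coeff (h j) y * hahn_coeff (g k) z)"
      unfolding case_prod_unfold by (rule sum.swap)
    also have "... = (SUM (y, z):P x. (SUM j:A x. hahn_coeff (h j) y) * (SUM k:C x. hahn_coeff (g k) z))"
      by (simp add: sum_product sum.cartesian_product)
    also have "... = (SUM (y, z):P x. hahn_coeff (hahn_sum h J) y * hahn_coeff (hahn_sum g K) z)"
    proof (rule sum.cong[OF refl])
      fix p assume p: "p : P x"
      obtain y z where yz: "p = (y, z)" by force
      have "hahn_coeff (hahn_sum h J) y = (SUM j:A x. hahn_coeff (h j) y)"
        by (rule hahn_coeff_hahn_sum[OF h]) (use finA AJ p yz in "auto simp: A_def")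
      moreover have "hahn_coeff (hahn_sum g K) z = (SUM k:C x. hahn_coeff (g k) z)"
        by (rule hahn_coeff_hahn_sum[OF g]) (use finA AJ p yz in "auto simp: C_def")
      ultimately show "(case p of (y, z) => (SUM j:A x. hahn_coeff (h j) y) * (SUM k:C x. hahn_coeff (g k) z))
        = (case p of (y, z) => hahn_coeff (hahn_sum h J) y * hahn_coeff (hahn_sum g K) z)" by (simp add: yz)
    qed
    also have "... = hahn_coeff (hahn_sum h J * hahn_sum g K) x" by (rule hahn_coeff_times_sum[symmetric])
         (use finP hahn_sum_support[OF h] hahn_sum_support[OF g] in "auto simp: P_def H_def G_def")
    finally show "hahn_coeff (hahn_sum (%(j, k). h j * g k) (J \<times> K)) x = hahn_coeff (hahn_sum h J * hahn_sum g K) x" .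
  qed
qed

text \<open>Fubini for Hahn sums: every coefficient is a finite sum and is grouped along the fibres
  of \<open>p\<close>.\<close>

lemma hahn_sum_group:
  assumes h: "hahn_summable h J" and p: "p ` J <= K"
  shows "hahn_summable (%k. hahn_sum h {j:J. p j = k}) K"
    "hahn_sum (%k. hahn_sum h {j:J. p j = k}) K = hahn_sum h J"
proof -
  let ?A = "%i. {j:J. hahn_coeff (h j) i ~= 0}"
  have fin: "finite (?A i)" for i using hahn_summable_finite[OF h] .
  have sub: "hahn_summable h {j:J. p j = k}" for k by (rule hahn_summable_subset[OF h]) auto
  have nz: "EX j:J. p j = k & hahn_coeff (h j) i ~= 0" if "hahn_coeff (hahn_sum h {j:J. p j = k}) i ~= 0" for k i
    using hahn_sum_support[OF sub that] by auto
  show s: "hahn_summable (%k. hahn_sum h {j:J. p j = k}) K" unfolding hahn_summable_def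
  proof (intro conjI allI)
    show "wo_set {i. EX k:K. hahn_coeff (hahn_sum h {j : J. p j = k}) i ~= 0}"
      by (rule wo_set_subset[OF hahn_summable_wo[OF h]]) (use nz in blast)
    have "{k : K. hahn_coeff (hahn_sum h {j : J. p j = k}) i ~= 0} <= p ` ?A i" for i using nz by blast
    thus "finite {k : K. hahn_coeff (hahn_sum h {j : J. p j = k}) i ~= 0}" for i
      using fin by (meson finite_imageI finite_subset)
  qed
  show "hahn_sum (%k. hahn_sum h {j:J. p j = k}) K = hahn_sum h J"
  proof (rule hahn_eqI)
    fix i
    have "hahn_coeff (hahn_sum (%k. hahn_sum h {j:J. p j = k}) K) i
      = (SUM k:p ` ?A i. hahn_coeff (hahn_sum h {j:J. p j = k}) i)"
      by (rule hahn_coeff_hahn_sum[OF s]) (use fin p nz in blast)+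
    also have "... = (SUM k:p ` ?A i. SUM j:{j:?A i. p j = k}. hahn_coeff (h j) i)"
      by (intro sum.cong refl hahn_coeff_hahn_sum sub finite_subset[OF _ fin[of i]]) auto
    also have "... = (SUM j:?A i. hahn_coeff (h j) i)" by (rule sum.group) (use fin in auto)
    also have "... = hahn_coeff (hahn_sum h J) i"
      by (rule hahn_coeff_hahn_sum[OF h, symmetric]) (use fin in auto)
    finally show "hahn_coeff (hahn_sum (%k. hahn_sum h {j:J. p j = k}) K) i = hahn_coeff (hahn_sum h J) i" .
  qed
qed

lemma hahn_sum_cong: "(!!j. j : J ==> h j = g j) ==> hahn_sum h J = hahn_sum g J"
  and hahn_summable_cong: "(!!j. j : J ==> h j = g j) ==> hahn_summable h J = hahn_summable g J"
proof -
  assume e: "!!j. j : J ==> h j = g j"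
  have 1: "{j. j : J & hahn_coeff (h j) i ~= 0} = {j. j : J & hahn_coeff (g j) i ~= 0}" for i using e by auto
  have 2: "(SUM j | j : J & hahn_coeff (h j) i ~= 0. hahn_coeff (h j) i)
    = (SUM j | j : J & hahn_coeff (g j) i ~= 0. hahn_coeff (g j) i)" for i by (rule sum.cong) (use e in auto)
  have 3: "(EX j:J. hahn_coeff (h j) i ~= 0) = (EX j:J. hahn_coeff (g j) i ~= 0)" for i using e by auto
  show s: "hahn_summable h J = hahn_summable g J" unfolding hahn_summable_def 1 3 ..
  show "hahn_sum h J = hahn_sum g J" unfolding hahn_sum_def s 2 ..
qed

lemma hahn_sum_finite:
  assumes "finite J" shows "hahn_summable h J" "hahn_sum h J = sum h J"
proof -
  have "{i. EX j:J. hahn_coeff (h j) i ~= 0} = (UN j:J. {i. hahn_coeff (h j) i ~= 0})" by auto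
  moreover have "wo_set (UN j:J. {i. hahn_coeff (h j) i ~= 0})"
    using assms by (induction J) (auto intro: wo_set_Un wo_set_supp wo_set_finite)
  ultimately show s: "hahn_summable h J" using assms by (simp add: hahn_summable_def)
  show "hahn_sum h J = sum h J"
    by (rule hahn_eqI) (subst hahn_coeff_hahn_sum[OF s assms], auto simp: hahn_coeff_sum)
qed

lemma hahn_sum_neutral:
  assumes "I <= J" "!!j. j : J - I ==> h j = 0"
  shows "hahn_summable h J = hahn_summable h I" "hahn_sum h J = hahn_sum h I"
proof -
  have z: "j : J & hahn_coeff (h j) i ~= 0 \<longleftrightarrow> j : I & hahn_coeff (h j) i ~= 0" for i j
    using assms by (cases "j : I") auto
  have 3: "(EX j:J. hahn_coeff (h j) i ~= 0) = (EX j:I. hahn_coeff (h j) i ~= 0)" for i using z by blast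
  show s: "hahn_summable h J = hahn_summable h I" unfolding hahn_summable_def z 3 ..
  show "hahn_sum h J = hahn_sum h I" unfolding hahn_sum_def s z ..
qed

lemma hahn_sum_reindex:
  assumes p: "bij_betw p I J" and h: "hahn_summable h J"
  shows "hahn_summable (%i. h (p i)) I" "hahn_sum (%i. h (p i)) I = hahn_sum h J"
proof -
  have J: "J = p ` I" and inj: "inj_on p I" using p by (auto simp: bij_betw_def)
  have fin: "finite {i:I. hahn_coeff (h (p i)) x ~= 0}" for x
  proof -
    have "finite (p ` {i:I. hahn_coeff (h (p i)) x ~= 0})"
      by (rule finite_subset[OF _ hahn_summable_finite[OF h, of x]]) (auto simp: J)
    thus ?thesis by (rule finite_imageD) (use inj in "auto simp: inj_on_def")
  qed
  show s: "hahn_summable (%i. h (p i)) I" using hahn_summable_wo[OF h] fin by (simp add: hahn_summable_def J)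
  show "hahn_sum (%i. h (p i)) I = hahn_sum h J"
  proof (rule hahn_eqI)
    fix x
    have "hahn_coeff (hahn_sum h J) x = (SUM j:p ` {i:I. hahn_coeff (h (p i)) x ~= 0}. hahn_coeff (h j) x)"
      by (rule hahn_coeff_hahn_sum[OF h]) (use fin in "auto simp: J")
    also have "... = (SUM i:{i:I. hahn_coeff (h (p i)) x ~= 0}. hahn_coeff (h (p i)) x)"
      by (subst sum.reindex) (use inj in "auto simp: inj_on_def")
    also have "... = hahn_coeff (hahn_sum (%i. h (p i)) I) x"
      by (rule hahn_coeff_hahn_sum[OF s, symmetric]) (use fin in auto)
    finally show "hahn_coeff (hahn_sum (%i. h (p i)) I) x = hahn_coeff (hahn_sum h J) x" by simp
  qed
qed

section \<open>Evaluation in Hahn fields\<close>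

definition mon :: "(nat => 'a::comm_monoid_mult) => (nat \<Rightarrow>\<^sub>0 nat) => 'a" where
  "mon a mu = (PROD i:keys mu. a i ^ lookup mu i)"

lemma mon_superset: "finite K ==> keys mu <= K ==> mon a mu = (PROD i:K. a i ^ lookup mu i)"
  unfolding mon_def by (rule prod.mono_neutral_left) (auto simp: in_keys_iff)

lemma mon_add: "mon a (mu + nu) = mon a mu * mon a nu"
proof -
  let ?K = "keys mu Un keys nu"
  have "mon a (mu + nu) = (PROD i:?K. a i ^ lookup (mu + nu) i)"
    by (rule mon_superset) (auto simp: in_keys_add)
  also have "... = mon a mu * mon a nu"
    by (simp add: mon_superset[of ?K mu] mon_superset[of ?K nu] lookup_add power_add prod.distrib)
  finally show ?thesis .
qed

lemma mon_zero [simp]: "mon a 0 = 1" and mon_single: "mon a (single i k) = a i ^ k"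
proof -
  show "mon a 0 = 1" by (simp add: mon_def)
  show "mon a (single i k) = a i ^ k" using mon_superset[of "{i}" "single i k" a] by (simp split: if_splits)
qed

lemma finite_mons:
  assumes "finite K"
  shows "finite {mu :: nat \<Rightarrow>\<^sub>0 nat. keys mu <= {..<n} & mon_degree mu : K}" (is "finite ?M")
proof -
  define F where "F = {f :: nat => nat. ALL i. (i : {..<n} --> f i : {..Max K}) & (i ~: {..<n} --> f i = 0)}"
  have "finite F" unfolding F_def by (rule finite_set_of_finite_funs) auto
  moreover have "lookup ` ?M <= F"
  proof
    fix f assume "f : lookup ` ?M"
    then obtain mu where mu: "keys mu <= {..<n}" "mon_degree mu : K" "f = lookup mu" by auto
    have "lookup mu i <= Max K" for i
    proof (cases "i : keys mu")
      case True
      hence "lookup mu i <= mon_degree mu" unfolding mon_degree_def by (intro member_le_sum) auto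
      thus ?thesis using Max_ge[OF assms mu(2)] by simp
    qed (simp add: in_keys_iff)
    moreover have "lookup mu i = 0" if "~ i < n" for i
      using mu(1) that by (metis in_keys_iff lessThan_iff subset_iff)
    ultimately show "f : F" by (auto simp: F_def mu(3))
  qed
  ultimately have "finite (lookup ` ?M)" by (rule rev_finite_subset)
  thus ?thesis by (rule finite_imageD) (auto simp: inj_on_def lookup_inject)
qed

text \<open>The link to Neumann's lemma: words of length \<open>k\<close> account for the exponents
  of a product of \<open>k\<close> infinitesimals whose supports lie in \<open>S\<close>.\<close>

definition word_supp :: "'g::linordered_ab_group_add set => nat => ('g, real) hahn => bool" where
  "word_supp S k f \<longleftrightarrow> (ALL x. hahn_coeff f x ~= 0 --> (EX w. set w <= S & length w = k & sum_list w = x))"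

lemma word_supp_mult:
  assumes "word_supp S k f" "word_supp S l g" shows "word_supp S (k + l) (f * g)" unfolding word_supp_def
proof (intro allI impI)
  fix x assume "hahn_coeff (f * g) x ~= 0"
  then obtain a b where "a + b = x" "hahn_coeff f a ~= 0" "hahn_coeff g b ~= 0"
    unfolding hahn_coeff_times by (rule convolution_nonzeroE)
  moreover from this assms obtain v w where "set v <= S" "length v = k" "sum_list v = a"
    "set w <= S" "length w = l" "sum_list w = b" unfolding word_supp_def by blast
  ultimately show "EX w. set w <= S & length w = k + l & sum_list w = x" by (intro exI[of _ "v @ w"]) auto
qed

lemma word_supp_one: "word_supp S 0 1" by (auto simp: word_supp_def split: if_splits)

lemma word_supp_power: "word_supp S 1 f ==> word_supp S k (f ^ k)"
  by (induction k) (use word_supp_one word_supp_mult[of S 1] in auto)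

lemma word_supp_mon:
  assumes "!!i. i : keys mu ==> word_supp S 1 (a i)"
  shows "word_supp S (mon_degree mu) (mon a mu)"
proof -
  have "finite K ==> (!!i. i : K ==> word_supp S 1 (a i)) ==>
    word_supp S (SUM i:K. lookup mu i) (PROD i:K. a i ^ lookup mu i)" for K
    by (induction K rule: finite_induct) (simp_all add: word_supp_one word_supp_mult word_supp_power)
  thus ?thesis unfolding mon_def mon_degree_def using assms by simp
qed

definition hahn_inf :: "('g::linordered_ab_group_add, real) hahn set" where
  "hahn_inf = {x. ALL i<=0. hahn_coeff x i = 0}"

text \<open>One sum over exponents and monomials together, unlike the nested sums of
  \<open>natural_structure\<close>, so that products can be regrouped freely. It is meant for
  infinitesimal arguments; other points are reached by expanding the series there first.\<close>

definition hahn_eval :: "('w => 'g) => ('w::linordered_ab_group_add, real mps) hahn =>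
    (nat => ('g::linordered_ab_group_add, real) hahn) => ('g, real) hahn" where
  "hahn_eval \<iota> f a = hahn_sum (%(i, mu). hahn_single (\<iota> i) (mps_coeff (hahn_coeff f i) mu) * mon a mu) UNIV"

locale hahn_evaluation =
  fixes \<iota> :: "'w::linordered_ab_group_add => 'g::linordered_ab_group_add"
  assumes emb: "ordered_group_embedding \<iota>"
begin

lemma \<iota>_mono: "i < j ==> \<iota> i < \<iota> j" and \<iota>_add: "\<iota> (i + j) = \<iota> i + \<iota> j"
  using emb by (auto simp: ordered_group_embedding_def strict_mono_def)

lemma \<iota>_inj: "\<iota> i = \<iota> j \<longleftrightarrow> i = j" using emb by (auto simp: ordered_group_embedding_def strict_mono_eq)

lemma \<iota>_0 [simp]: "\<iota> 0 = 0" using \<iota>_add[of 0 0] by simp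

lemma \<iota>_le: "i <= j \<longleftrightarrow> \<iota> i <= \<iota> j" using emb by (auto simp: ordered_group_embedding_def strict_mono_less_eq)

abbreviation vars :: "nat => 'w series => bool" where
  "vars n f == ALL i. mps_in_vars n (hahn_coeff f i)"

abbreviation hterm :: "'w series => (nat => ('g, real) hahn) => 'w \<times> (nat \<Rightarrow>\<^sub>0 nat) => ('g, real) hahn" where
  "hterm f a == (%(i, mu). hahn_single (\<iota> i) (mps_coeff (hahn_coeff f i) mu) * mon a mu)"

lemma term_nonzero:
  assumes f: "vars n f" and a: "!!i. i < n ==> word_supp S 1 (a i)"
    and nz: "hahn_coeff (hterm f a (i, mu)) x ~= 0"
  shows "mps_coeff (hahn_coeff f i) mu ~= 0" "keys mu <= {..<n}"
    "EX w. set w <= S & length w = mon_degree mu & \<iota> i + sum_list w = x"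
proof -
  show c: "mps_coeff (hahn_coeff f i) mu ~= 0" using nz by auto
  show k: "keys mu <= {..<n}" using c f unfolding mps_in_vars_def by blast
  have "word_supp S (mon_degree mu) (mon a mu)" by (rule word_supp_mon) (use k a in auto)
  moreover have "hahn_coeff (mon a mu) (x - \<iota> i) ~= 0" using nz by auto
  ultimately obtain w where "set w <= S" "length w = mon_degree mu" "sum_list w = x - \<iota> i"
    unfolding word_supp_def by blast
  thus "EX w. set w <= S & length w = mon_degree mu & \<iota> i + sum_list w = x" by (intro exI[of _ w]) auto
qed

lemma supp_words:
  fixes n :: nat and a :: "nat => ('g, real) hahn"
  assumes a: "!!i. i < n ==> a i : hahn_inf"
  obtains S where "wo_set S" "!!s. s : S ==> 0 < s" "!!i. i < n ==> word_supp S 1 (a i)"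
proof -
  define S where "S = (\<Union>i<n. {x. hahn_coeff (a i) x ~= 0})"
  have "wo_set (UN i:K. {x. hahn_coeff (a i) x ~= 0})" if "finite K" for K
    using that by (induction K) (auto intro: wo_set_Un wo_set_supp wo_set_finite)
  from this[OF finite_lessThan[of n]] have "wo_set S" by (simp only: S_def)
  moreover have "0 < s" if "s : S" for s using that a by (fastforce simp: S_def hahn_inf_def not_less[symmetric])
  moreover have "word_supp S 1 (a i)" if "i < n" for i unfolding word_supp_def
  proof (intro allI impI)
    fix x assume "hahn_coeff (a i) x ~= 0"
    thus "EX w. set w <= S & length w = 1 & sum_list w = x"
      using that by (intro exI[of _ "[x]"]) (auto simp: S_def)
  qed
  ultimately show ?thesis by (rule that)
qed

text \<open>The term \<open>(i, mu)\<close> contributes to exponents of the form \<iota>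
  \<open>i\<close> plus the sum of a word whose length is the degree of \<open>mu\<close>. By
  Neumann's lemma the sums of words are well-ordered and each of them is attained for finitely many
  lengths, hence for finitely many \<open>mu\<close>.\<close>

lemma term_summable:
  assumes f: "vars n f" and a: "!!i. i < n ==> a i : hahn_inf"
  shows "hahn_summable (hterm f a) UNIV"
proof -
  obtain S where S: "wo_set S" "!!s. s : S ==> 0 < s" "!!i. i < n ==> word_supp S 1 (a i)"
    by (rule supp_words[OF a]) (auto intro: that)
  define T where "T = {sum_list w |w. set w <= S}"
  define I where "I = \<iota> ` {i. hahn_coeff f i ~= 0}"
  have "wo_set T" unfolding T_def by (rule wo_set_words[OF S(1,2)])
  moreover have "wo_set I" unfolding wo_set_def
  proof (intro allI impI)
    fix X assume X: "X <= I" "X ~= {}"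
    let ?Y = "{i. hahn_coeff f i ~= 0 & \<iota> i : X}"
    have "?Y <= {i. hahn_coeff f i ~= 0}" "?Y ~= {}" using X by (auto simp: I_def)
    then obtain m where m: "m : ?Y" "!!x. x : ?Y ==> m <= x" by (rule wo_setD[OF wo_set_supp]) (rule that)
    have "\<iota> m <= x" if "x : X" for x
    proof -
      obtain i where "x = \<iota> i" "i : ?Y" using X(1) `x : X` by (auto simp: I_def)
      thus ?thesis using m(2)[of i] \<iota>_le by auto
    qed
    thus "EX m:X. ALL x:X. m <= x" using m(1) by (intro bexI[of _ "\<iota> m"]) auto
  qed
  ultimately have wo: "wo_set I" "wo_set T" by auto
  have nz: "\<iota> i : I & keys mu <= {..<n} & (EX w. set w <= S & length w = mon_degree mu & \<iota> i + sum_list w = x)"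
    if "hahn_coeff (hterm f a (i, mu)) x ~= 0" for i mu x
    using term_nonzero[OF f S(3) that] by (auto simp: I_def)
  show ?thesis unfolding hahn_summable_def
  proof (intro conjI allI)
    show "wo_set {x. EX j:UNIV. hahn_coeff (hterm f a j) x ~= 0}"
    proof (rule wo_set_subset[OF wo_set_sums[OF wo]], rule subsetI)
      fix x assume "x : {x. EX j:UNIV. hahn_coeff (hterm f a j) x ~= 0}"
      then obtain i mu where "hahn_coeff (hterm f a (i, mu)) x ~= 0" by auto
      from nz[OF this] show "x : {c. EX u:I. EX t:T. c = u + t}" by (auto simp: T_def)
    qed
    fix x
    define P where "P = {(u, t). u + t = x & u : I & t : T}"
    have finP: "finite P" unfolding P_def by (rule wo_set_finite_pairs[OF wo])
    define K where "K = (%t. {k. EX w. set w <= S & length w = k & sum_list w = t})"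
    have finK: "finite (K t)" for t unfolding K_def by (rule finite_words_length[OF S(1,2)])
    have fini: "finite {i. \<iota> i = u}" for u
    proof (cases "{i. \<iota> i = u} = {}")
      case False
      then obtain i where "\<iota> i = u" by auto
      hence "{i. \<iota> i = u} = {i}" using \<iota>_inj by auto
      thus ?thesis by simp
    qed (simp only: finite.emptyI)
    let ?Z = "UN p:P. {i. \<iota> i = fst p} \<times> {mu. keys mu <= {..<n} & mon_degree mu : K (snd p)}"
    have "finite ?Z" by (intro finite_UN_I finP finite_SigmaI finite_mons finK fini)
    moreover have "{j : UNIV. hahn_coeff (hterm f a j) x ~= 0} <= ?Z"
    proof
      fix j assume "j : {j : UNIV. hahn_coeff (hterm f a j) x ~= 0}"
      moreover obtain i mu where j: "j = (i, mu)" by force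
      ultimately have "hahn_coeff (hterm f a (i, mu)) x ~= 0" by simp
      from nz[OF this] obtain w where w: "\<iota> i : I" "keys mu <= {..<n}" "set w <= S"
        "length w = mon_degree mu" "\<iota> i + sum_list w = x" by blast
      hence "(\<iota> i, sum_list w) : P" by (auto simp: P_def T_def)
      moreover have "mon_degree mu : K (sum_list w)" using w by (auto simp: K_def)
      ultimately show "j : ?Z" using w(2) j by force
    qed
    ultimately show "finite {j : UNIV. hahn_coeff (hterm f a j) x ~= 0}" by (rule rev_finite_subset)
  qed
qed

lemma hahn_eval_add:
  assumes "vars n f" "vars n g" "!!i. i < n ==> a i : hahn_inf"
  shows "hahn_eval \<iota> (f + g) a = hahn_eval \<iota> f a + hahn_eval \<iota> g a"
proof -
  have "hterm (f + g) a = (%j. hterm f a j + hterm g a j)"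
    by (auto simp: fun_eq_iff hahn_single_add algebra_simps)
  thus ?thesis unfolding hahn_eval_def
    using hahn_sum_add(2)[OF term_summable[OF assms(1,3)] term_summable[OF assms(2,3)]] by simp
qed

lemma hahn_eval_mult:
  assumes "vars n f" "vars n g" "!!i. i < n ==> a i : hahn_inf"
  shows "hahn_eval \<iota> (f * g) a = hahn_eval \<iota> f a * hahn_eval \<iota> g a"
proof -
  have s: "hahn_summable (hterm f a) UNIV" "hahn_summable (hterm g a) UNIV"
    using term_summable assms by blast+
  let ?h = "%(j, k). hterm f a j * hterm g a k"
  let ?p = "%((i, mu), (i', mu')). (i + i' :: 'w, mu + mu' :: nat \<Rightarrow>\<^sub>0 nat)"
  have sp: "hahn_summable ?h (UNIV \<times> UNIV)" and eq: "hahn_sum ?h (UNIV \<times> UNIV) = hahn_eval \<iota> f a * hahn_eval \<iota> g a"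
    using hahn_sum_times[OF s] by (simp_all add: hahn_eval_def)
  \<comment> \<open>The fibre over \<open>(l, nu)\<close> may be infinite, since it contains all
    pairs of exponents with sum \<open>l\<close>. Only the finitely many pairs from the two supports
    give nonzero terms.\<close>
  have inner: "hahn_sum ?h {j : UNIV \<times> UNIV. ?p j = (l, nu)} = hterm (f * g) a (l, nu)" for l nu
  proof -
    define S where "S = {(i, i'). i + i' = l & hahn_coeff f i ~= 0 & hahn_coeff g i' ~= 0}"
    define D where "D = {(mu, mu'). mu + mu' = nu}"
    define I where "I = (%((i, i'), (mu, mu')). ((i, mu), (i', mu'))) ` (S \<times> D)"
    have fin: "finite S" "finite D" unfolding S_def D_def by (rule hahn_times_pairs_finite, rule finite_antidiagonal)
    hence finI: "finite I" by (simp add: I_def)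
    have IJ: "I <= {j : UNIV \<times> UNIV. ?p j = (l, nu)}" by (auto simp: I_def S_def D_def)
    have "hahn_sum ?h {j : UNIV \<times> UNIV. ?p j = (l, nu)} = hahn_sum ?h I"
    proof (rule hahn_sum_neutral(2)[OF IJ])
      fix j assume j: "j : {j : UNIV \<times> UNIV. ?p j = (l, nu)} - I"
      obtain i mu i' mu' where ij: "j = ((i, mu), (i', mu'))" by (metis surj_pair)
      have "(i, i') ~: S"
      proof
        assume "(i, i') : S"
        hence "((i, i'), (mu, mu')) : S \<times> D" using j ij by (auto simp: D_def)
        hence "j : I" unfolding I_def ij by force
        thus False using j by simp
      qed
      hence "hahn_coeff f i = 0 | hahn_coeff g i' = 0" using j ij by (auto simp: S_def)
      thus "?h j = 0" by (auto simp: ij)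
    qed
    also have "... = sum ?h I" by (rule hahn_sum_finite(2)[OF finI])
    also have "... = (SUM p:S \<times> D. ?h ((fst (fst p), fst (snd p)), (snd (fst p), snd (snd p))))"
      unfolding I_def by (subst sum.reindex) (auto simp: inj_on_def intro!: sum.cong)
    also have "... = (SUM p:S \<times> D. hahn_single (\<iota> l) (mps_coeff (hahn_coeff f (fst (fst p))) (fst (snd p)) *
        mps_coeff (hahn_coeff g (snd (fst p))) (snd (snd p))) * mon a nu)"
    proof (rule sum.cong[OF refl])
      fix x assume x: "x : S \<times> D"
      have "l = fst (fst x) + snd (fst x)" "nu = fst (snd x) + snd (snd x)" using x by (auto simp: S_def D_def)
      thus "?h ((fst (fst x), fst (snd x)), (snd (fst x), snd (snd x))) =
        hahn_single (\<iota> l) (mps_coeff (hahn_coeff f (fst (fst x))) (fst (snd x)) *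
        mps_coeff (hahn_coeff g (snd (fst x))) (snd (snd x))) * mon a nu"
        by (simp add: mon_add \<iota>_add hahn_single_times[symmetric] mult_ac)
    qed
    also have "... = hahn_single (\<iota> l) (SUM p:S \<times> D. mps_coeff (hahn_coeff f (fst (fst p))) (fst (snd p)) *
        mps_coeff (hahn_coeff g (snd (fst p))) (snd (snd p))) * mon a nu"
    proof -
      have hs: "hahn_single u (sum c X) = (SUM x:X. hahn_single u (c x))"
        for u :: 'g and c :: "('w \<times> 'w) \<times> (nat \<Rightarrow>\<^sub>0 nat) \<times> (nat \<Rightarrow>\<^sub>0 nat) => real" and X
        by (rule hahn_eqI) (simp add: hahn_coeff_sum)
      show ?thesis by (simp only: hs sum_distrib_right)
    qed
    also have "(SUM p:S \<times> D. mps_coeff (hahn_coeff f (fst (fst p))) (fst (snd p)) *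
        mps_coeff (hahn_coeff g (snd (fst p))) (snd (snd p)))
      = (SUM (i, i'):S. mps_coeff (hahn_coeff f i * hahn_coeff g i') nu)"
      unfolding mps_coeff_times D_def[symmetric] by (simp add: sum.cartesian_product case_prod_unfold)
    also have "... = mps_coeff (hahn_coeff (f * g) l) nu"
    proof -
      have "hahn_coeff (f * g) l = (SUM (i, i'):S. hahn_coeff f i * hahn_coeff g i')"
        by (rule hahn_coeff_times_sum[OF fin(1)]) (auto simp: S_def)
      thus ?thesis by (simp add: mps_coeff_sum case_prod_unfold)
    qed
    finally show ?thesis by simp
  qed
  have "hahn_eval \<iota> f a * hahn_eval \<iota> g a = hahn_sum (%k. hahn_sum ?h {j : UNIV \<times> UNIV. ?p j = k}) UNIV"
    using hahn_sum_group(2)[OF sp, of ?p UNIV] eq by simp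
  also have "... = hahn_eval \<iota> (f * g) a" unfolding hahn_eval_def
  proof (rule hahn_sum_cong)
    fix k :: "'w \<times> (nat \<Rightarrow>\<^sub>0 nat)"
    show "hahn_sum ?h {j : UNIV \<times> UNIV. ?p j = k} = hterm (f * g) a k"
      using inner[of "fst k" "snd k"] by (simp only: prod.collapse)
  qed
  finally show ?thesis ..
qed

lemma hahn_eval_single: "hahn_eval \<iota> (hahn_single 0 p) a = (SUM mu | mps_coeff p mu ~= 0. hahn_single 0 (mps_coeff p mu) * mon a mu)"
  if fin: "finite {mu. mps_coeff p mu ~= 0}"
proof -
  let ?I = "Pair 0 ` {mu. mps_coeff p mu ~= 0}"
  have "hahn_eval \<iota> (hahn_single 0 p) a = hahn_sum (hterm (hahn_single 0 p) a) ?I"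
    unfolding hahn_eval_def by (rule hahn_sum_neutral) (auto simp: image_iff, metis hahn_single_zero)
  also have "... = sum (hterm (hahn_single 0 p) a) ?I" by (rule hahn_sum_finite) (simp add: fin)
  also have "... = (SUM mu | mps_coeff p mu ~= 0. hahn_single 0 (mps_coeff p mu) * mon a mu)"
    by (subst sum.reindex) (auto simp: inj_on_def)
  finally show ?thesis .
qed

lemma hahn_eval_var: "hahn_eval \<iota> (hvar i) a = a i"
proof -
  have s: "{mu. mps_coeff (mps_var i :: real mps) mu ~= 0} = {single i 1}" by auto
  show ?thesis by (subst hahn_eval_single) (simp_all add: s mon_single hahn_single_zero_one del: One_nat_def)
qed

lemma hahn_eval_const: "hahn_eval \<iota> (hconst c) a = hahn_single 0 c"
proof (cases "c = 0")
  case False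
  hence s: "{mu. mps_coeff (mps_const c) mu ~= 0} = {0}" by auto
  show ?thesis by (subst hahn_eval_single) (simp_all only: s, simp_all)
qed (subst hahn_eval_single; simp)

lemma hahn_eval_one: "hahn_eval \<iota> 1 a = 1" using hahn_eval_const[of 1 a] by (simp add: hahn_single_zero_one)

lemma hahn_eval_permute:
  assumes f: "vars n f" and a: "!!i. i < n ==> a i : hahn_inf" and \<pi>: "\<pi> permutes {..<n}"
  shows "hahn_eval \<iota> (hahn_map (mps_permute \<pi>) f) a = hahn_eval \<iota> f (%i. a (\<pi> i))"
proof -
  have inj: "inj \<pi>" and bij: "bij \<pi>" using \<pi> permutes_inj permutes_bij by auto
  have inj': "inj (inv \<pi>)" using bij by (simp add: bij_imp_bij_inv bij_is_inj)
  let ?q = "%(i :: 'w, mu). (i, map_key \<pi> mu)"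
  have "bij_betw ?q UNIV UNIV" by (rule bij_betw_byWitness[where f' = "%(i, mu). (i, map_key (inv \<pi>) mu)"])
       (auto intro!: poly_mapping_eqI simp: lookup_map_key inj inj' bij bij_is_surj surj_f_inv_f)
  moreover have a': "a (\<pi> i) : hahn_inf" if "i < n" for i using a permutes_in_image[OF \<pi>, of i] that by simp
  ultimately have "hahn_sum (%j. hterm f (%i. a (\<pi> i)) (?q j)) UNIV = hahn_eval \<iota> f (%i. a (\<pi> i))"
    unfolding hahn_eval_def by (rule hahn_sum_reindex(2)[OF _ term_summable[OF f]])
  moreover have "hterm f (%i. a (\<pi> i)) (?q j) = hterm (hahn_map (mps_permute \<pi>) f) a j" for j
  proof -
    obtain i mu where j: "j = (i, mu)" by force
    have "mon (%i. a (\<pi> i)) (map_key \<pi> mu) = mon a mu" unfolding mon_def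
      by (rule prod.reindex_bij_witness[of _ "inv \<pi>" \<pi>])
         (auto simp: in_keys_iff lookup_map_key inj bij bij_is_surj surj_f_inv_f)
    thus ?thesis by (simp add: j hahn_coeff_map mps_permute.rep_eq)
  qed
  ultimately show ?thesis by (simp add: hahn_eval_def)
qed

lemma hahn_eval_cong:
  assumes f: "vars n f" and ab: "!!i. i < n ==> a i = b i"
  shows "hahn_eval \<iota> f a = hahn_eval \<iota> f b" unfolding hahn_eval_def
proof (rule hahn_sum_cong)
  fix j :: "'w \<times> (nat \<Rightarrow>\<^sub>0 nat)"
  obtain i mu where j: "j = (i, mu)" by force
  show "hterm f a j = hterm f b j"
  proof (cases "mps_coeff (hahn_coeff f i) mu = 0")
    case False
    hence "keys mu <= {..<n}" using f unfolding mps_in_vars_def by blast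
    hence "mon a mu = mon b mu" unfolding mon_def using ab by (intro prod.cong) auto
    thus ?thesis by (simp add: j)
  qed (simp add: j)
qed

text \<open>A contribution to an exponent at most 0 forces \<open>i = 0\<close> and the empty word,
  that is, the constant term of the top slice; but this is \<open>res f\<close>.\<close>

lemma hahn_eval_inf:
  assumes f: "vars n f" "integral_series f" "res f = 0" and a: "!!i. i < n ==> a i : hahn_inf"
  shows "hahn_eval \<iota> f a : hahn_inf" unfolding hahn_inf_def
proof (intro CollectI allI impI, rule ccontr)
  fix x :: 'g assume x: "x <= 0" and nz: "hahn_coeff (hahn_eval \<iota> f a) x ~= 0"
  obtain S where S: "wo_set S" "!!s. s : S ==> 0 < s" "!!i. i < n ==> word_supp S 1 (a i)"
    by (rule supp_words[OF a]) (auto intro: that)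
  obtain j where "hahn_coeff (hterm f a j) x ~= 0"
    using hahn_sum_support[OF term_summable[OF f(1) a] nz[unfolded hahn_eval_def]] by blast
  moreover obtain i mu where "j = (i, mu)" by force
  ultimately have i: "hahn_coeff (hterm f a (i, mu)) x ~= 0" by simp
  from term_nonzero(3)[OF f(1) S(3) i] obtain w where w: "set w <= S" "length w = mon_degree mu" "\<iota> i + sum_list w = x" by blast
  have c: "mps_coeff (hahn_coeff f i) mu ~= 0" by (rule term_nonzero(1)[OF f(1) S(3) i])
  hence "0 <= i" using f(2) by (force simp: integral_series_def not_less[symmetric])
  hence i0: "0 <= \<iota> i" using \<iota>_le[of 0 i] by simp
  have w0: "0 <= sum_list w" by (rule sum_list_nonneg_words) (use w S in auto)
  have "\<iota> i + sum_list w = 0" using add_nonneg_nonneg[OF i0 w0] x w(3) by simp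
  hence "\<iota> i = 0" "sum_list w = 0" using add_nonneg_eq_0_iff[OF i0 w0] by auto
  have "w = []"
  proof (rule ccontr)
    assume "w ~= []"
    hence "0 < sum_list w" by (intro sum_list_pos_words) (use w(1) S(2) in auto)
    thus False using `sum_list w = 0` by simp
  qed
  hence "mon_degree mu = 0" using w(2) by simp
  hence "mu = 0" unfolding mon_degree_def by (auto simp: in_keys_iff intro!: poly_mapping_eqI)
  moreover have "i = 0" using `\<iota> i = 0` \<iota>_inj[of i 0] by simp
  ultimately show False using c f(3) by (simp add: res_def)
qed

end

section \<open>Nagata substitution\<close>

lemma lex_minimal:
  fixes S :: "(nat => nat) set"
  assumes "S ~= {}"
  shows "EX mu:S. ALL nu:S. (ALL i<k. nu i = mu i) | (EX j<k. mu j < nu j & (ALL i. j < i & i < k --> nu i = mu i))"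
  using assms
proof (induction k arbitrary: S)
  case (Suc k)
  define m where "m = (LEAST m. EX nu:S. nu k = m)"
  have m: "EX nu:S. nu k = m" unfolding m_def by (rule LeastI_ex) (use Suc.prems in blast)
  have le: "m <= nu k" if "nu : S" for nu unfolding m_def by (rule Least_le) (use that in blast)
  have "{nu:S. nu k = m} ~= {}" using m by blast
  from Suc.IH[OF this] obtain mu where mu: "mu : S" "mu k = m" and min: "!!nu. nu : S ==> nu k = m ==>
    (ALL i<k. nu i = mu i) | (EX j<k. mu j < nu j & (ALL i. j < i & i < k --> nu i = mu i))" by blast
  have "(ALL i<Suc k. nu i = mu i) | (EX j<Suc k. mu j < nu j & (ALL i. j < i & i < Suc k --> nu i = mu i))" if nu: "nu : S" for nu
  proof (cases "nu k = m")
    case True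
    from min[OF nu this] show ?thesis
    proof
      assume "ALL i<k. nu i = mu i"
      thus ?thesis using True mu(2) by (auto simp: less_Suc_eq)
    next
      assume "EX j<k. mu j < nu j & (ALL i. j < i & i < k --> nu i = mu i)"
      then obtain j where "j < k" "mu j < nu j" "ALL i. j < i & i < k --> nu i = mu i" by blast
      thus ?thesis using True mu(2) by (intro disjI2 exI[of _ j]) (auto simp: less_Suc_eq)
    qed
  next
    case False
    hence "mu k < nu k" using le[OF nu] mu(2) by simp
    thus ?thesis by (intro disjI2 exI[of _ k]) auto
  qed
  thus ?case using mu(1) by blast
qed auto

text \<open>The exponents in \<open>mu\<close> are digits in base \<open>M\<close>, so the highest
  index at which \<open>nu\<close> differs decides; this is why \<open>lex_minimal\<close> compares
  from the highest index downwards. Digits of \<open>nu\<close> beyond the base only increase its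
  weight.\<close>

lemma weight_less:
  fixes mu nu :: "nat => nat"
  assumes M: "!!i. i < n ==> mu i < M" and j: "j < n" "mu j < nu j" "!!i. j < i ==> i < n ==> nu i = mu i"
  shows "(SUM i<n. mu i * M ^ i) < (SUM i<n. nu i * M ^ i)"
proof -
  have low: "(SUM i<k. mu i * M ^ i) < M ^ k" if "k <= n" for k using that
  proof (induction k)
    case (Suc k)
    have "(SUM i<Suc k. mu i * M ^ i) < M ^ k + mu k * M ^ k" using Suc by simp
    also have "... = (mu k + 1) * M ^ k" by simp
    also have "... <= M * M ^ k" using M[of k] Suc.prems by (intro mult_right_mono) auto
    finally show ?case by simp
  qed simp
  have split: "(SUM i<n. h i) = (SUM i<j. h i) + h j + (SUM i:{j<..<n}. h i)" for h :: "nat => nat"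
  proof -
    have "sum h {..<n} = sum h {..<j} + sum h {j..<n}"
      using j(1) by (subst sum.union_disjoint[symmetric]) (auto simp: ivl_disj_un)
    also have "{j..<n} = insert j {j<..<n}" using j(1) by auto
    finally show ?thesis by (simp add: add.assoc)
  qed
  have "(SUM i<n. mu i * M ^ i) < M ^ j + mu j * M ^ j + (SUM i:{j<..<n}. mu i * M ^ i)"
    using low[of j] j(1) by (simp add: split)
  also have "... = (mu j + 1) * M ^ j + (SUM i:{j<..<n}. nu i * M ^ i)" using j(3) by simp
  also have "... <= nu j * M ^ j + (SUM i:{j<..<n}. nu i * M ^ i)" using j(2) by (intro add_right_mono mult_right_mono) auto
  also have "... <= (SUM i<n. nu i * M ^ i)" by (simp add: split)
  finally show ?thesis .
qed

lemma mon_hahn_single: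
  "mon (%i. hahn_single (int (e i)) 1) mu = (hahn_single (int (SUM i:keys mu. lookup mu i * e i)) 1 :: (int, real) hahn)"
proof -
  have p: "hahn_single (int a) 1 ^ k = (hahn_single (int (k * a)) 1 :: (int, real) hahn)" for a k
    by (induction k) (simp_all add: hahn_single_zero_one hahn_single_times)
  have "finite K ==> (PROD i:K. hahn_single (int (e i)) 1 ^ lookup mu i)
    = (hahn_single (int (SUM i:K. lookup mu i * e i)) 1 :: (int, real) hahn)" for K
    by (induction K rule: finite_induct) (simp_all add: hahn_single_zero_one p hahn_single_times)
  thus ?thesis unfolding mon_def by simp
qed

text \<open>The variable number \<open>i\<close> is replaced by \<open>T ^ (M ^ i)\<close>. For \<open>M\<close> larger than all exponents of the
  lexicographically smallest monomial, that monomial alone has lowest degree after the substitution.\<close>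

lemma Nagata_nonzero:
  assumes p: "mps_in_vars n p" "p ~= 0"
  shows "EX M>0. hahn_eval (id :: int => int) (hahn_single 0 p) (%i. hahn_single (int (M ^ i)) 1) ~= 0"
proof -
  interpret hahn_evaluation "id :: int => int"
    by standard (simp add: ordered_group_embedding_def strict_mono_def)
  define S where "S = lookup ` {mu. mps_coeff p mu ~= 0}"
  have "S ~= {}" using p(2) mps_eqI[of p 0] by (auto simp: S_def)
  from lex_minimal[OF this, of n] obtain mu where mu: "mps_coeff p mu ~= 0"
    and min: "!!nu. mps_coeff p nu ~= 0 ==> (ALL i<n. lookup nu i = lookup mu i) |
      (EX j<n. lookup mu j < lookup nu j & (ALL i. j < i & i < n --> lookup nu i = lookup mu i))"
    unfolding S_def by blast
  define M where "M = Suc (Max (insert 0 (lookup mu ` {..<n})))"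
  have M: "lookup mu i < M" if "i < n" for i
    unfolding M_def less_Suc_eq_le by (rule Max_ge) (use that in auto)
  define W where "W = (%nu::nat \<Rightarrow>\<^sub>0 nat. SUM i<n. lookup nu i * M ^ i)"
  let ?a = "%i. hahn_single (int (M ^ i)) 1 :: (int, real) hahn"
  have keys: "keys nu <= {..<n}" if "mps_coeff p nu ~= 0" for nu using p(1) that unfolding mps_in_vars_def by blast
  have mon: "mon ?a nu = hahn_single (int (W nu)) 1" if "mps_coeff p nu ~= 0" for nu
  proof -
    have "(SUM i:keys nu. lookup nu i * M ^ i) = W nu"
      unfolding W_def by (rule sum.mono_neutral_left) (use keys[OF that] in "auto simp: in_keys_iff")
    thus ?thesis by (simp only: mon_hahn_single)
  qed
  have uniq: "W mu < W nu" if nu: "mps_coeff p nu ~= 0" "nu ~= mu" for nu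
  proof -
    have "~ (ALL i<n. lookup nu i = lookup mu i)"
    proof
      assume eq: "ALL i<n. lookup nu i = lookup mu i"
      have "lookup nu i = lookup mu i" for i
      proof (cases "i < n")
        case False
        hence "i ~: keys nu" "i ~: keys mu" using keys mu nu(1) by auto
        thus ?thesis by (simp add: in_keys_iff)
      qed (use eq in blast)
      thus False using nu(2) by (simp add: poly_mapping_eqI)
    qed
    then obtain j where "j < n" "lookup mu j < lookup nu j"
      "!!i. j < i ==> i < n ==> lookup nu i = lookup mu i" using min[OF nu(1)] by blast
    thus ?thesis unfolding W_def by (intro weight_less M)
  qed
  have f: "vars n (hahn_single 0 p :: (int, real mps) hahn)" using p(1) by (simp add: mps_in_vars_def)
  have "0 < M ^ i" for i by (simp add: M_def)
  hence a: "?a i : hahn_inf" for i unfolding hahn_inf_def by (auto simp del: of_nat_power)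
  have s: "hahn_summable (hterm (hahn_single 0 p) ?a) UNIV" by (rule term_summable[OF f a])
  have "hahn_coeff (hahn_eval id (hahn_single 0 p) ?a) (int (W mu)) = (SUM j:{(0, mu)}. hahn_coeff (hterm (hahn_single 0 p) ?a j) (int (W mu)))"
    unfolding hahn_eval_def
  proof (rule hahn_coeff_hahn_sum[OF s])
    fix j assume nz: "hahn_coeff (hterm (hahn_single 0 p) ?a j) (int (W mu)) ~= 0"
    obtain i nu where j: "j = (i, nu)" by force
    hence i: "i = 0" "mps_coeff p nu ~= 0" using nz by (auto split: if_splits)
    hence "W nu = W mu" using nz by (simp add: j mon[OF i(2)] del: of_nat_power split: if_splits)
    hence "nu = mu" using uniq[OF i(2)] by (cases "nu = mu") auto
    thus "j : {(0, mu)}" by (simp add: j i)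
  qed auto
  also have "... = mps_coeff p mu" by (simp add: mon[OF mu] del: of_nat_power)
  finally show ?thesis using mu by (intro exI[of _ M]) (auto simp: M_def)
qed

section \<open>Substitution that keeps the last variable\<close>

lemma mps_slice_permute_swap:
  fixes f :: "'a::comm_ring_1 mps"
  assumes f: "mps_in_vars (Suc n) f" and m: "n <= m"
  shows "mps_slice m (single m k) (mps_permute (transposition n m) f) = mps_slice n (single n k) f"
proof (rule mps_eqI)
  fix nu :: "nat \<Rightarrow>\<^sub>0 nat"
  let ?\<pi> = "transposition n m"
  have inj: "inj ?\<pi>" by simp
  have single: "map_key ?\<pi> (single m k) = single n k"
    by (rule poly_mapping_eqI) (auto simp: lookup_map_key lookup_single when_def Transposition.transpose_def)
  have out: "mps_coeff f mu = 0" if "lookup mu i ~= 0" "n < i" for mu i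
  proof (rule ccontr)
    assume "mps_coeff f mu ~= 0"
    hence "keys mu <= {..<Suc n}" using f unfolding mps_in_vars_def by blast
    moreover have "i : keys mu" using that by (simp add: in_keys_iff)
    ultimately show False using that by auto
  qed
  show "mps_coeff (mps_slice m (single m k) (mps_permute ?\<pi> f)) nu = mps_coeff (mps_slice n (single n k) f) nu"
  proof (cases "keys nu <= {..<n}")
    case True
    hence "lookup nu i = 0" if "n <= i" for i using that by (metis in_keys_iff leD lessThan_iff subset_iff)
    hence "map_key ?\<pi> nu = nu"
      using m by (intro poly_mapping_eqI) (auto simp: lookup_map_key Transposition.transpose_def)
    moreover have "keys nu <= {..<m}" using True m by auto
    ultimately show ?thesis using True by (simp add: mps_slice.rep_eq mps_permute.rep_eq map_key_add single)
  next
    case False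
    then obtain i where i: "i : keys nu" "n <= i" by (meson lessThan_iff not_less subsetI)
    have "mps_coeff f (map_key ?\<pi> (nu + single m k)) = 0" if "keys nu <= {..<m}"
    proof (cases "i = n")
      case True
      hence "n < m" using that i by auto
      thus ?thesis
        by (intro out[of _ m]) (use True i in "simp_all add: lookup_map_key lookup_add in_keys_iff")
    next
      case False
      have "i ~= m" using that i by auto
      thus ?thesis
        by (intro out[of _ i]) (use False i in "simp_all add: lookup_map_key lookup_add in_keys_iff")
    qed
    thus ?thesis using False by (simp add: mps_slice.rep_eq mps_permute.rep_eq)
  qed
qed

text \<open>The slice is viewed as a Hahn series over the integers concentrated in exponent 0. Then
  \<open>hahn_eval\<close> over the integers composes it with formal curves, which is a way to test
  whether a power series is nonzero.\<close>

definition top_slice :: "('w::linordered_ab_group_add, real mps) hahn => (int, real mps) hahn" where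
  "top_slice f = hahn_single 0 (hahn_coeff f 0)"

context real_weierstrass_system
begin

lemma top_slice_simps:
  "top_slice (f + g) = top_slice f + top_slice g" "top_slice (f - g) = top_slice f - top_slice g"
  "f : bgerm n ==> g : bgerm m ==> top_slice (f * g) = top_slice f * top_slice g"
  "top_slice (hvar i) = hvar i" "top_slice (hshift f) = hshift (top_slice f)"
  by (auto simp: top_slice_def hahn_single_add bgerm_def integral_series_times hahn_single_times hahn_map_single hahn_coeff_map
      intro!: hahn_eqI)

lemma top_slice_sum:
  fixes f :: "'x => 'w series"
  shows "top_slice (sum f A) = (SUM x:A. top_slice (f x))"
proof (induction A rule: infinite_finite_induct)
  case (insert x A)
  thus ?case by (simp add: top_slice_simps)
qed (simp_all add: top_slice_def)

text \<open>Moving the last variable from index \<open>n\<close> to \<open>2n\<close> frees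
  \<open>n\<close> indices for the arguments of the series to be substituted, while the coefficients
  in the last variable stay the same.\<close>

lemma germ_move_last:
  assumes "f : germ (Suc n)"
  shows "EX f':germ (Suc (n + n)). (ALL k. hslice (n + n) k f' = hslice n k f) & f' = hahn_map (mps_permute (transposition n (n + n))) f &
    (f : bgerm (Suc n) --> f' : bgerm (Suc (n + n)))"
proof -
  let ?f = "hahn_map (mps_permute (transposition n (n + n))) f"
  have f: "f : germ (Suc (n + n))" using assms germ_mono[of "Suc n" "Suc (n + n)"] by simp
  have \<pi>: "transposition n (n + n) permutes {..<Suc (n + n)}" by (rule permutes_swap_id) auto
  have "hslice (n + n) k ?f = hslice n k f" for k
    using mps_slice_permute_swap[OF in_vars_germ[OF assms], of "n + n" k]
    by (intro hahn_eqI) (simp add: hslice_def hahn_coeff_map mps_slice_add)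
  thus ?thesis using germ_permute[OF f \<pi>] integral_series_map[of f "mps_permute (transposition n (n + n))"] by (intro bexI[of _ ?f]) (auto simp: bgerm_def)
qed

end

context hahn_evaluation
begin

lemma vars_shift: "vars n f ==> vars (Suc n) (hshift f)"
proof
  fix i assume f: "vars n f"
  show "mps_in_vars (Suc n) (hahn_coeff (hshift f) i)" unfolding mps_in_vars_def
  proof (intro allI impI)
    fix mu assume "mps_coeff (hahn_coeff (hshift f) i) mu ~= 0"
    hence nz: "lookup mu 0 = 0" "mps_coeff (hahn_coeff f i) (map_key Suc mu) ~= 0"
      by (auto simp: hahn_coeff_map mps_shift.rep_eq split: if_splits)
    hence k: "keys (map_key Suc mu) <= {..<n}" using f unfolding mps_in_vars_def by blast
    show "keys mu <= {..<Suc n}"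
    proof
      fix j assume j: "j : keys mu"
      then obtain l where "j = Suc l" using nz(1) by (cases j) (auto simp: in_keys_iff)
      hence "l : keys (map_key Suc mu)" using j by (simp add: in_keys_iff lookup_map_key)
      thus "j : {..<Suc n}" using k `j = Suc l` by auto
    qed
  qed
qed

lemma vars_mono: "n <= m ==> vars n f ==> vars m f"
  unfolding mps_in_vars_def by (meson lessThan_subset_iff order_trans)

lemma hahn_eval_shift:
  assumes f: "vars n f" and a: "range a <= hahn_inf"
  shows "hahn_eval \<iota> (hshift f) a = hahn_eval \<iota> f (%i. a (Suc i))"
proof -
  obtain \<pi> where \<pi>: "\<pi> permutes {..<Suc n}" "!!i. i < n ==> \<pi> i = Suc i" "\<pi> n = 0"
    using shift_permutation[of n] by metis
  have "hshift f = hahn_map (mps_permute \<pi>) f"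
    by (rule hahn_eqI) (use mps_shift_eq_permute[of n _ \<pi>] f \<pi> in "auto simp: hahn_coeff_map")
  hence "hahn_eval \<iota> (hshift f) a = hahn_eval \<iota> f (%i. a (\<pi> i))"
    using hahn_eval_permute[OF vars_mono[OF _ f, of "Suc n"] _ \<pi>(1)] a by auto
  also have "... = hahn_eval \<iota> f (%i. a (Suc i))" by (rule hahn_eval_cong[OF f]) (simp add: \<pi>)
  finally show ?thesis .
qed

lemma hahn_eval_shiftn:
  assumes "vars m f" "range a <= hahn_inf"
  shows "vars (n + m) ((hshift ^^ n) f) & hahn_eval \<iota> ((hshift ^^ n) f) a = hahn_eval \<iota> f (%i. a (n + i))"
  using assms
proof (induction n arbitrary: a)
  case (Suc n)
  have v: "vars (n + m) ((hshift ^^ n) f)" using Suc.IH[OF Suc.prems] by simp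
  have "hahn_eval \<iota> ((hshift ^^ Suc n) f) a = hahn_eval \<iota> ((hshift ^^ n) f) (%i. a (Suc i))"
    using hahn_eval_shift[OF v Suc.prems(2)] by simp
  also have "... = hahn_eval \<iota> f (%i. a (Suc n + i))"
    using Suc.IH[OF Suc.prems(1), of "%i. a (Suc i)"] Suc.prems(2) by (auto simp: image_subset_iff)
  finally show ?case using vars_shift[OF v] by simp
qed simp

lemma hahn_eval_zero: "hahn_eval \<iota> 0 a = 0" using hahn_eval_const[of 0 a] by simp

text \<open>The counterpart of \<open>ev_substituted\<close> for formal curves. Top slices live over
  the integers and need not be germs of the system, so the variables are tracked by
  \<open>vars\<close> instead.\<close>

lemma hahn_eval_substituted:
  assumes F: "F = (SUM i<n. Q i * (hvar i - (hshift ^^ n) (g i))) + (hshift ^^ n) h"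
    and Q: "ALL i<n. vars (n + m) (Q i)" and g: "ALL i<n. vars m (g i)" and h: "vars m h"
    and a: "range a <= hahn_inf" "ALL i<n. a i = hahn_eval \<iota> (g i) (%j. a (n + j))"
  shows "hahn_eval \<iota> F a = hahn_eval \<iota> h (%j. a (n + j))"
proof -
  have va: "vars k (f1 + f2)" "vars k (f1 - f2)" if "vars k f1" "vars k f2" for k f1 f2
  proof -
    have *: "mps_coeff (hahn_coeff f1 i) mu = 0" "mps_coeff (hahn_coeff f2 i) mu = 0" if "~ keys mu <= {..<k}" for i mu
      using that `vars k f1` `vars k f2` unfolding mps_in_vars_def by blast+
    show "vars k (f1 + f2)" "vars k (f1 - f2)" unfolding mps_in_vars_def[of k] by (intro allI impI, rule ccontr, simp add: *)+
  qed
  have ai: "a i : hahn_inf" for i using a by auto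
  have diff: "hahn_eval \<iota> (f1 - f2) a = hahn_eval \<iota> f1 a - hahn_eval \<iota> f2 a" if "vars k f1" "vars k f2" for k f1 f2
    using hahn_eval_add[OF va(2)[OF that] that(2) ai] by simp
  have vm: "vars k (f1 * f2)" if "vars k f1" "vars k f2" for k f1 f2
  proof
    fix i
    show "mps_in_vars k (hahn_coeff (f1 * f2) i)" unfolding mps_in_vars_def
    proof (intro allI impI)
      fix mu assume nz: "mps_coeff (hahn_coeff (f1 * f2) i) mu ~= 0"
      let ?S = "{(a, b). a + b = i & hahn_coeff f1 a ~= 0 & hahn_coeff f2 b ~= 0}"
      have "hahn_coeff (f1 * f2) i = (SUM (a, b):?S. hahn_coeff f1 a * hahn_coeff f2 b)"
        by (rule hahn_coeff_times_sum[OF hahn_times_pairs_finite]) auto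
      then obtain p where "p : ?S" "mps_coeff (case p of (a, b) => hahn_coeff f1 a * hahn_coeff f2 b) mu ~= 0"
        using nz by (metis (no_types, lifting) mps_coeff_sum sum.neutral)
      then obtain a b where "mps_coeff (hahn_coeff f1 a * hahn_coeff f2 b) mu ~= 0" by (cases p) auto
      then obtain alpha beta where "alpha + beta = mu" "mps_coeff (hahn_coeff f1 a) alpha ~= 0" "mps_coeff (hahn_coeff f2 b) beta ~= 0"
        unfolding times_mps.rep_eq by (rule convolution_nonzeroE)
      thus "keys mu <= {..<k}" using that unfolding mps_in_vars_def by (auto simp: in_keys_add) blast+
    qed
  qed
  have vv: "vars (n + m) (hvar i :: 'w series)" if "i < n" for i using that by (auto simp: mps_in_vars_def)
  have L: "vars (n + m) (hvar i - (hshift ^^ n) (g i))" "hahn_eval \<iota> (hvar i - (hshift ^^ n) (g i)) a = 0" if i: "i < n" for i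
  proof -
    have gi: "vars m (g i)" using g i by blast
    note s = hahn_eval_shiftn[OF gi a(1), of n]
    show "vars (n + m) (hvar i - (hshift ^^ n) (g i))" using va(2)[OF vv[OF i]] s by blast
    show "hahn_eval \<iota> (hvar i - (hshift ^^ n) (g i)) a = 0"
      using diff[OF vv[OF i]] s a(2) i by (simp add: hahn_eval_var)
  qed
  have sum: "vars (n + m) (SUM i<k. Q i * (hvar i - (hshift ^^ n) (g i))) & hahn_eval \<iota> (SUM i<k. Q i * (hvar i - (hshift ^^ n) (g i))) a = 0"
    if "k <= n" for k using that
  proof (induction k)
    case (Suc k)
    have Qk: "vars (n + m) (Q k)" using Q Suc.prems by auto
    have k: "k < n" using Suc.prems by simp
    have "hahn_eval \<iota> (Q k * (hvar k - (hshift ^^ n) (g k))) a = 0"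
      using hahn_eval_mult[OF Qk L(1)[OF k] ai] L(2)[OF k] by simp
    thus ?case using Suc va(1)[OF _ vm[OF Qk L(1)[OF k]]] hahn_eval_add[OF _ vm[OF Qk L(1)[OF k]] ai] by simp
  qed (simp add: mps_in_vars_def hahn_eval_zero)
  note s = hahn_eval_shiftn[OF h a(1), of n]
  show ?thesis unfolding F using sum[OF order_refl] s hahn_eval_add[OF conjunct1[OF sum[OF order_refl]] conjunct1[OF s] ai]
    by simp
qed

end

context germ_model
begin

lemma ev_substituted:
  assumes F: "F = (SUM i<n. Q i * (hvar i - (hshift ^^ n) (g i))) + (hshift ^^ n) h"
    and Q: "ALL i<n. Q i : germ (n + m)" and g: "ALL i<n. g i : germ m" and h: "h : germ m"
    and a: "range a <= inf" "ALL i<n. a i = ev (g i) (%j. a (n + j))"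
  shows "ev F a = ev h (%j. a (n + j))"
proof -
  have L: "hvar i - (hshift ^^ n) (g i) : germ (n + m)" if "i < n" for i
    using that g germ_shiftn[of "g i" m n] by (intro germ_minus) auto
  have "ev (Q i * (hvar i - (hshift ^^ n) (g i))) a = 0" if i: "i < n" for i
  proof -
    have gi: "g i : germ m" using g i by blast
    have "ev (hvar i - (hshift ^^ n) (g i)) a = 0"
      using ev_minus[of "hvar i" "n + m" "(hshift ^^ n) (g i)" a] i germ_shiftn[OF gi, of n] a
      by (simp add: ev_var ev_shiftn[OF gi])
    thus ?thesis using ev_mult[OF _ L[OF i] a(1), of "Q i"] Q i by simp
  qed
  moreover have QL: "Q i * (hvar i - (hshift ^^ n) (g i)) : germ (n + m)" if "i < n" for i
    using Q L that germ_mult by blast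
  ultimately have S: "ev (SUM i<n. Q i * (hvar i - (hshift ^^ n) (g i))) a = 0"
    using ev_sum[of "{..<n}" "%i. Q i * (hvar i - (hshift ^^ n) (g i))" "n + m" a] a by auto
  have S': "(SUM i<n. Q i * (hvar i - (hshift ^^ n) (g i))) : germ (n + m)"
    by (rule germ_sum) (use QL in auto)
  show ?thesis unfolding F using ev_add[OF S' germ_shiftn[OF h] a(1)] S ev_shiftn[OF h a(1)] by simp
qed

text \<open>\<open>h\<close> stands for \<open>f\<close> with \<open>g i\<close> put in place of the
  \<open>i\<close>-th variable for \<open>i < n\<close>, the last variable being kept. The
  substitution is recorded through its effect on values, on the coefficients in the last variable,
  and on the top slices of these coefficients along formal curves.\<close>

definition substitutes :: "nat => (nat => 'w series) => 'w series => 'w series => bool" where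
  "substitutes n g f h \<longleftrightarrow> (f : bgerm (Suc n) --> h : bgerm (Suc n)) &
    (ALL c c' z. range c <= inf --> range c' <= inf --> z : inf --> (ALL i<n. c i = ev (g i) c') -->
      ev f (c(n := z)) = ev h (c'(n := z)) & (ALL k. ev (hslice n k f) c = ev (hslice n k h) c')) &
    (f : bgerm (Suc n) --> (ALL b w k. range b <= hahn_inf --> range w <= hahn_inf -->
      (ALL i<n. w i = hahn_eval (id :: int => int) (top_slice (g i)) b) -->
      hahn_eval (id :: int => int) (top_slice (hslice n k f)) w = hahn_eval id (top_slice (hslice n k h)) b))"

lemma substitutesD:
  assumes "substitutes n g f h"
  shows "f : bgerm (Suc n) ==> h : bgerm (Suc n)"
    "range c <= inf ==> range c' <= inf ==> z : inf ==> ALL i<n. c i = ev (g i) c' ==> ev f (c(n := z)) = ev h (c'(n := z))"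
    "range c <= inf ==> range c' <= inf ==> z : inf ==> ALL i<n. c i = ev (g i) c' ==> ev (hslice n k f) c = ev (hslice n k h) c'"
    "f : bgerm (Suc n) ==> range b <= hahn_inf ==> range w <= hahn_inf ==>
      ALL i<n. w i = hahn_eval (id :: int => int) (top_slice (g i)) b ==>
      hahn_eval (id :: int => int) (top_slice (hslice n k f)) w = hahn_eval id (top_slice (hslice n k h)) b"
  using assms unfolding substitutes_def by simp_all

lemma germ_substitute:
  assumes f: "f : germ (Suc n)" and g: "ALL i<n. g i : bgerm n & res (g i) = 0"
  shows "EX h:germ (Suc n). substitutes n g f h"
proof -
  obtain f' where f': "f' : germ (Suc (n + n))" "!!k. hslice (n + n) k f' = hslice n k f"
    "f' = hahn_map (mps_permute (transposition n (n + n))) f" "f : bgerm (Suc n) ==> f' : bgerm (Suc (n + n))"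
    using germ_move_last[OF f] by blast
  have g1: "!!i. i < n ==> g i : bgerm (Suc n) & res (g i) = 0" using g bgerm_mono[of n "Suc n"] by auto
  have "f' : germ (n + Suc n)" using f'(1) by simp
  from germ_compose[OF this, of g] g1 obtain h Q where hQ: "h : germ (Suc n)" "ALL i<n. Q i : germ (n + Suc n)"
    "f' = (SUM i<n. Q i * (hvar i - (hshift ^^ n) (g i))) + (hshift ^^ n) h"
    "integral_series f' --> h : bgerm (Suc n) & (ALL i<n. Q i : bgerm (n + Suc n))" by blast
  have gg: "ALL i<n. g i : germ n" "ALL i<n. g i : germ (Suc n)" using g g1 bgerm_germ by blast+
  have L: "hvar i - (hshift ^^ n) (g i) : germ (n + n)" "hvar i - (hshift ^^ n) (g i) : bgerm (n + n)" if "i < n" for i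
    using that g bgerm_shiftn[of "g i" n n] bgerm_germ by (auto intro!: bgerm_closed bgerm_germ)
  \<comment> \<open>The factors \<open>xi_i - g i\<close> do not involve the last variable, so
    taking its coefficients commutes with the division identity.\<close>
  have sl: "hslice n k f = (SUM i<n. hslice (n + n) k (Q i) * (hvar i - (hshift ^^ n) (g i))) + (hshift ^^ n) (hslice n k h)" for k
  proof -
    have "hslice (n + n) k f' = (SUM i<n. hslice (n + n) k (Q i * (hvar i - (hshift ^^ n) (g i)))) + (hshift ^^ n) (hslice n k h)"
      by (subst hQ(3)) (simp add: hslice_simps hslice_sum hslice_shiftn)
    thus ?thesis using f'(2) L by (simp add: hslice_times)
  qed
  have slQ: "ALL i<n. hslice (n + n) k (Q i) : germ (n + n)" for k using hQ(2) by (auto intro: hslice_germ)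
  have slh: "hslice n k h : germ n" for k using hQ(1) by (rule hslice_germ)
  have A: "ev f (c(n := z)) = ev h (c'(n := z)) & (ALL k. ev (hslice n k f) c = ev (hslice n k h) c')"
    if c: "range c <= inf" "range c' <= inf" "z : inf" "ALL i<n. c i = ev (g i) c'" for c c' z
  proof (intro conjI allI)
    define a where "a = (%i. if i < n then c i else (c'(n := z)) (i - n))"
    have a: "range a <= inf" using c(1-3) by (auto simp: a_def)
    have cz: "range (c(n := z)) <= inf" "range (c'(n := z)) <= inf" using c by auto
    have an: "(%j. a (n + j)) = c'(n := z)" by (auto simp: a_def)
    have "ev (g i) (c'(n := z)) = ev (g i) c'" if "i < n" for i
      by (rule ev_cong[of _ n]) (use gg that c cz in auto)
    hence "ALL i<n. a i = ev (g i) (%j. a (n + j))" unfolding an using c(4) by (simp add: a_def)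
    hence "ev f' a = ev h (c'(n := z))" using ev_substituted[OF hQ(3,2) gg(2) hQ(1) a] an by simp
    moreover have "ev f' a = ev f (%i. a (transposition n (n + n) i))"
      unfolding f'(3) using f germ_mono[of "Suc n" "Suc (n + n)" f] a by (intro ev_permute[of _ "Suc (n + n)"] permutes_swap_id) auto
    moreover have "... = ev f (c(n := z))"
    proof (rule ev_cong[OF f])
      fix i assume "i < Suc n"
      thus "a (transposition n (n + n) i) = (c(n := z)) i"
        by (cases "i = n") (auto simp: Transposition.transpose_def a_def)
    qed (use a cz in auto)
    ultimately show "ev f (c(n := z)) = ev h (c'(n := z))" by simp
  next
    fix k
    define a where "a = (%i. if i < n then c i else c' (i - n))"
    have a: "range a <= inf" using c(1,2) by (auto simp: a_def)
    have an: "(%j. a (n + j)) = c'" by (simp add: a_def)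
    have "ALL i<n. a i = ev (g i) (%j. a (n + j))" unfolding an using c(4) by (simp add: a_def)
    from ev_substituted[OF sl slQ gg(1) slh a this] have "ev (hslice n k f) a = ev (hslice n k h) c'" using an by simp
    moreover have "ev (hslice n k f) a = ev (hslice n k f) c"
      by (rule ev_cong[OF hslice_germ[OF f]]) (use a c in "auto simp: a_def")
    ultimately show "ev (hslice n k f) c = ev (hslice n k h) c'" by simp
  qed
  have C: "hahn_eval (id :: int => int) (top_slice (hslice n k f)) w = hahn_eval id (top_slice (hslice n k h)) b"
    if fb: "f : bgerm (Suc n)" and b: "range b <= hahn_inf" "range w <= hahn_inf"
      "ALL i<n. w i = hahn_eval (id :: int => int) (top_slice (g i)) b" for b w k
  proof -
    interpret I: hahn_evaluation "id :: int => int"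
      by standard (simp add: ordered_group_embedding_def strict_mono_def)
    have "integral_series f'" using f'(4)[OF fb] by (simp add: bgerm_def)
    hence hQ': "h : bgerm (Suc n)" "!!i. i < n ==> Q i : bgerm (Suc (n + n))" using hQ(4) by auto
    have slQ': "hslice (n + n) k (Q i) : bgerm (n + n)" if "i < n" for i using hQ'(2) that by (auto intro: hslice_bgerm)
    have vars: "I.vars N (top_slice q)" if "q : germ N" for q N
      using in_vars_germ[OF that] by (simp add: top_slice_def) (simp add: mps_in_vars_def)
    have shn: "top_slice ((hshift ^^ n) q) = (hshift ^^ n) (top_slice q)" for q :: "'w series"
      by (induction n) (simp_all add: top_slice_simps)
    have ts: "top_slice (hslice n k f) = (SUM i<n. top_slice (hslice (n + n) k (Q i)) * (hvar i - (hshift ^^ n) (top_slice (g i))))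
      + (hshift ^^ n) (top_slice (hslice n k h))"
    proof -
      have "top_slice (hslice (n + n) k (Q i) * (hvar i - (hshift ^^ n) (g i)))
        = top_slice (hslice (n + n) k (Q i)) * (hvar i - (hshift ^^ n) (top_slice (g i)))" if "i < n" for i
        using top_slice_simps(3)[OF slQ'[OF that] L(2)[OF that]] by (simp add: top_slice_simps shn)
      thus ?thesis by (subst sl) (simp add: top_slice_simps(1) top_slice_sum shn)
    qed
    define a where "a = (%i. if i < n then w i else b (i - n))"
    have a: "range a <= hahn_inf" using b(1,2) by (auto simp: a_def)
    have an: "(%j. a (n + j)) = b" by (simp add: a_def)
    have "ALL i<n. a i = hahn_eval id (top_slice (g i)) (%j. a (n + j))" unfolding an using b(3) by (simp add: a_def)
    from I.hahn_eval_substituted[OF ts _ _ _ a this, of n]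
    have "hahn_eval id (top_slice (hslice n k f)) a = hahn_eval id (top_slice (hslice n k h)) b"
      using vars slQ gg(1) slh an by auto
    moreover have "hahn_eval id (top_slice (hslice n k f)) a = hahn_eval id (top_slice (hslice n k f)) w"
      by (rule I.hahn_eval_cong[OF vars[OF hslice_germ[OF f]]]) (simp add: a_def)
    ultimately show ?thesis by simp
  qed
  have D: "f : bgerm (Suc n) --> h : bgerm (Suc n)" using f'(4) hQ(4) by (auto simp: bgerm_def)
  show ?thesis unfolding substitutes_def
    by (rule bexI[OF _ hQ(1)], intro conjI, fact D, intro allI impI, rule A, assumption+, intro allI impI, rule C, assumption+)
qed

end

section \<open>The strong Noetherian property\<close>

lemma sum_pad:
  fixes x y :: "nat => 'a::comm_ring_1"
  assumes "N <= N'"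
  shows "(SUM j<N'. x j * (if j < N then y j else 0)) = (SUM j<N. x j * y j)"
proof -
  have "(SUM j<N. x j * y j) = (SUM j<N. x j * (if j < N then y j else 0))" by (rule sum.cong) auto
  also have "... = (SUM j<N'. x j * (if j < N then y j else 0))"
    by (rule sum.mono_neutral_left) (use assms in auto)
  finally show ?thesis ..
qed

context germ_model
begin

text \<open>The value of \<open>f\<close> and all its coefficients in the last variable are packed
  into one function, so that a linear relation can be asserted for all of them with the same
  multipliers.\<close>

definition expansion :: "nat => (nat => 'p) => 'p => 'w series => nat option => 'p" where
  "expansion n c z f o' = (case o' of None => ev f (c(n := z)) | Some k => ev (hslice n k f) c)"

abbreviation expansions :: "nat => (nat => 'p) => 'p => (nat option => 'p) set" where
  "expansions n c z == expansion n c z ` germ (Suc n)"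

abbreviation bexpansions :: "nat => (nat => 'p) => 'p => (nat option => 'p) set" where
  "bexpansions n c z == expansion n c z ` bgerm (Suc n)"

lemma expansion_add:
  assumes "range c <= inf" "z : inf" "f : germ (Suc n)" "g : germ (Suc n)"
  shows "expansion n c z (f + g) = (%x. expansion n c z f x + expansion n c z g x)"
    "expansion n c z (f - g) = (%x. expansion n c z f x - expansion n c z g x)"
proof -
  have "range (c(n := z)) <= inf" using assms by auto
  thus "expansion n c z (f + g) = (%x. expansion n c z f x + expansion n c z g x)"
    "expansion n c z (f - g) = (%x. expansion n c z f x - expansion n c z g x)" using assms hslice_germ
    by (auto simp: expansion_def fun_eq_iff hslice_simps ev_add[of _ "Suc n"] ev_minus[of _ "Suc n"]
        ev_add[of _ n] ev_minus[of _ n] split: option.splits)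
qed

lemma expansion_times:
  assumes "range c <= inf" "z : inf" "f : germ (Suc n)" "g : germ n"
  shows "expansion n c z (f * g) = (%x. ev g c * expansion n c z f x)"
proof -
  have r: "range (c(n := z)) <= inf" using assms by auto
  have "ev g (c(n := z)) = ev g c" by (rule ev_cong[OF assms(4)]) (use r assms in auto)
  moreover have "g : germ (Suc n)" using assms(4) germ_mono[of n "Suc n"] by simp
  ultimately show ?thesis using assms r hslice_germ[OF assms(3)]
    by (auto simp: expansion_def fun_eq_iff hslice_times ev_mult[of _ "Suc n"] ev_mult[of _ n] mult.commute split: option.splits)
qed

lemma expansions_closed:
  assumes cz: "range c <= inf" "z : inf" and S: "S = germ | S = bgerm"
  shows "(%_. 0) : expansion n c z ` S (Suc n)"
    "G : expansion n c z ` S (Suc n) ==> H : expansion n c z ` S (Suc n) ==> (%x. G x + H x) : expansion n c z ` S (Suc n)"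
    "G : expansion n c z ` S (Suc n) ==> H : expansion n c z ` S (Suc n) ==> (%x. G x - H x) : expansion n c z ` S (Suc n)"
    "G : expansion n c z ` S (Suc n) ==> H : expansion n c z ` S (Suc n) ==> (%x. G (Some j) * H x) : expansion n c z ` S (Suc n)"
    "(!!j. j < (N :: nat) ==> F j : expansion n c z ` S (Suc n)) ==> (%x. SUM j<N. F j x) : expansion n c z ` S (Suc n)"
proof -
  let ?E = "expansion n c z ` S (Suc n)"
  have r: "range (c(n := z)) <= inf" using cz by auto
  have "expansion n c z 0 = (%_. 0)"
    by (auto simp: expansion_def fun_eq_iff hslice_simps ev_zero[OF r] ev_zero[OF cz(1)] split: option.splits)
  thus z: "(%_. 0) : ?E" using S bgerm_closed(2) germ_0 by (metis imageI)
  have g: "f : germ m" if "f : S m" for f m using S that bgerm_germ by blast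
  have c: "f + f' : S m" "f - f' : S m" "f * f' : S m" if "f : S m" "f' : S m" for f f' m
    using S that by (auto simp: germ_add germ_minus germ_mult bgerm_closed)
  show p: "(%x. G x + H x) : ?E" "(%x. G x - H x) : ?E" if "G : ?E" "H : ?E" for G H
    using that c by (auto simp: expansion_add[OF cz g g, symmetric])
  show "(%x. G (Some j) * H x) : ?E" if "G : ?E" "H : ?E"
  proof -
    obtain g h where gh: "g : S (Suc n)" "h : S (Suc n)" "G = expansion n c z g" "H = expansion n c z h"
      using `G : ?E` `H : ?E` by blast
    have sl: "hslice n j g : S n" using S gh(1) hslice_germ hslice_bgerm by blast
    hence "hslice n j g : S (Suc n)" using S germ_mono[of n "Suc n"] bgerm_mono[of n "Suc n"] by auto
    moreover have "(%x. G (Some j) * H x) = expansion n c z (h * hslice n j g)"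
      using expansion_times[OF cz g[OF gh(2)] g[OF sl]] gh by (simp add: expansion_def)
    ultimately show ?thesis using c gh(2) by blast
  qed
  show "(!!j. j < (N :: nat) ==> F j : ?E) ==> (%x. SUM j<N. F j x) : ?E" by (induction N) (simp_all add: z p)
qed

lemmas germ_expansions = expansions_closed[where S = germ, simplified] and bgerm_expansions = expansions_closed[where S = bgerm, simplified]

lemma bexpansions_expansions: "bexpansions n c z <= expansions n c z" using bgerm_germ by blast

text \<open>\<open>G\<close> is recovered from its first \<open>N\<close> coefficients with integral
  multipliers. At \<open>x = Some k\<close> this says that every later coefficient is an integral
  combination of those first ones.\<close>

definition spanning :: "nat => (nat => 'p) => 'p => nat => (nat => nat option => 'p) => (nat option => 'p) => bool" where
  "spanning n c z N H G \<longleftrightarrow> (ALL j<N. H j : bexpansions n c z) & (ALL x. G x = (SUM j<N. G (Some j) * H j x))"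

text \<open>Elimination in a finite family: the relation of one member \<open>G0\<close> is
  subtracted from the other members, and the differences are spanned by induction. For
  \<open>G0\<close> itself the difference is zero.\<close>

lemma spanning_set:
  assumes cz: "range c <= inf" "z : inf"
    and single: "!!G. G : expansions n c z ==> EX N H. spanning n c z N H G"
  shows "finite \<G> ==> \<G> <= expansions n c z ==> EX N H. ALL G:\<G>. spanning n c z N H G"
proof (induction "card \<G>" arbitrary: \<G> rule: less_induct)
  case less
  show ?case
  proof (cases "\<G> = {}")
    case False
    then obtain G0 where G0: "G0 : \<G>" by blast
    obtain N1 H1 where 1: "spanning n c z N1 H1 G0" using single less.prems G0 by blast
    let ?r = "%G x. G x - (SUM j<N1. G (Some j) * H1 j x)"
    let ?\<G> = "?r ` (\<G> - {G0})"
    have H1: "H1 j : bexpansions n c z" if "j < N1" for j using 1 that by (simp add: spanning_def)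
    have "card ?\<G> <= card (\<G> - {G0})" using less.prems by (intro card_image_le) simp
    also have "... < card \<G>" using less.prems(1) G0 by (metis card_Diff1_less)
    finally have "card ?\<G> < card \<G>" .
    moreover have "?\<G> <= expansions n c z"
    proof
      fix F assume "F : ?\<G>"
      then obtain G where G: "G : \<G>" "F = ?r G" by blast
      have "(%x. SUM j<N1. G (Some j) * H1 j x) : expansions n c z"
        by (intro germ_expansions(4,5)[OF cz]) (use H1 G less.prems bexpansions_expansions in blast)+
      thus "F : expansions n c z" using G less.prems germ_expansions(3)[OF cz] by blast
    qed
    ultimately obtain N2 H2 where 2: "!!G. G : \<G> - {G0} ==> spanning n c z N2 H2 (?r G)"
      using less.hyps[of ?\<G>] less.prems(1) by auto
    show ?thesis
    proof (cases "\<G> - {G0} = {}")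
      case True
      hence "\<G> = {G0}" using G0 by auto
      thus ?thesis using 1 by blast
    next
      case ne: False
      hence H2: "H2 j : bexpansions n c z" if "j < N2" for j using 2 that unfolding spanning_def by blast
      \<comment> \<open>From \<open>H1 j\<close> the part that the second family accounts for is
        removed; then the coefficients of \<open>G\<close> itself serve as coefficients for both
        families.\<close>
      define K where "K = (%j x. H1 j x - (SUM k<N2. H1 j (Some k) * H2 k x))"
      have K: "K j : bexpansions n c z" if "j < N1" for j
      proof -
        have "(%x. SUM k<N2. H1 j (Some k) * H2 k x) : bexpansions n c z"
          by (rule bgerm_expansions(5)[OF cz]) (use H1[OF that] H2 bgerm_expansions(4)[OF cz] in blast)
        thus ?thesis unfolding K_def using H1[OF that] bgerm_expansions(3)[OF cz] by blast
      qed
      define N where "N = max N1 N2"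
      define H where "H = (%j x. (if j < N1 then K j x else 0) + (if j < N2 then H2 j x else 0))"
      have H: "H j : bexpansions n c z" for j
      proof -
        have "(%x. if j < N1 then K j x else 0) : bexpansions n c z" "(%x. if j < N2 then H2 j x else 0) : bexpansions n c z"
          using K[of j] H2[of j] bgerm_expansions(1)[OF cz, of n] by (cases "j < N1"; cases "j < N2"; simp)+
        thus ?thesis unfolding H_def by (rule bgerm_expansions(2)[OF cz])
      qed
      have "spanning n c z N H G" if G: "G : \<G>" for G
      proof -
        have r: "?r G x = (SUM k<N2. ?r G (Some k) * H2 k x)" for x
        proof (cases "G = G0")
          case True
          have "G0 x = (SUM j<N1. G0 (Some j) * H1 j x)" for x using 1 unfolding spanning_def by blast
          hence "?r G x = 0" for x unfolding True right_minus_eq .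
          thus ?thesis by (simp only: mult_zero_left sum.neutral_const)
        next
          case False
          thus ?thesis using 2[of G] G unfolding spanning_def by blast
        qed
        have "G x = (SUM j<N. G (Some j) * H j x)" for x
        proof -
          have "(SUM j<N. G (Some j) * H j x) = (SUM j<N1. G (Some j) * K j x) + (SUM j<N2. G (Some j) * H2 j x)"
            unfolding H_def distrib_left sum.distrib by (simp only: sum_pad N_def max.cobounded1 max.cobounded2)
          also have "(SUM j<N1. G (Some j) * K j x) = (SUM j<N1. G (Some j) * H1 j x) - (SUM k<N2. (SUM j<N1. G (Some j) * H1 j (Some k)) * H2 k x)"
            unfolding K_def right_diff_distrib sum_subtractf sum_distrib_left sum_distrib_right
            by (subst sum.swap) (simp add: mult.assoc)
          finally have "(SUM j<N. G (Some j) * H j x) = (SUM j<N1. G (Some j) * H1 j x) + (SUM k<N2. ?r G (Some k) * H2 k x)"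
            by (simp add: left_diff_distrib sum_subtractf)
          also have "... = (SUM j<N1. G (Some j) * H1 j x) + ?r G x" by (simp only: r[of x, symmetric])
          also have "... = G x"
          proof -
            have "a + (b - a) = b" for a b :: 'p by simp
            thus ?thesis .
          qed
          finally show ?thesis ..
        qed
        thus ?thesis unfolding spanning_def using H by blast
      qed
      thus ?thesis by blast
    qed
  qed auto
qed

lemma expansion_sum:
  assumes "range c <= inf" "z : inf" "!!i. i < (s::nat) ==> f i : germ (Suc n)"
  shows "expansion n c z (SUM i<s. f i) x = (SUM i<s. expansion n c z (f i) x)" using assms(3)
proof (induction s)
  case 0
  have "range (c(n := z)) <= inf" using assms by auto
  thus ?case using assms by (simp add: expansion_def hslice_simps ev_zero split: option.splits)
next
  case (Suc s)
  have "(SUM i<s. f i) : germ (Suc n)" by (rule germ_sum) (use Suc.prems in auto)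
  thus ?case using Suc expansion_add(1)[OF assms(1,2)] by simp
qed

lemma expansion_shift:
  assumes c: "range c <= inf" "z : inf" and R: "R : germ (Suc n)"
  shows "expansion (Suc n) c z (hshift R) = expansion n (%i. c (Suc i)) z R"
proof -
  have r: "range (c(Suc n := z)) <= inf" using c by auto
  have s: "(%i. (c(Suc n := z)) (Suc i)) = (%i. c (Suc i))(n := z)" by auto
  show ?thesis using ev_shift[OF R r] ev_shift[OF hslice_germ[OF R] c(1)] unfolding s
    by (auto simp: expansion_def fun_eq_iff hslice_simps split: option.splits)
qed

lemma bexpansions_substitute:
  assumes c: "range c <= inf" "range c' <= inf" "z : inf" and g: "ALL i<n. g i : bgerm n & res (g i) = 0 & c i = ev (g i) c'"
  shows "bexpansions n c z <= bexpansions n c' z"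
proof
  fix G assume "G : bexpansions n c z"
  then obtain f where f: "f : bgerm (Suc n)" "G = expansion n c z f" by (auto simp:)
  have g': "ALL i<n. g i : bgerm n & res (g i) = 0" "ALL i<n. c i = ev (g i) c'" using g by auto
  obtain h where h: "substitutes n g f h" using germ_substitute[OF bgerm_germ[OF f(1)] g'(1)] by blast
  note hD = substitutesD(1)[OF h f(1)] substitutesD(2,3)[OF h c g'(2)]
  have "G = expansion n c' z h" using hD f by (auto simp: expansion_def fun_eq_iff split: option.splits)
  thus "G : bexpansions n c' z" using hD(1) by (auto simp:)
qed

lemma spanning_scale:
  assumes "spanning n c z N H G1" "!!x. G x = u * G1 x"
  shows "spanning n c z N H G"
proof -
  have "G x = (SUM j<N. G (Some j) * H j x)" for x
  proof -
    have "G1 x = (SUM j<N. G1 (Some j) * H j x)" using assms(1) unfolding spanning_def by blast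
    hence "G x = u * (SUM j<N. G1 (Some j) * H j x)" using assms(2) by metis
    thus ?thesis by (simp add: assms(2) sum_distrib_left mult.assoc)
  qed
  thus ?thesis using assms(1) unfolding spanning_def by blast
qed

lemma expansion_normalize:
  assumes c: "range c <= inf" "z : inf" and f: "f : germ (Suc n)" "f ~= 0"
  obtains u f1 where "f1 : bgerm (Suc n)" "hahn_coeff f1 0 ~= 0" "!!x. expansion n c z f x = u * expansion n c z f1 x"
proof -
  obtain a a' where a: "a : germ 0" "a' : germ 0" "a * a' = 1" "a * f : bgerm (Suc n)" "hahn_coeff (a * f) 0 ~= 0"
    using germ_normalize[OF f] by blast
  have a'n: "a' : germ n" using a(2) germ_mono[of 0 n] by simp
  have "(a * f) * a' = (a * a') * f" by (simp only: mult_ac)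
  hence "f = (a * f) * a'" using a(3) by simp
  hence "expansion n c z f = (%x. ev a' c * expansion n c z (a * f) x)"
    using expansion_times[OF c bgerm_germ[OF a(4)] a'n] by simp
  thus ?thesis using that[OF a(4,5), of "ev a' c"] by simp
qed

lemma spanning_zero:
  assumes c: "range c <= inf" "z : inf" shows "spanning n c z 0 H (expansion n c z 0)"
proof -
  have "range (c(n := z)) <= inf" using c by auto
  thus ?thesis using c by (simp add: spanning_def expansion_def hslice_simps ev_zero split: option.splits)
qed

text \<open>A one-variable form of the strong Noetherian property: the coefficients of \<open>G\<close> as a series in the
  last variable \<open>z\<close> are dominated by finitely many of them.\<close>

lemma spanning_exists:
  "range c <= inf ==> z : inf ==> G : expansions n c z ==> EX N H. spanning n c z N H G"
proof (induction n arbitrary: c G)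
  case 0
  note cz = 0(1,2)
  obtain f where f: "f : germ (Suc 0)" "G = expansion 0 c z f" using 0 by auto
  show ?case
  proof (cases "f = 0")
    case False
    then obtain u f1 where f1: "f1 : bgerm (Suc 0)" "hahn_coeff f1 0 ~= 0" and Gu: "!!x. expansion 0 c z f x = u * expansion 0 c z f1 x"
      using expansion_normalize[OF cz f(1)] by blast
    \<comment> \<open>In the single variable \<open>z\<close> the normalized series has a
      coefficient \<open>d\<close> with nonzero residue, hence a unit. The series divided by
      \<open>d\<close> is the one multiplier, at index \<open>k\<close>.\<close>
    obtain mu where mu: "mps_coeff (hahn_coeff f1 0) mu ~= 0" using f1(2) mps_eqI[of "hahn_coeff f1 0" 0] by auto
    hence "keys mu <= {..<Suc 0}" using in_vars_germ[OF bgerm_germ[OF f1(1)]] unfolding mps_in_vars_def by blast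
    hence "mu = single 0 (lookup mu 0)"
      by (intro poly_mapping_eqI) (auto simp: lookup_single when_def in_keys_iff subset_iff)
    then obtain k where k: "mps_coeff (hahn_coeff f1 0) (single 0 k) ~= 0" using mu by metis
    define d where "d = hslice 0 k f1"
    have d: "d : bgerm 0" "res d ~= 0" using hslice_bgerm[OF f1(1)] k by (auto simp: d_def hslice_simps)
    then obtain e where e: "e : bgerm 0" "d * e = 1" using bgerm_unit by blast
    have de: "ev d c * ev e c = 1" using ev_mult[OF bgerm_germ[OF d(1)] bgerm_germ[OF e(1)] cz(1)] e(2) ev_one[OF cz(1)] by simp
    define K where "K = expansion 0 c z (f1 * e)"
    have K: "K : bexpansions 0 c z" unfolding K_def using f1(1) e(1) bgerm_mono[of 0 "Suc 0" e] by (auto intro: bgerm_closed)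
    have Kx: "K x = ev e c * expansion 0 c z f1 x" for x
      unfolding K_def using expansion_times[OF cz bgerm_germ[OF f1(1)] bgerm_germ[OF e(1)]] by simp
    define H where "H = (%j x. if j = k then K x else 0)"
    have "H j : bexpansions 0 c z" for j unfolding H_def using K bgerm_expansions(1)[OF cz] by (cases "j = k") auto
    moreover have "expansion 0 c z f1 x = (SUM j<Suc k. expansion 0 c z f1 (Some j) * H j x)" for x
    proof -
      have "expansion 0 c z f1 (Some k) = ev d c" by (simp add: expansion_def d_def)
      have "(SUM j<Suc k. expansion 0 c z f1 (Some j) * H j x) = (SUM j<Suc k. if j = k then ev d c * K x else 0)"
        by (rule sum.cong) (auto simp: H_def expansion_def d_def)
      also have "... = ev d c * K x" by (simp add: sum.delta)
      also have "... = (ev d c * ev e c) * expansion 0 c z f1 x" by (simp add: Kx mult.assoc)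
      finally show ?thesis using de by simp
    qed
    ultimately have "spanning 0 c z (Suc k) H (expansion 0 c z f1)" unfolding spanning_def by blast
    hence "spanning 0 c z (Suc k) H G" by (rule spanning_scale) (simp add: f(2) Gu)
    thus ?thesis by blast
  qed (use spanning_zero[OF cz] f in blast)
next
  case (Suc m)
  define n where "n = Suc m"
  note cz = Suc.prems(1,2)
  obtain f where f: "f : germ (Suc n)" "G = expansion n c z f" using Suc.prems by (auto simp:  n_def)
  show ?case
  proof (cases "f = 0")
    case False
    then obtain u f1 where f1: "f1 : bgerm (Suc n)" "hahn_coeff f1 0 ~= 0" and Gu: "!!x. expansion n c z f x = u * expansion n c z f1 x"
      using expansion_normalize[OF cz f(1)] by blast
    obtain mu where mu: "mps_coeff (hahn_coeff f1 0) mu ~= 0" using f1(2) mps_eqI[of "hahn_coeff f1 0" 0] by auto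
    define k where "k = lookup mu n"
    define p where "p = hahn_coeff (hslice n k f1) 0"
    have muk: "keys mu <= {..<Suc n}" using mu in_vars_germ[OF bgerm_germ[OF f1(1)]] unfolding mps_in_vars_def by blast
    have pv: "mps_in_vars n p" unfolding p_def using in_vars_germ hslice_germ[OF bgerm_germ[OF f1(1)]] by blast
    have "keys (mu - single n k) <= {..<n}"
    proof
      fix i assume "i : keys (mu - single n k)"
      hence i: "lookup mu i - lookup (single n k) i ~= 0" by (simp add: in_keys_iff lookup_minus)
      hence "i ~= n" by (auto simp: k_def)
      moreover have "i : keys mu" using i by (auto simp: in_keys_iff)
      ultimately show "i : {..<n}" using muk by auto
    qed
    moreover have "mu - single n k + single n k = mu"
      by (rule poly_mapping_eqI) (auto simp: lookup_add lookup_minus lookup_single when_def k_def)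
    ultimately have "mps_coeff p (mu - single n k) = mps_coeff (hahn_coeff f1 0) mu"
      by (simp add: p_def hslice_def hahn_coeff_map mps_slice_add mps_slice.rep_eq)
    hence "p ~= 0" using mu by auto
    from Nagata_nonzero[OF pv this] obtain M where M: "M > 0"
      "hahn_eval (id :: int => int) (hahn_single 0 p) (%i. hahn_single (int (M ^ i)) 1) ~= 0" by blast
    \<comment> \<open>The \<open>k\<close>-th coefficient of \<open>f1\<close> may fail to be
      regular in the variable 0. The automorphism \<open>xi_i -> xi_i + xi_0^(M^i)\<close> for
      \<open>i > 0\<close> makes it regular; \<open>g'\<close> is its inverse, and \<open>c'\<close>
      is the point that \<open>g\<close> takes to \<open>c\<close>.\<close>
    define g where "g = (%i. if i = 0 then hvar 0 else hvar i + hvar 0 ^ (M ^ i) :: 'w series)"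
    define g' where "g' = (%i. if i = 0 then hvar 0 else hvar i - hvar 0 ^ (M ^ i) :: 'w series)"
    have v0: "(hvar 0 :: 'w series) : bgerm n'" if "0 < n'" for n' using that by (rule bgerm_closed(4))
    have rp: "res (hvar 0 ^ (M ^ i) :: 'w series) = 0" for i
      using res_power[OF v0[of 1], of "M ^ i"] M(1) by simp
    have gb: "ALL i<n'. g i : bgerm n' & res (g i) = 0" "ALL i<n'. g' i : bgerm n' & res (g' i) = 0" for n'
      by (auto simp: g_def g'_def rp intro!: bgerm_closed)
    define c' where "c' = (%i. ev (g' i) c)"
    have c': "range c' <= inf" unfolding c'_def using ev_inf[OF _ _ cz(1)] gb(2) by blast
    have evp: "ev (hvar 0 ^ l) b = b 0 ^ l" if "range b <= inf" for b l
      using ev_power[OF germ_var[of 0 1] that] by (simp add: ev_var[OF that])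
    have cg: "c i = ev (g i) c'" for i
    proof (cases "i = 0")
      case False
      have N: "hvar 0 ^ (M ^ i) : germ (Suc i)" by (rule germ_power) simp
      have "ev (g i) c' = c' i + c' 0 ^ (M ^ i)"
        using False ev_add[OF germ_var[OF lessI] N c'] ev_var[OF c'] evp[OF c'] by (simp add: g_def)
      also have "c' 0 = c 0" using ev_var[OF cz(1)] by (simp add: c'_def g'_def)
      also have "c' i = c i - c 0 ^ (M ^ i)"
        using False ev_minus[OF germ_var[OF lessI] N cz(1)] ev_var[OF cz(1)] evp[OF cz(1)] by (simp add: c'_def g'_def)
      finally show ?thesis by simp
    qed (use ev_var[OF cz(1)] ev_var[OF c'] in "simp add: g_def c'_def g'_def")
    obtain h where hs: "substitutes n g f1 h" using germ_substitute[OF bgerm_germ[OF f1(1)] gb(1)] by blast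
    have "ALL i<n. c i = ev (g i) c'" using cg by blast
    note h = substitutesD(1)[OF hs f1(1)] substitutesD(2,3)[OF hs cz(1) c' cz(2) this]
    note h3 = substitutesD(4)[OF hs f1(1)]
    have G1: "expansion n c z f1 = expansion n c' z h"
      using h(2,3) by (auto simp: expansion_def fun_eq_iff split: option.splits)
    define d where "d = hslice n k h"
    have d: "d : bgerm n" unfolding d_def by (rule hslice_bgerm[OF h(1)])
    \<comment> \<open>On the curve \<open>(T, 0, 0, ...)\<close> the top slice of \<open>d\<close>
      has the same value as \<open>p\<close> on the curve with entries \<open>T^(M^i)\<close>, which
      is nonzero. Only pure powers of the variable 0 survive on the first curve, so one of them
      occurs in \<open>d\<close>.\<close>
    have "EX l. mps_coeff (hahn_coeff d 0) (single 0 l) ~= 0"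
    proof -
      interpret I: hahn_evaluation "id :: int => int"
        by standard (simp add: ordered_group_embedding_def strict_mono_def)
      define he where "he = hahn_eval (id :: int => int)"
      note he_var = I.hahn_eval_var[folded he_def] and he_one = I.hahn_eval_one[folded he_def]
        and he_mult = I.hahn_eval_mult[folded he_def] and he_add = I.hahn_eval_add[folded he_def]
      define T where "T = (hahn_single 1 1 :: (int, real) hahn)"
      define b where "b = (%i :: nat. if i = 0 then T else 0)"
      have b: "range b <= hahn_inf" by (auto simp: b_def T_def hahn_inf_def)
      have bi: "b i : hahn_inf" for i using b by auto
      have b0: "b 0 = T" by (simp add: b_def)
      define w where "w = (%i. hahn_single (int (M ^ i)) 1 :: (int, real) hahn)"
      have inf: "hahn_single (int m) 1 : hahn_inf" if "0 < m" for m using that by (auto simp: hahn_inf_def)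
      have "w i : hahn_inf" for i unfolding w_def by (rule inf) (simp add: M(1))
      hence w: "range w <= hahn_inf" by auto
      have Tp: "T ^ l = hahn_single (int l) 1" for l
        by (induction l) (simp_all add: T_def hahn_single_zero_one hahn_single_times add.commute)
      have vv: "I.vars (Suc i) (hvar j :: (int, real mps) hahn)" if "j <= i" for i j using that by (auto simp: mps_in_vars_def)
      have pp: "I.vars (Suc i) (hvar 0 ^ l :: (int, real mps) hahn) & he (hvar 0 ^ l) b = T ^ l" for l i
      proof (induction l)
        case 0
        have "I.vars (Suc i) (1 :: (int, real mps) hahn)" by (auto simp: mps_in_vars_def split: if_splits)
        thus ?case unfolding power_0 using he_one by blast
      next
        case (Suc l)
        have eq: "(hvar 0 :: (int, real mps) hahn) ^ Suc l = hahn_single 0 (mps_var 0 ^ Suc l)"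
        proof -
          have "(hvar 0 :: (int, real mps) hahn) ^ l = hahn_single 0 (mps_var 0 ^ l)" for l
            by (induction l) (simp_all add: hahn_single_zero_one hahn_single_times)
          thus ?thesis .
        qed
        have "I.vars (Suc i) (hvar 0 ^ Suc l :: (int, real mps) hahn)"
          unfolding eq by (auto simp: mps_in_vars_def mps_var_power simp del: power_Suc split: if_splits)
        moreover have "he (hvar 0 ^ Suc l) b = T ^ Suc l"
          using he_mult[OF vv[of 0 i] conjunct1[OF Suc] bi] Suc by (simp add: he_var b0)
        ultimately show ?case by blast
      qed
      have tp: "top_slice (hvar 0 ^ l :: 'w series) = hvar 0 ^ l" for l
      proof (induction l)
        case (Suc l)
        thus ?case using top_slice_simps(3)[OF v0[of 1] bgerm_closed(9)[OF v0[of 1], of l]] by (simp add: top_slice_simps(4))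
      qed (simp add: top_slice_def hahn_single_zero_one)
      have wi: "w i = he (top_slice (g i)) b" for i
      proof (cases "i = 0")
        case True
        thus ?thesis by (simp add: g_def top_slice_simps(4) he_var b_def w_def T_def)
      next
        case False
        have "he (top_slice (g i)) b = he (hvar i + hvar 0 ^ (M ^ i)) b"
          using False by (simp add: g_def top_slice_simps(1,4) tp)
        also have "... = b i + T ^ (M ^ i)"
          using he_add[OF vv[of i i] conjunct1[OF pp[of i "M ^ i"]] bi] pp[of i "M ^ i"] by (simp add: he_var)
        finally show ?thesis using False by (simp add: b_def Tp w_def)
      qed
      have "he (top_slice d) b ~= 0"
        using h3[folded he_def, OF b w, of k] wi M(2)[folded he_def] by (simp add: d_def top_slice_def p_def w_def)
      then obtain x where x: "hahn_coeff (he (top_slice d) b) x ~= 0" using hahn_eqI[of _ 0] by fastforce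
      have vd: "I.vars n (top_slice d)"
        using in_vars_germ[OF bgerm_germ[OF d]] by (simp add: top_slice_def) (simp add: mps_in_vars_def)
      obtain j where "hahn_coeff (I.hterm (top_slice d) b j) x ~= 0"
        using hahn_sum_support[OF I.term_summable[OF vd bi] x[unfolded he_def hahn_eval_def]] by blast
      moreover obtain i nu where "j = (i, nu)" by force
      ultimately have nz: "hahn_coeff (hahn_single i (mps_coeff (hahn_coeff (top_slice d) i) nu) * mon b nu) x ~= 0" by simp
      hence c: "mps_coeff (hahn_coeff (top_slice d) i) nu ~= 0" "mon b nu ~= 0" by auto
      have "l ~: keys nu" if "l ~= 0" for l
      proof
        assume l: "l : keys nu"
        hence "b l ^ lookup nu l = 0" using that by (simp add: b_def in_keys_iff)
        hence "mon b nu = 0" unfolding mon_def using l by (intro prod_zero) auto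
        thus False using c by simp
      qed
      hence "nu = single 0 (lookup nu 0)"
        by (intro poly_mapping_eqI) (auto simp: lookup_single when_def in_keys_iff)
      moreover have "mps_coeff (hahn_coeff d 0) nu ~= 0" using c(1) by (auto simp: top_slice_def split: if_splits)
      ultimately show ?thesis by metis
    qed
    then obtain l where l: "mps_coeff (hahn_coeff d 0) (single 0 l) ~= 0" by blast
    define s where "s = (LEAST l. mps_coeff (hahn_coeff d 0) (single 0 l) ~= 0)"
    have reg: "mps_regular s (hahn_coeff d 0)"
      unfolding mps_regular_def s_def using LeastI[of "%l. mps_coeff (hahn_coeff d 0) (single 0 l) ~= 0", OF l] not_less_Least by blast
    have dS: "d : bgerm (Suc n)" using d bgerm_mono[of n "Suc n"] by simp
    \<comment> \<open>\<open>h\<close> is divided by its own \<open>k\<close>-th coefficient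
      \<open>d\<close>, with \<open>z\<close> as a parameter. The product \<open>Q * d\<close> is
      then a multiple of a coefficient of \<open>h\<close>, and the remainders lose the variable 0,
      so that the induction hypothesis applies to them.\<close>
    obtain Q R where QR: "Q : bgerm (Suc n)" "ALL i<s. R i : bgerm n" "h = Q * d + (SUM i<s. hshift (R i) * hvar 0 ^ i)"
      using germ_division[OF dS _ reg bgerm_germ[OF h(1)]] h(1) by (auto simp: bgerm_def)
    define c'' where "c'' = (%i. c' (Suc i))"
    have c'': "range c'' <= inf" using c' by (auto simp: c''_def)
    define E where "E = (%i. expansion m c'' z (R i))"
    have E: "E i = expansion n c' z (hshift (R i))" "E i : expansions m c'' z" if "i < s" for i
    proof -
      have R: "R i : germ (Suc m)" using QR(2) that bgerm_germ by (auto simp: n_def)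
      show "E i = expansion n c' z (hshift (R i))" unfolding E_def c''_def n_def using expansion_shift[OF c' cz(2) R] by simp
      show "E i : expansions m c'' z" using R by (auto simp: E_def )
    qed
    define X where "X = expansion n c' z Q"
    have X: "X : bexpansions n c' z" using QR(1) by (auto simp: X_def)
    have shE: "expansion n c' z (hshift (R i) * hvar 0 ^ i) = (%x. c' 0 ^ i * E i x)" if "i < s" for i
    proof -
      have "hshift (R i) : germ (Suc n)" using QR(2) that bgerm_germ germ_shift by blast
      moreover have "hvar 0 ^ i : germ n" by (rule germ_power) (simp add: n_def)
      ultimately show ?thesis using expansion_times[OF c' cz(2)] E(1)[OF that] evp[OF c'] by simp
    qed
    have RS: "hshift (R i) * hvar 0 ^ i : germ (Suc n)" if "i < s" for i
      using QR(2) that bgerm_germ germ_shift by (intro germ_mult germ_power) auto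
    have main: "expansion n c' z h x = ev d c' * X x + (SUM i<s. c' 0 ^ i * E i x)" for x
    proof -
      have Qd: "Q * d : germ (Suc n)" using QR(1) dS bgerm_germ germ_mult by blast
      have "expansion n c' z h x = expansion n c' z (Q * d) x + expansion n c' z (SUM i<s. hshift (R i) * hvar 0 ^ i) x"
        by (subst QR(3), subst expansion_add(1)[OF c' cz(2) Qd]) (auto intro!: germ_sum RS)
      also have "expansion n c' z (Q * d) x = ev d c' * X x"
        using expansion_times[OF c' cz(2) bgerm_germ[OF QR(1)] bgerm_germ[OF d]] by (simp add: X_def)
      also have "expansion n c' z (SUM i<s. hshift (R i) * hvar 0 ^ i) x = (SUM i<s. c' 0 ^ i * E i x)"
        by (subst expansion_sum[OF c' cz(2) RS]) (simp_all add: shE)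
      finally show ?thesis .
    qed
    have "insert (%_. 0) (E ` {..<s}) <= expansions m c'' z"
      using E(2) germ_expansions(1)[OF c'' cz(2)] by blast
    then obtain N H where NH: "!!G. G : insert (%_. 0) (E ` {..<s}) ==> spanning m c'' z N H G"
      using spanning_set[OF c'' cz(2) Suc.IH[OF c'' cz(2)], of "insert (%_. 0) (E ` {..<s})"] by blast
    have H: "H j : bexpansions n c' z" if "j < N" for j
    proof -
      have "H j : bexpansions m c'' z" using NH[of "%_. 0"] that by (simp add: spanning_def)
      then obtain r where r: "r : bgerm (Suc m)" "H j = expansion m c'' z r" by (auto simp:)
      hence "H j = expansion n c' z (hshift r)" unfolding c''_def n_def using expansion_shift[OF c' cz(2) bgerm_germ] by simp
      thus ?thesis using r bgerm_closed(10)[OF r(1)] by (auto simp: n_def)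
    qed
    have EH: "E i x = (SUM j<N. E i (Some j) * H j x)" if "i < s" for i x
      using NH[of "E i"] that unfolding spanning_def by blast
    define G2 where "G2 = expansion n c' z h"
    \<comment> \<open>The coefficients of the remainder polynomial are those of \<open>h\<close>
      minus multiples of \<open>d\<close>. Substituting this moves the multiples of \<open>d\<close>
      into the multiplier of the \<open>k\<close>-th coefficient.\<close>
    define Y where "Y = (%x. X x - (SUM j<N. X (Some j) * H j x))"
    have Y: "Y : bexpansions n c' z"
    proof -
      have "(%x. SUM j<N. X (Some j) * H j x) : bexpansions n c' z"
        by (rule bgerm_expansions(5)[OF c' cz(2)]) (rule bgerm_expansions(4)[OF c' cz(2) X H])
      thus ?thesis unfolding Y_def using bgerm_expansions(3)[OF c' cz(2)] X by blast
    qed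
    have G2k: "G2 (Some k) = ev d c'" by (simp add: G2_def expansion_def d_def)
    have G2x: "G2 x = G2 (Some k) * Y x + (SUM j<N. G2 (Some j) * H j x)" for x
    proof -
      have "(SUM i<s. c' 0 ^ i * E i x) = (SUM i<s. SUM j<N. c' 0 ^ i * (E i (Some j) * H j x))"
        by (rule sum.cong) (use EH in "auto simp: sum_distrib_left")
      also have "... = (SUM j<N. (SUM i<s. c' 0 ^ i * E i (Some j)) * H j x)"
        by (subst sum.swap) (simp add: sum_distrib_right mult.assoc)
      also have "... = (SUM j<N. (G2 (Some j) - ev d c' * X (Some j)) * H j x)" unfolding G2_def main by simp
      also have "... = (SUM j<N. G2 (Some j) * H j x) - ev d c' * (SUM j<N. X (Some j) * H j x)"
        by (simp add: left_diff_distrib sum_subtractf sum_distrib_left mult.assoc)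
      finally show ?thesis using main[of x] unfolding G2k Y_def by (simp add: G2_def right_diff_distrib)
    qed
    define N' where "N' = max N (Suc k)"
    define H' where "H' = (%j x. (if j < N then H j x else 0) + (if j = k then Y x else 0))"
    have "H' j : bexpansions n c' z" for j
    proof -
      have "(%x. if j < N then H j x else 0) : bexpansions n c' z" "(%x. if j = k then Y x else 0) : bexpansions n c' z"
        using H[of j] Y bgerm_expansions(1)[OF c' cz(2), of n] by (cases "j < N"; cases "j = k"; simp)+
      thus ?thesis unfolding H'_def by (rule bgerm_expansions(2)[OF c' cz(2)])
    qed
    moreover have "ALL i<n. g' i : bgerm n & res (g' i) = 0 & c' i = ev (g' i) c" using gb(2) by (simp add: c'_def)
    hence "bexpansions n c' z <= bexpansions n c z" by (rule bexpansions_substitute[OF c' cz])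
    moreover have "G2 x = (SUM j<N'. G2 (Some j) * H' j x)" for x
    proof -
      have "(SUM j<N'. G2 (Some j) * H' j x) = (SUM j<N. G2 (Some j) * H j x) + (SUM j<N'. G2 (Some j) * (if j = k then Y x else 0))"
        unfolding H'_def distrib_left sum.distrib by (simp only: sum_pad N'_def max.cobounded1)
      also have "(SUM j<N'. G2 (Some j) * (if j = k then Y x else 0)) = (SUM j<N'. if j = k then G2 (Some k) * Y x else 0)"
        by (rule sum.cong) auto
      also have "... = G2 (Some k) * Y x" by (simp add: N'_def)
      finally show ?thesis by (subst G2x) (simp only: add.commute)
    qed
    ultimately have "spanning n c z N' H' G2" unfolding spanning_def by blast
    hence "spanning n c z N' H' G" by (rule spanning_scale) (simp add: f(2) Gu G1 G2_def)
    thus ?thesis unfolding n_def by blast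
  qed (use spanning_zero[OF cz] f n_def in blast)
qed

section \<open>Weierstrass polynomials in one new element\<close>

lemma range_upd: "range b <= A ==> A <= inf ==> z : inf ==> range (b(n := z)) <= inf" by auto

lemma range_case_insert: "range b <= A ==> range (case_nat z b) <= insert z A" by (force split: nat.splits)

lemma range_case: "range b <= A ==> A <= inf ==> z : inf ==> range (case_nat z b) <= inf"
  using range_case_insert[of b A z] by auto

lemma ev_polynomial:
  assumes e: "range e <= inf" and R: "ALL i<s. R i : germ n"
  shows "(SUM i<s. hshift (R i) * hvar 0 ^ i) : germ (Suc n)"
    "ev (SUM i<s. hshift (R i) * hvar 0 ^ i) e = (SUM i<s. ev (R i) (%i. e (Suc i)) * e 0 ^ i)"
proof -
  have v: "(hvar 0 :: 'w series) : germ (Suc n)" by simp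
  have g: "hshift (R i) * hvar 0 ^ i : germ (Suc n)" if "i < s" for i
    using germ_mult[OF germ_shift germ_power[OF v]] R that by blast
  thus "(SUM i<s. hshift (R i) * hvar 0 ^ i) : germ (Suc n)" by (intro germ_sum) auto
  have "ev (hshift (R i) * hvar 0 ^ i) e = ev (R i) (%i. e (Suc i)) * e 0 ^ i" if "i < s" for i
  proof -
    have Ri: "R i : germ n" using R that by blast
    show ?thesis using ev_mult[OF germ_shift[OF Ri] germ_power[OF v] e] ev_shift[OF Ri e] ev_power[OF v e] ev_var[OF e] by simp
  qed
  thus "ev (SUM i<s. hshift (R i) * hvar 0 ^ i) e = (SUM i<s. ev (R i) (%i. e (Suc i)) * e 0 ^ i)"
    by (subst ev_sum[of _ _ "Suc n"]) (use e g in auto)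
qed

text \<open>The \<open>p i\<close> are values of germs with residue 0, whose arguments are appended
  to \<open>b\<close>. In the top slice of \<open>F\<close> the pure powers of the variable 0 below
  \<open>s\<close> therefore vanish and the \<open>s\<close>-th has coefficient
  \<open>res f\<close>, so \<open>F\<close> is regular of degree exactly \<open>s\<close>.\<close>

lemma front_polynomial:
  assumes A: "A <= inf" "0 : A" and z: "z : inf" and p: "ALL i<s. p i : gen0 A"
    and f: "f : bgerm (Suc n)" "range b <= A" "res f ~= 0"
  obtains M d F where "n <= M" "range d <= A" "F : bgerm (Suc M)" "mps_regular s (hahn_coeff F 0)"
    "ev F (case_nat z d) = (SUM i<s. p i * z ^ i) + z ^ s * ev f (case_nat z b)"
    "!!g. g : germ (Suc n) ==> ev g (case_nat z d) = ev g (case_nat z b)"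
proof -
  have "ALL i. EX N P a. i < s --> P : mgerm N & range a <= A & p i = ev P a"
    using p unfolding gen0_def by blast
  then obtain N P a where P: "!!i. i < s ==> P i : mgerm (N i) & range (a i) <= A & p i = ev (P i) (a i)" by metis
  have "ALL i<s. P i : germ (N i) & range (a i) <= A" using P bgerm_germ by (auto simp: mgerm_def)
  from common_point[OF A this] obtain m P' a' where a': "range a' <= A" and P1:
    "ALL i<s. P' i : germ m & ev (P' i) a' = ev (P i) (a i) &
      (P i : bgerm (N i) --> P' i : bgerm m) & res (P' i) = res (P i)" by blast
  define d where "d = (%i. if i < n then b i else a' (i - n))"
  have d: "range d <= A" using f(2) a' by (auto simp: d_def)
  have di: "range d <= inf" using d A by auto
  define R where "R = (%i. (hshift ^^ n) (P' i))"
  have R: "R i : bgerm (n + m)" "res (R i) = 0" "ev (R i) d = p i" if "i < s" for i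
  proof -
    have P': "P' i : bgerm m" "res (P' i) = 0" "ev (P' i) a' = p i" using P1 P that by (auto simp: mgerm_def)
    show "R i : bgerm (n + m)" "res (R i) = 0" using P' by (simp_all add: R_def bgerm_shiftn hshiftn_simps)
    show "ev (R i) d = p i" using ev_shiftn[OF bgerm_germ[OF P'(1)] di, of n] P'(3) by (simp add: R_def d_def)
  qed
  have e: "range (case_nat z d) <= inf" by (rule range_case[OF d A(1) z])
  have eq: "ev g (case_nat z d) = ev g (case_nat z b)" if "g : germ (Suc n)" for g
    by (rule ev_cong[OF that e range_case[OF f(2) A(1) z]]) (auto simp: d_def split: nat.splits)
  have fM: "f : bgerm (Suc (n + m))" using f(1) bgerm_mono[of "Suc n" "Suc (n + m)"] by simp
  have v: "(hvar 0 :: 'w series) : bgerm (Suc (n + m))" by (rule bgerm_closed) simp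
  have vf: "hvar 0 ^ s * f : bgerm (Suc (n + m))" by (intro bgerm_closed v fM)
  define F where "F = (SUM i<s. hshift (R i) * hvar 0 ^ i) + hvar 0 ^ s * f"
  have "F : bgerm (Suc (n + m))" unfolding F_def
    by (intro bgerm_closed(5) vf bgerm_sum) (use R(1) in "auto intro!: bgerm_closed")
  moreover have "mps_coeff (hahn_coeff F 0) (single 0 j) = (if j < s then 0 else mps_coeff (hahn_coeff f 0) (single 0 (j - s)))" for j
  proof -
    have "mps_coeff (hahn_coeff (hshift (R i) * hvar 0 ^ i) 0) (single 0 j) = 0" if "i < s" for i
      using coeff_shift_power[of "R i" i j] R[OF that] by (simp add: bgerm_def)
    moreover have "hahn_coeff (hvar 0 ^ s * f) 0 = mps_var 0 ^ s * hahn_coeff f 0"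
      using integral_series_times(2)[OF bgerm_integral[OF bgerm_closed(9)[OF v]] bgerm_integral[OF fM]] by (simp add: coeff_hvar_power)
    moreover have "mps_coeff (mps_var 0 ^ s * hahn_coeff f 0) (single 0 j)
      = (SUM l<=j. if l = s then mps_coeff (hahn_coeff f 0) (single 0 (j - l)) else 0)"
      unfolding mps_coeff_times_single by (rule sum.cong) (auto simp: mps_var_power single_eq_iff)
    ultimately show ?thesis by (simp add: F_def hahn_coeff_sum mps_coeff_sum)
  qed
  hence "mps_regular s (hahn_coeff F 0)" using f(3) by (simp add: mps_regular_def res_def)
  moreover have "ev F (case_nat z d) = (SUM i<s. p i * z ^ i) + z ^ s * ev f (case_nat z b)"
  proof -
    have "ALL i<s. R i : germ (n + m)" using R bgerm_germ by blast
    note P = ev_polynomial[OF e this]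
    show ?thesis unfolding F_def
      using ev_add[OF P(1) bgerm_germ[OF vf] e] ev_mult[OF bgerm_germ[OF bgerm_closed(9)[OF v]] bgerm_germ[OF fM] e]
        ev_power[OF bgerm_germ[OF v] e] ev_var[OF e] P(2) eq[OF bgerm_germ[OF f(1)]] R(3) by simp
  qed
  ultimately show ?thesis by (rule that[OF _ d _ _ _ eq, rotated]) simp_all
qed

text \<open>The monic equation makes \<open>z\<close> a zero of a germ \<open>D\<close> that is
  regular of degree \<open>s\<close>. Dividing a germ by \<open>D\<close> replaces its value at
  \<open>z\<close> by that of the remainder, a polynomial of degree below \<open>s\<close>.\<close>

lemma monic_elimination:
  assumes A: "A <= inf" "0 : A" and z: "z : inf" and p: "ALL i<s. p i : gen0 A"
    and zs: "z ^ s = (SUM i<s. p i * z ^ i)" and u: "u : gen (insert z A)"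
  shows "EX q. (ALL i<s. q i : gen A) & u = (SUM i<s. q i * z ^ i)"
proof -
  obtain k g a where "g : germ k" "range a <= insert z A" "u = ev g a" using u unfolding gen_def by blast
  from gen_insert(2)[OF A z this(1,2)] this(3)
  obtain n f b where f: "f : germ (Suc n)" "range b <= A" "u = ev f (case_nat z b)" by metis
  have p': "ALL i<s. - p i : gen0 A" using p gen0_uminus[OF A] by blast
  obtain M d D where D: "n <= M" "range d <= A" "D : bgerm (Suc M)" "mps_regular s (hahn_coeff D 0)"
    "ev D (case_nat z d) = (SUM i<s. - p i * z ^ i) + z ^ s * ev 1 (case_nat z b)"
    "ev f (case_nat z d) = ev f (case_nat z b)"
    by (rule front_polynomial[OF A z p' bgerm_closed(3)[of "Suc n"] f(2)]) (use f(1) in auto)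
  have e: "range (case_nat z d) <= inf" by (rule range_case[OF D(2) A(1) z])
  have D0: "ev D (case_nat z d) = 0" using D(5) zs ev_one[OF range_case[OF f(2) A(1) z]] by (simp add: sum_negf)
  have fM: "f : germ (Suc M)" using f(1) germ_mono[of "Suc n" "Suc M"] D(1) by simp
  obtain Q R where QR: "Q : germ (Suc M)" "ALL i<s. R i : germ M" "f = Q * D + (SUM i<s. hshift (R i) * hvar 0 ^ i)"
    using germ_division[OF D(3) _ D(4) fM] by auto
  note P = ev_polynomial[OF e QR(2)]
  have "u = ev (Q * D + (SUM i<s. hshift (R i) * hvar 0 ^ i)) (case_nat z d)" using f(3) D(6) QR(3) by simp
  hence "u = (SUM i<s. ev (R i) d * z ^ i)"
    using ev_add[OF germ_mult[OF QR(1) bgerm_germ[OF D(3)]] P(1) e] ev_mult[OF QR(1) bgerm_germ[OF D(3)] e] D0 P(2) by simp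
  moreover have "ALL i<s. ev (R i) d : gen A" using QR(2) D(2) unfolding gen_def by blast
  ultimately show ?thesis by (intro exI[of _ "%i. ev (R i) d"]) simp
qed

text \<open>By Weierstrass preparation these are the values at \<open>z\<close> of the series over \<open>A\<close> that are regular of degree \<open>s\<close>.\<close>

definition regular :: "'p set => 'p => nat => 'p set" where
  "regular A z s = {(kc r + w) * (z ^ s + (SUM i<s. a i * z ^ i)) |r w a. r ~= 0 & w : gen0 (insert z A) & (ALL i<s. a i : gen0 A)}"

lemma regularE:
  assumes "u : regular A z s"
  obtains r w a where "r ~= 0" "w : gen0 (insert z A)" "ALL i<s. a i : gen0 A" "u = (kc r + w) * (z ^ s + (SUM i<s. a i * z ^ i))"
  using assms unfolding regular_def by blast

lemma regular_mono: "A <= A' ==> regular A z s <= regular A' z s"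
  using gen0_mono[of "insert z A" "insert z A'"] gen0_mono[of A A'] unfolding regular_def by blast

lemma regular_gen1: "A <= inf ==> 0 : A ==> z : inf ==> regular A z s <= gen1 (insert z A)"
proof
  fix u assume A: "A <= inf" "0 : A" "z : inf" and u: "u : regular A z s"
  have A': "insert z A <= inf" "0 : insert z A" "gen0 A <= gen1 (insert z A)" "z : gen1 (insert z A)"
    using A gen0_mono[of A "insert z A"] gen0_gen1 gen0_incl[of "insert z A"] by auto
  obtain r w a where p: "w : gen0 (insert z A)" "ALL i<s. a i : gen0 A" "u = (kc r + w) * (z ^ s + (SUM i<s. a i * z ^ i))"
    using u by (rule regularE)
  show "u : gen1 (insert z A)" unfolding p(3)
    by (intro gen_closed(3,4)[OF A'(1,2)] gen_kc[OF A'(1,2)] gen0_gen1[OF p(1)] gen1_power[OF A'(1,2,4)] gen1_sum[OF A'(1,2)])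
      (use p(2) A'(3) in auto)
qed

text \<open>Preparation, evaluated: \<open>Q * h\<close> becomes a Weierstrass polynomial in
  \<open>z\<close>, and the inverse of the unit \<open>Q\<close> is the factor in front.\<close>

lemma regular_germ:
  assumes A: "A <= inf" "0 : A" and z: "z : inf" and h: "h : bgerm (Suc n)" "range b <= A" "mps_regular s (hahn_coeff h 0)"
  shows "ev h (case_nat z b) : regular A z s"
proof -
  let ?e = "case_nat z b"
  have e: "range ?e <= inf" by (rule range_case[OF h(2) A(1) z])
  obtain Q R where QR: "Q : bgerm (Suc n)" "res Q ~= 0" "ALL i<s. R i : bgerm n & res (R i) = 0"
    "hvar 0 ^ s = Q * h + (SUM i<s. hshift (R i) * hvar 0 ^ i)" using germ_Weierstrass[OF h(1) _ h(3)] by auto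
  have "ALL i<s. R i : germ n" using QR(3) bgerm_germ by blast
  note P = ev_polynomial[OF e this]
  have v: "(hvar 0 :: 'w series) : germ (Suc n)" by simp
  note Qh = bgerm_germ[OF QR(1)] bgerm_germ[OF h(1)]
  have "z ^ s = ev (hvar 0 ^ s) ?e" using ev_power[OF v e] by (simp add: ev_var[OF e])
  hence main: "ev Q ?e * ev h ?e = z ^ s + (SUM i<s. - ev (R i) b * z ^ i)" unfolding QR(4)
    using ev_add[OF germ_mult[OF Qh] P(1) e] ev_mult[OF Qh e] P(2) by (simp add: sum_negf)
  have A': "insert z A <= inf" "0 : insert z A" using A z by auto
  have "Q - hconst (res Q) : mgerm (Suc n)" using QR(1) by (simp add: mgerm_def bgerm_closed)
  hence q: "ev (Q - hconst (res Q)) ?e : gen0 (insert z A)" unfolding gen0_def using range_case_insert[OF h(2), of z] by blast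
  have "ev Q ?e = kc (res Q) + ev (Q - hconst (res Q)) ?e"
    using ev_minus[OF bgerm_germ[OF QR(1)] germ_const e] ev_const[OF e] by simp
  then obtain w where w: "w : gen0 (insert z A)" "ev Q ?e * (kc (1 / res Q) + w) = 1"
    using gen1_unit[OF A' q QR(2)] by metis
  have "ev h ?e = (ev Q ?e * (kc (1 / res Q) + w)) * ev h ?e" using w(2) by simp
  also have "... = (kc (1 / res Q) + w) * (ev Q ?e * ev h ?e)" by (simp only: mult_ac)
  finally have "ev h ?e = (kc (1 / res Q) + w) * (z ^ s + (SUM i<s. - ev (R i) b * z ^ i))" unfolding main .
  moreover have "- ev (R i) b : gen0 A" if "i < s" for i
    using gen0_uminus[OF A, of "ev (R i) b"] QR(3) that h(2) unfolding gen0_def mgerm_def by blast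
  ultimately show ?thesis unfolding regular_def using w(1) QR(2)
    by (intro CollectI exI[of _ "1 / res Q"] exI[of _ w] exI[of _ "%i. - ev (R i) b"]) auto
qed

text \<open>Here the factor of \<open>z ^ s\<close> still depends on \<open>z\<close>; preparation
  turns the expression into a monic polynomial times a unit.\<close>

lemma regularI:
  assumes A: "A <= inf" "0 : A" and z: "z : inf" and p: "ALL i<s. p i : gen0 A" and r: "r ~= 0" and w: "w : gen0 (insert z A)"
  shows "(SUM i<s. p i * z ^ i) + z ^ s * (kc r + w) : regular A z s"
proof -
  obtain k g a where g: "g : mgerm k" "range a <= insert z A" "w = ev g a" using w unfolding gen0_def by blast
  let ?g = "hconst r + g"
  have g': "?g : bgerm k" "res ?g = r" using g(1) by (auto simp: mgerm_def bgerm_closed)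
  have a: "range a <= inf" using g(2) A z by auto
  have evg: "ev ?g a = kc r + w" using ev_add[OF _ _ a, of "hconst r" k g] g(1,3) by (simp add: mgerm_def bgerm_germ ev_const[OF a])
  from gen_insert(2)[OF A z bgerm_germ[OF g'(1)] g(2)]
  obtain f b where f: "f : bgerm (Suc k)" "range b <= A" "res f ~= 0" "ev ?g a = ev f (case_nat z b)" using g' r by metis
  show ?thesis
  proof (rule front_polynomial[OF A z p f(1-3)])
    fix M d F assume "range d <= A" "F : bgerm (Suc M)" "mps_regular s (hahn_coeff F 0)"
      "ev F (case_nat z d) = (SUM i<s. p i * z ^ i) + z ^ s * ev f (case_nat z b)"
    thus ?thesis using regular_germ[OF A z, of F M d s] evg f(4) by simp
  qed
qed

lemma gen1_split:
  assumes A: "A <= inf" "0 : A" and z: "z : inf" and u: "u : gen1 (insert z A)"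
  shows "EX b:gen1 A. EX v:gen1 (insert z A). u = b + z * v"
proof -
  obtain n h b where h: "h : bgerm (Suc n)" "range b <= A" "u = ev h (case_nat z b)" using gen1_insert[OF assms] .
  let ?v = "hvar 0 :: 'w series" and ?e = "case_nat z b"
  have v: "?v : bgerm (Suc n)" by (rule bgerm_closed) simp
  have "mps_regular 1 (hahn_coeff ?v 0)" by (auto simp: mps_regular_def mps_var.rep_eq single_eq_iff single_Suc_neq_0[symmetric] dest: sym)
  then obtain Q R where QR: "Q : bgerm (Suc n)" "R : bgerm n" "h = Q * ?v + hshift R"
    using germ_division[OF v _ _ bgerm_germ[OF h(1)], of 1] bgerm_integral[OF h(1)] by auto
  have e: "range ?e <= inf" by (rule range_case[OF h(2) A(1) z])
  note g = bgerm_germ[OF QR(1)] bgerm_germ[OF v] bgerm_germ[OF QR(2)]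
  have "u = ev Q ?e * z + ev R b" unfolding h(3) QR(3)
    using ev_add[OF germ_mult[OF g(1,2)] germ_shift[OF g(3)] e] ev_mult[OF g(1,2) e] ev_var[OF e, of 0] ev_shift[OF g(3) e] by simp
  moreover have "ev R b : gen1 A" unfolding gen1_def using QR(2) h(2) by blast
  moreover have "ev Q ?e : gen1 (insert z A)" unfolding gen1_def using QR(1) range_case_insert[OF h(2), of z] by blast
  ultimately show ?thesis by (intro bexI[of _ "ev R b"] bexI[of _ "ev Q ?e"]) (auto simp: mult_ac add_ac)
qed

lemma gen1_split_power:
  assumes A: "A <= inf" "0 : A" and z: "z : inf" and u: "u : gen1 (insert z A)"
  shows "EX b. EX v:gen1 (insert z A). (ALL i<s. b i : gen1 A) & u = (SUM i<s. b i * z ^ i) + z ^ s * v"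
proof (induction s)
  case 0
  thus ?case using u by auto
next
  case (Suc s)
  then obtain b v where b: "v : gen1 (insert z A)" "ALL i<s. b i : gen1 A" "u = (SUM i<s. b i * z ^ i) + z ^ s * v" by blast
  obtain c v' where c: "c : gen1 A" "v' : gen1 (insert z A)" "v = c + z * v'" using gen1_split[OF A z b(1)] by blast
  have "u = (SUM i<Suc s. (b(s := c)) i * z ^ i) + z ^ Suc s * v'" by (simp add: b(3) c(3) algebra_simps)
  thus ?case using b(2) c(1,2) by (intro exI[of _ "b(s := c)"] bexI[of _ v']) (auto simp: less_Suc_eq)
qed

text \<open>The perturbation has residue 0 and so preserves the degree of regularity. After division
  by the unit, \<open>y\<close> is expanded in \<open>z\<close> up to order \<open>s\<close>; its
  low coefficients times \<open>x\<close> go into the polynomial, its tail times \<open>x\<close>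
  into the factor of \<open>z ^ s\<close>.\<close>

lemma regular_perturb:
  assumes A: "A <= inf" "0 : A" and z: "z : inf" and u: "u : regular A z s"
    and x: "x : gen0 A" and y: "y : gen1 (insert z A)"
  shows "u + x * y : regular A z s"
proof -
  have A': "insert z A <= inf" "0 : insert z A" using A z by auto
  obtain r w a where p: "r ~= 0" "w : gen0 (insert z A)" "ALL i<s. a i : gen0 A" "u = (kc r + w) * (z ^ s + (SUM i<s. a i * z ^ i))"
    using u by (rule regularE)
  obtain w' where w': "w' : gen0 (insert z A)" "(kc r + w) * (kc (1 / r) + w') = 1" using gen1_unit[OF A' p(2,1)] by blast
  have "(kc (1 / r) + w') * y : gen1 (insert z A)" by (intro gen_closed(3,4)[OF A'] gen_kc[OF A'] gen0_gen1[OF w'(1)] y)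
  then obtain b v where b: "v : gen1 (insert z A)" "ALL i<s. b i : gen1 A" "(kc (1 / r) + w') * y = (SUM i<s. b i * z ^ i) + z ^ s * v"
    using gen1_split_power[OF A z] by blast
  have "ALL i<s. a i + b i * x : gen0 A" using p(3) b(2) x by (auto intro: gen_closed(5,6)[OF A])
  moreover have "v * x : gen0 (insert z A)" using gen_closed(6)[OF A' b(1)] x gen0_mono[of A "insert z A"] by blast
  ultimately have "(SUM i<s. (a i + b i * x) * z ^ i) + z ^ s * (kc 1 + v * x) : regular A z s" by (intro regularI[OF A z]) auto
  then obtain r2 w2 a2 where q: "r2 ~= 0" "w2 : gen0 (insert z A)" "ALL i<s. a2 i : gen0 A"
    "(SUM i<s. (a i + b i * x) * z ^ i) + z ^ s * (kc 1 + v * x) = (kc r2 + w2) * (z ^ s + (SUM i<s. a2 i * z ^ i))"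
    by (rule regularE)
  have "y = ((kc r + w) * (kc (1 / r) + w')) * y" using w'(2) by simp
  also have "... = (kc r + w) * ((SUM i<s. b i * z ^ i) + z ^ s * v)" by (simp only: mult.assoc b(3))
  finally have "u + x * y = (kc r + w) * ((z ^ s + (SUM i<s. a i * z ^ i)) + x * ((SUM i<s. b i * z ^ i) + z ^ s * v))"
    unfolding p(4) by (simp only: distrib_left mult.left_commute)
  also have "(z ^ s + (SUM i<s. a i * z ^ i)) + x * ((SUM i<s. b i * z ^ i) + z ^ s * v)
    = (SUM i<s. (a i + b i * x) * z ^ i) + z ^ s * (kc 1 + v * x)"
    by (simp add: kc_simps distrib_left distrib_right sum.distrib sum_distrib_left mult_ac add_ac)
  finally have "u + x * y = (kc (r * r2) + (kc r * w2 + kc r2 * w + w * w2)) * (z ^ s + (SUM i<s. a2 i * z ^ i))"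
    unfolding q(4) by (simp add: kc_simps algebra_simps)
  moreover have "kc r * w2 + kc r2 * w + w * w2 : gen0 (insert z A)"
    by (intro gen_closed(5,6)[OF A'] gen_kc[OF A'] gen0_gen1 p(2) q(2))
  ultimately show ?thesis unfolding regular_def using p(1) q(1,3)
    by (intro CollectI exI[of _ "r * r2"] exI[of _ "kc r * w2 + kc r2 * w + w * w2"] exI[of _ a2]) auto
qed

text \<open>The sign fits the later use with \<open>V = Z + W\<close>, where
  \<open>- (v * V) + W * v\<close> equals \<open>- (Z * v)\<close>.\<close>

lemma regular_shift:
  assumes A: "A <= inf" "0 : A" and z: "z : inf" and u: "u : regular A z s"
  shows "- (u * z) : regular A z (Suc s)"
proof -
  have A': "insert z A <= inf" "0 : insert z A" using A z by auto
  obtain r w a where p: "r ~= 0" "w : gen0 (insert z A)" "ALL i<s. a i : gen0 A" "u = (kc r + w) * (z ^ s + (SUM i<s. a i * z ^ i))"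
    using u by (rule regularE)
  have S: "(SUM i<Suc s. case_nat 0 a i * z ^ i) = (SUM i<s. a i * z ^ i) * z"
    by (simp only: sum.lessThan_Suc_shift) (simp add: sum_distrib_left mult_ac)
  have "- (u * z) = (kc (- r) + - w) * (z ^ Suc s + (SUM i<Suc s. case_nat 0 a i * z ^ i))"
    unfolding p(4) S by (simp add: kc_simps algebra_simps)
  moreover have "ALL i<Suc s. case_nat 0 a i : gen0 A" using p(3) gen0_0[OF A] by (auto split: nat.splits)
  ultimately show ?thesis unfolding regular_def using p(1) gen0_uminus[OF A' p(2)]
    by (intro CollectI exI[of _ "- r"] exI[of _ "- w"] exI[of _ "case_nat 0 a"]) auto
qed

section \<open>Dividing out a dominating coefficient\<close>

lemma hslice_swap:
  assumes "h : germ (Suc n)" "n <= m"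
  shows "hslice m k (hahn_map (mps_permute (transposition n m)) h) = hslice n k h"
  using mps_slice_permute_swap[OF in_vars_germ[OF assms(1)] assms(2)]
  by (intro hahn_eqI) (simp add: hslice_def hahn_coeff_map mps_slice_add)

lemma bgerm_swap:
  assumes h: "h : bgerm (Suc n)" and nm: "n <= m"
  shows "hahn_map (mps_permute (transposition n m)) h : bgerm (Suc m)"
    "range a <= inf ==> range b <= inf ==> ALL i<n. a i = b i ==> a m = b n ==>
      ev (hahn_map (mps_permute (transposition n m)) h) a = ev h b"
proof -
  have hm: "h : bgerm (Suc m)" using h nm bgerm_mono[of "Suc n" "Suc m"] by simp
  have \<pi>: "transposition n m permutes {..<Suc m}" by (rule permutes_swap_id) (use nm in auto)
  show "hahn_map (mps_permute (transposition n m)) h : bgerm (Suc m)"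
    using germ_permute[OF bgerm_germ[OF hm] \<pi>] integral_series_map[of h "mps_permute (transposition n m)"] bgerm_integral[OF hm]
    by (simp add: bgerm_def)
  assume a: "range a <= inf" "range b <= inf" "ALL i<n. a i = b i" "a m = b n"
  have "ev (hahn_map (mps_permute (transposition n m)) h) a = ev h (%i. a (transposition n m i))"
    by (rule ev_permute[OF bgerm_germ[OF hm] a(1) \<pi>])
  also have "... = ev h b"
    by (rule ev_cong[OF bgerm_germ[OF h]]) (use a nm in "auto simp: Transposition.transpose_def less_Suc_eq")
  finally show "ev (hahn_map (mps_permute (transposition n m)) h) a = ev h b" .
qed

text \<open>Regularity refers to the variable 0, whereas \<open>z\<close> is the last variable here.
  A cycle brings it to the front; the pure powers of that variable have the residues of the slices
  as coefficients.\<close>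

lemma regular_hslice:
  assumes A: "A <= inf" "0 : A" and z: "z : inf" and h: "h : bgerm (Suc n)" "range b <= A"
    and reg: "res (hslice n s h) ~= 0" "ALL k<s. res (hslice n k h) = 0"
  shows "ev h (b(n := z)) : regular A z s"
proof -
  obtain \<pi> where \<pi>: "\<pi> permutes {..<Suc n}" "!!i. i < n ==> \<pi> i = Suc i" "\<pi> n = 0"
    using shift_permutation[of n] by metis
  define h' where "h' = hahn_map (mps_permute \<pi>) h"
  have e: "range (case_nat z b) <= inf" by (rule range_case[OF h(2) A(1) z])
  have h': "h' : bgerm (Suc n)" unfolding h'_def bgerm_def
    using germ_permute[OF bgerm_germ[OF h(1)] \<pi>(1)] integral_series_map[of h "mps_permute \<pi>"] bgerm_integral[OF h(1)] by simp
  have "ev h' (case_nat z b) = ev h (%i. case_nat z b (\<pi> i))" unfolding h'_def by (rule ev_permute[OF bgerm_germ[OF h(1)] e \<pi>(1)])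
  also have "... = ev h (b(n := z))"
    by (rule ev_cong[OF bgerm_germ[OF h(1)] _ range_upd[OF h(2) A(1) z]]) (use e \<pi> in "auto simp: less_Suc_eq split: nat.splits")
  finally have evh: "ev h' (case_nat z b) = ev h (b(n := z))" .
  have "map_key \<pi> (single 0 k) = single n k" for k :: nat
  proof (rule poly_mapping_eqI)
    fix i
    have "\<pi> i = 0 \<longleftrightarrow> i = n" using permutes_inj[OF \<pi>(1)] \<pi>(3) by (metis injD)
    thus "lookup (map_key \<pi> (single 0 k)) i = lookup (single n k) i"
      using permutes_inj[OF \<pi>(1)] by (auto simp: lookup_map_key lookup_single when_def)
  qed
  hence "mps_coeff (hahn_coeff h' 0) (single 0 k) = res (hslice n k h)" for k
    by (simp add: h'_def hahn_coeff_map mps_permute.rep_eq hslice_simps)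
  hence "mps_regular s (hahn_coeff h' 0)" using reg by (simp add: mps_regular_def)
  from regular_germ[OF A z h' h(2) this] show ?thesis unfolding evh .
qed

text \<open>\<open>alpha j\<close> are the coefficients of \<open>u\<close> as a series in \<open>z\<close>. If one of them divides the others, dividing by it
  leaves a series one of whose coefficients is \<open>1\<close>, which is therefore regular.\<close>

lemma strong_noetherian:
  assumes A: "A <= inf" "0 : A" and z: "z : inf" and one: "1 ~: inf" and u: "u : gen (insert z A)"
    and dom: "!!(N :: nat) alpha. (ALL j<N. alpha j : gen A) ==> (ALL j<N. alpha j = 0) |
      (EX i<N. alpha i ~= 0 & (ALL x. alpha i * x = alpha i --> x = 1) & (ALL j<N. EX r. EX eta:A. alpha j = alpha i * (kc r + eta)))"
  shows "u = 0 | (EX alpha:gen A. alpha ~= 0 & (EX s. EX v:regular A z s. u = alpha * v))"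
proof -
  obtain m g a where "g : germ m" "range a <= insert z A" "u = ev g a" using u unfolding gen_def by blast
  from gen_insert(1)[OF A z this(1,2)] this(3)
  obtain n f c where f: "f : germ (Suc n)" "range c <= A" "u = ev f (c(n := z))" by metis
  have ci: "range c <= inf" using f(2) A by auto
  have "expansion n c z f : expansions n c z" using f(1) by blast
  then obtain N H where NH: "spanning n c z N H (expansion n c z f)" using spanning_exists[OF ci z] by blast
  define alpha where "alpha = (%j. ev (hslice n j f) c)"
  have alphaA: "alpha j : gen A" for j unfolding alpha_def gen_def using hslice_germ[OF f(1)] f(2) by blast
  have alphaE: "expansion n c z f (Some j) = alpha j" for j by (simp add: expansion_def alpha_def)
  have "ALL j. EX h. j < N --> h : bgerm (Suc n) & H j = expansion n c z h"
    using NH by (auto simp: spanning_def image_iff)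
  then obtain h where h: "!!j. j < N ==> h j : bgerm (Suc n) & H j = expansion n c z (h j)" by metis
  have span: "expansion n c z f x = (SUM j<N. alpha j * expansion n c z (h j) x)" for x
  proof -
    have "expansion n c z f x = (SUM j<N. expansion n c z f (Some j) * H j x)" using NH unfolding spanning_def by blast
    also have "... = (SUM j<N. alpha j * expansion n c z (h j) x)" by (rule sum.cong) (use h in "auto simp: alphaE")
    finally show ?thesis .
  qed
  have uN: "u = (SUM j<N. alpha j * ev (h j) (c(n := z)))" using span[of None] by (simp add: expansion_def f(3))
  have alphaN: "alpha k = (SUM j<N. alpha j * ev (hslice n k (h j)) c)" for k
    using span[of "Some k"] by (simp add: expansion_def alpha_def)
  consider "ALL j<N. alpha j = 0" | i where "i < N" "alpha i ~= 0" "ALL x. alpha i * x = alpha i --> x = 1" "ALL j<N. EX r. EX eta:A. alpha j = alpha i * (kc r + eta)"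
    using dom[of N alpha] alphaA by blast
  thus ?thesis
  proof cases
    case 1
    thus ?thesis using uN by simp
  next
    case 2
    have "ALL j. EX r eta. j < N --> eta : A & alpha j = alpha i * (kc r + eta)" using 2(4) by blast
    then obtain r eta where r: "!!j. j < N ==> eta j : A & alpha j = alpha i * (kc (r j) + eta j)" by metis
    \<comment> \<open>The quotient of \<open>alpha j\<close> by \<open>alpha i\<close> is
      \<open>kc (r j) + eta j\<close>. The elements \<open>eta j\<close> become \<open>N\<close>
      additional variables between the old ones and \<open>z\<close>, so that this quotient is the
      value of the germ \<open>g j\<close>.\<close>
    define M where "M = n + N"
    define b where "b = (%j. if j < n then c j else if j < M then eta (j - n) else 0)"
    have bA: "range b <= A" using f(2) r A(2) by (auto simp: b_def M_def)
    have bi: "range b <= inf" using bA A by auto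
    have bz: "range (b(M := z)) <= inf" by (rule range_upd[OF bA A(1) z])
    have cz: "range (c(n := z)) <= inf" by (rule range_upd[OF f(2) A(1) z])
    have nM: "n <= M" by (simp add: M_def)
    define h' where "h' = (%j. hahn_map (mps_permute (transposition n M)) (h j))"
    define g where "g = (%j. hconst (r j) + hvar (n + j) :: 'w series)"
    have h': "h' j : bgerm (Suc M)" "ev (h' j) (b(M := z)) = ev (h j) (c(n := z))" "hslice M k (h' j) = hslice n k (h j)"
      if "j < N" for j k
    proof -
      have hj: "h j : bgerm (Suc n)" using h[OF that] by simp
      show "h' j : bgerm (Suc M)" unfolding h'_def by (rule bgerm_swap(1)[OF hj nM])
      show "ev (h' j) (b(M := z)) = ev (h j) (c(n := z))" unfolding h'_def
        by (rule bgerm_swap(2)[OF hj nM bz cz]) (auto simp: b_def M_def)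
      show "hslice M k (h' j) = hslice n k (h j)" unfolding h'_def by (rule hslice_swap[OF bgerm_germ[OF hj] nM])
    qed
    have g: "g j : bgerm M" "ev (g j) (b(M := z)) = kc (r j) + eta j" "ev (g j) b = kc (r j) + eta j" if "j < N" for j
    proof -
      have v: "(hvar (n + j) :: 'w series) : bgerm M" by (rule bgerm_closed) (use that in "simp add: M_def")
      show "g j : bgerm M" unfolding g_def by (intro bgerm_closed v)
      show "ev (g j) (b(M := z)) = kc (r j) + eta j" "ev (g j) b = kc (r j) + eta j"
        unfolding g_def using ev_add[OF germ_const bgerm_germ[OF v]] bz bi that
        by (simp_all add: ev_const ev_var b_def M_def)
    qed
    have gS: "g j : bgerm (Suc M)" if "j < N" for j using g(1)[OF that] bgerm_mono[of M "Suc M"] by simp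
    define F where "F = (SUM j<N. h' j * g j)"
    have hg: "h' j * g j : bgerm (Suc M)" if "j < N" for j by (rule bgerm_closed(7)[OF h'(1)[OF that] gS[OF that]])
    have F: "F : bgerm (Suc M)" unfolding F_def by (rule bgerm_sum) (use hg in auto)
    have evF: "ev F (b(M := z)) = (SUM j<N. (kc (r j) + eta j) * ev (h j) (c(n := z)))"
    proof -
      have "ev F (b(M := z)) = (SUM j<N. ev (h' j * g j) (b(M := z)))"
        unfolding F_def by (rule ev_sum[of _ _ "Suc M"]) (use hg bgerm_germ bz in auto)
      also have "... = (SUM j<N. (kc (r j) + eta j) * ev (h j) (c(n := z)))"
      proof (rule sum.cong[OF refl])
        fix j assume "j : {..<N}"
        hence j: "j < N" by simp
        show "ev (h' j * g j) (b(M := z)) = (kc (r j) + eta j) * ev (h j) (c(n := z))"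
          using ev_mult[OF bgerm_germ[OF h'(1)[OF j]] bgerm_germ[OF gS[OF j]] bz] h'(2)[OF j] g(2)[OF j] by (simp only: mult.commute)
      qed
      finally show ?thesis .
    qed
    have evs: "ev (hslice M k F) b = (SUM j<N. (kc (r j) + eta j) * ev (hslice n k (h j)) c)" for k
    proof -
      have sl: "hslice M k (h' j * g j) = hslice n k (h j) * g j" if "j < N" for j
        using hslice_times[OF bgerm_germ[OF g(1)[OF that]]] h'(3)[OF that] by simp
      have hn: "hslice n k (h j) : germ n" if "j < N" for j using h[OF that] hslice_germ bgerm_germ by blast
      have hM: "hslice n k (h j) : germ M" if "j < N" for j using hn[OF that] germ_mono[OF nM] by blast
      have evc: "ev (hslice n k (h j)) b = ev (hslice n k (h j)) c" if "j < N" for j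
        by (rule ev_cong[OF hn[OF that] bi ci]) (simp add: b_def)
      have "ev (hslice M k F) b = ev (SUM j<N. hslice n k (h j) * g j) b"
        unfolding F_def hslice_sum by (rule arg_cong[of _ _ "%x. ev x b"], rule sum.cong) (use sl in auto)
      also have "... = (SUM j<N. ev (hslice n k (h j) * g j) b)"
        by (rule ev_sum[of _ _ M]) (use hM g(1) bgerm_germ germ_mult bi in auto)
      also have "... = (SUM j<N. (kc (r j) + eta j) * ev (hslice n k (h j)) c)"
      proof (rule sum.cong[OF refl])
        fix j assume "j : {..<N}"
        hence j: "j < N" by simp
        show "ev (hslice n k (h j) * g j) b = (kc (r j) + eta j) * ev (hslice n k (h j)) c"
          using ev_mult[OF hM[OF j] bgerm_germ[OF g(1)[OF j]] bi] evc[OF j] g(3)[OF j] by (simp only: mult.commute)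
      qed
      finally show ?thesis .
    qed
    have "alpha i * ev (hslice M i F) b = (SUM j<N. alpha j * ev (hslice n i (h j)) c)"
      unfolding evs sum_distrib_left by (rule sum.cong) (use r in "auto simp: mult.assoc[symmetric]")
    hence one': "ev (hslice M i F) b = 1" using 2(3) alphaN[of i] by metis
    have slF: "hslice M k F : bgerm M" for k by (rule hslice_bgerm[OF F])
    have "res (hslice M i F) ~= 0" using ev_inf[OF slF _ bi] one' one by metis
    define s where "s = (LEAST k. res (hslice M k F) ~= 0)"
    have "res (hslice M s F) ~= 0" "ALL k<s. res (hslice M k F) = 0"
      unfolding s_def using LeastI[of "%k. res (hslice M k F) ~= 0", OF `res (hslice M i F) ~= 0`] not_less_Least by blast+
    hence "ev F (b(M := z)) : regular A z s" by (intro regular_hslice[OF A z F bA]) auto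
    moreover have "u = alpha i * ev F (b(M := z))"
      unfolding evF uN sum_distrib_left by (rule sum.cong) (use r in "auto simp: mult.assoc[symmetric]")
    ultimately show ?thesis using 2(2) alphaA by blast
  qed
qed

end

section \<open>Germs at infinitesimals of a field with analytic structure\<close>

lift_definition mps_scale :: "real => real mps => real mps" is "%r f nu. r ^ mon_degree nu * f nu" .

lemma mon_degree_superset: "finite K ==> keys mu <= K ==> mon_degree mu = (SUM i:K. lookup mu i)"
  unfolding mon_degree_def by (rule sum.mono_neutral_left) (auto simp: in_keys_iff)

lemma mon_degree_add: "mon_degree (mu + nu) = mon_degree mu + mon_degree nu"
proof -
  let ?K = "keys mu Un keys nu"
  have "mon_degree (mu + nu) = (SUM i:?K. lookup (mu + nu) i)"
    by (rule mon_degree_superset) (auto simp: in_keys_add)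
  thus ?thesis
    by (simp add: mon_degree_superset[of ?K mu] mon_degree_superset[of ?K nu] lookup_add sum.distrib)
qed

lemma mon_degree_simps [simp]: "mon_degree 0 = 0" "mon_degree (single i k) = k"
  using mon_degree_superset[of "{i}" "single i k"] by (auto simp: mon_degree_def split: if_splits)

lemma mon_degree_map_key:
  assumes "bij \<pi>" shows "mon_degree (map_key \<pi> mu) = mon_degree mu"
proof -
  have inj: "inj \<pi>" using assms by (rule bij_is_inj)
  show ?thesis unfolding mon_degree_def by (rule sum.reindex_bij_witness[of _ "inv \<pi>" \<pi>])
       (auto simp: in_keys_iff lookup_map_key inj assms bij_is_surj surj_f_inv_f)
qed

lemma mps_scale_simps:
  "mps_scale r 0 = 0" "mps_scale r (f + g) = mps_scale r f + mps_scale r g"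
  "mps_scale r (f * g) = mps_scale r f * mps_scale r g" "mps_scale r (mps_scale s f) = mps_scale (r * s) f"
  "mps_scale r (mps_const c) = mps_const c" "mps_scale r (mps_var i) = mps_const r * mps_var i"
proof -
  show "mps_scale r (f * g) = mps_scale r f * mps_scale r g"
  proof (rule mps_eqI)
    fix nu
    have "r ^ mon_degree nu * (SUM (a, b) | a + b = nu. mps_coeff f a * mps_coeff g b)
      = (SUM (a, b) | a + b = nu. (r ^ mon_degree a * mps_coeff f a) * (r ^ mon_degree b * mps_coeff g b))"
      unfolding sum_distrib_left by (rule sum.cong) (auto simp: mon_degree_add power_add)
    thus "mps_coeff (mps_scale r (f * g)) nu = mps_coeff (mps_scale r f * mps_scale r g) nu"
      by (simp add: mps_scale.rep_eq mps_coeff_times)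
  qed
qed (rule mps_eqI; simp add: mps_scale.rep_eq algebra_simps power_mult_distrib; fail)+

lemma mps_scale_permute: "bij \<pi> ==> mps_scale r (mps_permute \<pi> f) = mps_permute \<pi> (mps_scale r f)"
  by (rule mps_eqI) (simp add: mps_scale.rep_eq mps_permute.rep_eq mon_degree_map_key)

lemma mps_scale_constant: "mps_in_vars 0 f ==> mps_scale r f = f"
proof (rule mps_eqI)
  fix nu assume f: "mps_in_vars 0 f"
  show "mps_coeff (mps_scale r f) nu = mps_coeff f nu"
  proof (cases "mps_coeff f nu = 0")
    case False
    hence "keys nu = {}" using f unfolding mps_in_vars_def by auto
    hence "nu = 0" by simp
    thus ?thesis by (simp add: mps_scale.rep_eq)
  qed (simp add: mps_scale.rep_eq)
qed

lemma mps_affine_eq_scale: "mps_affine r a f = mps_scale r (mps_affine 1 a f)"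
  by (rule mps_eqI) (simp add: mps_scale.rep_eq mps_affine_def Abs_mps_inverse)

text \<open>At the origin every monomial except the constant one vanishes, so the infinite sum
  defining a Taylor coefficient has one term. Rescaling thus is an instance of the affine
  axiom.\<close>

lemma mps_affine_origin:
  assumes f: "mps_in_vars n f"
  shows "mps_affine r (replicate n 0) f = mps_scale r f"
proof (rule mps_eqI)
  fix nu
  let ?a = "replicate n (0::real)" and ?g = "mps_deriv nu f"
  have "mps_coeff ?g mu * mon_eval ?a mu = 0" if nz: "mu ~= 0" for mu
  proof (cases "mps_coeff ?g mu = 0")
    case False
    hence "mps_coeff f (mu + nu) ~= 0" by (auto simp: mps_deriv.rep_eq)
    hence "keys (mu + nu) <= {..<n}" using f unfolding mps_in_vars_def by blast
    hence k: "keys mu <= {..<n}" by (simp add: in_keys_add)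
    obtain i where i: "i : keys mu" using nz keys_eq_empty[of mu] by blast
    hence "?a ! i ^ lookup mu i = 0" using i subsetD[OF k i] by (simp add: in_keys_iff)
    hence "mon_eval ?a mu = 0" unfolding mon_eval_def using i by (intro prod_zero) auto
    thus ?thesis by simp
  qed simp
  hence "mps_eval ?g ?a = (\<Sum>\<^sub>\<infinity>mu\<in>{0}. mps_coeff ?g mu * mon_eval ?a mu)"
    unfolding mps_eval_def by (intro infsum_cong_neutral) auto
  also have "... = mps_coeff ?g 0" by (simp add: mon_eval_def)
  also have "... = mon_fact nu * mps_coeff f nu" by (simp add: mps_deriv.rep_eq mon_fact_def)
  finally have "mps_eval ?g ?a = mon_fact nu * mps_coeff f nu" .
  moreover have "mon_fact nu ~= 0" by (simp add: mon_fact_def)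
  ultimately show "mps_coeff (mps_affine r ?a f) nu = mps_coeff (mps_scale r f) nu"
    by (simp add: mps_affine_def Abs_mps_inverse mps_scale.rep_eq mps_taylor_def)
qed

lemma affine_radius_scale: "a ~= [] ==> 0 < r ==> affine_radius alpha r a = affine_radius alpha 1 a / r"
proof -
  assume a: "a ~= []" and r: "0 < r"
  have m: "mono (%x::real. x / r)" using r by (intro monoI divide_right_mono) auto
  have "(%c. min ((alpha - c) / r) ((alpha + c) / r)) ` set a = (%x. x / r) ` (%c. min ((alpha - c) / 1) ((alpha + c) / 1)) ` set a"
    using r by (simp add: image_image min_divide_distrib_right)
  thus ?thesis unfolding affine_radius_def
    using mono_Min_commute[OF m, of "(%c. min ((alpha - c) / 1) ((alpha + c) / 1)) ` set a"] a by simp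
qed

section \<open>Infinitesimals, real numbers and standard parts\<close>

definition infinitesimals :: "'k::linordered_field set" where
  "infinitesimals = {x. ALL n. of_nat n * \<bar>x\<bar> <= 1}"

lemma infinite_inverse: "x ~: val_ring ==> inverse x : infinitesimals"
proof -
  assume "x ~: val_ring"
  hence gt: "of_nat n < \<bar>x\<bar>" for n by (auto simp: val_ring_iff not_le)
  have x: "0 < \<bar>x\<bar>" using gt[of 0] by simp
  have "of_nat n * \<bar>inverse x\<bar> <= 1" for n
    using gt[of n] x by (simp add: divide_inverse[symmetric] abs_inverse pos_divide_le_eq less_imp_le)
  thus ?thesis by (simp add: infinitesimals_def)
qed

lemma infinitesimals_val_ring: "x : infinitesimals ==> x : val_ring"
  unfolding val_ring_iff infinitesimals_def by (auto dest: spec[of _ 1] intro!: exI[of _ 1])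

locale analytic_weierstrass = real_weierstrass_system B + S: analytic_structure B e \<sigma>
  for B :: "nat => real => ('w::linordered_ab_group_add, real mps) hahn set"
    and e :: "'w series => 'k::linordered_field"
    and \<sigma> :: "nat => real => 'w series => 'k list => 'k"
begin

lemma germ0_eq: "germ 0 = B 0 1"
proof
  show "germ 0 <= B 0 1"
  proof
    fix f assume "f : germ 0"
    then obtain delta where "0 < delta" "f : B 0 delta" by (rule germE)
    thus "f : B 0 1" using B0[of delta 1] by simp
  qed
  show "B 0 1 <= germ 0" by (rule subsetI, rule germI[of 1]) auto
qed

definition er :: "real => 'k" where "er r = e (hconst r)"

lemma er_simps: "er (r + s) = er r + er s" "er (r * s) = er r * er s" "er 1 = 1" "er 0 = 0" "er (- r) = - er r"
  "er (r - s) = er r - er s" "er (of_nat n) = of_nat n"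
proof -
  have m: "hconst r : B 0 1" for r using germ_const[of r 0] by (simp add: germ0_eq)
  show add: "er (r + s) = er r + er s" for r s using S.e_add[OF m m] by (simp add: er_def hahn_single_add)
  show "er (r * s) = er r * er s" using S.e_mult[OF m m, of r s] by (simp add: er_def hahn_single_times)
  show one: "er 1 = 1" using S.e_one by (simp add: er_def hahn_single_zero_one)
  show zero: "er 0 = 0" using add[of 0 0] by simp
  show um: "er (- r) = - er r" for r using add[of r "- r"] zero by (simp add: eq_neg_iff_add_eq_0 add.commute)
  show "er (r - s) = er r - er s" using add[of r "- s"] um by simp
  show "er (of_nat n) = of_nat n" by (induction n) (simp_all add: zero add one)
qed

lemma er_nonzero: "r ~= 0 ==> er r ~= 0" using er_simps(2)[of r "1 / r"] er_simps(3) by auto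

text \<open>Positive reals are squares of nonzero reals, and this is preserved by ring
  homomorphisms.\<close>

lemma er_pos: "0 < r ==> 0 < er r"
proof -
  assume r: "0 < r"
  hence "er r = er (sqrt r) * er (sqrt r)" by (simp add: er_simps(2)[symmetric])
  thus ?thesis using er_nonzero[of "sqrt r"] r by (auto simp: zero_less_mult_iff linorder_neq_iff)
qed

lemma er_less_iff: "er r < er s \<longleftrightarrow> r < s" and er_le_iff: "er r <= er s \<longleftrightarrow> r <= s"
proof -
  have *: "r < s ==> er r < er s" for r s using er_pos[of "s - r"] by (simp add: er_simps)
  show "er r < er s \<longleftrightarrow> r < s" using *[of r s] *[of s r] by (cases r s rule: linorder_cases) auto
  show "er r <= er s \<longleftrightarrow> r <= s" using *[of r s] *[of s r] by (cases r s rule: linorder_cases) auto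
qed

lemma er_divide: "er (r / s) = er r / er s"
proof (cases "s = 0")
  case False
  hence "er (r / s) * er s = er r" by (simp add: er_simps(2)[symmetric])
  thus ?thesis using er_nonzero[OF False] by (simp add: field_simps)
qed (simp add: er_simps)

lemma infinitesimal_le: "x : infinitesimals ==> 0 < r ==> \<bar>x\<bar> <= er r"
proof -
  assume x: "x : infinitesimals" and r: "0 < r"
  obtain n :: nat where n: "1 / r < of_nat n" using reals_Archimedean2 by blast
  hence n0: "0 < n" using r by (cases n) auto
  have "of_nat n * \<bar>x\<bar> <= 1" using x by (simp add: infinitesimals_def)
  hence "\<bar>x\<bar> <= er (1 / of_nat n)" using n0 by (simp add: er_divide er_simps field_simps)
  also have "... <= er r" unfolding er_le_iff using n n0 r by (simp add: field_simps)
  finally show ?thesis .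
qed

text \<open>The real number is the supremum of the cut that \<open>x\<close> makes in the
  reals.\<close>

lemma standard_part_exists:
  assumes x: "x : val_ring"
  shows "EX r. x - er r : infinitesimals"
proof -
  obtain m where m: "\<bar>x\<bar> <= of_nat m" using x by (auto simp: val_ring_iff)
  define S where "S = {s. er s <= x}"
  have up: "s <= of_nat m" if "s : S" for s
  proof -
    have "er s <= er (of_nat m)" using that m by (simp add: S_def er_simps(7))
    thus ?thesis by (simp only: er_le_iff)
  qed
  hence bdd: "bdd_above S" by (auto simp: bdd_above_def)
  have "er (- of_nat m) <= x" using m by (simp add: er_simps(5,7))
  hence ne: "S ~= {}" unfolding S_def by blast
  define r where "r = Sup S"
  have "of_nat n * \<bar>x - er r\<bar> <= 1" for n
  proof (cases "n = 0")
    case False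
    have en: "er (1 / of_nat n) = 1 / of_nat n" by (simp add: er_divide er_simps)
    have n: "(0::'k) < of_nat n" using False by simp
    have "x - er r <= 1 / of_nat n"
    proof (rule ccontr)
      assume "~ x - er r <= 1 / of_nat n"
      hence "er (r + 1 / of_nat n) <= x" by (simp add: er_simps(1) en algebra_simps)
      hence "r + 1 / of_nat n : S" by (simp add: S_def)
      hence "r + 1 / of_nat n <= r" using cSup_upper[OF _ bdd] unfolding r_def by blast
      thus False using False by simp
    qed
    moreover have "er r - x <= 1 / of_nat n"
    proof (rule ccontr)
      assume "~ er r - x <= 1 / of_nat n"
      hence lt: "x < er (r - 1 / of_nat n)" by (simp add: er_simps(6) en algebra_simps)
      have "s <= r - 1 / of_nat n" if "s : S" for s
      proof -
        have "er s < er (r - 1 / of_nat n)" using that lt by (simp add: S_def)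
        thus ?thesis by (simp add: er_less_iff)
      qed
      hence "r <= r - 1 / of_nat n" unfolding r_def by (intro cSup_least ne)
      thus False using False by simp
    qed
    ultimately have "\<bar>x - er r\<bar> <= 1 / of_nat n" by (simp add: abs_le_iff)
    thus ?thesis using n by (simp add: field_simps)
  qed simp
  thus ?thesis by (auto simp: infinitesimals_def)
qed

text \<open>The structure \<sigma> evaluates series of radius above 1. A germ of radius
  \<open>delta\<close> is rescaled to radius \<open>delta / r\<close>, which exceeds 1 for
  \<open>r < delta\<close>; the infinitesimal point is divided by \<open>r\<close> and remains in
  the box.\<close>

definition scaled_value :: "nat => real => real => 'w series => (nat => 'k) => 'k" where
  "scaled_value n delta r f a = \<sigma> n (delta / r) (hahn_map (mps_scale r) f) (map (%i. a i / er r) [0..<n])"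

lemma hscale_simps:
  "hahn_map (mps_scale r) (f + g) = hahn_map (mps_scale r) f + hahn_map (mps_scale r) g"
  "hahn_map (mps_scale r) (f * g) = hahn_map (mps_scale r) f * hahn_map (mps_scale r) g"
  "hahn_map (mps_scale r) 1 = (1 :: 'w series)"
  "hahn_map (mps_scale r) (hvar i) = hconst r * (hvar i :: 'w series)"
  by (auto intro!: hahn_map_add hahn_map_times simp: mps_scale_simps hahn_single_times hahn_map_single)
     (use hahn_map_single[of "mps_scale r" 0 "1 :: real mps"] mps_scale_simps(5)[of r 1] in "simp_all add: mps_scale_simps hahn_single_zero_one hahn_single_times")

lemma hscale_affine:
  assumes "f : germ n"
  shows "hahn_map (mps_affine r (replicate n 0)) f = hahn_map (mps_scale r) f"
  by (rule hahn_eqI) (use mps_affine_origin[OF in_vars_germ[OF assms]] in "simp add: hahn_map.rep_eq")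

lemma affine_radius_origin: "1 <= n ==> affine_radius delta r (replicate n 0) = delta / r"
proof -
  assume "1 <= n"
  hence "(%c. min ((delta - c) / r) ((delta + c) / r)) ` set (replicate n 0) = {delta / r}" by auto
  thus ?thesis unfolding affine_radius_def by (simp only: Min_singleton)
qed

lemma hscale_B: "0 < delta ==> f : B n delta ==> 1 <= n ==> 0 < r ==> hahn_map (mps_scale r) f : B n (delta / r)"
  using affine[of delta f n "replicate n 0" r] hscale_affine[OF germI] affine_radius_origin by auto

lemma box_scaled: "range a <= infinitesimals ==> 0 < r ==> map (%i. a i / er r) [0..<n] : unit_box n"
proof -
  assume a: "range a <= infinitesimals" and r: "0 < r"
  have "\<bar>a i / er r\<bar> <= 1" for i
  proof -
    have "\<bar>a i\<bar> <= er r" by (rule infinitesimal_le) (use a r in auto)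
    thus ?thesis using er_pos[OF r] by (simp add: field_simps)
  qed
  hence "a i / er r <= 1 & -1 <= a i / er r" for i by (metis abs_le_iff minus_le_iff)
  thus ?thesis by (auto simp: unit_box_def simp del: abs_divide)
qed

text \<open>Three changes are made separately: of the scale by compatibility with affine
  substitutions (\<open>U1\<close>), of the radius by compatibility with inclusions
  (\<open>U2\<close>), and of the number of variables by \<open>extend\<close> (\<open>U3\<close>).
  The condition \<open>1 <= n\<close> comes from the affine axiom.\<close>

lemma scaled_value_unique:
  assumes 1: "1 <= n" "f : B n delta" "0 < r" "r < delta" and 2: "1 <= n'" "f : B n' delta'" "0 < r'" "r' < delta'"
    and a: "range a <= infinitesimals"
  shows "scaled_value n delta r f a = scaled_value n' delta' r' f a"
proof -
  have U1: "scaled_value n delta r f a = scaled_value n delta s f a"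
    if n: "1 <= n" and f: "f : B n delta" and s: "0 < s" "s <= r" "r < delta" for n delta r s
  proof -
    have pos: "0 < delta" "0 < r" using s by auto
    let ?z = "replicate n (0::real)" and ?g = "hahn_map (mps_scale r) f"
    let ?xs = "map (%i. a i / er s) [0..<n]" and ?ys = "map (%i. a i / er r) [0..<n]"
    have g: "?g : B n (delta / r)" by (rule hscale_B[OF pos(1) f n pos(2)])
    have rad: "affine_radius (delta / r) (s / r) ?z = delta / s" using n pos s by (simp add: affine_radius_origin)
    have sc: "hahn_map (mps_affine (s / r) ?z) ?g = hahn_map (mps_scale s) f"
    proof -
      have "?g : germ n" by (rule germI[OF _ g]) (use pos in simp)
      hence "hahn_map (mps_affine (s / r) ?z) ?g = hahn_map (mps_scale (s / r)) ?g" by (rule hscale_affine)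
      also have "... = hahn_map (mps_scale s) f"
        by (rule hahn_eqI) (use pos in "simp add: hahn_coeff_map mps_scale_simps")
      finally show ?thesis .
    qed
    have ys: "?ys = map2 (%x c. er (s / r) * x + er c) ?xs ?z"
      using pos s er_nonzero[of s] er_nonzero[of r] by (intro nth_equalityI) (auto simp: er_simps er_divide field_simps)
    have "\<sigma> n (affine_radius (delta / r) (s / r) ?z) (hahn_map (mps_affine (s / r) ?z) ?g) ?xs = \<sigma> n (delta / r) ?g ?ys"
      unfolding er_def
    proof (rule S.affine[OF _ g n _ _ _ _ _ ys[unfolded er_def]])
      show "map (%i. a i / e (hconst s)) [0..<n] : unit_box n" "map (%i. a i / e (hconst r)) [0..<n] : unit_box n" unfolding er_def[symmetric] by (rule box_scaled[OF a], rule s pos)+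
    qed (use pos s n rad in auto)
    thus ?thesis unfolding scaled_value_def rad sc by simp
  qed
  have U2: "scaled_value n delta r f a = scaled_value n d r f a"
    if n: "1 <= n" and f: "f : B n delta" and s: "0 < r" "r < d" "d <= delta" for n delta r d
  proof (cases "d = delta")
    case False
    have "hahn_map (mps_scale r) f : B n (delta / r)" by (rule hscale_B) (use n f s in auto)
    thus ?thesis unfolding scaled_value_def
      by (intro S.inclusion[symmetric]) (use s False box_scaled[OF a] in "auto simp: field_simps")
  qed simp
  have U3: "scaled_value n delta r f a = scaled_value (n + k) delta r f a"
    if n: "1 <= n" and f: "f : B n delta" and s: "0 < r" "r < delta" for n delta r k
  proof (induction k)
    case (Suc k)
    have "f : B (n + k) delta" using mono[of n "n + k" delta delta] f s by auto
    hence g: "hahn_map (mps_scale r) f : B (n + k) (delta / r)" by (intro hscale_B) (use n s in auto)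
    have "map (%i. a i / er r) [0..<Suc (n + k)] : unit_box (Suc (n + k))" by (rule box_scaled[OF a s(1)])
    hence x: "a (n + k) / er r : {-1..1}" by (simp add: unit_box_def)
    have "scaled_value (Suc (n + k)) delta r f a = scaled_value (n + k) delta r f a"
      unfolding scaled_value_def using S.extend[OF _ g box_scaled[OF a s(1)] x] s by simp
    thus ?case using Suc by simp
  qed simp
  define N d s where "N = max n n'" and "d = min delta delta'" and "s = min r r'"
  have *: "scaled_value n delta r f a = scaled_value N d s f a"
    if "1 <= n" "f : B n delta" "0 < r" "r < delta" "n <= N" "d <= delta" "s <= r" "0 < s" "s < d" for n delta r
  proof -
    have "scaled_value n delta r f a = scaled_value n delta s f a" by (rule U1) (use that in auto)
    also have "... = scaled_value n d s f a" by (rule U2) (use that in auto)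
    also have "... = scaled_value (n + (N - n)) d s f a" by (rule U3) (use that mono[of n n d delta] in auto)
    finally show ?thesis using that by simp
  qed
  have "scaled_value n delta r f a = scaled_value N d s f a" "scaled_value n' delta' r' f a = scaled_value N d s f a"
    by (rule *; use 1 2 in "auto simp: N_def d_def s_def")+
  thus ?thesis by simp
qed

definition eval :: "'w series => (nat => 'k) => 'k" where
  "eval f a = (THE v. EX n delta r. 1 <= n & f : B n delta & 0 < r & r < delta & v = scaled_value n delta r f a)"

lemma eval_eq:
  assumes "1 <= n" "f : B n delta" "0 < r" "r < delta" "range a <= infinitesimals"
  shows "eval f a = scaled_value n delta r f a" unfolding eval_def
proof (rule the_equality)
  show "EX n' delta' r'. 1 <= n' & f : B n' delta' & 0 < r' & r' < delta' & scaled_value n delta r f a = scaled_value n' delta' r' f a"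
    using assms by blast
  show "v = scaled_value n delta r f a" if "EX n delta r. 1 <= n & f : B n delta & 0 < r & r < delta & v = scaled_value n delta r f a" for v
    using that scaled_value_unique assms by blast
qed

text \<open>With the scale \<open>delta / 2\<close> the new radius is always 2, and the variable
  added by \<open>Suc n\<close> guarantees that there is one to rescale.\<close>

lemma germ_radius:
  assumes "f : germ n" "g : germ n"
  obtains delta where "0 < delta" "f : B (Suc n) delta" "g : B (Suc n) delta"
    "!!h. h : B (Suc n) delta ==> hahn_map (mps_scale (delta / 2)) h : B (Suc n) 2"
    "!!h a. h : B (Suc n) delta ==> range a <= infinitesimals ==>
      eval h a = \<sigma> (Suc n) 2 (hahn_map (mps_scale (delta / 2)) h) (map (%i. a i / er (delta / 2)) [0..<Suc n])"
proof -
  obtain delta where delta: "0 < delta" "f : B (Suc n) delta" "g : B (Suc n) delta"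
    using germE2[OF assms, of "Suc n"] by auto
  have q: "delta / (delta / 2) = 2" using delta(1) by simp
  show ?thesis
  proof (rule that[OF delta])
    fix h assume h: "h : B (Suc n) delta"
    show "hahn_map (mps_scale (delta / 2)) h : B (Suc n) 2" using hscale_B[OF delta(1) h, of "delta / 2"] q delta(1) by simp
    fix a :: "nat => 'k" assume "range a <= infinitesimals"
    thus "eval h a = \<sigma> (Suc n) 2 (hahn_map (mps_scale (delta / 2)) h) (map (%i. a i / er (delta / 2)) [0..<Suc n])"
      using eval_eq[OF _ h, of "delta / 2" a] delta(1) q unfolding scaled_value_def by simp
  qed
qed

lemma eval_add: "f : germ n ==> g : germ n ==> range a <= infinitesimals ==> eval (f + g) a = eval f a + eval g a"
  and eval_mult: "f : germ n ==> g : germ n ==> range a <= infinitesimals ==> eval (f * g) a = eval f a * eval g a"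
proof -
  assume f: "f : germ n" and g: "g : germ n" and a: "range a <= infinitesimals"
  obtain delta where delta: "0 < delta" "f : B (Suc n) delta" "g : B (Suc n) delta"
    and sc: "!!h. h : B (Suc n) delta ==> hahn_map (mps_scale (delta / 2)) h : B (Suc n) 2"
    and ev: "!!h a. h : B (Suc n) delta ==> range a <= infinitesimals ==>
      eval h a = \<sigma> (Suc n) 2 (hahn_map (mps_scale (delta / 2)) h) (map (%i. a i / er (delta / 2)) [0..<Suc n])"
    by (rule germ_radius[OF f g]) (rule that)
  have box: "map (%i. a i / er (delta / 2)) [0..<Suc n] : unit_box (Suc n)" by (rule box_scaled[OF a]) (use delta in simp)
  have fg: "f + g : B (Suc n) delta" "f * g : B (Suc n) delta" using add[OF delta] mult[OF delta] by auto
  show "eval (f + g) a = eval f a + eval g a"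
    unfolding ev[OF fg(1) a] ev[OF delta(2) a] ev[OF delta(3) a] hscale_simps
    by (rule S.add) (use sc[OF delta(2)] sc[OF delta(3)] box in auto)
  show "eval (f * g) a = eval f a * eval g a"
    unfolding ev[OF fg(2) a] ev[OF delta(2) a] ev[OF delta(3) a] hscale_simps
    by (rule S.mult) (use sc[OF delta(2)] sc[OF delta(3)] box in auto)
qed

lemma eval_const:
  assumes b: "b : germ 0" and a: "range a <= infinitesimals"
  shows "eval b a = e b"
proof -
  have b1: "b : B 0 1" "b : B 0 2" "b : B (Suc 0) 2" using b B0[of 1 2] mono[of 0 "Suc 0" 2 2] by (auto simp: germ0_eq)
  have "hahn_map (mps_scale 1) b = b"
    by (rule hahn_eqI) (use in_vars_germ[OF b] in "simp add: hahn_coeff_map mps_scale_simps mps_scale_constant")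
  hence "eval b a = \<sigma> (Suc 0) 2 b [a 0]"
    using eval_eq[OF _ b1(3), of 1 a] a by (simp add: scaled_value_def er_simps)
  also have "... = \<sigma> 0 2 b []"
  proof -
    have "map (%i. a i / er 1) [0..<Suc 0] : unit_box (Suc 0)" by (rule box_scaled[OF a]) simp
    hence "a 0 : {-1..1}" by (simp add: unit_box_def er_simps)
    thus ?thesis using S.extend[of 2 b 0 "[]" "a 0"] b1(2) by (simp add: unit_box_def)
  qed
  also have "... = e b" using S.nullary[of 2 b] b1(1) by simp
  finally show ?thesis .
qed

lemma eval_var:
  assumes a: "range a <= infinitesimals" shows "eval (hvar i) a = a i"
proof -
  let ?v = "hvar i :: 'w series"
  obtain delta where delta: "0 < delta" "?v : B (Suc (Suc i)) delta"
    and ev: "!!h a. h : B (Suc (Suc i)) delta ==> range a <= infinitesimals ==>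
      eval h a = \<sigma> (Suc (Suc i)) 2 (hahn_map (mps_scale (delta / 2)) h) (map (%i. a i / er (delta / 2)) [0..<Suc (Suc i)])"
    using germ_radius[of ?v "Suc i" ?v] by (metis germ_var lessI)
  let ?xs = "map (%i. a i / er (delta / 2)) [0..<Suc (Suc i)]"
  have box: "?xs : unit_box (Suc (Suc i))" by (rule box_scaled[OF a]) (use delta in simp)
  have v: "?v : B (Suc (Suc i)) 2" by (rule polys) (auto intro: var_polys)
  have "eval ?v a = \<sigma> (Suc (Suc i)) 2 (hconst (delta / 2) * ?v) ?xs" unfolding ev[OF delta(2) a] hscale_simps ..
  also have "... = er (delta / 2) * \<sigma> (Suc (Suc i)) 2 ?v ?xs" unfolding er_def[of "delta / 2"] using S.scale[OF _ v box, of "delta / 2"] by (simp del: upt_Suc add: er_def)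
  also have "\<sigma> (Suc (Suc i)) 2 ?v ?xs = ?xs ! i" by (rule S.coordinate) (use box in "simp_all del: upt_Suc")
  also have "er (delta / 2) * ?xs ! i = a i" using er_nonzero[of "delta / 2"] delta(1) by (simp del: upt_Suc)
  finally show ?thesis .
qed

lemma eval_permute:
  assumes f: "f : germ n" and a: "range a <= infinitesimals" and \<pi>: "\<pi> permutes {..<n}"
  shows "eval (hahn_map (mps_permute \<pi>) f) a = eval f (%i. a (\<pi> i))"
proof -
  obtain delta where delta: "0 < delta" "f : B (Suc n) delta"
    and sc: "!!h. h : B (Suc n) delta ==> hahn_map (mps_scale (delta / 2)) h : B (Suc n) 2"
    and ev: "!!h a. h : B (Suc n) delta ==> range a <= infinitesimals ==>
      eval h a = \<sigma> (Suc n) 2 (hahn_map (mps_scale (delta / 2)) h) (map (%i. a i / er (delta / 2)) [0..<Suc n])"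
    by (rule germ_radius[OF f f]) (rule that)
  have \<pi>': "\<pi> permutes {..<Suc n}" using permutes_subset[OF \<pi>] by auto
  have box: "map (%i. a i / er (delta / 2)) [0..<Suc n] : unit_box (Suc n)" by (rule box_scaled[OF a]) (use delta in simp)
  have pf: "hahn_map (mps_permute \<pi>) f : B (Suc n) delta" by (rule permute[OF delta \<pi>'])
  have eq: "hahn_map (mps_scale r) (hahn_map (mps_permute \<pi>) f) = hahn_map (mps_permute \<pi>) (hahn_map (mps_scale r) f)" for r
    by (rule hahn_eqI) (simp add: hahn_coeff_map mps_scale_simps mps_scale_permute[OF permutes_bij[OF \<pi>]])
  have lt: "\<pi> i < Suc n" if "i < Suc n" for i using permutes_in_image[OF \<pi>', of i] that by simp
  have a': "range (%i. a (\<pi> i)) <= infinitesimals" using a by auto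
  have "eval (hahn_map (mps_permute \<pi>) f) a = \<sigma> (Suc n) 2 (hahn_map (mps_permute \<pi>) (hahn_map (mps_scale (delta / 2)) f)) (map (%i. a i / er (delta / 2)) [0..<Suc n])"
    unfolding ev[OF pf a] eq ..
  also have "... = \<sigma> (Suc n) 2 (hahn_map (mps_scale (delta / 2)) f) (map (%i. map (%i. a i / er (delta / 2)) [0..<Suc n] ! \<pi> i) [0..<Suc n])"
    by (rule S.permute) (use sc[OF delta(2)] \<pi>' box in auto)
  also have "map (%i. map (%i. a i / er (delta / 2)) [0..<Suc n] ! \<pi> i) [0..<Suc n] = map (%i. a (\<pi> i) / er (delta / 2)) [0..<Suc n]"
    by (rule map_cong) (use lt in "auto simp del: upt_Suc")
  finally show ?thesis unfolding ev[OF delta(2) a'] .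
qed

lemma eval_cong:
  assumes f: "f : germ n" and a: "range a <= infinitesimals" "range b <= infinitesimals" and ab: "!!i. i < n ==> a i = b i"
  shows "eval f a = eval f b"
proof (cases "n = 0")
  case True
  thus ?thesis using f eval_const a by simp
next
  case False
  obtain delta where delta: "0 < delta" "f : B n delta" using f germE by blast
  have m: "map (%i. a i / er (delta / 2)) [0..<n] = map (%i. b i / er (delta / 2)) [0..<n]" using ab by simp
  show ?thesis using eval_eq[OF _ delta(2), of "delta / 2"] False delta(1) a by (simp add: scaled_value_def m)
qed

lemma eval_one: "range a <= infinitesimals ==> eval 1 a = 1" using eval_const[of 1 a] S.e_one by simp

lemma eval_unit: "g : bgerm n ==> res g ~= 0 ==> range a <= infinitesimals ==> eval g a ~= 0"
proof
  assume g: "g : bgerm n" "res g ~= 0" and a: "range a <= infinitesimals" and z: "eval g a = 0"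
  obtain h where h: "h : bgerm n" "g * h = 1" using bgerm_unit[OF g] by blast
  have "eval g a * eval h a = 1" using eval_mult[OF bgerm_germ[OF g(1)] bgerm_germ[OF h(1)] a] h(2) eval_one[OF a] by simp
  thus False using z by simp
qed

text \<open>If \<open>p = f a\<close> were infinite, the unit \<open>1 - eta f\<close> would vanish at \<open>eta = 1 / p\<close>; if it had standard part
  \<open>r \<noteq> 0\<close>, the unit \<open>r + eta - f\<close> would vanish at \<open>eta = p - r\<close>.\<close>

lemma eval_inf:
  assumes f: "f : bgerm n" "res f = 0" and a: "range a <= infinitesimals"
  shows "eval f a : infinitesimals"
proof -
  define p where "p = eval f a"
  have fS: "f : bgerm (Suc n)" using f(1) bgerm_mono[of n "Suc n"] by simp
  have v: "(hvar n :: 'w series) : bgerm (Suc n)" by (rule bgerm_closed) simp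
  have at: "range (a(n := eta)) <= infinitesimals" "eval f (a(n := eta)) = p" "eval (hvar n) (a(n := eta)) = eta"
    if "eta : infinitesimals" for eta
  proof -
    show r: "range (a(n := eta)) <= infinitesimals" using a that by auto
    show "eval f (a(n := eta)) = p" unfolding p_def by (rule eval_cong[OF bgerm_germ[OF f(1)] r a]) auto
    show "eval (hvar n) (a(n := eta)) = eta" using eval_var[OF r, of n] by simp
  qed
  have um: "eval (- g) b = - eval g b" if "g : germ (Suc n)" "range b <= infinitesimals" for g b
    using eval_add[OF that(1) germ_uminus[OF that(1)] that(2)] eval_const[of 0 b] that er_simps(4)
    by (simp add: eq_neg_iff_add_eq_0 add.commute er_def)
  have "p : val_ring"
  proof (rule ccontr)
    assume p: "p ~: val_ring"
    define eta where "eta = inverse p"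
    have eta: "eta : infinitesimals" unfolding eta_def by (rule infinite_inverse[OF p])
    have "p ~= 0" using p by (auto simp: val_ring_iff)
    let ?m = "hvar n * f"
    have m: "?m : bgerm (Suc n)" by (intro bgerm_closed v fS)
    have g: "1 + - ?m : bgerm (Suc n)" by (intro bgerm_closed m)
    have "res (1 + - ?m) ~= 0" using res_mult[OF v fS] by simp
    hence "eval (1 + - ?m) (a(n := eta)) ~= 0" using eval_unit[OF g _ at(1)[OF eta]] by blast
    moreover have "eval (1 + - ?m) (a(n := eta)) = 1 - eta * p"
      using eval_add[OF germ_1 germ_uminus[OF bgerm_germ[OF m]] at(1)[OF eta]] eval_one[OF at(1)[OF eta]] um[OF bgerm_germ[OF m] at(1)[OF eta]]
        eval_mult[OF bgerm_germ[OF v] bgerm_germ[OF fS] at(1)[OF eta]] at(2,3)[OF eta] by simp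
    ultimately show False using `p ~= 0` by (simp add: eta_def)
  qed
  then obtain r where r: "p - er r : infinitesimals" using standard_part_exists by blast
  show ?thesis
  proof (cases "r = 0")
    case True
    thus ?thesis using r by (simp add: er_simps p_def)
  next
    case False
    let ?eta = "p - er r"
    have c: "hconst r + hvar n : bgerm (Suc n)" by (intro bgerm_closed v)
    have g: "(hconst r + hvar n) + - f : bgerm (Suc n)" by (intro bgerm_closed v fS)
    have "res ((hconst r + hvar n) + - f) ~= 0" using False f(2) by simp
    hence "eval ((hconst r + hvar n) + - f) (a(n := ?eta)) ~= 0" using eval_unit[OF g _ at(1)[OF r]] by blast
    moreover have "eval ((hconst r + hvar n) + - f) (a(n := ?eta)) = (er r + ?eta) + - p"
      using eval_add[OF bgerm_germ[OF c] germ_uminus[OF bgerm_germ[OF fS]] at(1)[OF r]] um[OF bgerm_germ[OF fS] at(1)[OF r]]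
        eval_add[OF germ_const bgerm_germ[OF v] at(1)[OF r]] at(2,3)[OF r] eval_const[of "hconst r", OF _ at(1)[OF r]]
      by (simp add: er_def)
    ultimately show ?thesis by simp
  qed
qed

lemma zero_infinitesimal: "0 : infinitesimals" by (simp add: infinitesimals_def)

sublocale model: germ_model B eval infinitesimals
proof unfold_locales
  show "eval f a = eval f b" if "f : germ n" "range a <= infinitesimals" "range b <= infinitesimals"
    "!!i. i < n ==> a i = b i" for f :: "'w series" and n a b using that by (rule eval_cong)
qed (rule zero_infinitesimal eval_one eval_add eval_mult eval_var eval_permute eval_inf; assumption)+

text \<open>Links the structure on the whole box with germs: infinitely close to the real point
  \<open>a0\<close>, a function of the structure is the value of the expansion of \<open>f\<close>
  at \<open>a0\<close>.\<close>

lemma sigma_eq_eval: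
  assumes alpha: "1 < alpha" and f: "f : B n alpha" and xs: "xs : unit_box n"
    and a0: "length a0 = n" "set a0 <= {-1..1}" "!!i. i < n ==> xs ! i - er (a0 ! i) : infinitesimals"
  shows "hahn_map (mps_affine 1 a0) f : germ n"
    "\<sigma> n alpha f xs = eval (hahn_map (mps_affine 1 a0) f) (%i. if i < n then xs ! i - er (a0 ! i) else 0)"
proof -
  let ?F = "hahn_map (mps_affine 1 a0) f" and ?a = "%i. if i < n then xs ! i - er (a0 ! i) else 0"
  have a: "range ?a <= infinitesimals" using a0(3) zero_infinitesimal by auto
  have len: "length xs = n" using xs by (simp add: unit_box_def)
  have "?F : germ n & \<sigma> n alpha f xs = eval ?F ?a"
  proof (cases "n = 0")
    case True
    have f0: "f : germ 0" using germI[of alpha f 0] f alpha True by simp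
    have "?F = hahn_map (mps_scale 1) f" using hscale_affine[OF f0, of 1] a0(1) True by simp
    also have "... = f"
      by (rule hahn_eqI) (use in_vars_germ[OF f0] in "simp add: hahn_coeff_map mps_scale_simps mps_scale_constant")
    finally have F: "?F = f" .
    have "\<sigma> n alpha f xs = e f" using S.nullary[OF alpha, of f] f0 True len by (simp add: germ0_eq)
    thus ?thesis using F eval_const[OF f0 a] f0 True by simp
  next
    case False
    have sub: "set a0 <= {-alpha<..<alpha}" using a0(2) alpha by (fastforce simp: subset_iff)
    have ne: "a0 ~= []" using False a0(1) by auto
    define delta where "delta = affine_radius alpha 1 a0"
    let ?M = "(%c. min ((alpha - c) / 1) ((alpha + c) / 1)) ` set a0"
    have "ALL x:?M. 0 < x" using sub by auto
    moreover have "finite ?M" "?M ~= {}" using ne by auto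
    ultimately have delta: "0 < delta" unfolding delta_def affine_radius_def using Min_gr_iff[of ?M 0] by blast
    have F: "?F : B n delta" unfolding delta_def by (rule affine) (use alpha f False a0(1) sub in auto)
    define r where "r = delta / 2"
    have r: "0 < r" "r < delta" using delta by (auto simp: r_def)
    have rad: "affine_radius alpha r a0 = delta / r" using affine_radius_scale[OF ne r(1)] by (simp add: delta_def)
    let ?xs = "map (%i. ?a i / er r) [0..<n]"
    have sc: "hahn_map (mps_affine r a0) f = hahn_map (mps_scale r) ?F"
      by (rule hahn_eqI) (simp add: hahn_map.rep_eq mps_affine_eq_scale[of r a0] mps_scale_simps)
    have ys: "xs = map2 (%x c. er r * x + er c) ?xs a0"
      using er_nonzero[of r] r len a0(1) by (intro nth_equalityI) auto
    \<comment> \<open>Translation alone could leave a radius at most 1, about which the structure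
      says nothing. So translation and rescaling by \<open>r\<close> are made in a single affine
      substitution.\<close>
    have "\<sigma> n (affine_radius alpha r a0) (hahn_map (mps_affine r a0) f) ?xs = \<sigma> n alpha f xs"
      by (rule S.affine) (use alpha f False a0(1) sub r rad xs ys box_scaled[OF a r(1)] in "simp_all add: er_def")
    hence "\<sigma> n alpha f xs = scaled_value n delta r ?F ?a" unfolding scaled_value_def rad sc by simp
    also have "... = eval ?F ?a" using eval_eq[OF _ F r a] False by simp
    finally show ?thesis using germI[OF delta F] by blast
  qed
  thus "?F : germ n" "\<sigma> n alpha f xs = eval ?F ?a" by auto
qed

end

section \<open>Analytic subfields\<close>

text \<open>The elements of \<open>good\<close> behave like the nonzero elements of a valued field
  over the reals, but \<open>good\<close> together with 0 is not assumed closed under addition. The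
  last premise of \<open>residue\<close> matters in a product, whose two components could have
  different residues.\<close>

locale valued_model = germ_model B ev inf
  for B :: "nat => real => ('w::linordered_ab_group_add, real mps) hahn set"
    and ev :: "'w series => (nat => 'p::comm_ring_1) => 'p" and inf :: "'p set" +
  fixes good :: "'p set" and val :: "'p => 'g::linordered_ab_group_add"
  assumes good_mult: "x : good ==> y : good ==> x * y : good"
    and val_mult: "x : good ==> y : good ==> val (x * y) = val x + val y"
    and good_inverse: "x : good ==> EX y:good. x * y = 1"
    and good_kc: "r ~= 0 ==> kc r : good"
    and val_kc: "r ~= 0 ==> val (kc r) = 0"
    and good_unit: "w : inf ==> 1 + w : good"
    and val_unit: "w : inf ==> val (1 + w) = 0"
    and good_inf: "x : good ==> x : inf \<longleftrightarrow> 0 < val x"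
    and residue: "x : good ==> val x = 0 ==> ALL r. x - kc r : insert 0 good ==> EX r. x - kc r : inf"
begin

lemma one_good: "1 : good" and val_one: "val 1 = 0" using good_unit[OF zero_inf] val_unit[OF zero_inf] by auto

lemma zero_not_good: "0 ~: good" using good_inverse[of 0] by auto

lemma one_not_inf: "1 ~: inf" using good_inf[OF one_good] val_one by simp

lemma good_cancel: "x : good ==> x * a = x * b ==> a = b"
  by (metis good_inverse mult.commute mult.left_commute mult.right_neutral)

lemma good_mult_eq_0: "x : good ==> x * a = 0 \<longleftrightarrow> a = 0" using good_cancel[of x a 0] by auto

lemma val_inverse: "x : good ==> x * y = 1 ==> y : good & val y = - val x"
proof -
  assume x: "x : good" and xy: "x * y = 1"
  obtain z where z: "z : good" "x * z = 1" using good_inverse[OF x] by blast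
  hence "y = z" using good_cancel[OF x] xy by metis
  moreover have "val x + val z = 0" using val_mult[OF x z(1)] z(2) val_one by simp
  ultimately show ?thesis using z(1) by (simp add: eq_neg_iff_add_eq_0 add.commute)
qed

lemma good_power: "x : good ==> x ^ n : good" by (induction n) (auto simp: one_good good_mult)

text \<open>Data that generate an analytic subfield: \<open>U\<close> holds the monomials that may
  lead, \<open>M\<close> the infinitesimals at which germs are evaluated. By the last clause a good
  monomial of nonnegative value is a real number up to infinitesimal values of germs at
  \<open>M\<close>.\<close>

definition frame :: "'p set => 'p set => bool" where
  "frame U M \<longleftrightarrow> M <= inf & 0 : M & U <= insert 0 good & range kc <= U & (ALL x:U. ALL y:U. x * y : U) &
    (ALL x:U Int good. EX y:U. x * y = 1) & (ALL x:U Int good. 0 <= val x --> (EX r. x - kc r : gen0 M))"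

text \<open>The perturbation \<open>w\<close> is restricted to values of germs at \<open>M\<close>;
  for an arbitrary infinitesimal the element would leave the field to be generated.\<close>

definition leading :: "'p set => 'p set => 'g => 'p set" where
  "leading U M v = {psi * (1 + w) |psi w. psi : U Int good & val psi = v & w : gen0 M}"

definition analytic_subfield :: "'p set => bool" where
  "analytic_subfield E \<longleftrightarrow> E <= insert 0 good & 0 : E & (ALL x:E. ALL y:E. x + y : E) & (ALL x:E. ALL y:E. x * y : E) &
    (ALL x:E Int good. EX y:E. x * y = 1) & gen (E Int inf) <= E"

context
  fixes U M :: "'p set"
  assumes fr: "frame U M"
begin

lemma frameD: "M <= inf" "0 : M" "U <= insert 0 good" "kc r : U" "1 : U"
  "x : U ==> y : U ==> x * y : U" "x : U ==> x : good ==> EX y:U. x * y = 1"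
  "x : U ==> x : good ==> 0 <= val x ==> EX r. x - kc r : gen0 M"
proof -
  show k: "kc r : U" for r using fr unfolding frame_def by blast
  show "1 : U" using k[of 1] by (simp add: kc_simps)
qed (use fr in "unfold frame_def, blast+")

lemma gen0M: "gen0 M <= inf" by (rule gen0_inf[OF frameD(1)])

text \<open>A nonzero residue would make \<open>x\<close> a nonzero real times \<open>1 + w\<close>
  with \<open>w\<close> infinitesimal, hence of value 0.\<close>

lemma frame_infinitesimal:
  assumes x: "x : U" "x : good" "0 < val x" shows "x : gen0 M"
proof -
  obtain r where r: "x - kc r : gen0 M" using frameD(8)[OF x(1,2) less_imp_le[OF x(3)]] by blast
  have "r = 0"
  proof (rule ccontr)
    assume nz: "r ~= 0"
    have m: "kc (1 / r) * (x - kc r) : gen0 M" using gen_closed(6)[OF frameD(1,2) gen_kc[OF frameD(1,2)] r] .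
    have "kc (1 / r) * kc r = 1" using nz by (simp add: kc_simps(4)[symmetric] kc_simps(2))
    hence eq: "kc (1 / r) * x = 1 + kc (1 / r) * (x - kc r)" by (simp add: algebra_simps)
    have "val (kc (1 / r) * x) = val x" using val_mult[OF good_kc x(2)] val_kc nz by simp
    moreover have "val (1 + kc (1 / r) * (x - kc r)) = 0" by (rule val_unit) (use m gen0M in blast)
    ultimately show False using x(3) eq by simp
  qed
  thus ?thesis using r by (simp add: kc_simps)
qed

lemma leadingI: "psi : U ==> psi : good ==> w : gen0 M ==> psi * (1 + w) : leading U M (val psi)"
  unfolding leading_def by blast

lemma leading_good: "u : leading U M v ==> u : good & val u = v"
  unfolding leading_def using good_mult good_unit val_mult val_unit gen0M by fastforce

lemma leading_monomial: "psi : U ==> psi : good ==> psi : leading U M (val psi)"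
  using leadingI[of psi 0] gen0_0[OF frameD(1,2)] by simp

lemma leading_mult:
  assumes "u : leading U M v" "u' : leading U M v'" shows "u * u' : leading U M (v + v')"
proof -
  obtain psi w psi' w' where u: "u = psi * (1 + w)" "psi : U" "psi : good" "val psi = v" "w : gen0 M"
    and u': "u' = psi' * (1 + w')" "psi' : U" "psi' : good" "val psi' = v'" "w' : gen0 M"
    using assms unfolding leading_def by blast
  have "w + w' + w * w' : gen0 M" by (intro gen_closed(5,6)[OF frameD(1,2)] u u' gen0_gen1)
  hence "(psi * psi') * (1 + (w + w' + w * w')) : leading U M (val (psi * psi'))"
    by (intro leadingI frameD(6) good_mult u u')
  thus ?thesis using val_mult[of psi psi'] u u' by (simp add: algebra_simps)
qed

lemma leading_unit:
  assumes r: "r ~= 0" and w: "w : gen0 M" shows "kc r + w : leading U M 0"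
proof -
  have "kc (1 / r) * w : gen0 M" using gen_closed(6)[OF frameD(1,2) gen_kc[OF frameD(1,2)] w] .
  from leadingI[OF frameD(4) good_kc[OF r] this] have "kc r * (1 + kc (1 / r) * w) : leading U M 0"
    using val_kc[OF r] by simp
  moreover have "kc r * kc (1 / r) = 1" using r by (simp add: kc_simps(4)[symmetric] kc_simps(2))
  hence "kc r * (1 + kc (1 / r) * w) = kc r + w" by (simp add: algebra_simps)
  ultimately show ?thesis by simp
qed

lemma frame_quotient:
  assumes x: "x : U" "x : good" and y: "y : U" "y : good"
  obtains q where "q : U" "q : good" "y = x * q" "val q = val y - val x"
proof -
  obtain z where z: "z : U" "x * z = 1" using frameD(7)[OF x] by blast
  have zg: "z : good" "val z = - val x" using val_inverse[OF x(2) z(2)] by auto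
  show ?thesis
  proof (rule that[of "z * y"])
    show "y = x * (z * y)" using z(2) by (simp add: mult.assoc[symmetric])
  qed (use frameD(6)[OF z(1) y(1)] good_mult[OF zg(1) y(2)] val_mult[OF zg(1) y(2)] zg in auto)
qed

text \<open>The quotient of the two monomials has positive value, so it is infinitesimal and is
  absorbed in the unit factor.\<close>

lemma leading_add:
  assumes "u : leading U M v" "u' : leading U M v'" and v: "v < v'" shows "u + u' : leading U M v"
proof -
  obtain psi w psi' w' where u: "u = psi * (1 + w)" "psi : U" "psi : good" "val psi = v" "w : gen0 M"
    and u': "u' = psi' * (1 + w')" "psi' : U" "psi' : good" "val psi' = v'" "w' : gen0 M"
    using assms unfolding leading_def by blast
  obtain q where q: "q : U" "q : good" "psi' = psi * q" "val q = val psi' - val psi"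
    by (rule frame_quotient[OF u(2,3) u'(2,3)])
  have qm: "q : gen0 M" by (rule frame_infinitesimal) (use q v u u' in auto)
  have "w + (q + q * w') : gen0 M" by (intro gen_closed(5,6)[OF frameD(1,2)] u u' qm gen0_gen1)
  from leadingI[OF u(2,3) this] show ?thesis unfolding u(1,4) u'(1) q(3) by (simp add: algebra_simps)
qed

lemma leading_sum:
  assumes "finite S" "ALL i:S. u i = 0 | u i : leading U M (v i)"
    "ALL i:S. ALL j:S. i ~= j --> u i ~= 0 --> u j ~= 0 --> v i ~= v j"
  shows "sum u S = 0 | (EX i:S. u i ~= 0 & sum u S : leading U M (v i))" using assms
proof (induction S rule: finite_induct)
  case (insert i S)
  have sum: "sum u (insert i S) = u i + sum u S" using insert(1,2) by simp
  have IH: "sum u S = 0 | (EX i:S. u i ~= 0 & sum u S : leading U M (v i))" using insert by auto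
  show ?case
  proof (cases "u i = 0 | sum u S = 0")
    case True
    thus ?thesis using IH insert(4) sum by auto
  next
    case False
    then obtain j where j: "j : S" "u j ~= 0" "sum u S : leading U M (v j)" using IH by blast
    have ui: "u i ~= 0" "u i : leading U M (v i)" using False insert(4) by auto
    have "i ~= j" using j(1) insert(2) by auto
    hence "v i ~= v j" using insert(5) j ui by auto
    thus ?thesis unfolding sum using leading_add[OF ui(2) j(3)] leading_add[OF j(3) ui(2)] ui j
      by (cases "v i < v j") (auto simp: add.commute)
  qed
qed simp

text \<open>The common reduction of all cases. A sum of two elements is a monomial times a value in
  \<open>gen1 M\<close>, so any cancellation is covered by \<open>key\<close>. An infinitesimal
  element lies in \<open>gen0 M\<close>, so germs at such elements are again germs at
  \<open>M\<close>.\<close>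

lemma extension:
  assumes key: "ALL u:gen M. u = 0 | (EX v. u : leading U M v)"
  shows "EX E. analytic_subfield E & U <= E & M <= E"
proof (intro exI conjI)
  define E where "E = insert 0 (\<Union>v. leading U M v)"
  note MD = frameD(1,2)
  have genE: "gen M <= E" using key by (auto simp: E_def)
  show sub: "U <= E" using leading_monomial frameD(3) by (fastforce simp: E_def)
  show "M <= E" using gen0_incl[OF MD] gen0_gen1 gen1_gen genE by blast
  have goodE: "E <= insert 0 good" using leading_good by (auto simp: E_def)
  have mult: "x * y : E" if "x : E" "y : E" for x y using that leading_mult by (fastforce simp: E_def)
  have inv: "EX y:E. x * y = 1" if x: "x : E" "x : good" for x
  proof -
    obtain psi w where u: "x = psi * (1 + w)" "psi : U" "psi : good" "w : gen0 M"
      using x zero_not_good unfolding E_def leading_def by auto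
    obtain y where y: "y : U" "psi * y = 1" using frameD(7)[OF u(2,3)] by blast
    have yg: "y : good" using val_inverse[OF u(3) y(2)] by simp
    obtain w' where w': "w' : gen0 M" "(1 + w) * (1 + w') = 1"
      using gen1_unit[OF MD u(4), of 1] by (auto simp: kc_simps)
    have "x * (y * (1 + w')) = 1" unfolding u(1) using y(2) w'(2) by (metis mult.assoc mult.left_commute mult.right_neutral)
    moreover have "y * (1 + w') : E" using leadingI[OF y(1) yg w'(1)] by (auto simp: E_def)
    ultimately show ?thesis by blast
  qed
  have add: "x + y : E" if xy: "x : E" "y : E" "x ~= 0" "y ~= 0" "val x <= val y" for x y
  proof -
    obtain psi w where u: "x = psi * (1 + w)" "psi : U" "psi : good" "w : gen0 M"
      using xy unfolding E_def leading_def by auto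
    obtain psi' w' where u': "y = psi' * (1 + w')" "psi' : U" "psi' : good" "w' : gen0 M"
      using xy unfolding E_def leading_def by auto
    have "val x = val psi" "val y = val psi'"
      using leading_good[OF leadingI[OF u(2-4)]] leading_good[OF leadingI[OF u'(2-4)]] u(1) u'(1) by auto
    obtain q where q: "q : U" "q : good" "psi' = psi * q" "val q = val psi' - val psi"
      by (rule frame_quotient[OF u(2,3) u'(2,3)])
    have "0 <= val q" using q(4) xy(5) `val x = val psi` `val y = val psi'` by simp
    then obtain r where r: "q - kc r : gen0 M" using frameD(8)[OF q(1,2)] by blast
    have "EX r. EX v:gen0 M. q = kc r + v" by (rule exI[of _ r], rule bexI[OF _ r]) simp
    hence "q : gen1 M" by (rule iffD2[OF gen1_decomp[OF MD]])
    moreover have one: "1 : gen1 M" using gen_kc[OF MD, of 1] by (simp add: kc_simps)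
    ultimately have "(1 + w) + q * (1 + w') : gen1 M"
      using gen0_gen1[OF u(4)] gen0_gen1[OF u'(4)] by (intro gen_closed(3,4)[OF MD]) auto
    hence "(1 + w) + q * (1 + w') : E" using gen1_gen genE by blast
    hence "psi * ((1 + w) + q * (1 + w')) : E" using mult sub u(2) by blast
    thus ?thesis unfolding u(1) u'(1) q(3) by (simp add: algebra_simps)
  qed
  have "E Int inf <= gen0 M"
  proof
    fix x assume x: "x : E Int inf"
    show "x : gen0 M"
    proof (cases "x = 0")
      case False
      then obtain psi w where u: "x = psi * (1 + w)" "psi : U" "psi : good" "w : gen0 M"
        using x unfolding E_def leading_def by auto
      have "x : good" "val x = val psi" using leading_good[OF leadingI[OF u(2-4)]] u(1) by auto
      hence "psi : gen0 M" using frame_infinitesimal[OF u(2,3)] good_inf x by auto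
      hence "psi + psi * w : gen0 M" by (intro gen_closed(5,6)[OF MD] gen0_gen1 u)
      thus ?thesis unfolding u(1) by (simp add: algebra_simps)
    qed (simp add: gen0_0[OF MD])
  qed
  hence "gen (E Int inf) <= gen M" using gen_compose(1)[OF MD] unfolding gen_def[of "E Int inf"] by blast
  hence "gen (E Int inf) <= E" using genE by blast
  moreover have "x + y : E" if "x : E" "y : E" for x y
    using add[of x y] add[of y x] that linear[of "val x" "val y"] by (cases "x = 0"; cases "y = 0") (auto simp: add.commute)
  ultimately show "analytic_subfield E"
    unfolding analytic_subfield_def using goodE mult inv by (auto simp: E_def)
qed

end

section \<open>Arithmetic inside an analytic subfield\<close>

context
  fixes E :: "'p set"
  assumes sf: "analytic_subfield E"
begin

abbreviation "small == E Int inf"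

lemma subfieldD: "E <= insert 0 good" "0 : E" "x : E ==> y : E ==> x + y : E" "x : E ==> y : E ==> x * y : E"
  "x : E ==> x : good ==> EX y:E. x * y = 1" "gen small <= E"
  using sf unfolding analytic_subfield_def by blast+

lemma smallD: "small <= inf" "0 : small" using subfieldD(2) zero_inf by auto

lemma subfield_kc: "kc r : E" using gen_kc[OF smallD, of r] gen1_gen subfieldD(6) by blast

lemma subfield_one: "1 : E" using subfield_kc[of 1] by (simp add: kc_simps)

lemma subfield_uminus: "x : E ==> - x : E"
  using subfieldD(4)[OF subfield_kc[of "-1"], of x] by (simp add: kc_simps)

lemma subfield_minus: "x : E ==> y : E ==> x - y : E" using subfieldD(3)[OF _ subfield_uminus, of x y] by simp

lemma subfield_sum: "(!!i. i : S ==> f i : E) ==> sum f S : E"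
  by (induction S rule: infinite_finite_induct) (auto simp: subfieldD)

lemma subfield_power: "x : E ==> x ^ n : E" by (induction n) (auto simp: subfieldD subfield_one)

lemma gen0_small: "gen0 small = small"
  using gen0_incl[OF smallD] gen0_inf[OF smallD(1)] gen0_gen1 gen1_gen subfieldD(6) by blast

lemma subfield_good: "x : E ==> x ~= 0 ==> x : good" using subfieldD(1) by blast

lemma subfield_residue:
  assumes x: "x : E" "x : good" "0 <= val x" shows "EX r. x - kc r : small"
proof (cases "val x = 0")
  case True
  have "ALL r. x - kc r : insert 0 good" using subfield_minus[OF x(1) subfield_kc] subfieldD(1) by blast
  thus ?thesis using residue[OF x(2) True] subfield_minus[OF x(1) subfield_kc] by blast
next
  case False
  hence "x : inf" using good_inf[OF x(2)] x(3) by simp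
  thus ?thesis using x(1) by (intro exI[of _ 0]) (simp add: kc_simps)
qed

lemma subfield_gen1: "x : E ==> x : good ==> 0 <= val x ==> x : gen1 small"
proof -
  assume "x : E" "x : good" "0 <= val x"
  then obtain r where r: "x - kc r : gen0 small" using subfield_residue gen0_small by blast
  have "EX r. EX v:gen0 small. x = kc r + v" by (rule exI[of _ r], rule bexI[OF _ r]) simp
  thus ?thesis by (rule iffD2[OF gen1_decomp[OF smallD]])
qed

lemma subfield_quotient:
  assumes "x : E" "x : good" "y : E"
  obtains q where "q : E" "y = x * q" "y ~= 0 ==> q : good & val q = val y - val x"
proof -
  obtain z where z: "z : E" "x * z = 1" using subfieldD(5)[OF assms(1,2)] by blast
  have zg: "z : good" "val z = - val x" using val_inverse[OF assms(2) z(2)] by auto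
  show ?thesis
  proof (rule that[of "z * y"])
    show "y = x * (z * y)" using z(2) by (simp add: mult.assoc[symmetric])
    assume "y ~= 0"
    hence "y : good" using subfield_good assms by blast
    thus "z * y : good & val (z * y) = val y - val x" using zg good_mult val_mult by simp
  qed (use subfieldD(4) z assms in auto)
qed

text \<open>A nonzero \<open>alpha i\<close> of least value divides all the others with integral
  quotients.\<close>

lemma dominating:
  fixes N :: nat
  assumes "ALL j<N. alpha j : E"
  shows "(ALL j<N. alpha j = 0) | (EX i<N. alpha i : good & (ALL j<N. EX q:gen1 small Int E. alpha j = alpha i * q))"
proof (cases "ALL j<N. alpha j = 0")
  case False
  define J where "J = {j. j < N & alpha j ~= 0}"
  have J: "finite J" "J ~= {}" using False by (auto simp: J_def)
  obtain i where i: "i : J" "ALL j:J. val (alpha i) <= val (alpha j)"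
    using ex_min_if_finite[of "(%j. val (alpha j)) ` J"] J by (force simp: not_less)
  have ig: "i < N" "alpha i : E" "alpha i : good" using i assms subfield_good by (auto simp: J_def)
  have "EX q:gen1 small Int E. alpha j = alpha i * q" if j: "j < N" for j
  proof (cases "alpha j = 0")
    case True
    have "0 : gen1 small" using gen_kc[OF smallD, of 0] by (simp add: kc_simps)
    thus ?thesis using True subfieldD(2) by (intro bexI[of _ 0]) auto
  next
    case False
    obtain q where q: "q : E" "alpha j = alpha i * q" "alpha j ~= 0 ==> q : good & val q = val (alpha j) - val (alpha i)"
      by (rule subfield_quotient[OF ig(2,3), of "alpha j"]) (use assms j in auto)
    have "val (alpha i) <= val (alpha j)" using i j False by (auto simp: J_def)
    hence "q : gen1 small" using q False by (intro subfield_gen1) auto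
    thus ?thesis using q by blast
  qed
  thus ?thesis using ig by blast
qed simp

text \<open>Over an analytic subfield the domination hypothesis holds: the coefficients lie in
  \<open>E\<close>, their quotients by one of least value are integral, and an integral element is a
  real number plus an infinitesimal of \<open>E\<close>.\<close>

lemma subfield_noetherian:
  assumes z: "z : inf" and u: "u : gen (insert z small)"
  shows "u = 0 | (EX alpha:E Int good. EX s. EX v:regular small z s. u = alpha * v)"
proof -
  have "u = 0 | (EX alpha:gen small. alpha ~= 0 & (EX s. EX v:regular small z s. u = alpha * v))"
  proof (rule strong_noetherian[OF smallD z one_not_inf u])
    fix N :: nat and alpha :: "nat => 'p"
    assume "ALL j<N. alpha j : gen small"
    hence "ALL j<N. alpha j : E" using subfieldD(6) by blast
    from dominating[OF this] show "(ALL j<N. alpha j = 0) |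
      (EX i<N. alpha i ~= 0 & (ALL x. alpha i * x = alpha i --> x = 1) & (ALL j<N. EX r. EX eta:small. alpha j = alpha i * (kc r + eta)))"
    proof
      assume "EX i<N. alpha i : good & (ALL j<N. EX q:gen1 small Int E. alpha j = alpha i * q)"
      then obtain i where i: "i < N" "alpha i : good" "ALL j<N. EX q:gen1 small Int E. alpha j = alpha i * q" by blast
      have "EX r. EX eta:small. alpha j = alpha i * (kc r + eta)" if "j < N" for j
      proof -
        obtain q where q: "q : gen1 small" "alpha j = alpha i * q" using i(3) `j < N` by blast
        thus ?thesis using iffD1[OF gen1_decomp[OF smallD] q(1)] gen0_small by auto
      qed
      moreover have "x = 1" if "alpha i * x = alpha i" for x using good_cancel[OF i(2), of x 1] that by simp
      moreover have "alpha i ~= 0" using i(2) zero_not_good by auto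
      ultimately show ?thesis using i(1) by blast
    qed simp
  qed
  thus ?thesis using subfieldD(6) subfield_good by blast
qed

end

end

section \<open>Torsion extensions\<close>

definition power_span :: "'a::comm_ring_1 set => 'a => nat => 'a set" where
  "power_span Q X N = {SUM k<N. q k * X ^ k |q. ALL k<N. q k : Q}"

text \<open>With \<open>X ^ N\<close> in \<open>Q\<close> all higher powers of \<open>X\<close>
  reduce to exponents below \<open>N\<close>, so the span is a ring.\<close>

lemma power_span_closed:
  fixes X :: "'a::comm_ring_1"
  assumes N: "0 < N" and Q': "0 : Q" "ALL x:Q. ALL y:Q. x + y : Q" "ALL x:Q. ALL y:Q. x * y : Q"
    and XN: "X ^ N : Q"
  shows "p : Q ==> p * X ^ i : power_span Q X N"
    and "x : power_span Q X N ==> y : power_span Q X N ==> x + y : power_span Q X N"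
    and "x : power_span Q X N ==> y : power_span Q X N ==> x * y : power_span Q X N"
    and "finite I ==> (ALL i:I. f i : power_span Q X N) ==> sum f I : power_span Q X N"
proof -
  have Q: "0 : Q" "!!x y. x : Q ==> y : Q ==> x + y : Q" "!!x y. x : Q ==> y : Q ==> x * y : Q"
    using Q' by blast+
  let ?S = "power_span Q X N"
  show mono: "p * X ^ i : ?S" if p: "p : Q" for p i
  proof -
    have pow: "p * (X ^ N) ^ m : Q" for m
    proof (induction m)
      case (Suc m)
      have "X ^ N * (p * (X ^ N) ^ m) : Q" by (rule Q(3)[OF XN Suc])
      thus ?case by (simp add: mult_ac)
    qed (simp add: p)
    have "X ^ i = X ^ (N * (i div N)) * X ^ (i mod N)" by (simp add: power_add[symmetric])
    hence "p * X ^ i = (p * (X ^ N) ^ (i div N)) * X ^ (i mod N)" by (simp add: power_mult mult.assoc)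
    also have "... = (SUM k<N. (if k = i mod N then p * (X ^ N) ^ (i div N) else 0) * X ^ k)"
      using N by (simp add: if_distrib[of "%x. x * _"] sum.delta cong: if_cong)
    finally show ?thesis unfolding power_span_def using pow Q(1)
      by (intro CollectI exI[of _ "%k. if k = i mod N then p * (X ^ N) ^ (i div N) else 0"]) auto
  qed
  show add: "x + y : ?S" if xy: "x : ?S" "y : ?S" for x y
  proof -
    obtain p q where pq: "ALL k<N. p k : Q" "ALL k<N. q k : Q" "x = (SUM k<N. p k * X ^ k)" "y = (SUM k<N. q k * X ^ k)"
      using xy unfolding power_span_def by blast
    have "x + y = (SUM k<N. (p k + q k) * X ^ k)" by (simp add: pq sum.distrib algebra_simps)
    moreover have "ALL k<N. p k + q k : Q" using pq Q(2) by blast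
    ultimately show ?thesis unfolding power_span_def by (intro CollectI exI[of _ "%k. p k + q k"]) blast
  qed
  have sum: "sum f I : ?S" if "finite I" "ALL i:I. f i : ?S" for f :: "'i => 'a" and I
    using that mono[OF Q(1), of 0] by (induction I rule: finite_induct) (auto simp: add)
  thus "finite I ==> (ALL i:I. f i : ?S) ==> sum f I : ?S" by blast
  show "x * y : ?S" if xy: "x : ?S" "y : ?S" for x y
  proof -
    obtain p q where pq: "ALL k<N. p k : Q" "ALL k<N. q k : Q" "x = (SUM k<N. p k * X ^ k)" "y = (SUM k<N. q k * X ^ k)"
      using xy unfolding power_span_def by blast
    have xy: "x * y = (SUM j:{..<N} \<times> {..<N}. (p (fst j) * q (snd j)) * X ^ (fst j + snd j))"
      unfolding pq(3,4) sum_product sum.cartesian_product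
      by (intro sum.cong refl) (auto simp: power_add mult_ac)
    show ?thesis unfolding xy using pq by (intro sum ballI mono Q(3)) auto
  qed
qed

context germ_model
begin

lemma kc_of_nat: "kc (of_nat n) = of_nat n" by (induction n) (simp_all add: kc_simps)

lemma inf_closed:
  "x : inf ==> y : inf ==> x + y : inf" "x : inf ==> y : inf ==> x * y : inf" "x : inf ==> kc r * x : inf"
  "x : inf ==> - x : inf" "x : inf ==> y : inf ==> x - y : inf"
proof -
  have i: "gen0 inf = inf" using gen0_inf[OF order_refl] gen0_incl[OF order_refl zero_inf] by blast
  note c = gen_closed[OF order_refl zero_inf]
  show a: "x : inf ==> y : inf ==> x + y : inf" for x y using c(5)[of x y] i by simp
  show "x : inf ==> y : inf ==> x * y : inf" using c(6)[OF gen0_gen1, of x y] i by simp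
  show k: "x : inf ==> kc r * x : inf" for x r using c(6)[OF gen_kc[OF order_refl zero_inf], of x r] i by simp
  show m: "x : inf ==> - x : inf" for x using k[of x "-1"] by (simp add: kc_simps)
  show "x : inf ==> y : inf ==> x - y : inf" using a[of x "- y"] m[of y] by simp
qed

lemma inf_power: "x : inf ==> 0 < n ==> x ^ n : inf"
proof (induction n)
  case (Suc n)
  thus ?case by (cases "n = 0") (auto intro: inf_closed(2))
qed simp

lemma gen_finite:
  assumes M: "M <= inf" "0 : M" and u: "u : gen M"
  shows "EX Z. finite Z & Z <= M & u : gen (insert 0 Z)"
proof -
  obtain f n a where f: "f : germ n" "range a <= M" "u = ev f a" using u unfolding gen_def by blast
  let ?a = "%i. if i < n then a i else 0"
  have ra: "range ?a <= insert 0 (a ` {..<n})" by auto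
  have "u = ev f ?a" unfolding f(3) by (rule ev_cong[OF f(1)]) (use f(2) M in "auto simp: subset_iff zero_inf")
  hence "u : gen (insert 0 (a ` {..<n}))" unfolding gen_def using f(1) ra by blast
  thus ?thesis using f(2) by (intro exI[of _ "a ` {..<n}"]) auto
qed

text \<open>If \<open>z ^ m\<close> is itself a value over \<open>A\<close>, this is a monic
  equation for \<open>z\<close> with a single coefficient, in degree 0, and
  \<open>monic_elimination\<close> makes every new value a polynomial in \<open>z\<close> over
  \<open>gen A\<close>.\<close>

lemma gen_insert_closed:
  assumes A: "A <= inf" "0 : A" and z: "z : inf" "z : S" and m: "0 < m" "z ^ m : gen0 A"
    and S: "1 : S" "!!x y. x : S ==> y : S ==> x * y : S"
      "!!f I. finite (I :: nat set) ==> ALL i:I. f i : S ==> sum f I : S" "gen A <= S"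
  shows "gen (insert z A) <= S"
proof
  fix u assume u: "u : gen (insert z A)"
  have p: "ALL i<m. (if i = 0 then z ^ m else 0) : gen0 A" using m gen0_0[OF A] by auto
  have "z ^ m = (SUM i<m. (if i = 0 then z ^ m else 0) * z ^ i)"
    using m by (simp add: if_distrib[of "%x. x * _"] sum.delta cong: if_cong)
  from monic_elimination[OF A z(1) p this u]
  obtain q where q: "ALL i<m. q i : gen A" "u = (SUM i<m. q i * z ^ i)" by blast
  have "z ^ i : S" for i using S z by (induction i) auto
  thus "u : S" unfolding q(2) using q(1) S(4) by (intro S(3)) (auto intro!: S(2))
qed

text \<open>Hensel's lemma by preparation. With \<open>w\<close> as a second variable,
  \<open>(1 + xi_0)^N - 1 - w\<close> is regular of degree 1, because its linear coefficient
  \<open>N\<close> is a nonzero real. The remainder of the preparation, evaluated at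
  \<open>w\<close>, is the root.\<close>

lemma nth_root:
  assumes w: "w : inf" and N: "0 < N"
  shows "EX eta:inf. (1 + eta) ^ N = 1 + w"
proof -
  define R :: "nat => 'w series" where "R = (%k. if k = 0 then - hvar 0 else hconst (of_nat (N choose k)))"
  define f where "f = (SUM k<=N. hshift (R k) * hvar 0 ^ k)"
  have R: "R k : bgerm 1" for k by (auto simp: R_def intro!: bgerm_closed)
  have f: "f : bgerm 2" unfolding f_def
    using bgerm_closed(10)[OF R] by (intro bgerm_sum bgerm_closed(7,9)) (auto simp: numeral_2_eq_2 intro!: bgerm_closed)
  have "mps_coeff (hahn_coeff f 0) (single 0 j) = (SUM k<=N. if j = k then res (R k) else 0)" for j
    unfolding f_def hahn_coeff_sum mps_coeff_sum
    by (rule sum.cong[OF refl]) (use coeff_shift_power[OF bgerm_integral[OF R]] in simp)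
  hence "mps_regular 1 (hahn_coeff f 0)" using N by (auto simp: mps_regular_def R_def simp del: single_zero)
  then obtain Q P where QP: "Q : bgerm 2" "res Q ~= 0" "ALL i<1. P i : bgerm 1 & res (P i) = 0"
    "hvar 0 ^ 1 = Q * f + (SUM i<1. hshift (P i) * hvar 0 ^ i)" using germ_Weierstrass[OF f, of 1] by auto
  let ?b = "%_::nat. w"
  define eta where "eta = ev (P 0) ?b"
  have b: "range ?b <= inf" using w by auto
  have P: "P 0 : bgerm 1" "res (P 0) = 0" using QP(3) by auto
  have eta: "eta : inf" unfolding eta_def by (rule ev_inf[OF P b])
  define e where "e = case_nat eta ?b"
  have e: "range e <= inf" "e 0 = eta" "(%i. e (Suc i)) = ?b" using eta w by (auto simp: e_def split: nat.splits)
  note Qg = bgerm_germ[OF QP(1)] and fg = bgerm_germ[OF f] and Pg = bgerm_germ[OF P(1)]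
  have Ps: "hshift (P 0) : germ 2" using germ_shift[OF Pg] by (simp add: numeral_2_eq_2)
  have eq: "hvar 0 = Q * f + hshift (P 0)" using QP(4) by simp
  have "eta = ev (Q * f + hshift (P 0)) e" unfolding eq[symmetric] ev_var[OF e(1)] e(2) ..
  also have "... = ev Q e * ev f e + eta"
    using ev_add[OF germ_mult[OF Qg fg] Ps e(1)] ev_mult[OF Qg fg e(1)] ev_shift[OF Pg e(1)] by (simp add: e(3) eta_def)
  finally have z: "ev Q e * ev f e = 0" by simp
  obtain Q' where Q': "Q' : bgerm 2" "Q * Q' = 1" using bgerm_unit[OF QP(1,2)] by blast
  have "ev Q e * ev Q' e = 1" using ev_mult[OF Qg bgerm_germ[OF Q'(1)] e(1)] Q'(2) ev_one[OF e(1)] by simp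
  hence fz: "ev f e = 0" using z by (metis mult.commute mult.left_commute mult.right_neutral mult_zero_right)
  have v: "(hvar 0 :: 'w series) : germ 2" by simp
  have S: "hshift (R k) : germ 2" "hvar 0 ^ k : germ 2" for k
    using germ_shift[OF bgerm_germ[OF R]] germ_power[OF v] by (simp_all add: numeral_2_eq_2)
  have "ev (hshift (R k) * hvar 0 ^ k) e = ev (R k) ?b * eta ^ k" for k
    using ev_mult[OF S e(1)] ev_shift[OF bgerm_germ[OF R] e(1)] ev_power[OF v e(1)] by (simp add: e ev_var[OF e(1)])
  hence "ev f e = (SUM k<=N. ev (R k) ?b * eta ^ k)"
    unfolding f_def using ev_sum[of "{..N}" "%k. hshift (R k) * hvar 0 ^ k" 2 e] germ_mult[OF S] e(1) by simp
  moreover have "ev (R k) ?b = (if k = 0 then - w else of_nat (N choose k))" for k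
    using ev_uminus[of "hvar 0" 1 ?b] b by (simp add: R_def ev_var ev_const kc_of_nat)
  ultimately have "(SUM k<=N. (if k = 0 then - w else of_nat (N choose k)) * eta ^ k) = 0" using fz by simp
  moreover have "(1 + eta) ^ N = (SUM k<=N. of_nat (N choose k) * eta ^ k)"
    using binomial_ring[of eta 1 N] by (simp add: add.commute)
  moreover have "(SUM k<=N. of_nat (N choose k) * eta ^ k) - (SUM k<=N. (if k = 0 then - w else of_nat (N choose k)) * eta ^ k)
    = (SUM k<=N. if k = 0 then 1 + w else 0)" unfolding sum_subtractf[symmetric] by (rule sum.cong) auto
  ultimately have "(1 + eta) ^ N = 1 + w" by simp
  thus ?thesis using eta by blast
qed

end

context valued_model
begin

text \<open>The monomials over \<open>E\<close>. In the uses \<open>Y\<close> is the inverse of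
  \<open>X\<close>, so that natural exponents cover all integer powers.\<close>

definition adjoin :: "'p set => 'p => 'p => 'p set" where
  "adjoin E X Y = {p * X ^ i * Y ^ j |p i j. p : E}"

lemma adjoinI: "p : E ==> p * X ^ i * Y ^ j : adjoin E X Y" unfolding adjoin_def by blast

context
  fixes E X Y
  assumes sf: "analytic_subfield E" and X: "X : good" "X * Y = 1"
begin

lemma subset_adjoin: "E <= adjoin E X Y" and adjoin_X: "X : adjoin E X Y"
  using adjoinI[of _ E X 0 Y 0] adjoinI[OF subfield_one[OF sf], of X 1 Y 0] by auto

lemma Y_good: "Y : good" using val_inverse[OF X] by simp

text \<open>By hypothesis the monomials of value 0 lie in \<open>E\<close> and have their residues
  there. Those of positive value are infinitesimal and belong to the chosen set of
  arguments.\<close>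

lemma frame_adjoin:
  assumes "ALL p:E Int good. ALL i j. val (p * X ^ i * Y ^ j) = 0 --> p * X ^ i * Y ^ j : E"
  shows "frame (adjoin E X Y) (adjoin E X Y Int inf)"
proof -
  let ?U = "adjoin E X Y" and ?M = "adjoin E X Y Int inf"
  have m: "?M <= inf" "0 : ?M" using zero_inf subfieldD(2)[OF sf] subset_adjoin by auto
  have "x * y : ?U" if xy: "x : ?U" "y : ?U" for x y
  proof -
    obtain p i j q k l where x: "x = p * X ^ i * Y ^ j" "p : E" and y: "y = q * X ^ k * Y ^ l" "q : E"
      using xy unfolding adjoin_def by blast
    have "x * y = (p * q) * X ^ (i + k) * Y ^ (j + l)" by (simp add: x y power_add mult_ac)
    thus ?thesis using adjoinI[OF subfieldD(4)[OF sf x(2) y(2)]] by simp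
  qed
  moreover have gd: "p : good" if "p * X ^ i * Y ^ j : good" "p : E" for p i j
    using that subfield_good[OF sf] zero_not_good by (cases "p = 0") auto
  have "EX y:?U. x * y = 1" if x': "x : ?U" "x : good" for x
  proof -
    obtain p i j where x: "x = p * X ^ i * Y ^ j" "p : E" using x' unfolding adjoin_def by blast
    obtain q where q: "q : E" "p * q = 1" using subfieldD(5)[OF sf x(2)] gd x x'(2) by blast
    have "x * (q * X ^ j * Y ^ i) = (p * q) * (X * Y) ^ i * (X * Y) ^ j" by (simp add: x power_mult_distrib mult_ac)
    thus ?thesis using q X(2) adjoinI[OF q(1)] by (intro bexI[of _ "q * X ^ j * Y ^ i"]) auto
  qed
  moreover have "EX r. x - kc r : gen0 ?M" if x': "x : ?U" "x : good" "0 <= val x" for x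
  proof (cases "val x = 0")
    case True
    obtain p i j where x: "x = p * X ^ i * Y ^ j" "p : E" using x' unfolding adjoin_def by blast
    have "x : E" using assms gd x x'(2) True by blast
    then obtain r where "x - kc r : E Int inf" using subfield_residue[OF sf _ x'(2,3)] by blast
    thus ?thesis using subset_adjoin gen0_incl[OF m] by blast
  next
    case False
    hence "x : ?M" using x' good_inf by auto
    thus ?thesis using gen0_incl[OF m] by (intro exI[of _ 0]) (auto simp: kc_simps)
  qed
  moreover have "?U <= insert 0 good"
  proof
    fix x assume "x : ?U"
    then obtain p i j where x: "x = p * X ^ i * Y ^ j" "p : E" unfolding adjoin_def by blast
    show "x : insert 0 good"
    proof (cases "p = 0")
      case False
      thus ?thesis using subfield_good[OF sf x(2)] x(1) good_mult good_power[OF X(1)] good_power[OF Y_good] by auto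
    qed (simp add: x)
  qed
  moreover have "range kc <= ?U" using subset_adjoin subfield_kc[OF sf] by auto
  ultimately show ?thesis unfolding frame_def using m by blast
qed

lemma val_power_distinct:
  assumes p: "p : E" "q : E" and ij: "i < j" and nz: "p * X ^ i ~= 0" "q * X ^ j ~= 0"
    and eq: "val (p * X ^ i) = val (q * X ^ j)"
  shows "EX t:E Int good. val (t * X ^ (j - i)) = 0"
proof -
  have g: "p : good" "q : good" using subfield_good[OF sf p(1)] subfield_good[OF sf p(2)] nz by fastforce+
  have q0: "q ~= 0" using g zero_not_good by auto
  obtain t where t: "t : E" "q = p * t" "q ~= 0 ==> t : good & val t = val q - val p"
    using subfield_quotient[OF sf p(1) g(1) p(2)] by blast
  have tg: "t : good" using t(3) q0 by simp
  have "q * X ^ j = (p * X ^ i) * (t * X ^ (j - i))" using ij by (simp add: t(2) power_add[symmetric] mult_ac)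
  hence "val (q * X ^ j) = val (p * X ^ i) + val (t * X ^ (j - i))"
    using val_mult good_mult g tg good_power[OF X(1)] by simp
  thus ?thesis using eq t(1) tg by auto
qed

end

text \<open>All values lie in the span of \<open>1, X, ..., X^(N-1)\<close> over \<open>E\<close>.
  By \<open>indep\<close> no smaller positive power of \<open>X\<close> has a value from
  \<open>E\<close>, so the nonzero terms of such a sum have distinct values and the one of least
  value leads.\<close>

lemma torsion_extension:
  assumes sf: "analytic_subfield E" and X: "X : good" and c: "c : E" "c : good" and XN: "X ^ N = c" and N: "0 < N"
    and indep: "ALL p:E Int good. ALL j. 0 < j --> j < N --> val (p * X ^ j) ~= 0"
  shows "EX E'. analytic_subfield E' & E <= E' & X : E'"
proof -
  obtain d where d: "d : E" "c * d = 1" using subfieldD(5)[OF sf c] by blast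
  define Y where "Y = d * X ^ (N - 1)"
  have "X * Y = X ^ N * d" using N by (cases N) (simp_all add: Y_def mult_ac)
  hence XY: "X * Y = 1" using XN d by simp
  let ?U = "adjoin E X Y" and ?M = "adjoin E X Y Int inf"
  have red: "EX q:E. p * X ^ i = q * X ^ (i mod N)" if p: "p : E" for p i
  proof -
    have "X ^ i = X ^ (N * (i div N)) * X ^ (i mod N)" by (simp add: power_add[symmetric])
    also have "X ^ (N * (i div N)) = c ^ (i div N)" by (simp add: power_mult XN)
    finally have "p * X ^ i = (p * c ^ (i div N)) * X ^ (i mod N)" by (simp add: mult.assoc)
    thus ?thesis using subfieldD(4)[OF sf p subfield_power[OF sf c(1)]] by blast
  qed
  have redY: "EX q:E. p * X ^ i * Y ^ j = q * X ^ ((i + (N - 1) * j) mod N)" if p: "p : E" for p i j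
  proof -
    have "p * X ^ i * Y ^ j = (p * d ^ j) * X ^ (i + (N - 1) * j)" by (simp only: Y_def power_add power_mult power_mult_distrib mult.assoc mult.left_commute)
    thus ?thesis using red[OF subfieldD(4)[OF sf p subfield_power[OF sf d(1)]]] by metis
  qed
  have "p * X ^ i * Y ^ j : E" if p: "p : E Int good" "val (p * X ^ i * Y ^ j) = 0" for p i j
  proof -
    let ?k = "(i + (N - 1) * j) mod N"
    obtain q where q: "q : E" "p * X ^ i * Y ^ j = q * X ^ ?k" using redY p(1) by blast
    have "p * X ^ i * Y ^ j : good" using p(1) good_mult good_power[OF X] good_power[OF Y_good[OF sf X XY]] by auto
    hence "q : good" using q subfield_good[OF sf q(1)] zero_not_good by (cases "q = 0") auto
    hence "?k = 0" using indep p(2) q mod_less_divisor[OF N] by (metis IntI gr0I)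
    thus ?thesis using q by simp
  qed
  hence fr: "frame ?U ?M" by (intro frame_adjoin[OF sf X XY] ballI allI impI)
  let ?S = "power_span E X N"
  have "ALL x:E. ALL y:E. x + y : E" "ALL x:E. ALL y:E. x * y : E" "X ^ N : E" using subfieldD(3,4)[OF sf] XN c by auto
  note S = power_span_closed[OF N subfieldD(2)[OF sf] this]
  have S_adjoin: "?U <= ?S"
  proof
    fix x assume "x : ?U"
    then obtain p i j where x: "x = p * X ^ i * Y ^ j" "p : E" unfolding adjoin_def by blast
    thus "x : ?S" using redY[OF x(2)] S(1) by metis
  qed
  \<comment> \<open>A value involves finitely many of the new infinitesimals. They are added one at
    a time; the \<open>N\<close>-th power of each lies in \<open>E\<close>, which provides the monic
    equation.\<close>
  have S_gen: "gen (Z Un (E Int inf)) <= ?S" if "finite Z" "Z <= ?M" for Z using that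
  proof (induction Z rule: finite_induct)
    case empty
    show ?case using subfieldD(6)[OF sf] S(1)[of _ 0] by auto
  next
    case (insert z Z)
    let ?A = "Z Un (E Int inf)"
    have A: "?A <= inf" "0 : ?A" using insert(4) smallD[OF sf] by auto
    have z: "z : ?U" "z : inf" using insert(4) by auto
    obtain p i j where zx: "z = p * X ^ i * Y ^ j" "p : E" using z(1) unfolding adjoin_def by blast
    have "z ^ N = p ^ N * (X ^ N) ^ i * (d ^ N * (X ^ N) ^ (N - 1)) ^ j"
      by (simp add: zx Y_def power_mult_distrib power_mult[symmetric] mult_ac)
    also have "... : E" unfolding XN by (intro subfieldD(4)[OF sf] subfield_power[OF sf] zx c d)
    finally have zN: "z ^ N : gen0 ?A" using gen0_incl[OF A] inf_power[OF z(2) N] by blast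
    have "z : ?S" "1 : ?S" "gen ?A <= ?S" using z(1) S_adjoin S(1)[OF subfield_one[OF sf], of 0] insert by auto
    from gen_insert_closed[OF A z(2) this(1) N zN this(2) S(3,4) this(3)] show ?case by simp
  qed
  have "u = 0 | (EX v. u : leading ?U ?M v)" if u: "u : gen ?M" for u
  proof -
    have M: "?M <= inf" "0 : ?M" using frameD(1,2)[OF fr] by auto
    obtain Z where Z: "finite Z" "Z <= ?M" "u : gen (insert 0 Z)" using gen_finite[OF M u] by blast
    have "insert 0 Z <= Z Un (E Int inf)" using smallD[OF sf] by auto
    hence "u : ?S" using S_gen[OF Z(1,2)] gen_mono Z(3) by blast
    then obtain q where q: "ALL k<N. q k : E" "u = (SUM k<N. q k * X ^ k)" unfolding power_span_def by blast
    have "ALL k:{..<N}. q k * X ^ k = 0 | q k * X ^ k : leading ?U ?M (val (q k * X ^ k))"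
    proof
      fix k assume "k : {..<N}"
      hence "q k * X ^ k : ?U" using q(1) adjoinI[of "q k" E X k Y 0] by simp
      thus "q k * X ^ k = 0 | q k * X ^ k : leading ?U ?M (val (q k * X ^ k))"
        using frameD(3)[OF fr] leading_monomial[OF fr] by blast
    qed
    moreover have *: "val (q i * X ^ i) ~= val (q j * X ^ j)" if ij: "i < j" "j < N" "q i * X ^ i ~= 0" "q j * X ^ j ~= 0" for i j
    proof
      assume "val (q i * X ^ i) = val (q j * X ^ j)"
      then obtain t where "t : E Int good" "val (t * X ^ (j - i)) = 0"
        using val_power_distinct[OF sf X XY _ _ ij(1,3,4)] q(1) ij by auto
      thus False using indep ij by auto
    qed
    have "ALL i:{..<N}. ALL j:{..<N}. i ~= j --> q i * X ^ i ~= 0 --> q j * X ^ j ~= 0 --> val (q i * X ^ i) ~= val (q j * X ^ j)"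
      using *[symmetric] * by (metis lessThan_iff linorder_neqE_nat)
    ultimately show ?thesis using leading_sum[OF fr finite_lessThan, of N "%k. q k * X ^ k" "%k. val (q k * X ^ k)"] q(2) by blast
  qed
  then obtain E' where "analytic_subfield E'" "?U <= E'" using extension[OF fr] by blast
  thus ?thesis using subset_adjoin[OF sf X XY] adjoin_X[OF sf X XY] by blast
qed

end

section \<open>Immediate extensions\<close>

lemma polynomial_shift:
  fixes x a :: "'a::comm_ring_1"
  shows "(SUM i<=s. c i * (a + x) ^ i) = (SUM j<=s. (SUM i<=s. c i * of_nat (i choose j) * a ^ (i - j)) * x ^ j)"
proof -
  have "(a + x) ^ i = (SUM j<=s. of_nat (i choose j) * x ^ j * a ^ (i - j))" if "i <= s" for i
  proof -
    have "(a + x) ^ i = (SUM j<=i. of_nat (i choose j) * x ^ j * a ^ (i - j))"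
      using binomial_ring[of x a i] by (simp add: add.commute)
    also have "... = (SUM j<=s. of_nat (i choose j) * x ^ j * a ^ (i - j))"
      using that by (intro sum.mono_neutral_left) (auto, metis binomial_eq_0 mult_zero_left not_le of_nat_0)
    finally show ?thesis .
  qed
  hence "(SUM i<=s. c i * (a + x) ^ i) = (SUM i<=s. SUM j<=s. c i * (of_nat (i choose j) * x ^ j * a ^ (i - j)))"
    by (simp add: sum_distrib_left)
  also have "... = (SUM j<=s. SUM i<=s. c i * (of_nat (i choose j) * x ^ j * a ^ (i - j)))" by (rule sum.swap)
  also have "... = (SUM j<=s. (SUM i<=s. c i * of_nat (i choose j) * a ^ (i - j)) * x ^ j)"
    unfolding sum_distrib_right by (intro sum.cong refl) (simp add: mult_ac)
  finally show ?thesis .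
qed

context germ_model
begin

lemma gen_trans:
  assumes A: "A <= inf" "0 : A" and Z: "Z <= gen0 A"
  shows "gen Z <= gen A" "gen0 Z <= gen0 A"
proof -
  have Z': "range a <= gen0 A" if "range a <= Z" for a :: "nat => 'p" using that Z by (rule subset_trans)
  show "gen Z <= gen A"
  proof
    fix u assume "u : gen Z"
    then obtain f n a where "f : germ n" "range a <= Z" "u = ev f a" unfolding gen_def by blast
    thus "u : gen A" using gen_compose(1)[OF A Z'] by simp
  qed
  show "gen0 Z <= gen0 A"
  proof
    fix u assume "u : gen0 Z"
    then obtain f n a where "f : mgerm n" "range a <= Z" "u = ev f a" unfolding gen0_def by blast
    thus "u : gen0 A" using gen_compose(3)[OF A Z'] by simp
  qed
qed

text \<open>The coefficients below \<open>k\<close> have residue 0 and \<open>c k\<close> has not;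
  the terms above degree \<open>k\<close> are absorbed in the factor of
  \<open>z ^ k\<close>.\<close>

lemma regular_polynomial:
  assumes A: "A <= inf" "0 : A" and z: "z : inf" and c: "ALL j<=n. c j : gen1 A" and k: "k <= n" "c k ~: inf" "ALL j<k. c j : gen0 A"
  shows "(SUM j<=n. c j * z ^ j) : regular A z k"
proof -
  have iz: "insert z A <= inf" "0 : insert z A" "A <= insert z A" using A z by auto
  have zg: "z : gen0 (insert z A)" using gen0_incl[OF iz(1,2)] by blast
  obtain r v where rv: "v : gen0 A" "c k = kc r + v" using c k(1) gen1_decomp[OF A, of "c k"] by blast
  have r: "r ~= 0"
  proof
    assume "r = 0"
    hence "c k : inf" using rv gen0_inf[OF A(1)] by (auto simp: kc_simps)
    thus False using k(2) by simp
  qed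
  define w where "w = (SUM j:{Suc k..n}. c j * z ^ (j - k))"
  have "c j * z ^ (j - k) : gen0 (insert z A)" if j: "j : {Suc k..n}" for j
  proof -
    have "c j : gen1 (insert z A)" using c j gen1_mono[OF iz(3)] by auto
    moreover have "j - k = Suc (j - Suc k)" using j by auto
    hence "c j * z ^ (j - k) = (c j * z ^ (j - Suc k)) * z" by (simp add: mult_ac)
    ultimately show ?thesis using gen_closed(6)[OF iz(1,2) gen_closed(4)[OF iz(1,2) _ gen1_power[OF iz(1,2) gen0_gen1[OF zg]]] zg] by simp
  qed
  hence "w : gen0 (insert z A)" unfolding w_def by (rule gen0_sum[OF iz(1,2)])
  hence "v + w : gen0 (insert z A)" using rv(1) gen0_mono[OF iz(3)] by (intro gen_closed(5)[OF iz(1,2)]) auto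
  from regularI[OF A z k(3) r this] have "(SUM j<k. c j * z ^ j) + z ^ k * (c k + w) : regular A z k" by (simp add: rv(2) add.assoc)
  moreover have "(SUM j<=n. c j * z ^ j) = (SUM j<k. c j * z ^ j) + z ^ k * (c k + w)"
  proof -
    have "w * z ^ k = (SUM j:{Suc k..n}. c j * z ^ j)" unfolding w_def sum_distrib_right
      by (rule sum.cong) (auto simp: mult.assoc simp flip: power_add)
    moreover have "{..n} = {..<k} Un {k} Un {Suc k..n}" using k(1) by auto
    hence "(SUM j<=n. c j * z ^ j) = (SUM j<k. c j * z ^ j) + c k * z ^ k + (SUM j:{Suc k..n}. c j * z ^ j)"
      using sum.union_disjoint[of "{..<k}" "{Suc k..n}" "%j. c j * z ^ j"] by (simp add: disjoint_iff)
    ultimately show ?thesis by (simp add: algebra_simps)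
  qed
  ultimately show ?thesis by simp
qed

lemma inf_sum: "(!!i. i : S ==> f i : inf) ==> sum f S : inf"
  by (induction S rule: infinite_finite_induct) (auto simp: inf_closed zero_inf)

end

context valued_model
begin

context
  fixes E :: "'p set" and X :: 'p
  assumes sf: "analytic_subfield E"
    and immediate: "ALL c:E. X - c : good & (EX r:E Int good. val r = val (X - c))"
begin

text \<open>The infinitesimal quotients of \<open>X - c\<close> by \<open>r\<close>: close-ups of
  \<open>X\<close> as seen from points of \<open>E\<close>.\<close>

definition fractions :: "'p set" where
  "fractions = {z : inf. EX c:E. EX r:E Int good. X = c + r * z}"

abbreviation (input) "thick == (E Int inf) Un fractions"

lemmas small = smallD[OF sf]

lemma thick: "thick <= inf" "0 : thick" using small by (auto simp: fractions_def)

lemma frame_thick: "frame E thick"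
proof -
  have "EX r. x - kc r : gen0 thick" if x: "x : E Int good" "0 <= val x" for x
    using subfield_residue[OF sf, of x] x gen0_incl[OF thick] by blast
  thus ?thesis unfolding frame_def
    by (intro conjI thick ballI impI) (use subfieldD[OF sf] subfield_kc[OF sf] in auto)
qed

text \<open>As the extension is immediate, \<open>X - c\<close> can be rescaled within
  \<open>E\<close> to value 0 and then has a nonzero real residue \<open>s\<close>. The rest is a
  fraction again, now centred at \<open>c + r * kc s\<close>.\<close>

lemma approximation:
  assumes c: "c : E"
  obtains r s z where "r : E" "r : good" "s ~= 0" "z : fractions" "X - c = r * (kc s + z)"
proof -
  obtain r where r: "r : E" "r : good" "val r = val (X - c)" using immediate c by blast
  obtain q where q: "q : E" "r * q = 1" using subfieldD(5)[OF sf r(1,2)] by blast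
  have qg: "q : good" "val q = - val r" using val_inverse[OF r(2) q(2)] by auto
  have Xc: "X - c : good" using immediate c by blast
  let ?y = "q * (X - c)"
  have y: "?y : good" "val ?y = 0" using good_mult[OF qg(1) Xc] val_mult[OF qg(1) Xc] qg r by auto
  \<comment> \<open>This is the premise of \<open>residue\<close>: the differences from reals are
    rescaled differences of \<open>X\<close> from elements of \<open>E\<close>.\<close>
  have "?y - kc t : good" for t
  proof -
    have "c + r * kc t : E" using subfieldD(3,4)[OF sf] c r subfield_kc[OF sf] by blast
    hence "X - (c + r * kc t) : good" using immediate by blast
    hence "q * (X - (c + r * kc t)) : good" by (rule good_mult[OF qg(1)])
    moreover have "q * (X - (c + r * kc t)) = ?y - (r * q) * kc t" by (simp add: algebra_simps)
    ultimately show ?thesis using q by simp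
  qed
  then obtain s where s: "?y - kc s : inf" using residue[OF y] by blast
  have "?y ~: inf" using good_inf[OF y(1)] y(2) by simp
  hence "s ~= 0" using s by (auto simp: kc_simps)
  have "r * ?y = (r * q) * (X - c)" by (simp only: mult.assoc)
  hence eq: "X - c = r * (kc s + (?y - kc s))" using q by simp
  have "X = (c + r * kc s) + r * (?y - kc s)" using eq by (simp add: algebra_simps)
  moreover have "c + r * kc s : E" using subfieldD(3,4)[OF sf] c r subfield_kc[OF sf] by blast
  ultimately have "?y - kc s : fractions" unfolding fractions_def using s r by blast
  thus ?thesis using that r `s ~= 0` eq by blast
qed

text \<open>The fraction whose denominator has the larger value is the closer view, and the other
  one is an affine function of it with coefficients in \<open>E\<close>. So finitely many fractions
  are controlled by a single one.\<close>

lemma fractions_directed: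
  assumes "y : fractions" "z : fractions"
  shows "y : gen0 (insert z (E Int inf)) | z : gen0 (insert y (E Int inf))"
proof -
  have *: "z : gen0 (insert y (E Int inf))"
    if y: "y : inf" "c : E" "r : E" "r : good" "X = c + r * y"
      and z: "z : inf" "d : E" "t : E" "t : good" "X = d + t * z" and le: "val t <= val r" for y z c r d t
  proof -
    have A: "insert y (E Int inf) <= inf" "0 : insert y (E Int inf)" using small y by auto
    have r0: "r ~= 0" using y(4) zero_not_good by auto
    obtain q where q: "q : E" "r = t * q" "q : good" "val q = val r - val t"
      using subfield_quotient[OF sf z(3,4) y(3)] r0 by metis
    obtain h where h: "h : E" "c - d = t * h"
      using subfield_quotient[OF sf z(3,4) subfield_minus[OF sf y(2) z(2)]] by metis
    have "t * z = t * (h + q * y)" using y(5) z(5) q(2) h(2) by (simp add: algebra_simps)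
    hence eq: "z = h + q * y" by (rule good_cancel[OF z(4)])
    have "q : gen1 (E Int inf)" using subfield_gen1[OF sf q(1,3)] q(4) le by simp
    hence "q : gen1 (insert y (E Int inf))" using gen1_mono by blast
    hence qy: "q * y : gen0 (insert y (E Int inf))" using gen_closed(6)[OF A] gen0_incl[OF A] by blast
    hence "q * y : inf" using gen0_inf[OF A(1)] by blast
    hence "h : inf" using inf_closed(5)[OF z(1), of "q * y"] eq by simp
    hence "h : gen0 (insert y (E Int inf))" using h(1) gen0_incl[OF A] by blast
    thus ?thesis unfolding eq by (rule gen_closed(5)[OF A _ qy])
  qed
  obtain c r d t where y: "y : inf" "c : E" "r : E" "r : good" "X = c + r * y"
    and z: "z : inf" "d : E" "t : E" "t : good" "X = d + t * z" using assms unfolding fractions_def by blast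
  show ?thesis using *[OF y z] *[OF z y] linear[of "val t" "val r"] by blast
qed

lemma fraction_cover:
  assumes "finite Z" "Z <= thick"
  shows "EX z:fractions. Z <= gen0 (insert z (E Int inf))" using assms
proof (induction Z rule: finite_induct)
  case empty
  show ?case using approximation[OF subfieldD(2)[OF sf]] by blast
next
  case (insert y Z)
  then obtain z where z: "z : fractions" "Z <= gen0 (insert z (E Int inf))" by auto
  have A: "insert x (E Int inf) <= inf" "0 : insert x (E Int inf)" if "x : fractions" for x
    using that small by (auto simp: fractions_def)
  show ?case
  proof (cases "y : gen0 (insert z (E Int inf))")
    case True
    thus ?thesis using z by blast
  next
    case False
    hence "y ~: E Int inf" using gen0_incl[OF A[OF z(1)]] by blast
    hence y: "y : fractions" using insert by auto
    note Ay = A[OF y]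
    have "z : gen0 (insert y (E Int inf))" using fractions_directed[OF y z(1)] False by blast
    hence "insert z (E Int inf) <= gen0 (insert y (E Int inf))" using gen0_incl[OF Ay] by blast
    hence "gen0 (insert z (E Int inf)) <= gen0 (insert y (E Int inf))" by (rule gen_trans(2)[OF Ay])
    thus ?thesis using y z(2) gen0_incl[OF Ay] by blast
  qed
qed

text \<open>The Tschirnhaus transformation kills the second coefficient of the Weierstrass polynomial, so that
  it is not a power of a linear polynomial modulo infinitesimals, and zooming in further lowers its order.\<close>

lemma regular_leading:
  assumes z: "z : fractions" and u: "u : regular (E Int inf) z s"
  shows "EX v. u : leading E thick v" using assms
proof (induction s arbitrary: z u rule: less_induct)
  case (less s)
  note fr = frame_thick
  obtain c r where zi: "z : inf" and cr: "c : E" "r : E" "r : good" "X = c + r * z"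
    using less(2) unfolding fractions_def by blast
  obtain t w a where tw: "t ~= 0" "w : gen0 (insert z (E Int inf))" "ALL i<s. a i : gen0 (E Int inf)"
    "u = (kc t + w) * (z ^ s + (SUM i<s. a i * z ^ i))" using less(3) by (rule regularE)
  have "w : gen0 thick" using tw(2) less(2) gen_trans(2)[OF thick] gen0_incl[OF thick] by blast
  hence unit: "kc t + w : leading E thick 0" by (rule leading_unit[OF fr tw(1)])
  define P where "P = z ^ s + (SUM i<s. a i * z ^ i)"
  have "EX v. P : leading E thick v"
  proof (cases "s = 0")
    case True
    thus ?thesis using leading_monomial[OF fr subfield_one[OF sf] one_good] by (auto simp: P_def)
  next
    case False
    define a' where "a' = (%i. if i < s then a i else 1)"
    have a': "a' i : E" for i using tw(3) gen0_small[OF sf] subfield_one[OF sf] by (auto simp: a'_def)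
    \<comment> \<open>With \<open>z + b\<close> as the variable the coefficient of degree
      \<open>s - 1\<close> disappears.\<close>
    define b where "b = kc (1 / of_nat s) * a (s - 1)"
    have as: "a (s - 1) : E Int inf" using tw(3) gen0_small[OF sf] False by simp
    have b: "b : E" "b : inf" using as subfieldD(4)[OF sf subfield_kc[OF sf]] inf_closed(3) by (auto simp: b_def)
    have "kc (of_nat s) * kc (1 / of_nat s) = 1" using False by (simp add: kc_simps(4)[symmetric] kc_simps(2))
    hence sb: "of_nat s * b = a (s - 1)" by (simp add: b_def kc_of_nat mult.assoc[symmetric])
    define b' where "b' = (%j. SUM i<=s. a' i * of_nat (i choose j) * (- b) ^ (i - j))"
    have b': "b' j : E" for j unfolding b'_def kc_of_nat[symmetric]
      by (intro subfield_sum[OF sf] subfieldD(4)[OF sf] a' subfield_kc[OF sf] subfield_power[OF sf] subfield_uminus[OF sf] b)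
    have Pb: "P = (SUM j<=s. b' j * (z + b) ^ j)"
    proof -
      have "P = (SUM i<=s. a' i * (- b + (z + b)) ^ i)"
        by (simp add: P_def a'_def atMost_Suc lessThan_Suc_atMost[symmetric] lessThan_Suc)
      also have "... = (SUM j<=s. b' j * (z + b) ^ j)" unfolding b'_def by (rule polynomial_shift)
      finally show ?thesis .
    qed
    have "b' s = (SUM i<=s. if i = s then 1 else 0)" unfolding b'_def
      by (rule sum.cong) (auto simp: a'_def le_less binomial_eq_0)
    hence b's: "b' s = 1" by simp
    have "b' (s - 1) = (SUM i<=s. if i = s then - a (s - 1) else if i = s - 1 then a (s - 1) else 0)" unfolding b'_def
    proof (rule sum.cong[OF refl])
      fix i assume i: "i : {..s}"
      have "s choose (s - 1) = s" using binomial_symmetric[of 1 s] False by simp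
      thus "a' i * of_nat (i choose (s - 1)) * (- b) ^ (i - (s - 1)) = (if i = s then - a (s - 1) else if i = s - 1 then a (s - 1) else 0)"
      proof -
        consider "i = s" | "i = s - 1" "i < s" | "i < s - 1" using i False by (metis Suc_pred' atMost_iff le_less less_Suc_eq neq0_conv)
        thus ?thesis
        proof cases
          case 1
          hence "i - (s - 1) = 1" using False by simp
          thus ?thesis using 1 sb `s choose (s - 1) = s` by (simp add: a'_def)
        qed (auto simp: a'_def binomial_eq_0)
      qed
    qed
    also have "... = (SUM i<=s. (if i = s then - a (s - 1) else 0) + (if i = s - 1 then a (s - 1) else 0))"
      using False by (intro sum.cong) auto
    also have "... = 0" using False by (simp add: sum.distrib)
    finally have b's1: "b' (s - 1) = 0" .
    have c': "c - r * b : E" using subfield_minus[OF sf cr(1) subfieldD(4)[OF sf cr(2) b(1)]] .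
    \<comment> \<open>\<open>X\<close> is approximated anew from the shifted centre, which gives
      \<open>z + b = rho * (kc r0 + z')\<close> with \<open>r0\<close> nonzero and a closer fraction
      \<open>z'\<close>.\<close>
    obtain rho' r0 z' where rho': "rho' : E" "rho' : good" "r0 ~= 0" "z' : fractions" "X - (c - r * b) = rho' * (kc r0 + z')"
      using approximation[OF c'] by metis
    have rho'0: "rho' ~= 0" using rho'(2) zero_not_good by auto
    obtain rho where rho: "rho : E" "rho' = r * rho" "rho : good"
      using subfield_quotient[OF sf cr(2,3) rho'(1)] rho'0 by metis
    have "r * (z + b) = r * (rho * (kc r0 + z'))" using rho'(5) cr(4) rho(2) by (simp add: algebra_simps)
    hence zb: "z + b = rho * (kc r0 + z')" by (rule good_cancel[OF cr(3)])
    have z': "z' : inf" using rho'(4) by (simp add: fractions_def)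
    have "ALL j<Suc s. b' j * rho ^ j : E" using b' subfieldD(4)[OF sf] subfield_power[OF sf rho(1)] by blast
    moreover have "b' s * rho ^ s ~= 0" using b's good_power[OF rho(3), of s] zero_not_good by auto
    \<comment> \<open>Dividing by a coefficient of least value makes all coefficients integral and
      one of them equal to 1.\<close>
    ultimately obtain i where i: "i < Suc s" "b' i * rho ^ i : good"
      "ALL j<Suc s. EX q:gen1 (E Int inf) Int E. b' j * rho ^ j = b' i * rho ^ i * q"
      using dominating[OF sf, of "Suc s" "%j. b' j * rho ^ j"] by blast
    define D where "D = b' i * rho ^ i"
    have D: "D : E" "D : good" using i b' subfieldD(4)[OF sf] subfield_power[OF sf rho(1)] by (auto simp: D_def)
    have "ALL j. EX q. j <= s --> q : gen1 (E Int inf) Int E & b' j * rho ^ j = D * q" using i(3) by (auto simp: D_def less_Suc_eq_le)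
    then obtain beta where beta: "!!j. j <= s ==> beta j : gen1 (E Int inf) & beta j : E & b' j * rho ^ j = D * beta j"
      unfolding choice_iff by blast
    have "D * beta i = b' i * rho ^ i" using beta[of i] i(1) by simp
    hence "D * beta i = D * 1" by (simp only: D_def[symmetric] mult_1_right)
    hence betai: "beta i = 1" by (rule good_cancel[OF D(2)])
    have betas1: "beta (s - 1) = 0" using beta[of "s - 1"] b's1 good_mult_eq_0[OF D(2)] by simp
    define gamma where "gamma = (%j. SUM i<=s. beta i * of_nat (i choose j) * kc r0 ^ (i - j))"
    have gamma: "gamma j : E" for j unfolding gamma_def kc_of_nat[symmetric]
      using beta by (intro subfield_sum[OF sf] subfieldD(4)[OF sf] subfield_kc[OF sf] subfield_power[OF sf]) auto
    have k1: "kc x : gen1 (E Int inf)" for x using gen_kc[OF small] by blast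
    have gamma1: "gamma j : gen1 (E Int inf)" for j unfolding gamma_def kc_of_nat[symmetric]
      using beta by (intro gen1_sum[OF small] gen_closed(4)[OF small] k1 gen1_power[OF small]) auto
    have PQ: "P = D * (SUM j<=s. gamma j * z' ^ j)"
    proof -
      have "P = (SUM j<=s. (b' j * rho ^ j) * (kc r0 + z') ^ j)" unfolding Pb zb by (simp add: power_mult_distrib mult.assoc)
      also have "... = (SUM j<=s. (D * beta j) * (kc r0 + z') ^ j)" using beta by simp
      also have "... = D * (SUM j<=s. beta j * (kc r0 + z') ^ j)" by (simp add: sum_distrib_left mult.assoc)
      finally show ?thesis unfolding gamma_def polynomial_shift .
    qed
    \<comment> \<open>Otherwise the polynomial would be a multiple of the pure power
      \<open>z' ^ s\<close> up to infinitesimal coefficients. Since \<open>beta (s - 1) = 0\<close>,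
      its coefficient of degree \<open>s - 1\<close> is \<open>beta s * of_nat s * kc r0\<close>, so
      \<open>beta s\<close> would be infinitesimal; by descending induction so would all
      \<open>beta j\<close>, against \<open>beta i = 1\<close>.\<close>
    have ex: "EX k<s. gamma k ~: inf"
    proof (rule ccontr)
      assume "~ (EX k<s. gamma k ~: inf)"
      hence all: "gamma k : inf" if "k < s" for k using that by blast
      have split: "gamma j = beta j + (SUM i:{Suc j..s}. beta i * of_nat (i choose j) * kc r0 ^ (i - j))" if "j <= s" for j
      proof -
        have "gamma j = (SUM i:{j..s}. beta i * of_nat (i choose j) * kc r0 ^ (i - j))" unfolding gamma_def
          by (rule sum.mono_neutral_right) (auto simp: not_le binomial_eq_0)
        also have "{j..s} = insert j {Suc j..s}" using that by auto
        finally show ?thesis by simp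
      qed
      have "s choose (s - 1) = s" using binomial_symmetric[of 1 s] False by simp
      moreover have "{Suc (s - 1)..s} = {s}" "s - (s - 1) = 1" using False by auto
      ultimately have "gamma (s - 1) = beta s * of_nat s * kc r0" using split[of "s - 1"] betas1 by simp
      hence "beta s * of_nat s * kc r0 : inf" using all[of "s - 1"] False by simp
      hence "kc (1 / (of_nat s * r0)) * (beta s * of_nat s * kc r0) : inf" by (rule inf_closed(3))
      moreover have "kc (1 / (of_nat s * r0)) * (beta s * of_nat s * kc r0) = beta s * kc (1 / (of_nat s * r0) * (of_nat s * r0))"
        by (simp only: kc_simps(4) kc_of_nat[symmetric] mult_ac)
      moreover have "1 / (of_nat s * r0) * (of_nat s * r0) = 1" using False rho'(3) by simp
      ultimately have betas: "beta s : inf" by (simp add: kc_simps(2))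
      have betainf: "m <= s ==> beta (s - m) : inf" for m
      proof (induction m rule: less_induct)
        case (less m)
        show ?case
        proof (cases "m = 0")
          case nz: False
          let ?j = "s - m"
          have "beta i : inf" if "i : {Suc ?j..s}" for i using less(1)[of "s - i"] that less(2) nz by auto
          hence "beta i * of_nat (i choose ?j) * kc r0 ^ (i - ?j) : inf" if "i : {Suc ?j..s}" for i
          proof -
            have "kc r0 ^ n * x : inf" if "x : inf" for n x
              using that by (induction n) (auto simp: mult.assoc intro: inf_closed(3))
            moreover have "kc (of_nat (i choose ?j)) * beta i : inf" using that `!!i. i : {Suc ?j..s} ==> beta i : inf` by (intro inf_closed(3)) auto
            ultimately have "kc r0 ^ (i - ?j) * (kc (of_nat (i choose ?j)) * beta i) : inf" by blast
            moreover have "kc r0 ^ (i - ?j) * (kc (of_nat (i choose ?j)) * beta i) = beta i * of_nat (i choose ?j) * kc r0 ^ (i - ?j)"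
              by (simp add: kc_of_nat mult_ac)
            ultimately show ?thesis by simp
          qed
          hence "(SUM i:{Suc ?j..s}. beta i * of_nat (i choose ?j) * kc r0 ^ (i - ?j)) : inf" by (rule inf_sum)
          moreover have "gamma ?j : inf" using all[of ?j] nz False by simp
          ultimately have "gamma ?j - (SUM i:{Suc ?j..s}. beta i * of_nat (i choose ?j) * kc r0 ^ (i - ?j)) : inf" by (intro inf_closed(5))
          thus ?thesis using split[of ?j] by simp
        qed (use betas in simp)
      qed
      have "beta i : inf" using betainf[of "s - i"] i(1) by simp
      thus False using betai one_not_inf by simp
    qed
    define k where "k = (LEAST k. gamma k ~: inf)"
    obtain k0 where k0: "k0 < s" "gamma k0 ~: inf" using ex by blast
    have k: "gamma k ~: inf" "k < s" "ALL j<k. gamma j : inf"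
      unfolding k_def using LeastI[of "%k. gamma k ~: inf", OF k0(2)] Least_le[of "%k. gamma k ~: inf", OF k0(2)] k0(1) not_less_Least by (simp, simp, blast)
    have "(SUM j<=s. gamma j * z' ^ j) : regular (E Int inf) z' k"
      by (rule regular_polynomial[OF small z']) (use gamma1 k gamma gen0_small[OF sf] in auto)
    from less(1)[OF k(2) rho'(4) this] obtain v where "(SUM j<=s. gamma j * z' ^ j) : leading E thick v" by blast
    from leading_mult[OF fr leading_monomial[OF fr D] this] show ?thesis unfolding PQ by blast
  qed
  thus ?case unfolding tw(4) P_def[symmetric] using leading_mult[OF fr unit] by blast
qed

text \<open>A value involves finitely many fractions, which one fraction \<open>z\<close> controls.
  What the Noetherian property leaves is an element of \<open>E\<close> times a regular value in
  \<open>z\<close>, and \<open>regular_leading\<close> applies.\<close>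

lemma immediate_extension: "EX E'. analytic_subfield E' & E <= E' & X : E'"
proof -
  have "u = 0 | (EX v. u : leading E thick v)" if u: "u : gen thick" for u
  proof -
    obtain Z where Z: "finite Z" "Z <= thick" "u : gen (insert 0 Z)" using gen_finite[OF thick u] by blast
    obtain z where z: "z : fractions" "insert 0 Z <= gen0 (insert z (E Int inf))"
      using fraction_cover[of "insert 0 Z"] Z thick(2) by auto
    have zi: "z : inf" using z(1) by (simp add: fractions_def)
    have A: "insert z (E Int inf) <= inf" "0 : insert z (E Int inf)" using zi small by auto
    have "u : gen (insert z (E Int inf))" using gen_trans(1)[OF A z(2)] Z(3) by blast
    hence "u = 0 | (EX alpha:E Int good. EX s. EX v:regular (E Int inf) z s. u = alpha * v)" by (rule subfield_noetherian[OF sf zi])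
    thus ?thesis
    proof
      assume "EX alpha:E Int good. EX s. EX v:regular (E Int inf) z s. u = alpha * v"
      then obtain alpha s v where v: "alpha : E" "alpha : good" "v : regular (E Int inf) z s" "u = alpha * v" by blast
      obtain l where "v : leading E thick l" using regular_leading[OF z(1) v(3)] by blast
      from leading_mult[OF frame_thick leading_monomial[OF frame_thick v(1,2)] this] show ?thesis unfolding v(4) by blast
    qed simp
  qed
  then obtain E' where E': "analytic_subfield E'" "E <= E'" "thick <= E'" using extension[OF frame_thick] by blast
  obtain r s z where z: "r : E" "z : fractions" "X - 0 = r * (kc s + z)"
    using approximation[OF subfieldD(2)[OF sf]] by metis
  have "r : E'" "z : E'" using z(1,2) E'(2,3) by blast+
  hence "r * (kc s + z) : E'" by (intro subfieldD(3,4)[OF E'(1)] subfield_kc[OF E'(1)])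
  hence "X : E'" using z(3) by simp
  thus ?thesis using E'(1,2) by blast
qed

end

end

section \<open>Free extensions\<close>

context valued_model
begin

text \<open>The value of \<open>X\<close> has infinite order modulo the values of \<open>E\<close>;
  negative exponents are covered by taking inverses.\<close>

definition free_pair :: "'p set => 'p => 'p => bool" where
  "free_pair E X Y \<longleftrightarrow> X : good & X * Y = 1 & (ALL p:E Int good. ALL j>0. val (p * X ^ j) ~= 0)"

lemma adjoin_commute: "adjoin E X Y = adjoin E Y X"
proof -
  have "adjoin E X Y <= adjoin E Y X" for X Y
  proof
    fix x assume "x : adjoin E X Y"
    then obtain p i j where x: "x = p * X ^ i * Y ^ j" "p : E" unfolding adjoin_def by blast
    have "x = p * Y ^ j * X ^ i" by (simp add: x mult_ac)
    thus "x : adjoin E Y X" using adjoinI[OF x(2)] by simp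
  qed
  thus ?thesis by blast
qed

context
  fixes E assumes sf: "analytic_subfield E"
begin

lemma pair_cancel: "X * Y = 1 ==> X ^ (a + b) * Y ^ b = X ^ a" for X Y :: 'p
proof -
  assume "X * Y = 1"
  hence "X ^ b * Y ^ b = 1" by (simp add: power_mult_distrib[symmetric])
  thus ?thesis by (simp add: power_add mult.assoc)
qed

lemma inverse_val_0:
  assumes X: "X : good" "X * Y = 1" and p: "p : E" "p : good" and v: "val (p * Y ^ j) = 0"
  shows "EX q:E Int good. val (q * X ^ j) = 0"
proof -
  obtain q where q: "q : E" "p * q = 1" using subfieldD(5)[OF sf p] by blast
  have g: "p * Y ^ j : good" using good_mult[OF p(2) good_power[OF Y_good[OF sf X]]] .
  have "p * Y ^ j * (q * X ^ j) = (p * q) * (X * Y) ^ j" by (simp add: power_mult_distrib mult_ac)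
  hence "p * Y ^ j * (q * X ^ j) = 1" using q X by simp
  from val_inverse[OF g this] have "val (q * X ^ j) = 0" using v by simp
  thus ?thesis using q val_inverse[OF p(2) q(2)] by blast
qed

lemma free_pair_sym:
  assumes fp: "free_pair E X Y" shows "free_pair E Y X"
proof -
  have X: "X : good" "X * Y = 1" and fr: "ALL p:E Int good. ALL j>0. val (p * X ^ j) ~= 0" using fp unfolding free_pair_def by auto
  have "val (p * Y ^ j) ~= 0" if "p : E Int good" "0 < j" for p j
    using inverse_val_0[OF X, of p j] fr that by blast
  thus ?thesis unfolding free_pair_def using Y_good[OF sf X] X by (auto simp: mult.commute)
qed

lemma free_pair_power:
  assumes fp: "free_pair E X Y" and k: "0 < k" shows "free_pair E (X ^ k) (Y ^ k)"
proof -
  have X: "X : good" "X * Y = 1" and fr: "ALL p:E Int good. ALL j>0. val (p * X ^ j) ~= 0" using fp unfolding free_pair_def by auto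
  have "val (p * (X ^ k) ^ j) ~= 0" if "p : E Int good" "0 < j" for p j
  proof -
    have "0 < k * j" using k that by simp
    hence "val (p * X ^ (k * j)) ~= 0" using fr that by blast
    thus ?thesis by (simp add: power_mult)
  qed
  moreover have "X ^ k * Y ^ k = 1" using X by (simp add: power_mult_distrib[symmetric])
  ultimately show ?thesis unfolding free_pair_def using good_power[OF X(1)] by blast
qed

lemma free_monomial:
  assumes fp: "free_pair E X Y" and p: "p : E" "p : good" and v: "val (p * X ^ a * Y ^ b) = 0"
  shows "a = b"
proof (rule ccontr)
  assume "a ~= b"
  have X: "X : good" "X * Y = 1" and fr: "ALL p:E Int good. ALL j>0. val (p * X ^ j) ~= 0" using fp unfolding free_pair_def by auto
  have YX: "Y * X = 1" using X by (simp add: mult.commute)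
  consider "b < a" | "a < b" using `a ~= b` by linarith
  thus False
  proof cases
    case 1
    hence "X ^ a * Y ^ b = X ^ (a - b)" using pair_cancel[OF X(2), of "a - b" b] by simp
    hence "val (p * X ^ (a - b)) = 0" using v by (simp add: mult.assoc)
    thus False using fr p 1 by auto
  next
    case 2
    hence "X ^ a * Y ^ b = Y ^ (b - a)" using pair_cancel[OF YX, of "b - a" a] by (simp add: mult.commute)
    hence "val (p * Y ^ (b - a)) = 0" using v by (simp add: mult.assoc)
    thus False using inverse_val_0[OF X p] fr 2 by fastforce
  qed
qed

text \<open>The quotient of the two monomials has value 0, so by freeness its total exponent of
  \<open>X\<close> is 0.\<close>

lemma free_val_eq:
  assumes fp: "free_pair E X Y" and p: "p : E" "p : good" and q: "q : E" "q : good"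
    and v: "val (p * X ^ a * Y ^ b) = val (q * X ^ c * Y ^ d)"
  shows "a + d = c + b"
proof -
  have X: "X : good" "X * Y = 1" using fp unfolding free_pair_def by auto
  note Y = Y_good[OF sf X]
  obtain t where t: "t : E" "q * t = 1" using subfieldD(5)[OF sf q] by blast
  have tg: "t : good" using val_inverse[OF q(2) t(2)] by simp
  have g: "q * X ^ c * Y ^ d : good" "p * X ^ a * Y ^ b : good" "t * X ^ d * Y ^ c : good"
    using good_mult good_power X Y p q tg by simp_all
  have "q * X ^ c * Y ^ d * (t * X ^ d * Y ^ c) = (q * t) * (X * Y) ^ c * (X * Y) ^ d" by (simp add: power_mult_distrib mult_ac)
  hence "q * X ^ c * Y ^ d * (t * X ^ d * Y ^ c) = 1" using t X by simp
  hence "val (t * X ^ d * Y ^ c) = - val (q * X ^ c * Y ^ d)" using val_inverse[OF g(1)] by blast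
  hence "val ((p * X ^ a * Y ^ b) * (t * X ^ d * Y ^ c)) = 0" using val_mult[OF g(2,3)] v by simp
  moreover have "(p * X ^ a * Y ^ b) * (t * X ^ d * Y ^ c) = (p * t) * X ^ (a + d) * Y ^ (b + c)"
    by (simp add: power_add mult_ac)
  ultimately have "a + d = b + c" using free_monomial[OF fp subfieldD(4)[OF sf p(1) t(1)] good_mult[OF p(2) tg]] by simp
  thus ?thesis by simp
qed

lemma frame_free:
  assumes fp: "free_pair E X Y"
  shows "frame (adjoin E X Y) (adjoin E X Y Int inf)"
proof -
  have X: "X : good" "X * Y = 1" using fp unfolding free_pair_def by auto
  have "p * X ^ i * Y ^ j : E" if "p : E Int good" "val (p * X ^ i * Y ^ j) = 0" for p i j
  proof -
    have "i = j" using free_monomial[OF fp _ _ that(2)] that(1) by blast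
    hence "p * X ^ i * Y ^ j = p * (X * Y) ^ i" by (simp add: power_mult_distrib mult.assoc)
    thus ?thesis using X that by simp
  qed
  thus ?thesis by (intro frame_adjoin[OF sf X] ballI allI impI)
qed

text \<open>The leading value is that of a monomial in the given \<open>X\<close> and
  \<open>Y\<close>, which need not be the elements that \<open>U\<close> is built from: later they
  are \<open>K\<close>-th powers, and exponents modulo \<open>K\<close> tell the terms
  apart.\<close>

definition free_leading :: "'p set => 'p set => 'p => 'p => 'p set" where
  "free_leading U M X Y = {u. u = 0 | (EX alpha:E Int good. EX i j. u : leading U M (val (alpha * X ^ i * Y ^ j)))}"

lemma free_leading_commute: "free_leading U M X Y = free_leading U M Y X"
proof -
  have "free_leading U M X Y <= free_leading U M Y X" for X Y
  proof
    fix u assume u: "u : free_leading U M X Y"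
    show "u : free_leading U M Y X"
    proof (cases "u = 0")
      case False
      then obtain alpha i j where *: "alpha : E Int good" "u : leading U M (val (alpha * X ^ i * Y ^ j))"
        using u unfolding free_leading_def by blast
      have eq: "alpha * X ^ i * Y ^ j = alpha * Y ^ j * X ^ i" by (simp add: mult_ac)
      have "u : leading U M (val (alpha * Y ^ j * X ^ i))" using *(2) unfolding eq .
      thus ?thesis unfolding free_leading_def using *(1) by blast
    qed (simp add: free_leading_def)
  qed
  thus ?thesis by blast
qed

end

text \<open>In the next context \<open>V = Z + W\<close>, and \<open>Z\<close> is a root of \<open>\<zeta>\<^sup>2 - V \<zeta> + Z W\<close>, so that series in \<open>Z\<close> and \<open>W\<close>
  are linear polynomials in \<open>Z\<close> over the series in \<open>V\<close>.\<close>

context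
  fixes E U M X Y Z W d d'
  assumes sf: "analytic_subfield E" and fr: "frame U M" and fp: "free_pair E X Y"
    and sub: "adjoin E X Y <= U" and sm: "E Int inf <= M"
    and Z: "Z : M" "Z = d * X" "d : E" and W: "W : M" "W = d' * Y" "d' : E"
begin

abbreviation (input) "A == E Int inf"
abbreviation (input) "LL == free_leading E U M X Y"

lemma XY: "X : good" "X * Y = 1" using fp unfolding free_pair_def by auto

lemmas A = smallD[OF sf] and M = frameD(1,2)[OF fr]

lemma ZW: "Z : inf" "W : inf" "Z + W : inf" "Z * W : A"
proof -
  show i: "Z : inf" "W : inf" using Z(1) W(1) M by auto
  show "Z + W : inf" by (rule inf_closed(1)[OF i])
  have "Z * W = d * d' * (X * Y)" by (simp add: Z(2) W(2) mult_ac)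
  hence "Z * W : E" using XY subfieldD(4)[OF sf Z(3) W(3)] by simp
  thus "Z * W : A" using inf_closed(2)[OF i] by blast
qed

lemma free_leading_scale:
  assumes alpha: "alpha : E" and u: "u : LL" shows "alpha * u : LL"
proof (cases "alpha = 0 | u = 0")
  case False
  then obtain beta i j where b: "beta : E Int good" "u : leading U M (val (beta * X ^ i * Y ^ j))"
    using u unfolding free_leading_def[OF sf] by blast
  have alphag: "alpha : good" using subfield_good[OF sf alpha] False by simp
  have "alpha : U" using sub subset_adjoin[OF sf XY] alpha by blast
  from leading_mult[OF fr leading_monomial[OF fr this alphag] b(2)]
  have "alpha * u : leading U M (val alpha + val (beta * X ^ i * Y ^ j))" .
  moreover have "beta * X ^ i * Y ^ j : good" using b good_mult good_power XY Y_good[OF sf XY] by simp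
  hence "val alpha + val (beta * X ^ i * Y ^ j) = val ((alpha * beta) * X ^ i * Y ^ j)"
    using val_mult[OF alphag] by (simp add: mult.assoc)
  ultimately show ?thesis unfolding free_leading_def[OF sf] using b alphag alpha good_mult subfieldD(4)[OF sf] by auto
qed (auto simp: free_leading_def[OF sf])

lemma free_leading_unit:
  assumes r: "r ~= 0" and w: "w : gen0 M" and u: "u : LL" shows "(kc r + w) * u : LL"
  using leading_mult[OF fr leading_unit[OF fr r w]] u unfolding free_leading_def[OF sf] by fastforce

lemma monomial_leading:
  assumes "q : E" shows "q * X ^ i * Y ^ j = 0 | q * X ^ i * Y ^ j : leading U M (val (q * X ^ i * Y ^ j))"
  using leading_monomial[OF fr] frameD(3)[OF fr] sub adjoinI[OF assms, of X i Y j] by blast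

lemma polynomial_leading:
  fixes I :: "nat set"
  assumes q: "ALL i:I. q i : E" and I: "finite I" and ij: "inj_on (%i. int (a i) - int (b i)) I"
  shows "(SUM i:I. q i * X ^ a i * Y ^ b i) = 0 |
    (EX i:I. q i : good & (SUM i:I. q i * X ^ a i * Y ^ b i) : leading U M (val (q i * X ^ a i * Y ^ b i)))"
proof -
  let ?u = "%i. q i * X ^ a i * Y ^ b i"
  have g: "q i : good" if "i : I" "?u i ~= 0" for i using subfield_good[OF sf] q that by fastforce
  have "sum ?u I = 0 | (EX i:I. ?u i ~= 0 & sum ?u I : leading U M (val (?u i)))"
  proof (rule leading_sum[OF fr I])
    show "ALL i:I. ?u i = 0 | ?u i : leading U M (val (?u i))" using monomial_leading q by blast
    show "ALL i:I. ALL j:I. i ~= j --> ?u i ~= 0 --> ?u j ~= 0 --> val (?u i) ~= val (?u j)"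
    proof (intro ballI impI notI)
      fix i j assume *: "i : I" "j : I" "i ~= j" "?u i ~= 0" "?u j ~= 0" "val (?u i) = val (?u j)"
      have "a i + b j = a j + b i"
        by (rule free_val_eq[OF sf fp _ g[OF *(1,4)] _ g[OF *(2,5)] *(6)]) (use q * in auto)
      hence "int (a i) - int (b i) = int (a j) - int (b j)" by linarith
      thus False using inj_onD[OF ij] * by blast
    qed
  qed
  thus ?thesis using g by blast
qed

text \<open>With a multiple of \<open>X\<close> as the only new infinitesimal, the Weierstrass
  polynomial is a sum of monomials with different exponents of \<open>X\<close>, hence its nonzero
  terms have different values.\<close>

lemma gen_Z_leading:
  assumes G: "G : gen (insert Z A)"
  shows "G = 0 | (EX alpha:E Int good. EX i. G : leading U M (val (alpha * X ^ i)))"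
proof -
  have "G = 0 | (EX alpha:E Int good. EX s. EX v:regular A Z s. G = alpha * v)" by (rule subfield_noetherian[OF sf ZW(1) G])
  thus ?thesis
  proof
    assume "EX alpha:E Int good. EX s. EX v:regular A Z s. G = alpha * v"
    then obtain alpha s v where v: "alpha : E" "alpha : good" "v : regular A Z s" "G = alpha * v" by blast
    obtain r w a where p: "r ~= 0" "w : gen0 (insert Z A)" "ALL i<s. a i : gen0 A" "v = (kc r + w) * (Z ^ s + (SUM i<s. a i * Z ^ i))"
      using v(3) by (rule regularE)
    have "insert Z A <= gen0 M" using gen0_incl[OF M] Z(1) sm by blast
    hence w: "w : gen0 M" using gen_trans(2)[OF M] p(2) by blast
    define q where "q = (%i. (if i < s then a i else 1) * d ^ i)"
    have a: "a i : E" if "i < s" for i using p(3) gen0_small[OF sf] that by auto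
    have q: "q i : E" for i unfolding q_def
      using a subfieldD(4)[OF sf _ subfield_power[OF sf Z(3)]] subfield_one[OF sf] by auto
    have P: "Z ^ s + (SUM i<s. a i * Z ^ i) = (SUM i:{..s}. q i * X ^ i * Y ^ 0)"
      by (simp add: lessThan_Suc_atMost[symmetric] q_def Z(2) power_mult_distrib mult.assoc)
    have "inj_on (%i. int i - int 0) {..s}" by (auto simp: inj_on_def)
    from polynomial_leading[of "{..s}" q "%i. i" "%_. 0", OF _ _ this]
    have "Z ^ s + (SUM i<s. a i * Z ^ i) = 0 | (EX i. q i : good & Z ^ s + (SUM i<s. a i * Z ^ i) : leading U M (val (q i * X ^ i)))"
      unfolding P using q by auto
    thus ?thesis
    proof
      assume "EX i. q i : good & Z ^ s + (SUM i<s. a i * Z ^ i) : leading U M (val (q i * X ^ i))"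
      then obtain i where i: "q i : good" "Z ^ s + (SUM i<s. a i * Z ^ i) : leading U M (val (q i * X ^ i))" by blast
      have alphaU: "alpha : U" using sub subset_adjoin[OF sf XY] v(1) by blast
      have "alpha * ((kc r + w) * (Z ^ s + (SUM i<s. a i * Z ^ i))) : leading U M (val alpha + (0 + val (q i * X ^ i)))"
        by (intro leading_mult[OF fr] leading_monomial[OF fr] leading_unit[OF fr] alphaU v p w i)
      moreover have "val alpha + (0 + val (q i * X ^ i)) = val ((alpha * q i) * X ^ i)"
        using val_mult[OF v(2) good_mult[OF i(1) good_power[OF XY(1)]]] by (simp add: mult.assoc)
      ultimately have "G : leading U M (val ((alpha * q i) * X ^ i))" using v(4) p(4) by simp
      moreover have "alpha * q i : E Int good" using subfieldD(4)[OF sf v(1) q] good_mult[OF v(2) i(1)] by blast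
      ultimately show ?thesis by blast
    qed (simp add: v(4) p(4))
  qed simp
qed

text \<open>\<open>Z * W\<close> lies in \<open>E\<close>, so mixed terms reduce. Writing
  \<open>C = b + Z * v\<close>, the first part gives a term in \<open>W\<close> over
  \<open>E\<close>, and in the second one factor \<open>W\<close> is traded for the element
  \<open>Z * W\<close>. A polynomial in \<open>W\<close> and a series in \<open>Z\<close>
  remain.\<close>

lemma split_power:
  assumes "C : gen1 (insert Z A)"
  shows "EX q G. (ALL j. q j : E) & G : gen (insert Z A) & C * W ^ i = (SUM j:{1..i}. q j * W ^ j) + G"
  using assms
proof (induction i arbitrary: C)
  case 0
  thus ?case using gen1_gen subfieldD(2)[OF sf] by (intro exI[of _ "%_. 0"] exI[of _ C]) auto
next
  case (Suc i)
  have AZ: "insert Z A <= inf" "0 : insert Z A" using A ZW by auto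
  obtain b v where bv: "b : gen1 A" "v : gen1 (insert Z A)" "C = b + Z * v" using gen1_split[OF A ZW(1) Suc(2)] by blast
  have "Z * W : gen1 (insert Z A)" using ZW(4) gen0_incl[OF AZ] gen0_gen1 by blast
  hence "(Z * W) * v : gen1 (insert Z A)" by (rule gen_closed(4)[OF AZ _ bv(2)])
  from Suc(1)[OF this] obtain q G where q: "ALL j. q j : E" "G : gen (insert Z A)"
    "(Z * W) * v * W ^ i = (SUM j:{1..i}. q j * W ^ j) + G" by blast
  have b: "b : E" using bv(1) gen1_gen subfieldD(6)[OF sf] by blast
  have "C * W ^ Suc i = b * W ^ Suc i + (Z * W) * v * W ^ i" by (simp add: bv(3) algebra_simps)
  also have "... = (SUM j:{1..Suc i}. (q(Suc i := b)) j * W ^ j) + G" unfolding q(3)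
    by (simp add: algebra_simps)
  finally show ?case using q b by (intro exI[of _ "q(Suc i := b)"] exI[of _ G]) auto
qed

text \<open>The powers of \<open>V\<close> are expanded in \<open>W\<close> and sorted into a
  polynomial in \<open>W\<close> without constant term and a series in \<open>Z\<close>. The leading
  exponents of \<open>X\<close> are negative in the first and nonnegative in the second, so the two
  values differ and nothing cancels.\<close>

lemma regular_free_leading:
  assumes v: "v : regular (insert Z A) (Z + W) s"
  shows "v : LL"
proof -
  let ?V = "Z + W" and ?A = "insert Z A"
  have AZ: "?A <= inf" "0 : ?A" using A ZW by auto
  obtain r w a where p: "r ~= 0" "w : gen0 (insert ?V ?A)" "ALL i<s. a i : gen0 ?A"
    "v = (kc r + w) * (?V ^ s + (SUM i<s. a i * ?V ^ i))" using v by (rule regularE)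
  have "?V : gen0 M" using gen_closed(5)[OF M] gen0_incl[OF M] Z(1) W(1) by blast
  hence "insert ?V ?A <= gen0 M" using gen0_incl[OF M] Z(1) sm by blast
  hence w: "w : gen0 M" using gen_trans(2)[OF M] p(2) by blast
  define a' where "a' = (%i. if i < s then a i else 1)"
  have k1: "kc x : gen1 ?A" for x by (rule gen_kc[OF AZ])
  have a': "a' i : gen1 ?A" for i using p(3) gen0_gen1 k1[of 1] by (auto simp: a'_def kc_simps)
  define C where "C = (%j. SUM i<=s. a' i * of_nat (i choose j) * Z ^ (i - j))"
  have "Z : gen1 ?A" using gen0_incl[OF AZ] gen0_gen1 by blast
  hence "C j : gen1 ?A" for j unfolding C_def kc_of_nat[symmetric]
    by (intro gen1_sum[OF AZ] gen_closed(4)[OF AZ] a' k1 gen1_power[OF AZ])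
  hence "ALL j. EX q G. (ALL l. q l : E) & G : gen ?A & C j * W ^ j = (SUM l:{1..j}. q l * W ^ l) + G"
    using split_power by blast
  then obtain q G where qG: "!!j l. q j l : E" "!!j. G j : gen ?A" "!!j. C j * W ^ j = (SUM l:{1..j}. q j l * W ^ l) + G j"
    by metis
  define Q where "Q = (%l. SUM j<=s. if l <= j then q j l else 0)"
  have Q: "Q l : E" for l unfolding Q_def by (rule subfield_sum[OF sf]) (use qG subfieldD(2)[OF sf] in auto)
  have P: "?V ^ s + (SUM i<s. a i * ?V ^ i) = (SUM l:{1..s}. Q l * W ^ l) + (SUM j<=s. G j)"
  proof -
    have "?V ^ s + (SUM i<s. a i * ?V ^ i) = (SUM i<=s. a' i * ?V ^ i)"
      by (simp add: a'_def lessThan_Suc_atMost[symmetric])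
    also have "... = (SUM j<=s. C j * W ^ j)" unfolding C_def by (rule polynomial_shift)
    also have "... = (SUM j<=s. SUM l:{1..j}. q j l * W ^ l) + (SUM j<=s. G j)" unfolding qG(3) sum.distrib ..
    also have "(SUM j<=s. SUM l:{1..j}. q j l * W ^ l) = (SUM j<=s. SUM l:{1..s}. (if l <= j then q j l else 0) * W ^ l)"
    proof (rule sum.cong[OF refl])
      fix j assume "j : {..s}"
      thus "(SUM l:{1..j}. q j l * W ^ l) = (SUM l:{1..s}. (if l <= j then q j l else 0) * W ^ l)"
        by (intro sum.mono_neutral_cong_left) auto
    qed
    also have "... = (SUM l:{1..s}. Q l * W ^ l)" unfolding Q_def sum_distrib_right by (rule sum.swap)
    finally show ?thesis .
  qed
  define G' where "G' = (SUM j<=s. G j)"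
  have "(SUM j:I. G j) : gen ?A" if "finite I" for I
    using that gen1_gen[OF k1[of 0]] by (induction I rule: finite_induct) (auto simp: kc_simps intro: gen_closed(1)[OF AZ] qG(2))
  hence G': "G' = 0 | (EX alpha:E Int good. EX i. G' : leading U M (val (alpha * X ^ i)))"
    unfolding G'_def by (intro gen_Z_leading) simp
  define S where "S = (SUM l:{1..s}. Q l * W ^ l)"
  have S_eq: "S = (SUM l:{1..s}. (Q l * d' ^ l) * X ^ 0 * Y ^ l)" by (simp add: S_def W(2) power_mult_distrib mult.assoc)
  have "inj_on (%l. int 0 - int l) {1..s}" by (auto simp: inj_on_def)
  from polynomial_leading[of "{1..s}" "%l. Q l * d' ^ l" "%_. 0" "%l. l", OF _ _ this]
  have S: "S = 0 | (EX l:{1..s}. Q l * d' ^ l : good & S : leading U M (val ((Q l * d' ^ l) * X ^ 0 * Y ^ l)))"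
    unfolding S_eq[symmetric] using Q W(3) subfieldD(4)[OF sf] subfield_power[OF sf] by auto
  have "S + G' : LL"
  proof (cases "S = 0 | G' = 0")
    case True
    have "G' : LL"
    proof (cases "G' = 0")
      case False
      then obtain alpha i where "alpha : E Int good" "G' : leading U M (val (alpha * X ^ i))" using G' by blast
      hence "alpha : E Int good" "G' : leading U M (val (alpha * X ^ i * Y ^ 0))" by auto
      thus ?thesis unfolding free_leading_def[OF sf] by blast
    qed (simp add: free_leading_def[OF sf])
    moreover have "S : LL" using S Q W(3) subfieldD(4)[OF sf] subfield_power[OF sf] unfolding free_leading_def[OF sf] by blast
    ultimately show ?thesis using True by auto
  next
    case False
    obtain alpha i where alpha: "alpha : E" "alpha : good" "G' : leading U M (val (alpha * X ^ i * Y ^ 0))" using G' False by auto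
    obtain l where l: "l : {1..s}" "Q l * d' ^ l : good" "S : leading U M (val ((Q l * d' ^ l) * X ^ 0 * Y ^ l))" using S False by blast
    let ?beta = "Q l * d' ^ l"
    have beta: "?beta : E" using Q W(3) subfieldD(4)[OF sf] subfield_power[OF sf] by blast
    have "val (alpha * X ^ i * Y ^ 0) ~= val (?beta * X ^ 0 * Y ^ l)"
    proof
      assume "val (alpha * X ^ i * Y ^ 0) = val (?beta * X ^ 0 * Y ^ l)"
      hence "i + l = 0 + 0" by (rule free_val_eq[OF sf fp alpha(1,2) beta l(2)])
      thus False using l(1) by simp
    qed
    then consider "val (alpha * X ^ i * Y ^ 0) < val (?beta * X ^ 0 * Y ^ l)" | "val (?beta * X ^ 0 * Y ^ l) < val (alpha * X ^ i * Y ^ 0)" by fastforce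
    thus ?thesis
    proof cases
      case 1
      from leading_add[OF fr alpha(3) l(3) this] have "S + G' : leading U M (val (alpha * X ^ i * Y ^ 0))" by (simp only: add.commute)
      thus ?thesis unfolding free_leading_def[OF sf] using alpha(1,2) by blast
    next
      case 2
      from leading_add[OF fr l(3) alpha(3) this] show ?thesis unfolding free_leading_def[OF sf] using beta l(2) by blast
    qed
  qed
  thus ?thesis unfolding p(4) P S_def[symmetric] G'_def[symmetric] by (rule free_leading_unit[OF p(1) w])
qed

end

text \<open>The quadratic equation of \<open>Z\<close> gives \<open>u = q 0 + q 1 * Z\<close>, and
  each nonzero \<open>q i\<close> is an element of \<open>E\<close> times a regular value in
  \<open>V\<close>. The element of smaller value is divided out. If it belongs to
  \<open>q 0\<close>, the other summand is a perturbation by a multiple of \<open>Z\<close>, with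
  \<open>Z\<close> joined to the old infinitesimals; otherwise \<open>Z = V - W\<close> is used and
  \<open>W\<close> is joined instead.\<close>

lemma gen_pair_leading:
  assumes sf: "analytic_subfield E" and fr: "frame U M" and fp: "free_pair E X Y"
    and sub: "adjoin E X Y <= U" and sm: "E Int inf <= M"
    and Z: "Z : M" "Z = d * X" "d : E" and W: "W : M" "W = d' * Y" "d' : E"
    and u: "u : gen (insert Z (insert W (E Int inf)))"
  shows "u : free_leading E U M X Y"
proof -
  let ?A = "E Int inf" and ?LL = "free_leading E U M X Y" and ?V = "Z + W"
  note ctx = sf fr fp sub sm Z W
  note A = smallD[OF sf] and zw = ZW[OF ctx]
  have AV: "insert ?V ?A <= inf" "0 : insert ?V ?A" and AZV: "insert Z (insert ?V ?A) <= inf" "0 : insert Z (insert ?V ?A)"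
    and AZ: "insert Z ?A <= inf" "0 : insert Z ?A" and AW: "insert W ?A <= inf" "0 : insert W ?A"
    using A zw by auto
  have scale: "alpha * x : ?LL" if "alpha : E" "x : ?LL" for alpha x by (rule free_leading_scale[OF ctx that])
  have regZ: "v : ?LL" if "v : regular (insert Z ?A) ?V s" for v s by (rule regular_free_leading[OF ctx that])
  have regW: "v : ?LL" if v: "v : regular (insert W ?A) ?V s" for v s
  proof -
    have "adjoin E Y X <= U" using sub adjoin_commute by simp
    moreover have "v : regular (insert W ?A) (W + Z) s" using v by (simp add: add.commute)
    ultimately have "v : free_leading E U M Y X"
      by (intro regular_free_leading[OF sf fr free_pair_sym[OF sf fp] _ sm W Z])
    thus ?thesis using free_leading_commute[OF sf, of U M X Y] by simp
  qed
  have gens: "insert Z (insert ?V ?A) <= gen0 (insert Z (insert ?V ?A))" by (rule gen0_incl[OF AZV])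
  have mZ: "kc (-1) * Z : gen0 (insert Z (insert ?V ?A))"
    by (rule gen_closed(6)[OF AZV gen_kc[OF AZV]]) (use gens in blast)
  have "?V + kc (-1) * Z : gen0 (insert Z (insert ?V ?A))"
    by (rule gen_closed(5)[OF AZV _ mZ]) (use gens in blast)
  hence "W : gen0 (insert Z (insert ?V ?A))" by (simp add: kc_simps)
  hence "insert Z (insert W ?A) <= gen0 (insert Z (insert ?V ?A))" using gens by blast
  hence u': "u : gen (insert Z (insert ?V ?A))" using gen_trans(1)[OF AZV] u by blast
  have ZWg: "Z * W : gen0 (insert ?V ?A)" using zw(4) gen0_incl[OF AV] by blast
  have "kc (-1) * (Z * W) : gen0 (insert ?V ?A)" by (rule gen_closed(6)[OF AV gen_kc[OF AV] ZWg])
  hence mZW: "- (Z * W) : gen0 (insert ?V ?A)" by (simp add: kc_simps)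
  have "?V : gen0 (insert ?V ?A)" using gen0_incl[OF AV] by blast
  hence p: "ALL i<2. (if i = (0::nat) then - (Z * W) else ?V) : gen0 (insert ?V ?A)" using mZW by simp
  have "Z ^ 2 = (SUM i<2. (if i = (0::nat) then - (Z * W) else ?V) * Z ^ i)"
    by (simp add: numeral_2_eq_2 algebra_simps)
  from monic_elimination[OF AV zw(1) p this u']
  obtain q where q: "ALL i<2. q i : gen (insert ?V ?A)" "u = (SUM i<2. q i * Z ^ i)" by blast
  have u_eq: "u = q 0 + q 1 * Z" using q(2) by (simp add: numeral_2_eq_2)
  have noeth: "q i = 0 | (EX alpha:E Int good. EX s. EX v:regular ?A ?V s. q i = alpha * v)" if "i < 2" for i
    by (rule subfield_noetherian[OF sf zw(3)]) (use q that in blast)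
  have reg1: "v : gen1 (insert ?V ?A)" if "v : regular ?A ?V s" for v s
    using regular_gen1[OF A zw(3)] that by blast
  have zero1: "0 : gen1 (insert ?V ?A)" using gen_kc[OF AV, of 0] by (simp add: kc_simps)
  have case1: "v + Z * y : ?LL" if v: "v : regular ?A ?V s" and y: "y : gen1 (insert ?V ?A)" for v y s
  proof (rule regZ)
    have "v : regular (insert Z ?A) ?V s" using v regular_mono[of ?A "insert Z ?A"] by blast
    moreover have "y : gen1 (insert ?V (insert Z ?A))" using y gen1_mono[of "insert ?V ?A" "insert ?V (insert Z ?A)"] by blast
    moreover have "Z : gen0 (insert Z ?A)" using gen0_incl[OF AZ] by blast
    ultimately show "v + Z * y : regular (insert Z ?A) ?V s" by (intro regular_perturb[OF AZ zw(3)])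
  qed
  \<comment> \<open>Up to sign, \<open>Z * v\<close> is \<open>- (v * V)\<close>, regular of one
    degree more, perturbed by \<open>W * v\<close>. In this case the factor \<open>x\<close> is
    infinitesimal, so \<open>x * y\<close> is a perturbation as well.\<close>
  have case2: "x * y + Z * v : ?LL" if v: "v : regular ?A ?V s" and y: "y : gen1 (insert ?V ?A)" and x: "x : ?A" for v y s x
  proof -
    have up: "t : gen1 (insert ?V (insert W ?A))" if "t : gen1 (insert ?V ?A)" for t
      using that gen1_mono[of "insert ?V ?A" "insert ?V (insert W ?A)"] by blast
    have "- (v * ?V) : regular ?A ?V (Suc s)" by (rule regular_shift[OF A zw(3) v])
    hence "- (v * ?V) : regular (insert W ?A) ?V (Suc s)" using regular_mono[of ?A "insert W ?A"] by blast
    moreover have "W : gen0 (insert W ?A)" using gen0_incl[OF AW] by blast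
    ultimately have 1: "- (v * ?V) + W * v : regular (insert W ?A) ?V (Suc s)"
      by (intro regular_perturb[OF AW zw(3)] up reg1[OF v])
    have "- x : ?A" using x subfield_uminus[OF sf] inf_closed(4) by blast
    hence "- x : gen0 (insert W ?A)" using gen0_incl[OF AW] by blast
    hence "(- (v * ?V) + W * v) + (- x) * y : regular (insert W ?A) ?V (Suc s)"
      by (intro regular_perturb[OF AW zw(3) 1] up y)
    hence "kc (-1) * ((- (v * ?V) + W * v) + (- x) * y) : ?LL" by (intro scale subfield_kc[OF sf] regW)
    moreover have "kc (-1) * ((- (v * ?V) + W * v) + (- x) * y) = x * y + Z * v" by (simp add: kc_simps algebra_simps)
    ultimately show ?thesis by simp
  qed
  show ?thesis
  proof (cases "q 1 = 0")
    case True
    show ?thesis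
    proof (cases "q 0 = 0")
      case False
      then obtain alpha s v where v: "alpha : E" "v : regular ?A ?V s" "q 0 = alpha * v" using noeth[of 0] by auto
      have "alpha * (v + Z * 0) : ?LL" by (intro scale v case1[OF v(2)] zero1)
      thus ?thesis unfolding u_eq using v(3) True by simp
    qed (use True u_eq in "simp add: free_leading_def[OF sf]")
  next
    case False
    then obtain beta t w where w: "beta : E" "beta : good" "w : regular ?A ?V t" "q 1 = beta * w" using noeth[of 1] by auto
    have beta0: "beta ~= 0" using w(2) zero_not_good by auto
    show ?thesis
    proof (cases "q 0 = 0")
      case True
      have "beta * (0 * w + Z * w) : ?LL" by (intro scale w case2[OF w(3)] reg1[OF w(3)] A)
      thus ?thesis unfolding u_eq using w(4) True by (simp add: mult_ac)
    next
      case False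
      then obtain alpha s v where v: "alpha : E" "alpha : good" "v : regular ?A ?V s" "q 0 = alpha * v" using noeth[of 0] by auto
      have alpha0: "alpha ~= 0" using v(2) zero_not_good by auto
      show ?thesis
      proof (cases "val alpha <= val beta")
        case True
        obtain c where c: "c : E" "beta = alpha * c" "c : good" "val c = val beta - val alpha"
          using subfield_quotient[OF sf v(1,2) w(1)] beta0 by metis
        have "c : gen1 ?A" using subfield_gen1[OF sf c(1,3)] c(4) True by simp
        hence "c : gen1 (insert ?V ?A)" using gen1_mono[of ?A "insert ?V ?A"] by blast
        hence "c * w : gen1 (insert ?V ?A)" by (rule gen_closed(4)[OF AV _ reg1[OF w(3)]])
        hence "alpha * (v + Z * (c * w)) : ?LL" by (intro scale v case1[OF v(3)])
        thus ?thesis unfolding u_eq v(4) w(4) c(2) by (simp add: algebra_simps)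
      next
        case False
        obtain c where c: "c : E" "alpha = beta * c" "c : good" "val c = val alpha - val beta"
          using subfield_quotient[OF sf w(1,2) v(1)] alpha0 by metis
        have "c : ?A" using good_inf[OF c(3)] c(1,4) False by simp
        hence "beta * (c * v + Z * w) : ?LL" by (intro scale w case2[OF w(3)] reg1[OF v(3)])
        thus ?thesis unfolding u_eq v(4) w(4) c(2) by (simp add: algebra_simps)
      qed
    qed
  qed
qed

section \<open>Finitely many monomials with exponents of either sign\<close>

definition power_multiple :: "'p set => 'p => nat => 'p => bool" where
  "power_multiple E X K z \<longleftrightarrow> (EX p:E Int good. EX k>0. k dvd K & z = p * X ^ k)"

lemma common_power:
  assumes "finite P" "ALL z:P. EX K>0. power_multiple E X K z"
  shows "EX K>0. ALL z:P. power_multiple E X K z" using assms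
proof (induction P rule: finite_induct)
  case (insert z P)
  obtain K where K: "0 < K" "ALL z:P. power_multiple E X K z" using insert by auto
  obtain L where L: "0 < L" "power_multiple E X L z" using insert by auto
  have "power_multiple E X (K * L) y" if "power_multiple E X K y | power_multiple E X L y" for y
    using that unfolding power_multiple_def by (meson dvd_mult dvd_mult2)
  thus ?case using K L by (intro exI[of _ "K * L"]) auto
qed auto

text \<open>Each \<open>z\<close> has a power of the form \<open>c z * X ^ K\<close>. When
  \<open>c x\<close> has least value, all these powers are integral multiples of the one
  infinitesimal \<open>c x * X ^ K\<close>. So every \<open>z\<close> satisfies a monic equation
  over it, although it need not be a series in it.\<close>

lemma dominating_root:
  assumes sf: "analytic_subfield E" and X: "X : good" and P: "finite P" "P ~= {}" "P <= inf" and K: "0 < K" "ALL z:P. power_multiple E X K z"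
  shows "EX d:E Int good. d * X ^ K : inf & (ALL z:P. EX m>0. EX q:gen1 (E Int inf). z ^ m = q * (d * X ^ K))"
proof -
  have "EX c m. c : E Int good & 0 < m & z ^ m = c * X ^ K" if z: "z : P" for z
  proof -
    obtain p k where p: "p : E" "p : good" "0 < k" "k dvd K" "z = p * X ^ k" using K(2) z unfolding power_multiple_def by blast
    obtain m where m: "K = k * m" using p(4) by (auto elim: dvdE)
    have "z ^ m = p ^ m * X ^ K" by (simp add: p(5) m power_mult_distrib power_mult)
    moreover have "0 < m" using m K(1) by (cases m) auto
    ultimately show ?thesis using subfield_power[OF sf p(1)] good_power[OF p(2)] by blast
  qed
  then obtain c m where cm: "!!z. z : P ==> c z : E Int good & 0 < m z & z ^ m z = c z * X ^ K" by metis
  obtain x where x: "x : P" "ALL z:P. val (c x) <= val (c z)"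
    using ex_min_if_finite[of "(%z. val (c z)) ` P"] P(1,2) by (force simp: not_less)
  have cx: "c x : E" "c x : good" using cm[OF x(1)] by auto
  have "c x * X ^ K : inf" using cm[OF x(1)] inf_power[of x "m x"] x(1) P(3) by (metis subsetD)
  moreover have "EX m>0. EX q:gen1 (E Int inf). z ^ m = q * (c x * X ^ K)" if z: "z : P" for z
  proof -
    have cz: "c z : E" "c z ~= 0" using cm[OF z] zero_not_good by auto
    obtain q where q: "q : E" "c z = c x * q" "q : good" "val q = val (c z) - val (c x)"
      using subfield_quotient[OF sf cx cz(1)] cz(2) by metis
    have "q : gen1 (E Int inf)" using subfield_gen1[OF sf q(1,3)] q(4) x(2) z by simp
    moreover have "z ^ m z = q * (c x * X ^ K)" using cm[OF z] q(2) by (simp add: mult_ac)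
    ultimately show ?thesis using cm[OF z] by blast
  qed
  ultimately show ?thesis using cx by blast
qed

text \<open>All the monomials satisfy monic equations over \<open>Z = d * X ^ K\<close> and
  \<open>W = d' * Y ^ K\<close>, so every value is a combination of
  \<open>1, X, ..., X^(K-1)\<close> over a ring built from the series in \<open>Z\<close> and
  \<open>W\<close>. Each nonzero coefficient has a leading value in powers of \<open>X ^ K\<close>;
  hence the exponents of different summands are distinct modulo \<open>K\<close>.\<close>

lemma gen_free_leading:
  assumes sf: "analytic_subfield E" and fp: "free_pair E X Y"
    and P: "finite P" "P ~= {}" "P <= inf" "ALL z:P. EX K>0. power_multiple E X K z"
    and N: "finite N" "N <= inf" "ALL z:N. EX K>0. power_multiple E Y K z"
    and u: "u : gen (P Un N Un (E Int inf))"
  shows "u = 0 | (EX v. u : leading (adjoin E X Y) (adjoin E X Y Int inf) v)"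
proof -
  let ?A = "E Int inf" and ?U = "adjoin E X Y" and ?M = "adjoin E X Y Int inf"
  note A = smallD[OF sf]
  have X: "X : good" "X * Y = 1" using fp unfolding free_pair_def by auto
  note Y = Y_good[OF sf X]
  have YX: "Y * X = 1" using X by (simp add: mult.commute)
  note fr = frame_free[OF sf fp]
  obtain K1 where K1: "0 < K1" "ALL z:P. power_multiple E X K1 z" using common_power[OF P(1,4)] by blast
  obtain K2 where K2: "0 < K2" "ALL z:N. power_multiple E Y K2 z" using common_power[OF N(1,3)] by blast
  define K where "K = K1 * K2"
  have K: "0 < K" "ALL z:P. power_multiple E X K z" "ALL z:N. power_multiple E Y K z"
    using K1 K2 unfolding K_def power_multiple_def by (simp, meson dvd_mult2, meson dvd_mult)
  obtain d where d: "d : E" "d : good" "d * X ^ K : inf" "ALL z:P. EX m>0. EX q:gen1 ?A. z ^ m = q * (d * X ^ K)"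
    using dominating_root[OF sf X(1) P(1-3) K(1,2)] by blast
  \<comment> \<open>If no monomial in \<open>Y\<close> occurs, \<open>d'\<close> and with it
    \<open>W\<close> is 0.\<close>
  have "EX d':E. (N ~= {} --> d' : good) & d' * Y ^ K : inf & (ALL z:N. EX m>0. EX q:gen1 ?A. z ^ m = q * (d' * Y ^ K))"
  proof (cases "N = {}")
    case True
    thus ?thesis using subfieldD(2)[OF sf] zero_inf by (intro bexI[of _ 0]) auto
  next
    case False
    thus ?thesis using dominating_root[OF sf Y N(1) False N(2) K(1,3)] by blast
  qed
  then obtain d' where d': "d' : E" "N ~= {} --> d' : good" "d' * Y ^ K : inf" "ALL z:N. EX m>0. EX q:gen1 ?A. z ^ m = q * (d' * Y ^ K)" by blast
  define Z W where "Z = d * X ^ K" and "W = d' * Y ^ K"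
  let ?A' = "insert Z (insert W ?A)"
  have ZWi: "Z : inf" "W : inf" using d d' by (auto simp: Z_def W_def)
  have A': "?A' <= inf" "0 : ?A'" using A ZWi by auto
  have fpK: "free_pair E (X ^ K) (Y ^ K)" by (rule free_pair_power[OF sf fp K(1)])
  have XK: "X ^ K : good" "X ^ K * Y ^ K = 1" using fpK unfolding free_pair_def by auto
  have adj: "adjoin E (X ^ K) (Y ^ K) <= ?U"
  proof
    fix x assume "x : adjoin E (X ^ K) (Y ^ K)"
    then obtain p i j where x: "x = p * (X ^ K) ^ i * (Y ^ K) ^ j" "p : E" unfolding adjoin_def by blast
    hence "x = p * X ^ (K * i) * Y ^ (K * j)" by (simp add: power_mult)
    thus "x : ?U" using adjoinI[OF x(2)] by simp
  qed
  have ZM: "Z : ?M" "W : ?M"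
    using adjoinI[OF d(1), of X K Y 0] adjoinI[OF d'(1), of X 0 Y K] ZWi by (auto simp: Z_def W_def)
  have sm: "?A <= ?M" using subset_adjoin[OF sf X] by blast
  note ctx = sf fr fpK adj sm ZM(1) Z_def d(1) ZM(2) W_def d'(1)
  let ?LL = "free_leading E ?U ?M (X ^ K) (Y ^ K)"
  have genLL: "g : ?LL" if "g : gen ?A'" for g by (rule gen_pair_leading[OF ctx that])
  define Q where "Q = {\<phi> * g |\<phi> g. \<phi> : E & g : gen ?A'}"
  have QI: "\<phi> * g : Q" if "\<phi> : E" "g : gen ?A'" for \<phi> g using that unfolding Q_def by blast
  have k1: "kc r : gen1 ?A'" for r by (rule gen_kc[OF A'])
  have g1: "1 : gen ?A'" using gen1_gen[OF k1[of 1]] by (simp add: kc_simps)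
  have Q_gen: "g : Q" if "g : gen ?A'" for g using QI[OF subfield_one[OF sf] that] by simp
  have Q_E: "\<phi> : Q" if "\<phi> : E" for \<phi> using QI[OF that g1] by simp
  have Q_mult: "x * y : Q" if "x : Q" "y : Q" for x y
  proof -
    obtain \<phi> g psi h where xy: "x = \<phi> * g" "\<phi> : E" "g : gen ?A'" "y = psi * h" "psi : E" "h : gen ?A'" using `x : Q` `y : Q` unfolding Q_def by blast
    have "x * y = (\<phi> * psi) * (g * h)" by (simp add: xy mult_ac)
    thus ?thesis using QI[OF subfieldD(4)[OF sf xy(2,5)] gen_closed(2)[OF A' xy(3,6)]] by simp
  qed
  have Q_add': "\<phi> * g + psi * h : Q" if *: "\<phi> : E" "g : gen ?A'" "psi : E" "h : gen ?A'" "\<phi> : good" "psi : good" "val \<phi> <= val psi" for \<phi> g psi h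
  proof -
    have "psi ~= 0" using *(6) zero_not_good by auto
    then obtain c where c: "c : E" "psi = \<phi> * c" "c : good" "val c = val psi - val \<phi>"
      using subfield_quotient[OF sf *(1,5,3)] by metis
    have "c : gen1 ?A" using subfield_gen1[OF sf c(1,3)] c(4) *(7) by simp
    hence "c : gen ?A'" using gen1_mono[of ?A ?A'] gen1_gen by blast
    hence "g + c * h : gen ?A'" by (intro gen_closed(1,2)[OF A'] *)
    from QI[OF *(1) this] show ?thesis by (simp add: c(2) algebra_simps)
  qed
  have Q_add: "x + y : Q" if "x : Q" "y : Q" for x y
  proof -
    obtain \<phi> g psi h where xy: "x = \<phi> * g" "\<phi> : E" "g : gen ?A'" "y = psi * h" "psi : E" "h : gen ?A'" using `x : Q` `y : Q` unfolding Q_def by blast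
    show ?thesis
    proof (cases "\<phi> = 0 | psi = 0")
      case True
      thus ?thesis using xy `x : Q` `y : Q` by auto
    next
      case False
      hence "\<phi> : good" "psi : good" using subfield_good[OF sf] xy by auto
      thus ?thesis using Q_add'[OF xy(2,3,5,6)] Q_add'[OF xy(5,6,2,3)] linear[of "val \<phi>" "val psi"] xy by (auto simp: add.commute)
    qed
  qed
  have Q0: "0 : Q" using Q_E[OF subfieldD(2)[OF sf]] .
  have ZWg: "Z : gen ?A'" "W : gen ?A'" using gen0_incl[OF A'] gen0_gen1 gen1_gen by blast+
  obtain c where c: "c : E" "d * c = 1" using subfieldD(5)[OF sf d(1,2)] by blast
  have "c * Z = (d * c) * X ^ K" by (simp add: Z_def mult_ac)
  hence XKQ: "X ^ K : Q" using QI[OF c(1) ZWg(1)] c(2) by simp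
  let ?S = "power_span Q X K"
  have "ALL x:Q. ALL y:Q. x + y : Q" "ALL x:Q. ALL y:Q. x * y : Q" using Q_add Q_mult by blast+
  note S = power_span_closed[OF K(1) Q0 this XKQ]
  have S_Q: "x : ?S" if "x : Q" for x using S(1)[OF that, of 0] by simp
  have PS: "z : ?S" if "z : P" for z
  proof -
    obtain p k where "p : E" "z = p * X ^ k" using K(2) `z : P` unfolding power_multiple_def by blast
    thus ?thesis using S(1)[OF Q_E] by simp
  qed
  have NS: "z : ?S" if "z : N" for z
  proof -
    obtain p k where p: "p : E" "k dvd K" "z = p * Y ^ k" using K(3) `z : N` unfolding power_multiple_def by blast
    have "d' : good" using d'(2) `z : N` by blast
    then obtain c where c: "c : E" "d' * c = 1" using subfieldD(5)[OF sf d'(1)] by blast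
    have "k <= K" using p(2) K(1) by (rule dvd_imp_le)
    hence "Y ^ K * X ^ (K - k) = Y ^ k" using pair_cancel[OF sf YX, of k "K - k"] by simp
    moreover have "c * W = (d' * c) * Y ^ K" by (simp add: W_def mult_ac)
    ultimately have "z = (p * c) * W * X ^ (K - k)" using c(2) by (simp add: p(3) mult.assoc)
    moreover have "(p * c) * W : Q" by (intro QI subfieldD(4)[OF sf] p c ZWg)
    ultimately show ?thesis using S(1) by simp
  qed
  have genS: "gen (R Un ?A') <= ?S" if "finite R" "R <= P Un N" for R using that
  proof (induction R rule: finite_induct)
    case empty
    thus ?case using Q_gen S_Q by auto
  next
    case (insert z R)
    let ?C = "R Un ?A'"
    have C: "?C <= inf" "0 : ?C" using insert(4) A' P(3) N(2) by auto
    have z: "z : inf" "z : ?S" using insert(4) P(3) N(2) PS NS by auto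
    have "EX m>0. EX q:gen1 ?A. z ^ m = q * Z | z ^ m = q * W"
      using insert(4) d(4) d'(4) unfolding Z_def[symmetric] W_def[symmetric] by blast
    then obtain m q where m: "0 < m" "q : gen1 ?A" "z ^ m = q * Z | z ^ m = q * W" by blast
    have "q : gen1 ?C" using m(2) gen1_mono[of ?A ?C] by blast
    moreover have "Z : gen0 ?C" "W : gen0 ?C" using gen0_incl[OF C] by auto
    ultimately have zm: "z ^ m : gen0 ?C" using m(3) gen_closed(6)[OF C] by metis
    have "1 : ?S" "gen ?C <= ?S" using S_Q[OF Q_E[OF subfield_one[OF sf]]] insert by auto
    from gen_insert_closed[OF C z m(1) zm this(1) S(3,4) this(2)] show ?case by (simp only: Un_insert_left)
  qed
  have "P Un N Un ?A <= (P Un N) Un ?A'" by blast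
  hence "gen (P Un N Un ?A) <= gen ((P Un N) Un ?A')" by (rule gen_mono)
  hence "u : ?S" using u genS[of "P Un N"] P(1) N(1) by auto
  then obtain q where q: "ALL k<K. q k : Q" "u = (SUM k<K. q k * X ^ k)" unfolding power_span_def by blast
  have "EX alpha i j. alpha : E Int good & q k : leading ?U ?M (val (alpha * (X ^ K) ^ i * (Y ^ K) ^ j))" if k: "k < K" "q k ~= 0" for k
  proof -
    obtain \<phi> g where "q k = \<phi> * g" "\<phi> : E" "g : gen ?A'" using q(1) k(1) unfolding Q_def by blast
    hence "q k : ?LL" using free_leading_scale[OF ctx _ genLL] by simp
    thus ?thesis using k(2) unfolding free_leading_def[OF sf] by blast
  qed
  then obtain alpha i j where alpha: "!!k. k < K ==> q k ~= 0 ==>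
    alpha k : E Int good & q k : leading ?U ?M (val (alpha k * (X ^ K) ^ i k * (Y ^ K) ^ j k))" by metis
  define v where "v = (%k. val (alpha k * X ^ (K * i k + k) * Y ^ (K * j k)))"
  have lead: "q k * X ^ k : leading ?U ?M (v k)" if k: "k < K" "q k ~= 0" for k
  proof -
    have Xk: "X ^ k : ?U" "X ^ k : good" using adjoinI[OF subfield_one[OF sf], of X k Y 0] good_power[OF X(1)] by auto
    have g: "alpha k * (X ^ K) ^ i k * (Y ^ K) ^ j k : good" using alpha[OF k] good_mult good_power X(1) Y by simp
    have "alpha k * (X ^ K) ^ i k * (Y ^ K) ^ j k * X ^ k = alpha k * X ^ (K * i k + k) * Y ^ (K * j k)"
      by (simp add: power_add power_mult mult_ac)
    hence "v k = val (alpha k * (X ^ K) ^ i k * (Y ^ K) ^ j k) + val (X ^ k)"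
      unfolding v_def using val_mult[OF g Xk(2)] by simp
    thus ?thesis using leading_mult[OF fr _ leading_monomial[OF fr Xk]] alpha[OF k] by simp
  qed
  have dist: "v k ~= v l" if k: "k < K" "q k ~= 0" and l: "l < K" "q l ~= 0" and kl: "k ~= l" for k l
  proof
    assume "v k = v l"
    hence "(K * i k + k) + K * j l = (K * i l + l) + K * j k"
      unfolding v_def using alpha[OF k] alpha[OF l] by (intro free_val_eq[OF sf fp]) auto
    hence "(k + K * (i k + j l)) mod K = (l + K * (i l + j k)) mod K" by (simp add: algebra_simps)
    thus False using k(1) l(1) kl by simp
  qed
  have "sum (%k. q k * X ^ k) {..<K} = 0 | (EX k:{..<K}. q k * X ^ k ~= 0 & sum (%k. q k * X ^ k) {..<K} : leading ?U ?M (v k))"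
  proof (rule leading_sum[OF fr])
    show "ALL k:{..<K}. q k * X ^ k = 0 | q k * X ^ k : leading ?U ?M (v k)"
    proof
      fix k assume "k : {..<K}"
      thus "q k * X ^ k = 0 | q k * X ^ k : leading ?U ?M (v k)" using lead[of k] by (cases "q k = 0") auto
    qed
    show "ALL k:{..<K}. ALL l:{..<K}. k ~= l --> q k * X ^ k ~= 0 --> q l * X ^ l ~= 0 --> v k ~= v l"
    proof (intro ballI impI)
      fix k l assume "k : {..<K}" "l : {..<K}" "k ~= l" "q k * X ^ k ~= 0" "q l * X ^ l ~= 0"
      thus "v k ~= v l" by (intro dist) auto
    qed
  qed simp
  thus ?thesis unfolding q(2)[symmetric] by blast
qed

text \<open>The monomials involved are sorted by the sign of the exponent of \<open>X\<close>; those
  with exponent 0 lie in \<open>E\<close>. As \<open>gen_free_leading\<close> asks for a positive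
  exponent, \<open>X\<close> and \<open>Y\<close> are exchanged when there are only negative
  ones.\<close>

lemma free_extension:
  assumes sf: "analytic_subfield E" and fp: "free_pair E X Y"
  shows "EX E'. analytic_subfield E' & E <= E' & X : E'"
proof -
  let ?U = "adjoin E X Y" and ?M = "adjoin E X Y Int inf"
  have X: "X : good" "X * Y = 1" using fp unfolding free_pair_def by auto
  have YX: "Y * X = 1" using X by (simp add: mult.commute)
  note fr = frame_free[OF sf fp] and fp' = free_pair_sym[OF sf fp]
  note M = frameD(1,2)[OF fr]
  have "u = 0 | (EX v. u : leading ?U ?M v)" if u: "u : gen ?M" for u
  proof -
    obtain F where F: "finite F" "F <= ?M" "u : gen (insert 0 F)" using gen_finite[OF M u] by blast
    define P N where "P = {z:F. EX K>0. power_multiple E X K z}" and "N = {z:F. EX K>0. power_multiple E Y K z}"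
    have P: "finite P" "P <= inf" "ALL z:P. EX K>0. power_multiple E X K z" and N: "finite N" "N <= inf" "ALL z:N. EX K>0. power_multiple E Y K z"
      using F by (auto simp: P_def N_def)
    have "z : P Un N Un (E Int inf)" if z: "z : F" for z
    proof -
      obtain p i j where p: "z = p * X ^ i * Y ^ j" "p : E" using F(2) z unfolding adjoin_def by blast
      have pm: "power_multiple E T k (p * T ^ k)" if "0 < k" "p ~= 0" for T k
        unfolding power_multiple_def using subfield_good[OF sf p(2) that(2)] p(2) that(1) by (intro bexI[of _ p] exI[of _ k]) auto
      consider "p = 0 | i = j" | "p ~= 0" "j < i" | "p ~= 0" "i < j" by linarith
      thus ?thesis
      proof cases
        case 1
        hence "z : E" using p pair_cancel[OF sf X(2), of 0 j] by (auto simp: mult.assoc)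
        thus ?thesis using F(2) z by auto
      next
        case 2
        hence "z = p * X ^ (i - j)" using p(1) pair_cancel[OF sf X(2), of "i - j" j] by (simp add: mult.assoc)
        hence "power_multiple E X (i - j) z" using pm[of "i - j" X] 2 by simp
        thus ?thesis using z 2 unfolding P_def by (auto intro!: exI[of _ "i - j"])
      next
        case 3
        hence "X ^ i * Y ^ j = Y ^ (j - i)" using pair_cancel[OF sf YX, of "j - i" i] by (simp add: mult.commute)
        hence "z = p * Y ^ (j - i)" using p(1) by (simp add: mult.assoc)
        hence "power_multiple E Y (j - i) z" using pm[of "j - i" Y] 3 by simp
        thus ?thesis using z 3 unfolding N_def by (auto intro!: exI[of _ "j - i"])
      qed
    qed
    hence "insert 0 F <= P Un N Un (E Int inf)" using smallD(2)[OF sf] by blast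
    hence u': "u : gen (P Un N Un (E Int inf))" using gen_mono F(3) by blast
    consider "P ~= {}" | "N ~= {}" | "P = {}" "N = {}" by blast
    thus ?thesis
    proof cases
      case 1
      thus ?thesis using gen_free_leading[OF sf fp P(1) _ P(2,3) N u'] by blast
    next
      case 2
      have "u : gen (N Un P Un (E Int inf))" using u' by (simp add: Un_commute)
      from gen_free_leading[OF sf fp' N(1) 2 N(2,3) P this] show ?thesis unfolding adjoin_commute[of E Y X] .
    next
      case 3
      hence "u : E" using u' subfieldD(6)[OF sf] by auto
      hence "u : ?U" using subset_adjoin[OF sf X] by blast
      thus ?thesis using leading_monomial[OF fr, of u] subfield_good[OF sf `u : E`] by (cases "u = 0") auto
    qed
  qed
  then obtain E' where "analytic_subfield E'" "?U <= E'" using extension[OF fr] by blast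
  thus ?thesis using subset_adjoin[OF sf X] adjoin_X[OF sf X] by blast
qed

end

section \<open>The product of an analytic field and a Hahn field\<close>

lemma hahn_sum_single_times:
  fixes h :: "'j => ('g::linordered_ab_group_add, 'a::comm_ring_1) hahn"
  assumes h: "hahn_summable h J"
  shows "hahn_summable (%j. x * h j) J" "hahn_sum (%j. x * h j) J = x * hahn_sum h J"
proof -
  have s: "hahn_summable (%_. x) {()}" "hahn_sum (%_. x) {()} = x" using hahn_sum_finite[of "{()}" "%_. x"] by auto
  note t = hahn_sum_times[OF s(1) h]
  have "bij_betw (Pair ()) J ({()} \<times> J)" by (auto simp: bij_betw_def inj_on_def)
  from hahn_sum_reindex[OF this t(1)] show "hahn_summable (%j. x * h j) J" "hahn_sum (%j. x * h j) J = x * hahn_sum h J"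
    using t(2) s(2) by simp_all
qed

context hahn_evaluation
begin

lemma hahn_eval_monomial: "hahn_eval \<iota> (hahn_single omega (mps_const c)) a = hahn_single (\<iota> omega) c"
proof -
  have "hahn_eval \<iota> (hahn_single omega (mps_const c)) a = hahn_sum (hterm (hahn_single omega (mps_const c)) a) {(omega, 0)}"
    unfolding hahn_eval_def
  proof (rule hahn_sum_neutral(2))
    show "hterm (hahn_single omega (mps_const c)) a j = 0" if "j : UNIV - {(omega, 0)}" for j
      using that by (cases j) (auto simp: mps_const.rep_eq zero_mps.rep_eq hahn_single_zero)
  qed simp
  also have "... = hahn_single (\<iota> omega) c" using hahn_sum_finite(2)[of "{(omega, 0)}" "hterm (hahn_single omega (mps_const c)) a"]
    by (simp add: mps_const.rep_eq)
  finally show ?thesis .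
qed

text \<open>The nested sums of the natural structure are the single sum of \<open>hahn_eval\<close>,
  for the series expanded at the real parts, grouped by the exponent \<open>i\<close>.\<close>

lemma natural_structure_eq:
  fixes a :: "('g, real) hahn list"
  assumes F: "vars n (hahn_map (mps_affine 1 (map (%x. hahn_coeff x 0) a)) f)" and len: "length a = n"
    and inf: "!!i. i < n ==> a ! i - hahn_single 0 (hahn_coeff (a ! i) 0) : hahn_inf"
  shows "natural_structure \<iota> n alpha f a = hahn_eval \<iota> (hahn_map (mps_affine 1 (map (%x. hahn_coeff x 0) a)) f)
    (%i. if i < n then a ! i - hahn_single 0 (hahn_coeff (a ! i) 0) else 0)"
proof -
  define a0 where "a0 = map (%x. hahn_coeff x 0) a"
  define \<epsilon> where "\<epsilon> = map (%x. x - hahn_single 0 (hahn_coeff x 0)) a"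
  define b where "b = (%i. if i < n then a ! i - hahn_single 0 (hahn_coeff (a ! i) 0) else 0)"
  define F where "F = hahn_map (mps_affine 1 a0) f"
  define J :: "('w \<times> (nat \<Rightarrow>\<^sub>0 nat)) set" where "J = {j. hahn_coeff f (fst j) ~= 0 & keys (snd j) <= {..<n}}"
  have b: "b i : hahn_inf" if "i < n" for i using inf that by (simp add: b_def)
  have F: "vars n F" using F by (simp add: F_def a0_def)
  have sF: "hahn_summable (hterm F b) UNIV" by (rule term_summable[OF F b])
  have coeffF: "mps_coeff (hahn_coeff F i) mu = (if hahn_coeff f i = 0 then 0 else mps_taylor (hahn_coeff f i) a0 mu)" for i mu
    by (simp add: F_def hahn_map.rep_eq mps_affine_def Abs_mps_inverse zero_mps.rep_eq)
  have eval: "mon b mu = mon_eval \<epsilon> mu" if "keys mu <= {..<n}" for mu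
    unfolding mon_def mon_eval_def by (rule prod.cong[OF refl]) (use that len in "auto simp: b_def \<epsilon>_def subset_iff")
  have "hahn_eval \<iota> F b = hahn_sum (hterm F b) J" unfolding hahn_eval_def
  proof (rule hahn_sum_neutral(2))
    fix j assume "j : UNIV - J"
    moreover obtain i mu where j: "j = (i, mu)" by force
    ultimately have "mps_coeff (hahn_coeff F i) mu = 0"
    proof (cases "hahn_coeff f i = 0")
      case False
      hence "~ keys mu <= {..<n}" using j `j : UNIV - J` by (simp add: J_def)
      thus ?thesis using F unfolding mps_in_vars_def by blast
    qed (simp add: coeffF)
    thus "hterm F b j = 0" by (simp add: j hahn_single_zero)
  qed simp
  also have "... = hahn_sum (%i. hahn_sum (hterm F b) {j:J. fst j = i}) {i. hahn_coeff f i ~= 0}"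
    by (rule hahn_sum_group(2)[symmetric]) (use hahn_summable_subset[OF sF] in "auto simp: J_def")
  also have "... = hahn_sum (%i. hahn_single (\<iota> i) 1 *
      hahn_sum (%mu. hahn_single 0 (mps_taylor (hahn_coeff f i) a0 mu) * mon_eval \<epsilon> mu) {mu. keys mu <= {..<n}})
      {i. hahn_coeff f i ~= 0}"
  proof (rule hahn_sum_cong)
    fix i assume "i : {i. hahn_coeff f i ~= 0}"
    hence i: "hahn_coeff f i ~= 0" by simp
    let ?K = "{mu :: nat \<Rightarrow>\<^sub>0 nat. keys mu <= {..<n}}"
    have bij: "bij_betw (Pair i) ?K {j:J. fst j = i}" using i by (auto simp: bij_betw_def inj_on_def J_def)
    have s: "hahn_summable (hterm F b) {j:J. fst j = i}" by (rule hahn_summable_subset[OF sF]) simp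
    have tt: "hterm F b (i, mu) = hahn_single (\<iota> i) 1 * (hahn_single 0 (mps_taylor (hahn_coeff f i) a0 mu) * mon_eval \<epsilon> mu)"
      if "mu : ?K" for mu
    proof -
      have "hahn_single (\<iota> i) (mps_taylor (hahn_coeff f i) a0 mu) = hahn_single (\<iota> i) 1 * hahn_single 0 (mps_taylor (hahn_coeff f i) a0 mu)"
        by (simp add: hahn_single_times)
      thus ?thesis using eval that i by (simp add: coeffF mult.assoc)
    qed
    let ?h = "%mu. hahn_single 0 (mps_taylor (hahn_coeff f i) a0 mu) * mon_eval \<epsilon> mu"
    have cancel: "hahn_single (- \<iota> i) 1 * (hahn_single (\<iota> i) 1 * x) = x" for x :: "('g, real) hahn"
      by (simp add: mult.assoc[symmetric] hahn_single_times hahn_single_zero_one)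
    note r = hahn_sum_reindex[OF bij s]
    \<comment> \<open>Summability of the inner family has to be established without the factor, as
      \<open>hahn_sum\<close> is 0 by default otherwise. Multiplication by the inverse monomial
      transfers it.\<close>
    have "hahn_summable (%mu. hahn_single (- \<iota> i) 1 * hterm F b (i, mu)) ?K" by (rule hahn_sum_single_times(1)[OF r(1)])
    moreover have "hahn_single (- \<iota> i) 1 * hterm F b (i, mu) = ?h mu" if "mu : ?K" for mu unfolding tt[OF that] by (rule cancel)
    ultimately have sh: "hahn_summable ?h ?K" using hahn_summable_cong by (metis (no_types, lifting))
    have "hahn_sum (hterm F b) {j:J. fst j = i} = hahn_sum (%mu. hterm F b (i, mu)) ?K"
      by (rule r(2)[symmetric])
    also have "... = hahn_sum (%mu. hahn_single (\<iota> i) 1 * ?h mu) ?K" by (rule hahn_sum_cong) (rule tt)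
    also have "... = hahn_single (\<iota> i) 1 * hahn_sum ?h ?K" by (rule hahn_sum_single_times(2)[OF sh])
    finally show "hahn_sum (hterm F b) {j:J. fst j = i} = hahn_single (\<iota> i) 1 * hahn_sum ?h ?K" .
  qed
  also have "... = natural_structure \<iota> n alpha f a" unfolding natural_structure_def Let_def a0_def \<epsilon>_def ..
  finally show ?thesis unfolding F_def a0_def b_def ..
qed

end

section \<open>The product ring and the natural valuation\<close>

instantiation prod :: (comm_ring_1, comm_ring_1) comm_ring_1
begin

definition times_prod :: "'a \<times> 'b => 'a \<times> 'b => 'a \<times> 'b" where
  "times_prod x y = (fst x * fst y, snd x * snd y)"

definition one_prod :: "'a \<times> 'b" where
  "one_prod = (1, 1)"

instance by standard (auto simp: times_prod_def one_prod_def prod_eq_iff algebra_simps)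

end

lemma prod_ring_simps [simp]:
  fixes x y :: "'a::comm_ring_1 \<times> 'b::comm_ring_1"
  shows "fst (x * y) = fst x * fst y" "snd (x * y) = snd x * snd y" "fst (1 :: 'a \<times> 'b) = 1" "snd (1 :: 'a \<times> 'b) = 1"
  by (simp_all add: times_prod_def one_prod_def)

lemma prod_power [simp]:
  fixes x :: "'a::comm_ring_1 \<times> 'b::comm_ring_1"
  shows "fst (x ^ n) = fst x ^ n" "snd (x ^ n) = snd x ^ n" by (induction n) simp_all

abbreviation nval :: "'k::linordered_field => 'k vgroup" where
  "nval == abs_vgroup"

lemma val_rel_refl: "x ~= 0 ==> val_rel x x" by (simp add: val_rel_def)

lemma nval_simps:
  "x ~= 0 ==> y ~= 0 ==> nval (x * y) = nval x + nval y" "nval 1 = 0" "x ~= 0 ==> nval (inverse x) = - nval x"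
  "x ~= 0 ==> y ~= 0 ==> nval (x / y) = nval x - nval y"
  using plus_vgroup.abs_eq uminus_vgroup.abs_eq minus_vgroup.abs_eq val_rel_refl
  by (fastforce simp: zero_vgroup.abs_eq)+

lemma nval_le_iff: "x ~= 0 ==> y ~= 0 ==> nval x <= nval y \<longleftrightarrow> y / x : val_ring"
  using less_eq_vgroup.abs_eq val_rel_refl by blast

lemma val_ring_add: "x : val_ring ==> y : val_ring ==> x + y : val_ring"
proof -
  assume "x : val_ring" "y : val_ring"
  then obtain m n where "\<bar>x\<bar> <= of_nat m" "\<bar>y\<bar> <= of_nat n" by (auto simp: val_ring_iff)
  hence "\<bar>x + y\<bar> <= of_nat (m + n)" by simp
  thus ?thesis unfolding val_ring_iff by blast
qed

lemma nval_minus: "x ~= 0 ==> nval (- x) = nval x"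
proof -
  assume x: "x ~= 0"
  have "\<bar>- 1\<bar> <= (of_nat 1 :: 'a)" by simp
  hence "- 1 : (val_ring :: 'a set)" unfolding val_ring_iff by blast
  thus ?thesis using x by (intro antisym) (simp_all add: nval_le_iff)
qed

lemma nval_add: "x ~= 0 ==> y ~= 0 ==> x + y ~= 0 ==> g < nval x ==> g < nval y ==> g < nval (x + y)"
proof -
  have *: "nval x <= nval (x + y)" if "x ~= 0" "y ~= 0" "x + y ~= 0" "nval x <= nval y" for x y :: 'a
  proof -
    have "1 + y / x : val_ring" using that by (intro val_ring_add) (simp_all add: nval_le_iff)
    thus ?thesis using that by (simp add: nval_le_iff add_divide_distrib)
  qed
  assume "x ~= 0" "y ~= 0" "x + y ~= 0" "g < nval x" "g < nval y"
  thus ?thesis using *[of x y] *[of y x] linear[of "nval x" "nval y"] by (auto simp: add.commute)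
qed

lemma infinitesimal_iff: "x ~= 0 ==> x : infinitesimals \<longleftrightarrow> 0 < nval x"
proof
  assume x: "x ~= 0"
  have le: "nval x <= 0 \<longleftrightarrow> inverse x : val_ring" using nval_le_iff[of x 1] x by (simp add: nval_simps divide_inverse)
  show "x : infinitesimals" if "0 < nval x"
    using infinite_inverse[of "inverse x"] le that by (auto simp: not_le[symmetric])
  show "0 < nval x" if i: "x : infinitesimals"
  proof (rule ccontr)
    assume "~ 0 < nval x"
    then obtain n where n: "\<bar>inverse x\<bar> <= of_nat n" using le by (auto simp: val_ring_iff not_less)
    have "1 = \<bar>inverse x\<bar> * \<bar>x\<bar>" using x by (simp add: abs_mult[symmetric])
    also have "... <= of_nat n * \<bar>x\<bar>" using n by (intro mult_right_mono) auto
    finally have "2 <= of_nat (2 * n) * \<bar>x\<bar>" by simp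
    moreover have "of_nat (2 * n) * \<bar>x\<bar> <= 1" using i unfolding infinitesimals_def by blast
    ultimately show False by simp
  qed
qed

lemma hahn_inf_iff: "y ~= 0 ==> y : hahn_inf \<longleftrightarrow> 0 < hahn_ord y"
proof
  assume y: "y ~= 0"
  show "0 < hahn_ord y" if "y : hahn_inf"
    using that hahn_coeff_ord[OF y] by (auto simp: hahn_inf_def not_le[symmetric])
  show "y : hahn_inf" if "0 < hahn_ord y" using that hahn_coeff_below_ord[of _ y] by (auto simp: hahn_inf_def)
qed

lemma hahn_pos_iff: "y ~= 0 ==> 0 < y \<longleftrightarrow> 0 < hahn_coeff y (hahn_ord y)" for y :: "('g::linordered_ab_group_add, real) hahn"
  by (auto simp: less_hahn_def)

lemma hahn_single_facts:
  fixes r :: real and gamma :: "'g::linordered_ab_group_add"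
  assumes "r ~= 0"
  shows "hahn_single gamma r ~= 0" "hahn_ord (hahn_single gamma r) = gamma" "0 < hahn_single gamma r \<longleftrightarrow> 0 < r"
proof -
  have c: "hahn_coeff (hahn_single gamma r) gamma ~= 0" using assms by simp
  thus nz: "hahn_single gamma r ~= 0" by (metis hahn_coeff_simps(1))
  show o: "hahn_ord (hahn_single gamma r) = gamma" by (rule hahn_ord_eqI) (use assms in auto)
  show "0 < hahn_single gamma r \<longleftrightarrow> 0 < r" using hahn_pos_iff[OF nz] o by simp
qed

lemma zero_hahn_inf: "0 : hahn_inf" by (simp add: hahn_inf_def)

locale analytic_pair = analytic_weierstrass B e \<sigma> + H: hahn_evaluation \<iota>
  for B :: "nat => real => ('w::linordered_ab_group_add, real mps) hahn set"
    and e :: "'w series => 'k::linordered_field"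
    and \<sigma> :: "nat => real => 'w series => 'k list => 'k"
    and \<iota> :: "'w => 'k vgroup"
begin

sublocale L: germ_model B "hahn_eval \<iota>" hahn_inf
proof unfold_locales
  note v = in_vars_germ
  fix f g :: "'w series" and n and a b :: "nat => ('k vgroup, real) hahn"
  show "(0 :: ('k vgroup, real) hahn) : hahn_inf" by (rule zero_hahn_inf)
  show "hahn_eval \<iota> 1 a = 1" by (rule H.hahn_eval_one)
  show "hahn_eval \<iota> (hvar i) a = a i" for i by (rule H.hahn_eval_var)
  show "f : germ n ==> g : germ n ==> range a <= hahn_inf ==> hahn_eval \<iota> (f + g) a = hahn_eval \<iota> f a + hahn_eval \<iota> g a"
    by (rule H.hahn_eval_add[of n]) (use v in blast)+
  show "f : germ n ==> g : germ n ==> range a <= hahn_inf ==> hahn_eval \<iota> (f * g) a = hahn_eval \<iota> f a * hahn_eval \<iota> g a"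
    by (rule H.hahn_eval_mult[of n]) (use v in blast)+
  show "f : germ n ==> range a <= hahn_inf ==> \<pi> permutes {..<n} ==> hahn_eval \<iota> (hahn_map (mps_permute \<pi>) f) a = hahn_eval \<iota> f (%i. a (\<pi> i))" for \<pi>
    by (rule H.hahn_eval_permute[of n]) (use v in blast)+
  show "f : germ n ==> (!!i. i < n ==> a i = b i) ==> hahn_eval \<iota> f a = hahn_eval \<iota> f b"
    by (rule H.hahn_eval_cong[of n]) (use v in blast)+
  show "f : bgerm n ==> res f = 0 ==> range a <= hahn_inf ==> hahn_eval \<iota> f a : hahn_inf"
    by (rule H.hahn_eval_inf[of n]) (use v bgerm_germ bgerm_integral in blast)+
qed

definition pair_ev :: "'w series => (nat => 'k \<times> ('k vgroup, real) hahn) => 'k \<times> ('k vgroup, real) hahn" where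
  "pair_ev f a = (eval f (%i. fst (a i)), hahn_eval \<iota> f (%i. snd (a i)))"

abbreviation pair_inf :: "('k \<times> ('k vgroup, real) hahn) set" where
  "pair_inf == infinitesimals \<times> hahn_inf"

text \<open>Equal signs make the resulting map preserve the order, and equal values let it respect
  the natural valuations; the value group of the field serves as the exponent group of the Hahn
  field.\<close>

definition pair_good :: "('k \<times> ('k vgroup, real) hahn) set" where
  "pair_good = {(x, y). x ~= 0 & y ~= 0 & nval x = hahn_ord y & (0 < x \<longleftrightarrow> 0 < y)}"

definition pair_val :: "'k \<times> ('k vgroup, real) hahn => 'k vgroup" where
  "pair_val p = hahn_ord (snd p)"

lemma range_components:
  fixes a :: "nat => 'k \<times> ('k vgroup, real) hahn"
  assumes "range a <= pair_inf"
  shows "range (%i. fst (a i)) <= infinitesimals" "range (%i. snd (a i)) <= hahn_inf"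
proof -
  have "a i : pair_inf" for i using assms by blast
  thus "range (%i. fst (a i)) <= infinitesimals" "range (%i. snd (a i)) <= hahn_inf"
    by (auto simp: mem_Times_iff)
qed

sublocale P: germ_model B pair_ev pair_inf
proof unfold_locales
  fix f g :: "'w series" and n and a b :: "nat => 'k \<times> ('k vgroup, real) hahn"
  show "0 : pair_inf" by (simp add: zero_infinitesimal zero_hahn_inf zero_prod_def)
  show "pair_ev 1 a = 1" if "range a <= pair_inf"
    using range_components[OF that] by (simp add: pair_ev_def one_prod_def eval_one H.hahn_eval_one)
  show "pair_ev (hvar i) a = a i" if "range a <= pair_inf" for i
    using range_components[OF that] by (simp add: pair_ev_def eval_var H.hahn_eval_var)
  show "pair_ev (f + g) a = pair_ev f a + pair_ev g a" if "f : germ n" "g : germ n" "range a <= pair_inf"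
    using eval_add[OF that(1,2)] L.ev_add[OF that(1,2)] range_components[OF that(3)] by (simp add: pair_ev_def prod_eq_iff)
  show "pair_ev (f * g) a = pair_ev f a * pair_ev g a" if "f : germ n" "g : germ n" "range a <= pair_inf"
    using eval_mult[OF that(1,2)] L.ev_mult[OF that(1,2)] range_components[OF that(3)] by (simp add: pair_ev_def prod_eq_iff)
  show "pair_ev (hahn_map (mps_permute \<pi>) f) a = pair_ev f (%i. a (\<pi> i))" if "f : germ n" "range a <= pair_inf" "\<pi> permutes {..<n}" for \<pi>
    using eval_permute[OF that(1) _ that(3)] L.ev_permute[OF that(1) _ that(3)] range_components[OF that(2)] by (simp add: pair_ev_def)
  show "pair_ev f a = pair_ev f b" if "f : germ n" "range a <= pair_inf" "range b <= pair_inf" "!!i. i < n ==> a i = b i"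
    using eval_cong[OF that(1) range_components(1)[OF that(2)] range_components(1)[OF that(3)]]
      L.ev_cong[OF that(1) range_components(2)[OF that(2)] range_components(2)[OF that(3)]] that(4) by (simp add: pair_ev_def)
  show "pair_ev f a : pair_inf" if "f : bgerm n" "res f = 0" "range a <= pair_inf"
    using eval_inf[OF that(1,2) range_components(1)[OF that(3)]] L.ev_inf[OF that(1,2) range_components(2)[OF that(3)]] by (simp add: pair_ev_def)
qed

lemma pair_kc: "P.kc r = (er r, hahn_single 0 r)"
  using eval_const[of "hconst r" "%_. 0"] H.hahn_eval_const zero_infinitesimal
  by (simp add: P.kc_def pair_ev_def er_def)

lemma nval_er: "r ~= 0 ==> nval (er r) = 0"
proof -
  assume r: "r ~= 0"
  have *: "er s : val_ring" for s
  proof -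
    obtain n :: nat where "\<bar>s\<bar> <= of_nat n" using real_arch_simple by blast
    hence "er s <= er (of_nat n)" "er (- of_nat n) <= er s" unfolding er_le_iff by auto
    hence "\<bar>er s\<bar> <= of_nat n" by (simp add: er_simps abs_le_iff)
    thus ?thesis by (auto simp: val_ring_iff)
  qed
  have "1 / er r : val_ring" using *[of "1 / r"] by (simp add: er_divide er_simps)
  thus ?thesis using nval_le_iff[OF er_nonzero[OF r], of 1] nval_le_iff[of 1, OF _ er_nonzero[OF r]] *[of r]
    by (intro antisym) (simp_all add: nval_simps)
qed

lemma unit_facts:
  fixes w :: 'k
  assumes "w : infinitesimals" shows "0 < 1 + w" "nval (1 + w) = 0"
proof -
  have "of_nat 2 * \<bar>w\<bar> <= 1" using assms unfolding infinitesimals_def by blast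
  thus pos: "0 < 1 + w" by (simp add: abs_if split: if_splits)
  have "1 + w : val_ring" by (rule val_ring_add[OF val_ring_1 infinitesimals_val_ring[OF assms]])
  hence "0 <= nval (1 + w)" using nval_le_iff[of 1 "1 + w"] pos by (simp add: nval_simps)
  moreover have "~ 0 < nval (1 + w)"
  proof
    assume "0 < nval (1 + w)"
    hence "1 + w : infinitesimals" using infinitesimal_iff[of "1 + w"] pos by simp
    hence "(1 + w) - w : infinitesimals" by (rule model.inf_closed(5)[OF _ assms])
    hence "1 : (infinitesimals :: 'k set)" by simp
    hence "of_nat 2 * \<bar>1 :: 'k\<bar> <= 1" unfolding infinitesimals_def by blast
    thus False by simp
  qed
  ultimately show "nval (1 + w) = 0" by simp
qed

lemma hahn_unit_facts:
  fixes w :: "('k vgroup, real) hahn"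
  assumes "w : hahn_inf" shows "0 < 1 + w" "hahn_ord (1 + w) = 0"
proof -
  show o: "hahn_ord (1 + w) = 0" by (rule hahn_ord_eqI) (use assms in "auto simp: hahn_inf_def")
  have c: "hahn_coeff (1 + w) 0 = 1" using assms by (simp add: hahn_inf_def)
  hence "1 + w ~= 0" by (metis hahn_coeff_simps(1) zero_neq_one)
  thus "0 < 1 + w" using hahn_pos_iff[of "1 + w"] o c by simp
qed

sublocale V: valued_model B pair_ev pair_inf pair_good pair_val
proof unfold_locales
  fix x y :: "'k \<times> ('k vgroup, real) hahn" and r :: real
  obtain x1 x2 y1 y2 where xy: "x = (x1, x2)" "y = (y1, y2)" by (metis surj_pair)
  note prod = times_prod_def one_prod_def
  show "x * y : pair_good" if "x : pair_good" "y : pair_good" using that unfolding xy pair_good_def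
    by (auto simp: prod nval_simps hahn_ord_times zero_less_mult_iff not_less_iff_gr_or_eq)
  show "pair_val (x * y) = pair_val x + pair_val y" if "x : pair_good" "y : pair_good"
    using that unfolding xy pair_good_def pair_val_def by (auto simp: prod hahn_ord_times)
  show "EX y:pair_good. x * y = 1" if x: "x : pair_good"
  proof
    have nz: "x1 ~= 0" "x2 ~= 0" using x by (auto simp: xy pair_good_def)
    show "x * (inverse x1, inverse x2) = 1" using nz by (simp add: xy prod)
    have "hahn_ord (x2 * inverse x2) = hahn_ord x2 + hahn_ord (inverse x2)" using nz by (intro hahn_ord_times) auto
    moreover have "hahn_ord (x2 * inverse x2) = 0" using nz hahn_single_facts(2)[of 1 "0 :: 'k vgroup"] by (simp add: hahn_single_zero_one)
    ultimately have "hahn_ord (inverse x2) = - hahn_ord x2" by (simp add: eq_neg_iff_add_eq_0 add.commute)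
    thus "(inverse x1, inverse x2) : pair_good" using x by (auto simp: xy pair_good_def nval_simps)
  qed
  show "P.kc r : pair_good" if "r ~= 0"
    using that hahn_single_facts[OF that, of "0 :: 'k vgroup"] nval_er[OF that] er_nonzero[OF that] er_less_iff[of 0 r] by (simp add: pair_kc pair_good_def er_simps)
  show "pair_val (P.kc r) = 0" if "r ~= 0" using hahn_single_facts(2)[OF that, of "0 :: 'k vgroup"] by (simp add: pair_kc pair_val_def)
  show "1 + x : pair_good" if "x : pair_inf"
    using that unit_facts[of x1] hahn_unit_facts[of x2] by (auto simp: xy prod pair_good_def)
  show "pair_val (1 + x) = 0" if "x : pair_inf"
    using that hahn_unit_facts[of x2] by (auto simp: xy prod pair_val_def)
  show "(x : pair_inf) = (0 < pair_val x)" if "x : pair_good"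
    using that infinitesimal_iff[of x1] hahn_inf_iff[of x2] by (auto simp: xy pair_good_def pair_val_def)
  show "EX r. x - P.kc r : pair_inf" if x: "x : pair_good" "pair_val x = 0" and r: "ALL r. x - P.kc r : insert 0 pair_good"
  proof -
    have "0 <= nval x1" using x by (auto simp: xy pair_good_def pair_val_def)
    hence "x1 : val_ring" using nval_le_iff[of 1 x1] x by (simp add: xy pair_good_def nval_simps)
    \<comment> \<open>The residue of the first component serves for the second one too: the
      difference from it is zero or good, and then both of its components have the same
      value.\<close>
    then obtain s where s: "x1 - er s : infinitesimals" using standard_part_exists by blast
    have "x - P.kc s : insert 0 pair_good" using r by blast
    hence "x2 - hahn_single 0 s : hahn_inf"
      using s infinitesimal_iff[of "x1 - er s"] hahn_inf_iff[of "x2 - hahn_single 0 s"] zero_hahn_inf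
      by (auto simp: xy pair_kc pair_good_def zero_prod_def)
    thus ?thesis using s by (intro exI[of _ s]) (simp add: xy pair_kc)
  qed
qed

end

section \<open>The embedding\<close>

context germ_model
begin

text \<open>Dividing by a variable splits off a multiple that vanishes at the origin; after all
  variables are removed a constant is left.\<close>

lemma germ_at_zero: "f : germ n ==> EX g:germ 0. ev f (%_. 0) = ev g (%_. 0)"
proof (induction n arbitrary: f)
  case (Suc n)
  let ?v = "hvar 0 :: 'w series" and ?z = "%_::nat. 0 :: 'p"
  have v: "?v : bgerm (Suc n)" by (rule bgerm_closed) simp
  have z: "range ?z <= inf" using zero_inf by auto
  have "mps_regular 1 (hahn_coeff ?v 0)" by (auto simp: mps_regular_def mps_var.rep_eq single_Suc_neq_0[symmetric] dest: sym)
  then obtain Q R where QR: "Q : germ (Suc n)" "R : germ n" "f = Q * ?v + hshift R"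
    using germ_division[OF v _ _ Suc(2), of 1] by auto
  have "ev f ?z = ev R ?z"
    unfolding QR(3) using ev_add[OF germ_mult[OF QR(1) bgerm_germ[OF v]] germ_shift[OF QR(2)] z] ev_mult[OF QR(1) bgerm_germ[OF v] z]
      ev_var[OF z, of 0] ev_shift[OF QR(2) z] by simp
  thus ?case using Suc(1)[OF QR(2)] by simp
qed blast

end

context valued_model
begin

text \<open>A germ has finitely many arguments, which all lie in one member of a chain; so the union
  of a chain is again closed under germs.\<close>

lemma maximal_subfield:
  assumes "EX E. analytic_subfield E"
  shows "EX E. analytic_subfield E & (ALL E'. analytic_subfield E' --> E <= E' --> E' = E)"
proof -
  have "EX E:Collect analytic_subfield. ALL E':Collect analytic_subfield. E <= E' --> E' = E"
  proof (rule subset_Zorn_nonempty)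
    show "Collect analytic_subfield ~= {}" using assms by auto
    fix C assume C: "C ~= {}" "subset.chain (Collect analytic_subfield) C"
    have sub: "analytic_subfield E" if "E : C" for E using C(2) that by (auto simp: subset_chain_def)
    have chain: "E <= E' | E' <= E" if "E : C" "E' : C" for E E' using C(2) that by (auto simp: subset_chain_def)
    have two: "EX E:C. x : E & y : E" if x: "x : \<Union>C" and y: "y : \<Union>C" for x y
      using x y chain by (metis UnionE subsetD)
    have "analytic_subfield (\<Union>C)" unfolding analytic_subfield_def
    proof (intro conjI ballI)
      show "\<Union>C <= insert 0 good" using subfieldD(1)[OF sub] by blast
      show "0 : \<Union>C" using subfieldD(2)[OF sub] C(1) by blast
      show "x + y : \<Union>C" if "x : \<Union>C" "y : \<Union>C" for x y using two[OF that] subfieldD(3)[OF sub] by blast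
      show "x * y : \<Union>C" if "x : \<Union>C" "y : \<Union>C" for x y using two[OF that] subfieldD(4)[OF sub] by blast
      show "EX y:\<Union>C. x * y = 1" if "x : \<Union>C Int good" for x using that subfieldD(5)[OF sub] by blast
      show "gen (\<Union>C Int inf) <= \<Union>C"
      proof
        fix u assume u: "u : gen (\<Union>C Int inf)"
        have M: "\<Union>C Int inf <= inf" "0 : \<Union>C Int inf" using subfieldD(2)[OF sub] C(1) zero_inf by blast+
        obtain Z where Z: "finite Z" "Z <= \<Union>C Int inf" "u : gen (insert 0 Z)" using gen_finite[OF M u] by blast
        obtain E where E: "E : C" "Z <= E" using finite_subset_Union_chain[OF Z(1) _ C] Z(2) by blast
        have "insert 0 Z <= E Int inf" using E(2) Z(2) smallD(2)[OF sub[OF E(1)]] by blast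
        hence "u : gen (E Int inf)" using gen_mono Z(3) by blast
        thus "u : \<Union>C" using subfieldD(6)[OF sub[OF E(1)]] E(1) by blast
      qed
    qed
    thus "\<Union>C : Collect analytic_subfield" by simp
  qed
  thus ?thesis by auto
qed

lemma val_power_eq: "x : good ==> y : good ==> val x = val y ==> val (x ^ n) = val (y ^ n)"
  by (induction n) (simp_all add: val_mult good_power)

end

section \<open>The inclusion of exponents and the initial analytic subfield\<close>

abbreviation tpow :: "'w::linordered_ab_group_add => 'w series" where
  "tpow omega == hahn_single omega (mps_const 1)"

locale rich_analytic = analytic_weierstrass B e \<sigma> + rich_real_weierstrass_system B
  for B :: "nat => real => ('w::linordered_ab_group_add, real mps) hahn set"
    and e :: "'w series => 'k::linordered_field"
    and \<sigma> :: "nat => real => 'w series => 'k list => 'k"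
begin

lemma tpow_B0: "tpow omega : B 0 1"
proof -
  have fin: "finite {i. hahn_coeff (hahn_single omega (1::real)) i ~= 0}" "finite {i. hahn_coeff (1 :: ('w, real) hahn) i ~= 0}"
    by (rule finite_subset[of _ "{omega}"], auto split: if_splits)
  have "hahn_single omega (1::real) : rat_functions" unfolding rat_functions_def
    by (intro CollectI exI[of _ "hahn_single omega 1"] exI[of _ 1]) (use fin in auto)
  hence "hahn_map mps_const (hahn_single omega (1::real)) : B 0 1" using rich by blast
  thus ?thesis by (simp add: hahn_map_single)
qed

lemma tpow_add: "tpow (omega + omega') = tpow omega * tpow omega'" and tpow_0: "tpow 0 = 1"
  by (simp_all add: hahn_single_times hahn_single_zero_one)

lemma e_tpow_add: "e (tpow (omega + omega')) = e (tpow omega) * e (tpow omega')"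
  unfolding tpow_add by (rule S.e_mult[OF tpow_B0 tpow_B0])

lemma e_tpow_pos: "0 < e (tpow omega)"
proof -
  have "hconst 0 : B 0 1" using germ_const[of 0 0] by (simp only: germ0_eq)
  hence "e (hconst 0) < e (tpow omega)"
    by (rule S.e_less[OF _ tpow_B0]) (use hahn_single_facts(3)[of 1 omega] in "simp add: hahn_map_single hahn_single_zero")
  thus ?thesis using er_simps(4) by (simp add: er_def)
qed

text \<open>In the ordered Hahn field \<open>t^omega\<close> lies below every \<open>1 / n\<close>,
  and \<open>e\<close> preserves the order of \<open>B 0 1\<close>.\<close>

lemma e_tpow_infinitesimal:
  assumes "0 < omega" shows "e (tpow omega) : infinitesimals"
proof -
  have "of_nat n * \<bar>e (tpow omega)\<bar> <= 1" for n
  proof (cases "n = 0")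
    case False
    have c: "hconst (1 / of_nat n) : B 0 1" using germ_const[of "1 / of_nat n" 0] by (simp only: germ0_eq)
    have o: "hahn_ord (hahn_single 0 (1 / real n) - hahn_single omega 1) = 0" by (rule hahn_ord_eqI) (use assms False in auto)
    have "hahn_coeff (hahn_single 0 (1 / real n) - hahn_single omega 1) 0 > 0" using assms False by auto
    moreover from this have "hahn_single omega 1 ~= hahn_single 0 (1 / real n)" by (metis diff_self hahn_coeff_simps(1) less_irrefl)
    ultimately have "hahn_single omega 1 < hahn_single 0 (1 / real n)" unfolding less_hahn_def o by blast
    hence "e (tpow omega) < er (1 / of_nat n)" unfolding er_def
      by (intro S.e_less[OF tpow_B0 c]) (simp add: hahn_map_single)
    hence "\<bar>e (tpow omega)\<bar> <= 1 / of_nat n" using e_tpow_pos[of omega] by (simp add: er_divide er_simps)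
    thus ?thesis using False by (simp add: field_simps)
  qed simp
  thus ?thesis unfolding infinitesimals_def by blast
qed

text \<open>The inclusion of groups claimed in the theorem. Richness puts every
  \<open>t^omega\<close> into \<open>B 0 1\<close>, so that it has an image in the field and thereby
  a value.\<close>

definition embed :: "'w => 'k vgroup" where
  "embed omega = nval (e (tpow omega))"

lemma embedding: "ordered_group_embedding embed"
proof -
  have nz: "e (tpow omega) ~= 0" for omega using e_tpow_pos[of omega] by simp
  have add: "embed (x + y) = embed x + embed y" for x y
    unfolding embed_def e_tpow_add by (rule nval_simps(1)[OF nz nz])
  have "embed x < embed y" if "x < y" for x y
  proof -
    have "0 < embed (y - x)" unfolding embed_def using e_tpow_infinitesimal[of "y - x"] infinitesimal_iff[OF nz] that by simp
    thus ?thesis using add[of x "y - x"] by simp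
  qed
  thus ?thesis unfolding ordered_group_embedding_def strict_mono_def using add by blast
qed

end

locale rich_pair = rich_analytic B e \<sigma> + analytic_pair B e \<sigma> \<iota>
  for B :: "nat => real => ('w::linordered_ab_group_add, real mps) hahn set"
    and e :: "'w series => 'k::linordered_field"
    and \<sigma> :: "nat => real => 'w series => 'k list => 'k"
    and \<iota> :: "'w => 'k vgroup" +
  assumes embed_eq: "\<iota> = embed"
begin

definition T :: "'w => 'k \<times> ('k vgroup, real) hahn" where
  "T omega = (e (tpow omega), hahn_single (\<iota> omega) 1)"

lemma T_good: "T omega : pair_good" and T_val: "pair_val (T omega) = \<iota> omega"
proof -
  have "\<iota> omega = nval (e (tpow omega))" by (simp add: embed_eq embed_def)
  thus "T omega : pair_good" "pair_val (T omega) = \<iota> omega"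
    using e_tpow_pos[of omega] hahn_single_facts[of 1 "\<iota> omega"]
    by (simp_all add: T_def pair_good_def pair_val_def)
qed

lemma T_mult: "T (omega + omega') = T omega * T omega'" and T_0: "T 0 = 1"
proof -
  have \<iota>: "\<iota> (omega + omega') = \<iota> omega + \<iota> omega'" by (rule H.\<iota>_add)
  show "T (omega + omega') = T omega * T omega'" unfolding T_def times_prod_def by (simp only: fst_conv snd_conv e_tpow_add \<iota> hahn_single_times mult_1)
  show "T 0 = 1" using S.e_one by (simp add: T_def one_prod_def tpow_0 hahn_single_zero_one)
qed

lemma ev_tpow: "pair_ev (tpow omega) (%_. 0) = T omega"
proof -
  have "tpow omega : germ 0" using tpow_B0 germ0_eq by simp
  hence "eval (tpow omega) (%_. 0) = e (tpow omega)" by (rule eval_const) (use zero_infinitesimal in auto)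
  thus ?thesis unfolding pair_ev_def T_def by (simp only: fst_zero snd_zero H.hahn_eval_monomial)
qed

lemma zero_point: "range (%_::nat. 0 :: 'k \<times> ('k vgroup, real) hahn) <= pair_inf" using P.zero_inf by auto

text \<open>The frame consists of the pairs of real multiples of \<open>t^omega\<close>, with 0 as
  the only argument. Values at 0 come from germs in zero variables; their coefficients are real
  constants, so a nonzero one is its leading monomial times a unit.\<close>

lemma initial_subfield: "EX E. V.analytic_subfield E"
proof -
  let ?z = "%_::nat. 0 :: 'k \<times> ('k vgroup, real) hahn"
  define U where "U = {P.kc r * T omega |r omega. True}"
  have M: "{0} <= pair_inf" "0 : {0 :: 'k \<times> ('k vgroup, real) hahn}" using P.zero_inf by auto
  have UI: "P.kc r * T omega : U" for r omega unfolding U_def by blast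
  have gen0I: "pair_ev f ?z : P.gen0 {0}" if "f : P.mgerm n" for f n unfolding P.gen0_def using that by blast
  have fr: "V.frame U {0}" unfolding V.frame_def
  proof (intro conjI ballI impI M)
    show "U <= insert 0 pair_good"
    proof
      fix x assume "x : U"
      then obtain r omega where x: "x = P.kc r * T omega" unfolding U_def by blast
      show "x : insert 0 pair_good"
        using V.good_mult[OF V.good_kc T_good, of r omega] by (cases "r = 0") (simp_all add: x P.kc_simps)
    qed
    show "range P.kc <= U"
    proof
      fix x assume "x : range P.kc"
      then obtain r where "x = P.kc r * T 0" by (auto simp: T_0)
      thus "x : U" using UI by simp
    qed
    show "x * y : U" if xy: "x : U" "y : U" for x y
    proof -
      obtain r omega s omega' where "x = P.kc r * T omega" "y = P.kc s * T omega'" using xy unfolding U_def by blast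
      hence "x * y = P.kc (r * s) * T (omega + omega')" by (simp add: P.kc_simps T_mult mult_ac)
      thus ?thesis using UI by simp
    qed
    show "EX y:U. x * y = 1" if x': "x : U Int pair_good" for x
    proof -
      obtain r omega where x: "x = P.kc r * T omega" using x' unfolding U_def by blast
      have "r ~= 0" using x' V.zero_not_good by (auto simp: x P.kc_simps)
      have "x * (P.kc (1 / r) * T (- omega)) = P.kc (r * (1 / r)) * T (omega + - omega)" by (simp only: x P.kc_simps(4) T_mult mult_ac)
      also have "... = 1" using `r ~= 0` by (simp add: P.kc_simps T_0)
      finally show ?thesis using UI by blast
    qed
    show "EX r. x - P.kc r : P.gen0 {0}" if x': "x : U Int pair_good" "0 <= pair_val x" for x
    proof -
      obtain r omega where x: "x = P.kc r * T omega" using x' unfolding U_def by blast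
      have "r ~= 0" using x' V.zero_not_good by (auto simp: x P.kc_simps)
      hence "pair_val x = \<iota> omega" using V.val_mult[OF V.good_kc T_good] V.val_kc T_val by (simp add: x)
      hence omega: "0 <= omega" using x'(2) H.\<iota>_le[of 0 omega] by simp
      show ?thesis
      proof (cases "omega = 0")
        case True
        thus ?thesis using P.gen0_0[OF M] by (intro exI[of _ r]) (simp add: x T_0)
      next
        case False
        have g: "tpow omega : germ 0" using tpow_B0 germ0_eq by simp
        have "integral_series (tpow omega)" "res (tpow omega) = 0" using omega False by (auto simp: integral_series_def res_def zero_mps.rep_eq)
        hence "tpow omega : P.mgerm 0" using g by (simp add: P.mgerm_def bgerm_def)
        hence "T omega : P.gen0 {0}" using gen0I[of "tpow omega" 0] ev_tpow by simp
        hence "x : P.gen0 {0}" unfolding x by (rule P.gen_closed(6)[OF M P.gen_kc[OF M]])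
        thus ?thesis by (intro exI[of _ 0]) (simp add: P.kc_simps)
      qed
    qed
  qed
  have "u = 0 | (EX v. u : V.leading U {0} v)" if u: "u : P.gen {0}" for u
  proof -
    obtain f n a where f: "f : germ n" "range a <= {0}" "u = pair_ev f a" using u unfolding P.gen_def by blast
    have "a = ?z" using f(2) by auto
    then obtain g where g: "g : germ 0" "u = pair_ev g ?z" using P.germ_at_zero[OF f(1)] f(3) by auto
    show ?thesis
    proof (cases "g = 0")
      case True
      thus ?thesis using g(2) P.ev_zero[OF zero_point] by simp
    next
      case False
      define omega where "omega = hahn_ord g"
      define h where "h = tpow (- omega) * g"
      have t: "tpow omega : germ 0" for omega using tpow_B0 germ0_eq by simp
      have h: "h : germ 0" unfolding h_def by (rule germ_mult[OF t g(1)])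
      have gh: "g = tpow omega * h" by (simp add: h_def mult.assoc[symmetric] hahn_single_times hahn_single_zero_one)
      have one: "mps_const 1 = (1 :: real mps)" by (rule mps_eqI) (simp add: mps_const.rep_eq one_mps.rep_eq)
      have hc: "hahn_coeff h i = hahn_coeff g (i + omega)" for i unfolding h_def
        by (simp add: hahn_coeff_single_times one)
      have int: "integral_series h" unfolding integral_series_def using hahn_coeff_below_ord[of _ g] by (auto simp: hc omega_def)
      define r where "r = res h"
      have "r ~= 0"
      proof
        assume "r = 0"
        hence z: "mps_coeff (hahn_coeff g omega) 0 = 0" by (simp add: r_def res_def hc)
        have "hahn_coeff g omega = 0"
        proof (rule mps_eqI)
          fix mu
          have "mps_coeff (hahn_coeff g omega) mu ~= 0 ==> mu = 0" using in_vars_germ[OF g(1), of omega] unfolding mps_in_vars_def by auto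
          thus "mps_coeff (hahn_coeff g omega) mu = mps_coeff 0 mu" using z by (cases "mu = 0") (auto simp: zero_mps.rep_eq)
        qed
        thus False using hahn_coeff_ord[OF False] by (simp add: omega_def)
      qed
      have hb: "h : bgerm 0" using h int by (simp add: bgerm_def)
      hence "h - hconst r : P.mgerm 0" by (simp add: P.mgerm_def bgerm_closed r_def)
      hence w: "pair_ev (h - hconst r) ?z : P.gen0 {0}" by (rule gen0I)
      have "pair_ev h ?z = P.kc r + pair_ev (h - hconst r) ?z"
        using P.ev_minus[OF h germ_const zero_point] P.ev_const[OF zero_point] by simp
      hence u: "u = T omega * (P.kc r + pair_ev (h - hconst r) ?z)"
        unfolding g(2) gh using P.ev_mult[OF t h zero_point] ev_tpow by simp
      have "T omega : U" using UI[of 1 omega] by (simp add: P.kc_simps)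
      hence "u : V.leading U {0} (pair_val (T omega) + 0)" unfolding u
        by (intro V.leading_mult[OF fr] V.leading_monomial[OF fr] V.leading_unit[OF fr `r ~= 0` w] T_good)
      thus ?thesis by blast
    qed
  qed
  thus ?thesis using V.extension[OF fr] by blast
qed

end

section \<open>A maximal analytic subfield projects onto the whole field\<close>

context rich_pair
begin

context
  fixes E :: "('k \<times> ('k vgroup, real) hahn) set"
  assumes sf: "V.analytic_subfield E" and max: "ALL E'. V.analytic_subfield E' --> E <= E' --> E' = E"
begin

lemma subfield_pair: "p : E ==> p ~= 0 ==> fst p ~= 0 & snd p ~= 0 & nval (fst p) = pair_val p & (0 < fst p \<longleftrightarrow> 0 < snd p)"
  using V.subfield_good[OF sf, of p] by (cases p) (auto simp: pair_good_def pair_val_def)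

text \<open>Both components of \<open>(x, y) ^ N\<close> have to match one element of
  \<open>E\<close>. The second is adjusted by the positive real \<open>mu\<close>, an
  \<open>N\<close>-th root of the quotient of the two residues. Then the quotient by
  \<open>p\<close> is a positive real times \<open>1 + w'\<close> in the product ring, and an
  \<open>N\<close>-th root of \<open>1 + w'\<close> is divided out. The result has the value of
  \<open>x\<close>, though its first component need not be \<open>x\<close>.\<close>

lemma new_value:
  assumes x: "0 < x" and N: "0 < N" and p: "p : E" "p : pair_good" "0 < fst p" "pair_val p = pair_val ((x, hahn_single (nval x) 1) ^ N)"
  shows "EX X:pair_good. pair_val X = nval x & X ^ N : E"
proof -
  let ?gamma = "nval x"
  define y where "y = (hahn_single ?gamma 1 :: ('k vgroup, real) hahn)"
  have y: "0 < y" "hahn_ord y = ?gamma" using hahn_single_facts[of 1 ?gamma] by (simp_all add: y_def)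
  have X0: "(x, y) : pair_good" using x y by (auto simp: pair_good_def)
  have sp: "0 < snd p" using p(2,3) by (cases p) (auto simp: pair_good_def)
  define q1 q2 where "q1 = x ^ N / fst p" and "q2 = y ^ N / snd p"
  have pos: "0 < q1" "0 < q2" using x y(1) p(3) sp by (simp_all add: q1_def q2_def)
  have "(q1, q2) * p = (x, y) ^ N" using p(3) sp by (simp add: prod_eq_iff q1_def q2_def)
  moreover obtain p' where p': "p' : pair_good" "p * p' = 1" using V.good_inverse[OF p(2)] by blast
  ultimately have q_eq: "(q1, q2) = (x, y) ^ N * p'" by (metis mult.assoc mult.right_neutral)
  have q: "(q1, q2) : pair_good" unfolding q_eq by (rule V.good_mult[OF V.good_power[OF X0] p'(1)])
  have "pair_val (q1, q2) = pair_val ((x, y) ^ N) + pair_val p'" unfolding q_eq by (rule V.val_mult[OF V.good_power[OF X0] p'(1)])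
  also have "pair_val p' = - pair_val p" using V.val_inverse[OF p(2) p'(2)] by simp
  finally have qv: "hahn_ord q2 = 0" "nval q1 = 0" using p(4) q by (simp_all add: pair_val_def y_def pair_good_def)
  have "q1 : val_ring" using nval_le_iff[of 1 q1] pos qv(2) by (simp add: nval_simps)
  then obtain s where s: "q1 - er s : infinitesimals" using standard_part_exists by blast
  have q1n: "q1 ~: infinitesimals" using infinitesimal_iff[of q1] pos(1) qv(2) by simp
  have "0 < s"
  proof (rule ccontr)
    assume "~ 0 < s"
    moreover have "s ~= 0" using s q1n er_simps(4) by auto
    ultimately have "s < 0" by simp
    hence "\<bar>q1 - er s\<bar> <= er (- s)" using infinitesimal_le[OF s, of "- s"] by simp
    hence "q1 <= 0" by (simp add: er_simps abs_le_iff)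
    thus False using pos(1) by simp
  qed
  define s' where "s' = hahn_coeff q2 0"
  have s': "0 < s'" using hahn_pos_iff[of q2] pos(2) qv(1) by (simp add: s'_def)
  have w2: "q2 - hahn_single 0 s' : hahn_inf" unfolding hahn_inf_def
  proof (intro CollectI allI impI)
    fix i :: "'k vgroup" assume "i <= 0"
    thus "hahn_coeff (q2 - hahn_single 0 s') i = 0"
      using hahn_coeff_below_ord[of i q2] qv(1) by (cases "i = 0") (simp_all add: s'_def)
  qed
  define mu where "mu = root N (s / s')"
  have mu: "0 < mu" "mu ^ N = s / s'" using `0 < s` s' N by (simp_all add: mu_def real_root_pow_pos)
  define y1 where "y1 = hahn_single 0 mu * y"
  have single_power: "hahn_single 0 r ^ n = (hahn_single 0 (r ^ n) :: ('k vgroup, real) hahn)" for r n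
    by (induction n) (simp_all add: hahn_single_times hahn_single_zero_one)
  define w where "w = (q1 - er s, hahn_single 0 (s / s') * (q2 - hahn_single 0 s'))"
  have Lkc: "L.kc r = hahn_single 0 r" for r by (simp add: L.kc_def H.hahn_eval_const)
  have w: "w : pair_inf" using s L.inf_closed(3)[OF w2, of "s / s'"] by (simp add: w_def Lkc)
  have m0: "mu ~= 0" using mu(1) by simp
  have hm: "0 < hahn_single (0 :: 'k vgroup) mu" "hahn_ord (hahn_single (0 :: 'k vgroup) mu) = 0" "hahn_single (0 :: 'k vgroup) mu ~= 0"
    using hahn_single_facts[OF m0, of "0 :: 'k vgroup"] mu(1) by auto
  have y1: "0 < y1" "hahn_ord y1 = ?gamma" using y hm hahn_ord_times[OF hm(3), of y] by (auto simp: y1_def)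
  have X1: "(x, y1) : pair_good" using x y1 by (auto simp: pair_good_def)
  have X1N: "(x, y1) ^ N = p * (P.kc s + w)"
  proof -
    have "hahn_single 0 (s / s') * q2 = hahn_single 0 s + hahn_single 0 (s / s') * (q2 - hahn_single 0 s')"
      using s' by (simp add: algebra_simps hahn_single_times)
    moreover have "y1 ^ N = snd p * (hahn_single 0 (s / s') * q2)"
      using sp by (simp add: y1_def power_mult_distrib single_power mu(2) q2_def)
    ultimately show ?thesis using p(3) by (simp add: prod_eq_iff pair_kc w_def q1_def)
  qed
  have kk: "P.kc s * P.kc (1 / s) = 1" using `0 < s` by (simp add: P.kc_simps(4)[symmetric] P.kc_simps(2))
  define w' where "w' = P.kc (1 / s) * w"
  have w': "w' : pair_inf" unfolding w'_def by (rule P.inf_closed(3)[OF w])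
  have "P.kc s * (1 + w') = P.kc s + (P.kc s * P.kc (1 / s)) * w" by (simp only: w'_def distrib_left mult_1_right mult.assoc)
  hence kw: "P.kc s + w = P.kc s * (1 + w')" using kk by simp
  obtain eta where eta: "eta : pair_inf" "(1 + eta) ^ N = 1 + w'" using P.nth_root[OF w' N] by blast
  note u = V.good_unit[OF eta(1)] V.val_unit[OF eta(1)]
  obtain d where d: "d : pair_good" "(1 + eta) * d = 1" using V.good_inverse[OF u(1)] by blast
  have dv: "pair_val d = 0" using V.val_inverse[OF u(1) d(2)] u(2) by simp
  have "((x, y1) * d) ^ N = p * P.kc s * ((1 + eta) * d) ^ N"
    by (simp only: power_mult_distrib X1N kw eta(2) mult.assoc)
  hence "((x, y1) * d) ^ N : E" using V.subfieldD(4)[OF sf p(1) V.subfield_kc[OF sf]] d(2) by simp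
  moreover have "pair_val ((x, y1) * d) = ?gamma" using V.val_mult[OF X1 d(1)] dv y1(2) by (simp add: pair_val_def)
  ultimately show ?thesis using V.good_mult[OF X1 d(1)] by blast
qed

text \<open>By maximality \<open>E\<close> has all values: a value that is torsion modulo those of
  \<open>E\<close>, of least order \<open>N\<close>, could be adjoined by
  \<open>torsion_extension\<close>, any other missing value by
  \<open>free_extension\<close>.\<close>

lemma no_new_value_pos:
  assumes x: "0 < x"
  shows "EX p:E Int pair_good. pair_val p = nval x"
proof (rule ccontr)
  assume none: "~ (EX p:E Int pair_good. pair_val p = nval x)"
  define X0 where "X0 = (x, hahn_single (nval x) 1 :: ('k vgroup, real) hahn)"
  have X0: "X0 : pair_good" "pair_val X0 = nval x"
    using x hahn_single_facts[of 1 "nval x"] by (auto simp: X0_def pair_good_def pair_val_def)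
  have inv: "EX q:E Int pair_good. pair_val q = pair_val (X ^ j)"
    if X: "X : pair_good" and p: "p : E Int pair_good" "pair_val (p * X ^ j) = 0" for p X j
  proof -
    obtain q where q: "q : E" "p * q = 1" using V.subfieldD(5)[OF sf] p(1) by blast
    have "p : pair_good" using p by blast
    hence "q : pair_good" "pair_val q = - pair_val p" using V.val_inverse q(2) by blast+
    moreover have "pair_val p + pair_val (X ^ j) = 0" using V.val_mult[OF _ V.good_power[OF X], of p j] p by simp
    hence "- pair_val p = pair_val (X ^ j)" by (rule minus_unique)
    ultimately show ?thesis using q(1) by auto
  qed
  show False
  proof (cases "EX N>0. EX p:E Int pair_good. pair_val p = pair_val (X0 ^ N)")
    case True
    define N where "N = (LEAST N. 0 < N & (EX p:E Int pair_good. pair_val p = pair_val (X0 ^ N)))"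
    have N: "0 < N" "EX p:E Int pair_good. pair_val p = pair_val (X0 ^ N)"
      using LeastI_ex[of "%N. 0 < N & (EX p:E Int pair_good. pair_val p = pair_val (X0 ^ N))"] True unfolding N_def by auto
    have least: "~ (EX p:E Int pair_good. pair_val p = pair_val (X0 ^ j))" if "0 < j" "j < N" for j
      using not_less_Least[of j "%N. 0 < N & (EX p:E Int pair_good. pair_val p = pair_val (X0 ^ N))"] that unfolding N_def by auto
    obtain p0 where p0: "p0 : E" "p0 : pair_good" "pair_val p0 = pair_val (X0 ^ N)" using N(2) by blast
    have "EX p:E. p : pair_good & 0 < fst p & pair_val p = pair_val (X0 ^ N)"
    proof (cases "0 < fst p0")
      case False
      have m: "P.kc (- 1) : pair_good" "pair_val (P.kc (- 1)) = 0" by (rule V.good_kc V.val_kc; simp)+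
      have "fst p0 ~= 0" using p0(2) by (auto simp: pair_good_def)
      hence "0 < fst (P.kc (- 1) * p0)" using False by (simp add: pair_kc er_simps)
      moreover have "P.kc (- 1) * p0 : E" by (rule V.subfieldD(4)[OF sf V.subfield_kc[OF sf] p0(1)])
      ultimately show ?thesis using V.good_mult[OF m(1) p0(2)] V.val_mult[OF m(1) p0(2)] m(2) p0(3) by auto
    qed (use p0 in blast)
    then obtain p where p: "p : E" "p : pair_good" "0 < fst p" "pair_val p = pair_val (X0 ^ N)" by blast
    obtain X where X: "X : pair_good" "pair_val X = nval x" "X ^ N : E"
      using new_value[OF x N(1) p(1-3)] p(4) unfolding X0_def by blast
    have "pair_val (p * X ^ j) ~= 0" if "p : E Int pair_good" "0 < j" "j < N" for p j
      using inv[OF X(1), of p j] least[of j] V.val_power_eq[OF X(1) X0(1)] X(2) X0(2) that by auto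
    then obtain E' where "V.analytic_subfield E'" "E <= E'" "X : E'"
      using V.torsion_extension[OF sf X(1) X(3) V.good_power[OF X(1)] refl N(1)] by blast
    hence "X : E" using max by blast
    thus False using none X by blast
  next
    case False
    obtain Y where Y: "Y : pair_good" "X0 * Y = 1" using V.good_inverse[OF X0(1)] by blast
    have "pair_val (p * X0 ^ j) ~= 0" if "p : E Int pair_good" "0 < j" for p j
      using inv[OF X0(1) that(1)] False that(2) by blast
    hence "V.free_pair E X0 Y" unfolding V.free_pair_def using X0 Y by blast
    then obtain E' where "V.analytic_subfield E'" "E <= E'" "X0 : E'" using V.free_extension[OF sf] by blast
    hence "X0 : E" using max by blast
    thus False using none X0 by blast
  qed
qed

lemma no_new_value: "x ~= 0 ==> EX p:E Int pair_good. pair_val p = nval x"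
  using no_new_value_pos[of x] no_new_value_pos[of "- x"] nval_minus[of x] by (cases "0 < x") auto

text \<open>An element of \<open>E\<close> with the value of \<open>x\<close> is multiplied by the
  residue of the quotient; the product differs from \<open>x\<close> by an element of larger value
  and has the same sign.\<close>

lemma approximant:
  assumes x: "x ~= 0"
  shows "EX t:E Int pair_good. pair_val t = nval x & (0 < fst t \<longleftrightarrow> 0 < x) & (x - fst t = 0 | nval x < nval (x - fst t))"
proof -
  obtain p where p: "p : E" "p : pair_good" "pair_val p = nval x" using no_new_value[OF x] by blast
  have p0: "fst p ~= 0" "nval (fst p) = nval x" using p(2,3) by (auto simp: pair_good_def pair_val_def)
  define q where "q = x / fst p"
  have q: "q ~= 0" "nval q = 0" using x p0 by (simp_all add: q_def nval_simps)
  have "q : val_ring" using nval_le_iff[of 1 q] q by (simp add: nval_simps)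
  then obtain s where s: "q - er s : infinitesimals" using standard_part_exists by blast
  have "q ~: infinitesimals" using infinitesimal_iff[OF q(1)] q(2) by simp
  hence s0: "s ~= 0" using s er_simps(4) by auto
  define t where "t = P.kc s * p"
  have k: "P.kc s : pair_good" "pair_val (P.kc s) = 0" using V.good_kc[OF s0] V.val_kc[OF s0] by auto
  have t: "t : E" "t : pair_good" "pair_val t = nval x"
    using V.subfieldD(4)[OF sf V.subfield_kc[OF sf] p(1)] V.good_mult[OF k(1) p(2)] V.val_mult[OF k(1) p(2)] k(2) p(3) by (auto simp: t_def)
  have ft: "fst t = er s * fst p" by (simp add: t_def pair_kc)
  have ft0: "fst t ~= 0" using er_nonzero[OF s0] p0(1) by (simp add: ft)
  have diff: "x - fst t = fst p * (q - er s)" using p0(1) by (simp add: ft q_def algebra_simps)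
  have "x - fst t = 0 | nval x < nval (x - fst t)"
  proof (cases "q - er s = 0")
    case False
    hence "0 < nval (q - er s)" using infinitesimal_iff s by blast
    thus ?thesis unfolding diff using False p0 by (simp add: nval_simps)
  qed (simp add: diff)
  moreover have "0 < fst t \<longleftrightarrow> 0 < x"
  proof -
    have "model.kc r = er r" for r by (simp add: model.kc_def er_def eval_const zero_infinitesimal)
    hence "er (1 / s) * (q - er s) : infinitesimals" using model.inf_closed(3)[OF s, of "1 / s"] by simp
    hence "0 < 1 + er (1 / s) * (q - er s)" by (rule unit_facts(1))
    moreover have "x = fst t * (1 + er (1 / s) * (q - er s))"
      using er_nonzero[OF s0] p0(1) by (simp add: ft q_def er_divide er_simps field_simps)
    ultimately show ?thesis by (metis mult_less_cancel_right_disj mult_zero_left order_less_asym)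
  qed
  ultimately show ?thesis using t by blast
qed

text \<open>As \<open>E\<close> has all values, an \<open>x\<close> outside the projection generates
  an immediate extension. Its partner \<open>y\<close> is a pseudo-limit of the images of
  approximations: the coefficient at \<open>g\<close> is taken from any \<open>c\<close> in
  \<open>E\<close> whose distance from \<open>x\<close> has value above \<open>g\<close>.\<close>

lemma total: "EX y. (x, y) : E"
proof (rule ccontr)
  assume none: "~ (EX y. (x, y) : E)"
  have nz: "x - fst c ~= 0" if "c : E" for c using none that by (cases c) auto
  have consistent: "hahn_coeff (snd c) g = hahn_coeff (snd d) g"
    if c: "c : E" "g < nval (x - fst c)" and d: "d : E" "g < nval (x - fst d)" for c d g
  proof (cases "c = d")
    case False
    have cd: "c - d : E" "c - d ~= 0" using V.subfield_minus[OF sf c(1) d(1)] False by auto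
    have "fst c - fst d = (x - fst d) + - (x - fst c)" by simp
    moreover have "fst (c - d) ~= 0" using subfield_pair[OF cd] by blast
    ultimately have "g < nval (fst c - fst d)"
      using nval_add[of "x - fst d" "- (x - fst c)" g] nz[OF c(1)] nz[OF d(1)] c d nval_minus[OF nz[OF c(1)]] by auto
    hence "g < hahn_ord (snd c - snd d)" using subfield_pair[OF cd] by (simp add: pair_val_def)
    thus ?thesis using hahn_coeff_below_ord[of g "snd c - snd d"] by simp
  qed simp
  define Y where "Y = (%g. if EX c:E. g < nval (x - fst c) then hahn_coeff (snd (SOME c. c : E & g < nval (x - fst c))) g else 0)"
  have Y: "Y g = hahn_coeff (snd c) g" if c: "c : E" "g < nval (x - fst c)" for c g
  proof -
    have "(SOME c. c : E & g < nval (x - fst c)) : E & g < nval (x - fst (SOME c. c : E & g < nval (x - fst c)))"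
      by (rule someI[of "%c. c : E & g < nval (x - fst c)"]) (use c in blast)
    hence "hahn_coeff (snd (SOME c. c : E & g < nval (x - fst c))) g = hahn_coeff (snd c) g" using consistent c by blast
    thus ?thesis unfolding Y_def using c by auto
  qed
  \<comment> \<open>Up to any given exponent of its support, \<open>Y\<close> agrees with a single
    Hahn series.\<close>
  have "wo_set {g. Y g ~= 0}" unfolding wo_set_def
  proof (intro allI impI)
    fix S assume S: "S <= {g. Y g ~= 0}" "S ~= {}"
    then obtain g where g: "g : S" "Y g ~= 0" by blast
    then obtain c where c: "c : E" "g < nval (x - fst c)" unfolding Y_def by (metis (no_types, lifting))
    let ?S = "{h:S. h <= g}"
    have "hahn_coeff (snd c) h ~= 0" if "h : ?S" for h
    proof -
      have "h < nval (x - fst c)" using that c(2) by auto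
      thus ?thesis using Y[OF c(1)] S(1) that by auto
    qed
    hence "?S <= {h. hahn_coeff (snd c) h ~= 0}" by blast
    moreover have "?S ~= {}" using g by auto
    ultimately obtain m where m: "m : ?S" "!!h. h : ?S ==> m <= h" by (rule wo_setD[OF wo_set_supp]) (rule that)
    have "m <= h" if "h : S" for h
    proof (cases "h <= g")
      case False
      thus ?thesis using m(1) by auto
    qed (use m(2) that in auto)
    thus "EX m:S. ALL h:S. m <= h" using m(1) by blast
  qed
  hence coeff: "hahn_coeff (Abs_hahn Y) g = Y g" for g by (simp add: Abs_hahn_inverse)
  define y where "y = Abs_hahn Y"
  have "(x, y) - c : pair_good & (EX r:E Int pair_good. pair_val r = pair_val ((x, y) - c))" if c: "c : E" for c
  proof -
    obtain t where t: "t : E" "t : pair_good" "pair_val t = nval (x - fst c)" "0 < fst t \<longleftrightarrow> 0 < x - fst c"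
      "x - fst c - fst t = 0 | nval (x - fst c) < nval (x - fst c - fst t)" using approximant[OF nz[OF c]] by blast
    \<comment> \<open>\<open>c + t\<close> is a better approximation than \<open>c\<close>. So the
      leading coefficient of \<open>y - snd c\<close> is that of \<open>snd t\<close>, and
      \<open>y - snd c\<close> shares value and sign with \<open>x - fst c\<close>.\<close>
    have ct: "c + t : E" by (rule V.subfieldD(3)[OF sf c t(1)])
    have "nval (x - fst c) < nval (x - fst (c + t))" using t(5) nz[OF ct] by (simp add: diff_diff_eq)
    hence Yt: "Y (nval (x - fst c)) = hahn_coeff (snd c + snd t) (nval (x - fst c))" using Y[OF ct] by simp
    have t2: "snd t ~= 0" "hahn_ord (snd t) = nval (x - fst c)" "0 < fst t \<longleftrightarrow> 0 < snd t"
      using t(2,3) by (auto simp: pair_good_def pair_val_def)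
    have lead: "hahn_coeff (y - snd c) (nval (x - fst c)) = hahn_coeff (snd t) (hahn_ord (snd t))"
      unfolding y_def using Yt coeff t2(2) by simp
    have nzc: "hahn_coeff (snd t) (hahn_ord (snd t)) ~= 0" by (rule hahn_coeff_ord[OF t2(1)])
    have ord: "hahn_ord (y - snd c) = nval (x - fst c)"
    proof (rule hahn_ord_eqI)
      show "hahn_coeff (y - snd c) (nval (x - fst c)) ~= 0" using lead nzc by simp
      show "hahn_coeff (y - snd c) g = 0" if "g < nval (x - fst c)" for g
        unfolding y_def using Y[OF c that] coeff by simp
    qed
    have yc: "y - snd c ~= 0" using lead nzc by (metis hahn_coeff_simps(1))
    have "0 < y - snd c \<longleftrightarrow> 0 < x - fst c"
      unfolding hahn_pos_iff[OF yc] ord lead using hahn_pos_iff[OF t2(1)] t2(3) t(4) by blast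
    hence "(x - fst c, y - snd c) : pair_good" unfolding pair_good_def using nz[OF c] yc ord by simp
    moreover have "(x, y) - c = (x - fst c, y - snd c)" by (simp add: prod_eq_iff)
    ultimately show ?thesis using t(1-3) ord by (auto simp: pair_val_def)
  qed
  then obtain E' where "V.analytic_subfield E'" "E <= E'" "(x, y) : E'" using V.immediate_extension[OF sf, of "(x, y)"] by blast
  hence "(x, y) : E" using max by blast
  thus False using none by blast
qed

section \<open>The embedding read off from the maximal subfield\<close>

lemma functional: "(x, y) : E ==> (x, y') : E ==> y = y'"
  using subfield_pair[OF V.subfield_minus[OF sf], of "(x, y)" "(x, y')"] by (auto simp: prod_eq_iff)

definition the_map :: "'k => ('k vgroup, real) hahn" where
  "the_map x = (THE y. (x, y) : E)"

lemma the_map_eq: "(x, y) : E ==> the_map x = y" unfolding the_map_def using functional by blast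

lemma the_map: "(x, the_map x) : E" using total[of x] the_map_eq by metis

lemma the_map_add: "the_map (x + y) = the_map x + the_map y" and the_map_mult: "the_map (x * y) = the_map x * the_map y"
  and the_map_er: "the_map (er r) = hahn_single 0 r"
proof -
  show "the_map (x + y) = the_map x + the_map y"
    using V.subfieldD(3)[OF sf the_map[of x] the_map[of y]] by (intro the_map_eq) simp
  show "the_map (x * y) = the_map x * the_map y"
    using V.subfieldD(4)[OF sf the_map[of x] the_map[of y]] by (intro the_map_eq) (simp add: times_prod_def)
  show "the_map (er r) = hahn_single 0 r" using V.subfield_kc[OF sf, of r] by (intro the_map_eq) (simp add: pair_kc)
qed

lemma the_map_0: "the_map 0 = 0" and the_map_1: "the_map 1 = 1"
  using the_map_er[of 0] the_map_er[of 1] by (simp_all add: er_simps hahn_single_zero hahn_single_zero_one)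

lemma the_map_uminus: "the_map (- x) = - the_map x"
  using the_map_add[of x "- x"] the_map_0 by (simp add: eq_neg_iff_add_eq_0 add.commute)

lemma the_map_diff: "the_map (x - y) = the_map x - the_map y"
  using the_map_add[of x "- y"] the_map_uminus by simp

lemma the_map_pos: "0 < the_map x \<longleftrightarrow> 0 < x"
proof (cases "x = 0")
  case False
  thus ?thesis using subfield_pair[OF the_map[of x]] by (auto simp: prod_eq_iff)
qed (simp add: the_map_0)

lemma the_map_less: "the_map x < the_map y \<longleftrightarrow> x < y" using the_map_pos[of "y - x"] by (simp add: the_map_diff)

lemma the_map_inf: "x : infinitesimals ==> the_map x : hahn_inf"
proof (cases "x = 0")
  case False
  assume "x : infinitesimals"
  moreover have "the_map x ~= 0" "nval x = hahn_ord (the_map x)"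
    using subfield_pair[OF the_map[of x]] False by (auto simp: prod_eq_iff pair_val_def)
  ultimately show ?thesis using infinitesimal_iff[OF False] hahn_inf_iff by auto
qed (simp add: the_map_0 zero_hahn_inf)

lemma standard_part_unit:
  assumes x: "x : {-1..1}" shows "EX r:{-1..1}. x - er r : infinitesimals"
proof -
  have "\<bar>x\<bar> <= of_nat 1" using x by (simp add: abs_le_iff minus_le_iff)
  hence "x : val_ring" unfolding val_ring_iff by blast
  then obtain r where r: "x - er r : infinitesimals" using standard_part_exists by blast
  have le: "\<bar>x - er r\<bar> <= er s" if "0 < s" for s by (rule infinitesimal_le[OF r that])
  have "r <= 1"
  proof (rule ccontr)
    assume "~ r <= 1"
    hence "er r - x <= er ((r - 1) / 2)" using le[of "(r - 1) / 2"] by (simp add: abs_le_iff)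
    moreover have "x <= er 1" using x er_simps(3) by simp
    ultimately have "er r <= er ((r - 1) / 2 + 1)" by (simp add: er_simps(1))
    thus False using `~ r <= 1` unfolding er_le_iff by (simp add: field_simps)
  qed
  moreover have "- 1 <= r"
  proof (rule ccontr)
    assume "~ - 1 <= r"
    hence "x - er r <= er ((- 1 - r) / 2)" using le[of "(- 1 - r) / 2"] by (simp add: abs_le_iff)
    moreover have "er (- 1) <= x" using x er_simps(3,5) by simp
    ultimately have "er (- 1) <= er ((- 1 - r) / 2 + r)" by (simp add: er_simps(1))
    thus False using `~ - 1 <= r` unfolding er_le_iff by (simp add: field_simps)
  qed
  ultimately show ?thesis using r by auto
qed

text \<open>The standard parts of \<open>xs\<close> are the real parts of the images. So both sides
  evaluate the same expanded series, at infinitesimals that correspond under the map, and closure of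
  \<open>E\<close> under germs puts the pair of values into the graph.\<close>

lemma the_map_sigma:
  assumes alpha: "1 < alpha" and f: "f : B n alpha" and xs: "xs : unit_box n"
  shows "the_map (\<sigma> n alpha f xs) = natural_structure \<iota> n alpha f (map the_map xs)"
proof -
  have len: "length xs = n" and box: "xs ! i : {-1..1}" if "i < n" for i using xs that nth_mem[of i xs] by (auto simp: unit_box_def simp del: nth_mem)
  have len: "length xs = n" using xs by (simp add: unit_box_def)
  define a0 where "a0 = map (%x. hahn_coeff (the_map x) 0) xs"
  have st: "a0 ! i : {-1..1} & xs ! i - er (a0 ! i) : infinitesimals" if i: "i < n" for i
  proof -
    obtain r where r: "r : {-1..1}" "xs ! i - er r : infinitesimals" using standard_part_unit[OF box[OF i]] by blast
    have "the_map (xs ! i) - hahn_single 0 r : hahn_inf" using the_map_inf[OF r(2)] by (simp add: the_map_diff the_map_er)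
    hence "hahn_coeff (the_map (xs ! i) - hahn_single 0 r) 0 = 0" unfolding hahn_inf_def by blast
    hence "a0 ! i = r" using i len by (simp add: a0_def)
    thus ?thesis using r by simp
  qed
  have a0: "length a0 = n" "set a0 <= {-1..1}" using st len by (auto simp: a0_def in_set_conv_nth)
  let ?F = "hahn_map (mps_affine 1 a0) f"
  define a where "a = (%i. if i < n then xs ! i - er (a0 ! i) else 0)"
  have F: "?F : germ n" "\<sigma> n alpha f xs = eval ?F a"
    using sigma_eq_eval[OF alpha f xs a0] st unfolding a_def by auto
  define b where "b = (%i. the_map (a i))"
  have ai: "a i : infinitesimals" for i using st model.zero_inf by (simp add: a_def)
  have "range (%i. (a i, b i)) <= E Int pair_inf" using the_map ai the_map_inf by (auto simp: b_def)
  hence "pair_ev ?F (%i. (a i, b i)) : P.gen (E Int pair_inf)" unfolding P.gen_def using F(1) by blast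
  hence "(eval ?F a, hahn_eval \<iota> ?F b) : E" using V.subfieldD(6)[OF sf] by (auto simp: pair_ev_def)
  hence main: "the_map (\<sigma> n alpha f xs) = hahn_eval \<iota> ?F b" unfolding F(2) by (rule the_map_eq)
  have map_eq: "map (%x. hahn_coeff x 0) (map the_map xs) = a0" by (simp add: a0_def)
  have b_eq: "b = (%i. if i < n then map the_map xs ! i - hahn_single 0 (hahn_coeff (map the_map xs ! i) 0) else 0)"
    using len by (auto simp: fun_eq_iff b_def a_def a0_def the_map_diff the_map_er the_map_0)
  have "natural_structure \<iota> n alpha f (map the_map xs) = hahn_eval \<iota> ?F b" unfolding b_eq
  proof (rule H.natural_structure_eq[where a = "map the_map xs" and n = n, unfolded map_eq])
    show "ALL i. mps_in_vars n (hahn_coeff ?F i)" using in_vars_germ[OF F(1)] by blast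
    show "length (map the_map xs) = n" using len by simp
    fix i assume i: "i < n"
    have "the_map (a i) : hahn_inf" by (rule the_map_inf[OF ai])
    thus "map the_map xs ! i - hahn_single 0 (hahn_coeff (map the_map xs ! i) 0) : hahn_inf"
      using i len by (simp add: a_def a0_def the_map_diff the_map_er)
  qed
  thus ?thesis using main by simp
qed

lemma the_map_embedding: "L_embedding B \<sigma> (natural_structure \<iota>) the_map" unfolding L_embedding_def
proof (intro conjI allI ballI impI)
  show inj: "inj the_map"
  proof (rule injI)
    fix x y assume "the_map x = the_map y"
    thus "x = y" using the_map_less[of x y] the_map_less[of y x] by (cases x y rule: linorder_cases) auto
  qed
  show "the_map 0 = 0" "the_map 1 = 1" by (rule the_map_0 the_map_1)+
  show "the_map (x + y) = the_map x + the_map y" "the_map (x * y) = the_map x * the_map y" for x y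
    by (rule the_map_add the_map_mult)+
  show "(x < y) = (the_map x < the_map y)" for x y by (simp add: the_map_less)
  show "the_map (inverse x) = inverse (the_map x)" for x
  proof (cases "x = 0")
    case False
    hence "the_map x * the_map (inverse x) = 1" using the_map_mult[of x "inverse x"] the_map_1 by simp
    thus ?thesis by (rule inverse_unique[symmetric])
  qed (simp add: the_map_0)
  fix n f and xs :: "'k list" assume f: "f : symbols B n" and len: "length xs = n"
  have le: "the_map x <= the_map y \<longleftrightarrow> x <= y" for x y using the_map_less[of y x] by (simp add: not_less[symmetric])
  have "the_map x : {-1..1} \<longleftrightarrow> x : {-1..1}" for x
    using le[of "- 1" x] le[of x 1] the_map_1 the_map_uminus[of 1] by simp
  hence box: "map the_map xs : unit_box n \<longleftrightarrow> xs : unit_box n" by (auto simp: unit_box_def)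
  show "the_map (interp B \<sigma> n f xs) = interp B (natural_structure \<iota>) n f (map the_map xs)"
  proof (cases "xs : unit_box n")
    case True
    define alpha where "alpha = (SOME alpha. 1 < alpha & f : B n alpha)"
    obtain beta where "1 < beta & f : B n beta" using f unfolding symbols_def by blast
    hence alpha: "1 < alpha & f : B n alpha" unfolding alpha_def by (rule someI)
    show ?thesis unfolding interp_def induced_map_def alpha_def[symmetric] using True box the_map_sigma[of alpha f n xs] alpha by simp
  qed (simp add: interp_def box the_map_0)
qed

end

end

theorem theorem3p1p3:
  fixes B :: "nat \<Rightarrow> real \<Rightarrow> ('w::linordered_ab_group_add, real mps) hahn set"
    and e :: "('w, real mps) hahn \<Rightarrow> 'k::linordered_field"
    and \<sigma> :: "nat \<Rightarrow> real \<Rightarrow> ('w, real mps) hahn \<Rightarrow> 'k list \<Rightarrow> 'k"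
  assumes "rich_real_weierstrass_system B"
    and "analytic_structure B e \<sigma>"
  shows "\<exists>\<iota> :: 'w \<Rightarrow> 'k vgroup. ordered_group_embedding \<iota> \<and>
    (\<exists>\<phi> :: 'k \<Rightarrow> ('k vgroup, real) hahn. L_embedding B \<sigma> (natural_structure \<iota>) \<phi>)"
proof -
  interpret R: rich_real_weierstrass_system B by fact
  interpret S: analytic_structure B e \<sigma> by fact
  interpret A: rich_analytic B e \<sigma> by unfold_locales
  interpret rich_pair B e \<sigma> A.embed by unfold_locales (use A.embedding in simp_all)
  obtain E where "V.analytic_subfield E" "ALL E'. V.analytic_subfield E' --> E <= E' --> E' = E"
    using V.maximal_subfield[OF initial_subfield] by blast
  hence "L_embedding B \<sigma> (natural_structure A.embed) (the_map E)" by (rule the_map_embedding)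
  thus ?thesis using A.embedding by blast
qed

end
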